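(* Let $G=(V,E)$ be a de Bruijn graph of order $k$ over an alphabet $\Sigma$ with $|\Sigma|=\mathcal O(1)$, let $m=|E|$, and let $c$ be an interval function for $G$ of interval width $w$. Then the problem $\mathrm{diET}_w$ (deciding whether $G$ has a $c$-respecting Eulerian trail) can be solved in $\mathcal O\big(m\cdot \lambda^{\frac{w}{k-1}+1}\big)$ time, where $\lambda=\min(|\Sigma|^{k-1},2w-1)$.
   Context: For $b\in\mathbb N$ let $[b]=\{1,\dots,b\}$ and let $\mathcal I_b=\{[i,j]: 1\le i\le j\le b\}\cup\{\emptyset\}$ be the set of integer intervals on $[b]$. For a directed graph $G=(V,E)$ with $m=|E|$, an interval function is a map $c\colon E\to\mathcal I_m$; its interval width is the maximum length (number of elements) of $c(e)$ over $e\in E$. An Eulerian trail is a sequence $e_1\dots e_m$ of edges forming a directed walk using every edge exactly once; it is $c$-respecting if $t\in c(e_t)$ for all $t\in[m]$. The parametrized problem $\mathrm{diET}_w$ (parameter $w\in\mathbb N^+$): given a directed graph $G$ and an interval function $c$ of interval width $w$, decide whether $G$ has a $c$-respecting Eulerian trail. A de Bruijn graph of order $k$ over $\Sigma$ is a simple directed graph whose nodes are strings of length $k-1$ over $\Sigma$ and every edge $(u,v)$ satisfies $u[2\,..\,k-1]=v[1\,..\,k-2]$. The computational model is the word RAM. *)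

theory Defs
  imports Complex_Main "Graph_Theory.Pair_Digraph"
begin

section \<open>Word RAM\<close>

text \<open>
  Programs use finitely many registers and a random-access memory indexed by words.  A word of
  size \<open>W\<close> is a natural number below \<open>2 ^ W\<close>; the word size is a parameter of the execution, not of
  the program.
\<close>

datatype binop = Add | Sub | Mul | Div | Mod | BAnd | BOr | BXor | Shl | Shr

datatype test = Eq nat nat | Less nat nat

datatype com =
    Skip
  | Const nat nat
  | Op binop nat nat nat
  | Load nat nat
  | Store nat nat
  | Seq com com
  | Cond test com com
  | While test com

record ram =
  reg :: "nat \<Rightarrow> nat"
  mem :: "nat \<Rightarrow> nat"

text \<open>Subtraction wraps around; division by zero yields 0 and remainder by zero the dividend.\<close>

fun binop_val :: "nat \<Rightarrow> binop \<Rightarrow> nat \<Rightarrow> nat \<Rightarrow> nat" where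
  "binop_val W Add x y = (x + y) mod 2 ^ W"
| "binop_val W Sub x y = (x + (2 ^ W - y)) mod 2 ^ W"
| "binop_val W Mul x y = (x * y) mod 2 ^ W"
| "binop_val W Div x y = x div y"
| "binop_val W Mod x y = x mod y"
| "binop_val W BAnd x y = and x y"
| "binop_val W BOr x y = or x y"
| "binop_val W BXor x y = xor x y"
| "binop_val W Shl x y = (x * 2 ^ y) mod 2 ^ W"
| "binop_val W Shr x y = x div 2 ^ y"

fun test_val :: "test \<Rightarrow> ram \<Rightarrow> bool" where
  "test_val (Eq i j) s \<longleftrightarrow> reg s i = reg s j"
| "test_val (Less i j) s \<longleftrightarrow> reg s i < reg s j"

text \<open>
  \<open>exec W P s t s'\<close>: on word size \<open>W\<close>, program \<open>P\<close> started in \<open>s\<close> halts in \<open>s'\<close> after \<open>t\<close> time steps.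
  Every instruction and every evaluation of a test costs one step.
\<close>

inductive exec :: "nat \<Rightarrow> com \<Rightarrow> ram \<Rightarrow> nat \<Rightarrow> ram \<Rightarrow> bool" for W :: nat where
  Skip: "exec W Skip s 1 s"
| Const: "exec W (Const r n) s 1 (s\<lparr>reg := (reg s)(r := n mod 2 ^ W)\<rparr>)"
| Op: "exec W (Op f r i j) s 1 (s\<lparr>reg := (reg s)(r := binop_val W f (reg s i) (reg s j))\<rparr>)"
| Load: "exec W (Load r i) s 1 (s\<lparr>reg := (reg s)(r := mem s (reg s i))\<rparr>)"
| Store: "exec W (Store i r) s 1 (s\<lparr>mem := (mem s)(reg s i := reg s r)\<rparr>)"
| Seq: "exec W P s t s' \<Longrightarrow> exec W Q s' t' s'' \<Longrightarrow> exec W (Seq P Q) s (t + t') s''"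
| CondTrue: "test_val b s \<Longrightarrow> exec W P s t s' \<Longrightarrow> exec W (Cond b P Q) s (Suc t) s'"
| CondFalse: "\<not> test_val b s \<Longrightarrow> exec W Q s t s' \<Longrightarrow> exec W (Cond b P Q) s (Suc t) s'"
| WhileFalse: "\<not> test_val b s \<Longrightarrow> exec W (While b P) s 1 s"
| WhileTrue: "test_val b s \<Longrightarrow> exec W P s t s' \<Longrightarrow> exec W (While b P) s' t' s'' \<Longrightarrow>
    exec W (While b P) s (Suc (t + t')) s''"

inductive_cases exec_SkipE: "exec W Skip s t s'"
inductive_cases exec_ConstE: "exec W (Const r n) s t s'"
inductive_cases exec_OpE: "exec W (Op f r i j) s t s'"
inductive_cases exec_LoadE: "exec W (Load r i) s t s'"
inductive_cases exec_StoreE: "exec W (Store i r) s t s'"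
inductive_cases exec_SeqE: "exec W (Seq P Q) s t s'"
inductive_cases exec_CondE: "exec W (Cond b P Q) s t s'"
inductive_cases exec_WhileE: "exec W (While b P) s t s'"

lemma exec_deterministic:
  "exec W P s t s' \<Longrightarrow> exec W P s u s'' \<Longrightarrow> u = t \<and> s'' = s'"
proof (induction arbitrary: u s'' rule: exec.induct)
  case (Seq P s t s' Q t' s2)
  from Seq.prems show ?case by (rule exec_SeqE) (use Seq.IH in blast)
next
  case (CondTrue b s P t s' Q)
  from CondTrue.prems show ?case by (rule exec_CondE) (use CondTrue in blast)+
next
  case (CondFalse b s Q t s' P)
  from CondFalse.prems show ?case by (rule exec_CondE) (use CondFalse in blast)+
next
  case (WhileFalse b s P)
  from WhileFalse.prems show ?case by (rule exec_WhileE) (use WhileFalse in auto)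
next
  case (WhileTrue b s P t s' t' s2)
  from WhileTrue.prems show ?case by (rule exec_WhileE) (use WhileTrue in blast)+
qed (auto elim: exec_SkipE exec_ConstE exec_OpE exec_LoadE exec_StoreE)

definition initial :: "nat list \<Rightarrow> ram" where
  "initial xs = \<lparr>reg = (\<lambda>_. 0), mem = (\<lambda>i. if i < length xs then xs ! i else 0)\<rparr>"

text \<open>The answer is delivered in register 0: 1 for yes, 0 for no.\<close>

definition decides_within :: "nat \<Rightarrow> com \<Rightarrow> nat list \<Rightarrow> real \<Rightarrow> bool \<Rightarrow> bool" where
  "decides_within W P xs T yes \<longleftrightarrow>
     (\<exists>t s. exec W P (initial xs) t s \<and> real t \<le> T \<and> reg s 0 = (if yes then 1 else 0))"

text \<open>
  The usual requirement that words have \<open>\<Omega>(log n)\<close> bits and can address the memory in use.  Here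
  \<open>T\<close> is a time bound up to a constant factor, hence also a bound on the number of cells touched.
  Whenever \<open>T\<close> is polynomial in the length of the input, the second conjunct amounts to
  \<open>W = \<Omega>(log (length xs))\<close>.
\<close>

definition adequate_word_size :: "nat \<Rightarrow> nat list \<Rightarrow> real \<Rightarrow> nat \<Rightarrow> bool" where
  "adequate_word_size a xs T W \<longleftrightarrow>
     (\<forall>x\<in>set xs. x < 2 ^ W) \<and> real a * log 2 (real (length xs) + T) \<le> real W"


section \<open>Interval-respecting Eulerian trails\<close>

text \<open>
  In \<open>pair_pre_digraph\<close> arcs are pairs of vertices, so there are no parallel arcs; loops are allowed,
  as de Bruijn graphs have them at constant strings.
\<close>

definition de_bruijn_graph :: "nat \<Rightarrow> 'a set \<Rightarrow> 'a list pair_pre_digraph \<Rightarrow> bool" where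
  "de_bruijn_graph k \<Sigma> G \<longleftrightarrow>
     pair_wf_digraph G \<and>
     (\<forall>u\<in>pverts G. length u = k - 1 \<and> set u \<subseteq> \<Sigma>) \<and>
     (\<forall>(u, v)\<in>parcs G. tl u = take (k - 2) v)"

definition intervals :: "nat \<Rightarrow> nat set set" where
  "intervals b = {{i..j} | i j. 1 \<le> i \<and> i \<le> j \<and> j \<le> b} \<union> {{}}"

definition interval_function :: "'v pair_pre_digraph \<Rightarrow> ('v \<times> 'v \<Rightarrow> nat set) \<Rightarrow> bool" where
  "interval_function G c \<longleftrightarrow> (\<forall>e\<in>parcs G. c e \<in> intervals (card (parcs G)))"

text \<open>The inserted 0 only matters for graphs without arcs.\<close>

definition interval_width :: "'v pair_pre_digraph \<Rightarrow> ('v \<times> 'v \<Rightarrow> nat set) \<Rightarrow> nat" where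
  "interval_width G c = Max (insert 0 ((\<lambda>e. card (c e)) ` parcs G))"

text \<open>
  Unlike \<open>euler_trail\<close> in the theory of Euler digraphs, an Eulerian trail here need not visit
  isolated vertices.
\<close>

definition eulerian_trail :: "'v pair_pre_digraph \<Rightarrow> ('v \<times> 'v) list \<Rightarrow> bool" where
  "eulerian_trail G p \<longleftrightarrow> (\<exists>u v. pre_digraph.trail (with_proj G) u p v) \<and> set p = parcs G"

definition respecting :: "('e \<Rightarrow> nat set) \<Rightarrow> 'e list \<Rightarrow> bool" where
  "respecting c p \<longleftrightarrow> (\<forall>t\<in>{1..length p}. t \<in> c (p ! (t - 1)))"

definition diET :: "'v pair_pre_digraph \<Rightarrow> ('v \<times> 'v \<Rightarrow> nat set) \<Rightarrow> bool" where
  "diET G c \<longleftrightarrow> (\<exists>p. eulerian_trail G p \<and> respecting c p)"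


section \<open>Instances as memory contents\<close>

definition enumerates :: "'b list \<Rightarrow> 'b set \<Rightarrow> bool" where
  "enumerates xs A \<longleftrightarrow> distinct xs \<and> set xs = A"

definition position :: "'b list \<Rightarrow> 'b \<Rightarrow> nat" where
  "position xs x = length (takeWhile (\<lambda>y. y \<noteq> x) xs)"

definition encode_interval :: "nat set \<Rightarrow> nat list" where
  "encode_interval I = (if I = {} then [1, 0] else [Min I, Max I])"

text \<open>
  Relative to enumerations \<open>ls\<close>, \<open>vs\<close>, \<open>es\<close> of the alphabet, the vertices and the arcs, an instance is
  laid out as the five numbers \<open>|E|\<close>, \<open>w\<close>, \<open>k\<close>, \<open>|\<Sigma>|\<close>, \<open>|V|\<close>, followed by four words per arc (tail, head
  and the two ends of its interval), followed by the vertex strings, one letter per word.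
\<close>

definition encode_instance ::
  "'a list \<Rightarrow> 'a list list \<Rightarrow> ('a list \<times> 'a list) list \<Rightarrow> nat \<Rightarrow> nat \<Rightarrow>
     ('a list \<times> 'a list \<Rightarrow> nat set) \<Rightarrow> nat list" where
  "encode_instance ls vs es k w c =
     [length es, w, k, length ls, length vs]
     @ concat (map (\<lambda>(u, v). [position vs u, position vs v] @ encode_interval (c (u, v))) es)
     @ concat (map (map (position ls)) vs)"

definition time_bound :: "nat \<Rightarrow> nat \<Rightarrow> nat \<Rightarrow> nat \<Rightarrow> real" where
  "time_bound \<sigma> k m w =
     real m * real (min (\<sigma> ^ (k - 1)) (2 * w - 1)) powr (real w / (real k - 1) + 1)"

end

theory Submission
  imports Defs "HOL-Real_Asymp.Real_Asymp"
begin

text \<open>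
  Write \<open>K = k - 1\<close> and let \<open>m\<close> be the number of arcs.  The program explores, for \<open>t = 1, \<dots>, m\<close>, the
  states \<open>(v, l)\<close> of the walks of length \<open>t\<close> that respect the intervals and repeat no arc: \<open>v\<close> is the
  current vertex and \<open>l\<close> lists those arcs of the walk whose interval is not over yet and which are
  critical.  An arc is critical if, judging by the intervals, its tail can be entered or left in two
  ways around the time at which the arc can be used; a noncritical arc cannot be repeated anyway,
  apart from the first arc of the walk.

  Two necessary conditions are checked beforehand: for every \<open>t\<close>, at most \<open>t + w - 1\<close> intervals begin
  by time \<open>t\<close>, and only few critical arcs have an interval near \<open>t\<close>.

  The last \<open>w\<close> arcs of a walk are determined by every \<open>(K + 1)\<close>-st of them, and each of these can
  be chosen in at most \<open>2 w - 1\<close> ways because of the first condition, or \<open>|\<Sigma>| ^ (K + 1)\<close> ways.  This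
  gives the exponent \<open>w / K\<close>.  The arcs at later positions must avoid those already chosen, which
  saves a constant factor at a constant proportion of the positions.  If \<open>w\<close> is large compared to
  \<open>K * log w\<close>, this saving absorbs all polynomial overhead.  Otherwise the second condition
  leaves so few critical arcs that the lists \<open>l\<close> can be counted directly.

  The second condition is necessary because the word spelled by a solution has no repeated factor of
  length \<open>K + 1\<close>, and such a word has only \<open>O((n / K) * log (n / K))\<close> repeated factors of length \<open>K\<close>
  within a window of length \<open>n\<close>.
\<close>

section \<open>Repetitions in words without repeated long factors\<close>

definition defect :: "('a \<Rightarrow> 'b) \<Rightarrow> 'a set \<Rightarrow> nat" where
  "defect f A = card A - card (f ` A)"

lemma card_eq_image_plus_defect:
  "finite A \<Longrightarrow> card A = card (f ` A) + defect f A"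
  by (simp add: defect_def card_image_le)

lemma defect_mono:
  assumes "finite B" "A \<subseteq> B"
  shows "defect f A \<le> defect f B"
proof -
  have fA: "finite A" using assms finite_subset by blast
  have "f ` B \<subseteq> f ` A \<union> f ` (B - A)" by auto
  then have "card (f ` B) \<le> card (f ` A \<union> f ` (B - A))"
    by (intro card_mono) (use assms fA in auto)
  also have "\<dots> \<le> card (f ` A) + card (f ` (B - A))" by (rule card_Un_le)
  also have "\<dots> \<le> card (f ` A) + card (B - A)" using assms by (simp add: card_image_le)
  also have "card (B - A) = card B - card A" using assms fA by (simp add: card_Diff_subset)
  finally have "card (f ` B) \<le> card (f ` A) + (card B - card A)" .
  moreover have "card A \<le> card B" using assms by (simp add: card_mono)
  ultimately show ?thesis using card_eq_image_plus_defect[OF fA, of f] card_eq_image_plus_defect[OF assms(1), of f]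
    by linarith
qed

lemma defect_Un_disjoint_images:
  assumes "finite A" "finite B" "f ` A \<inter> f ` B = {}"
  shows "defect f (A \<union> B) = defect f A + defect f B"
proof -
  have "A \<inter> B = {}" using assms(3) by auto
  then have "card (A \<union> B) = card A + card B" using assms by (simp add: card_Un_disjoint)
  moreover have "card (f ` (A \<union> B)) = card (f ` A) + card (f ` B)"
    using assms by (simp add: image_Un card_Un_disjoint)
  ultimately show ?thesis
    using card_eq_image_plus_defect[of A f] card_eq_image_plus_defect[of B f]
      card_eq_image_plus_defect[of "A \<union> B" f] assms by simp
qed

lemma defect_Un_le:
  assumes "finite A" "finite B"
  shows "defect f (A \<union> B) \<le> card A + defect f B"
proof -
  have "card (f ` B) \<le> card (f ` (A \<union> B))" by (intro card_mono) (use assms in auto)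
  moreover have "card (A \<union> B) \<le> card A + card B" by (rule card_Un_le)
  ultimately show ?thesis
    using card_eq_image_plus_defect[of B f] card_eq_image_plus_defect[of "A \<union> B" f] assms by simp
qed

lemma defect_image_cong:
  assumes "finite A" "inj_on g A" "\<And>x y. x \<in> A \<Longrightarrow> y \<in> A \<Longrightarrow> f x = f y \<longleftrightarrow> h (g x) = h (g y)"
  shows "defect f A = defect h (g ` A)"
proof -
  have "card (g ` A) = card A" using assms by (simp add: card_image)
  moreover have "card (f ` A) = card (h ` g ` A)"
  proof -
    let ?F = "\<lambda>z. h (g (SOME x. x \<in> A \<and> f x = z))"
    have F: "?F (f x) = h (g x)" if "x \<in> A" for x
    proof -
      have "(SOME y. y \<in> A \<and> f y = f x) \<in> A \<and> f (SOME y. y \<in> A \<and> f y = f x) = f x"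
        using someI[of "\<lambda>y. y \<in> A \<and> f y = f x" x] that by simp
      then show ?thesis using assms(3) that by blast
    qed
    have "bij_betw ?F (f ` A) (h ` g ` A)"
      unfolding bij_betw_def
    proof
      show "inj_on ?F (f ` A)"
      proof (rule inj_onI)
        fix a b assume ab: "a \<in> f ` A" "b \<in> f ` A" and eq: "?F a = ?F b"
        from ab obtain x y where "x \<in> A" "y \<in> A" "a = f x" "b = f y" by blast
        then show "a = b" using F eq assms(3) by metis
      qed
      have "?F ` f ` A = (\<lambda>x. h (g x)) ` A" unfolding image_image
        by (rule image_cong[OF refl]) (rule F)
      then show "?F ` f ` A = h ` g ` A" by (simp add: image_image)
    qed
    then show ?thesis by (rule bij_betw_same_card)
  qed
  ultimately show ?thesis by (simp add: defect_def)
qed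

lemma defect_UN_disjoint_images:
  assumes "finite I" "\<And>i. i \<in> I \<Longrightarrow> finite (A i)"
    "\<And>i j. i \<in> I \<Longrightarrow> j \<in> I \<Longrightarrow> i \<noteq> j \<Longrightarrow> f ` A i \<inter> f ` A j = {}"
  shows "defect f (\<Union>i\<in>I. A i) = (\<Sum>i\<in>I. defect f (A i))"
  using assms
proof (induction I rule: finite_induct)
  case empty then show ?case by (simp add: defect_def)
next
  case (insert i I)
  have "f ` A i \<inter> f ` (\<Union>j\<in>I. A j) = {}"
  proof -
    have "f ` A i \<inter> f ` A j = {}" if "j \<in> I" for j
      using insert.prems(2)[of i j] insert.hyps(2) that by blast
    then show ?thesis by blast
  qed
  then have "defect f (A i \<union> (\<Union>j\<in>I. A j)) = defect f (A i) + defect f (\<Union>j\<in>I. A j)"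
    using insert.hyps(1) insert.prems(1) by (intro defect_Un_disjoint_images) simp_all
  moreover have "defect f (\<Union>j\<in>I. A j) = (\<Sum>j\<in>I. defect f (A j))"
    by (rule insert.IH) (use insert.prems in blast)+
  ultimately show ?case using insert.hyps by (simp del: UN_simps)
qed

lemma card_repeated_le_defect:
  assumes "finite A"
  shows "card {x \<in> A. \<exists>y\<in>A. y \<noteq> x \<and> f y = f x} \<le> 2 * defect f A"
proof -
  let ?R = "{x \<in> A. \<exists>y\<in>A. y \<noteq> x \<and> f y = f x}"
  have fR: "finite ?R" using assms by simp
  have "2 * card (f ` ?R) \<le> card ?R"
  proof -
    have "card ?R = (\<Sum>z\<in>f ` ?R. card {x \<in> ?R. f x = z})"
      using sum.image_gen[OF fR, of "\<lambda>_. 1::nat" f] by simp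
    also have "\<dots> \<ge> (\<Sum>z\<in>f ` ?R. 2)"
    proof (rule sum_mono)
      fix z assume "z \<in> f ` ?R"
      then obtain x y where "x \<in> A" "y \<in> A" "y \<noteq> x" "f y = f x" "z = f x" by blast
      then have "{x, y} \<subseteq> {x \<in> ?R. f x = z}" by auto
      then have "card {x, y} \<le> card {x \<in> ?R. f x = z}" by (intro card_mono) (use assms in auto)
      then show "2 \<le> card {x \<in> ?R. f x = z}" using \<open>y \<noteq> x\<close> by simp
    qed
    finally show ?thesis by simp
  qed
  then have "card ?R \<le> 2 * defect f ?R" using card_eq_image_plus_defect[OF fR, of f] by linarith
  also have "defect f ?R \<le> defect f A" by (rule defect_mono) (use assms in auto)
  finally show ?thesis by simp
qed

lemma defect_tree_bound:
  fixes L :: "'p \<Rightarrow> nat \<Rightarrow> 'b" and \<kappa> :: "nat \<Rightarrow> 'p \<Rightarrow> 'k"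
  assumes "finite O'" "finite A"
    and "\<And>p q. p \<in> O' \<Longrightarrow> q \<in> O' \<Longrightarrow> p \<noteq> q \<Longrightarrow> \<exists>x. L p x \<noteq> L q x"
    and "\<And>p q a. p \<in> O' \<Longrightarrow> q \<in> O' \<Longrightarrow> p \<noteq> q \<Longrightarrow> a \<in> A \<Longrightarrow> \<kappa> a p = \<kappa> a q \<Longrightarrow>
           (\<forall>x<a. L p x = L q x) \<and> L p a \<noteq> L q a"
  shows "real (\<Sum>a\<in>A. defect (\<kappa> a) O') \<le> card O' * log 2 (card O')"
  using assms(1,3,4)
proof (induction "card O'" arbitrary: O' rule: less_induct)
  case less
  note fin = less.prems(1) and inj = less.prems(2) and sep = less.prems(3)
  show ?case
  proof (cases "card O' \<le> 1")
    case True
    then have "inj_on (\<kappa> a) O'" for a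
      using fin by (metis card_le_Suc0_iff_eq inj_onI One_nat_def)
    then have "defect (\<kappa> a) O' = 0" for a by (simp add: defect_def card_image)
    then show ?thesis using True by (cases "card O'") auto
  next
    case False
    then obtain p0 q0 where pq: "p0 \<in> O'" "q0 \<in> O'" "p0 \<noteq> q0"
      using fin by (metis card_le_Suc0_iff_eq One_nat_def)
    define l where "l = (LEAST x. \<exists>p\<in>O'. \<exists>q\<in>O'. L p x \<noteq> L q x)"
    have ex: "\<exists>x. \<exists>p\<in>O'. \<exists>q\<in>O'. L p x \<noteq> L q x" using inj[OF pq] pq by blast
    have "\<exists>p\<in>O'. \<exists>q\<in>O'. L p l \<noteq> L q l" unfolding l_def using LeastI_ex[OF ex] by blast
    then obtain p q where p: "p \<in> O'" and q: "q \<in> O'" and ne: "L p l \<noteq> L q l" by blast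
    have agree: "L x y = L z y" if "y < l" "x \<in> O'" "z \<in> O'" for x y z
      using not_less_Least[of y "\<lambda>x. \<exists>p\<in>O'. \<exists>q\<in>O'. L p x \<noteq> L q x"] that unfolding l_def by blast
    define X where "X b = {x \<in> O'. L x l = b}" for b
    have fX: "finite (X b)" for b using fin by (simp add: X_def)
    have "card (X (L p l)) + card (X (L q l)) \<le> card O'"
    proof -
      have "card (X (L p l) \<union> X (L q l)) = card (X (L p l)) + card (X (L q l))"
        by (rule card_Un_disjoint) (use fX ne in \<open>auto simp: X_def\<close>)
      moreover have "card (X (L p l) \<union> X (L q l)) \<le> card O'"
        by (rule card_mono) (use fin in \<open>auto simp: X_def\<close>)
      ultimately show ?thesis by simp
    qed
    then have "2 * card (X (L p l)) \<le> card O' \<or> 2 * card (X (L q l)) \<le> card O'" by linarith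
    then obtain r where r: "r \<in> O'" "2 * card (X (L r l)) \<le> card O'" using p q by blast
    define X1 where "X1 = X (L r l)"
    define X2 where "X2 = O' - X1"
    have f12: "finite X1" "finite X2" using fX fin by (auto simp: X1_def X2_def)
    have un: "O' = X1 \<union> X2" "X1 \<inter> X2 = {}" by (auto simp: X1_def X2_def X_def)
    have rX: "r \<in> X1" using r by (simp add: X1_def X_def)
    have c: "card O' = card X1 + card X2" using un f12 by (metis card_Un_disjoint)
    have c1: "card X1 \<ge> 1" using rX card_gt_0_iff[of X1] f12(1) by fastforce
    have half: "2 * card X1 \<le> card O'" using r by (simp add: X1_def)
    have c2: "card X2 \<ge> card X1" using half c by linarith
    have cross: "a = l" if "x \<in> X1" "y \<in> X2" "a \<in> A" "\<kappa> a x = \<kappa> a y" for a x y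
    proof -
      have xy: "x \<in> O'" "y \<in> O'" "x \<noteq> y" using that un by auto
      have d: "L x l \<noteq> L y l" using that by (auto simp: X1_def X2_def X_def)
      from sep[OF xy that(3,4)] have s: "\<forall>z<a. L x z = L y z" "L x a \<noteq> L y a" by auto
      have "\<not> l < a" using s(1) d by blast
      moreover have "\<not> a < l" using s(2) agree xy by blast
      ultimately show ?thesis by simp
    qed
    have step: "defect (\<kappa> a) O' \<le> defect (\<kappa> a) X1 + defect (\<kappa> a) X2 + (if a = l then card X1 else 0)"
      if "a \<in> A" for a
    proof (cases "a = l")
      case True
      then show ?thesis using defect_Un_le[OF f12, of "\<kappa> a"] un by simp
    next
      case False
      then have "\<kappa> a ` X1 \<inter> \<kappa> a ` X2 = {}" using cross[OF _ _ that] by blast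
      then show ?thesis using defect_Un_disjoint_images[OF f12, of "\<kappa> a"] un(1) by simp
    qed
    have "(\<Sum>a\<in>A. defect (\<kappa> a) O')
      \<le> (\<Sum>a\<in>A. defect (\<kappa> a) X1 + defect (\<kappa> a) X2 + (if a = l then card X1 else 0))"
      by (rule sum_mono) (rule step)
    also have "\<dots> \<le> (\<Sum>a\<in>A. defect (\<kappa> a) X1) + (\<Sum>a\<in>A. defect (\<kappa> a) X2) + card X1"
      using assms(2) by (simp add: sum.distrib sum.delta)
    finally have le: "real (\<Sum>a\<in>A. defect (\<kappa> a) O')
        \<le> real (\<Sum>a\<in>A. defect (\<kappa> a) X1) + real (\<Sum>a\<in>A. defect (\<kappa> a) X2) + real (card X1)"
      by linarith
    have i1: "real (\<Sum>a\<in>A. defect (\<kappa> a) X1) \<le> card X1 * log 2 (card X1)"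
    proof (rule less.hyps)
      show "card X1 < card O'" using c c1 c2 by linarith
      show "finite X1" by (rule f12)
      show "\<exists>x. L p x \<noteq> L q x" if "p \<in> X1" "q \<in> X1" "p \<noteq> q" for p q
        using inj that un(1) by blast
      show "(\<forall>x<a. L p x = L q x) \<and> L p a \<noteq> L q a"
        if "p \<in> X1" "q \<in> X1" "p \<noteq> q" "a \<in> A" "\<kappa> a p = \<kappa> a q" for p q a
        by (rule sep) (use that un(1) in blast)+
    qed
    have i2: "real (\<Sum>a\<in>A. defect (\<kappa> a) X2) \<le> card X2 * log 2 (card X2)"
    proof (rule less.hyps)
      show "card X2 < card O'" using c c1 by linarith
      show "finite X2" by (rule f12)
      show "\<exists>x. L p x \<noteq> L q x" if "p \<in> X2" "q \<in> X2" "p \<noteq> q" for p q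
        using inj that un(1) by blast
      show "(\<forall>x<a. L p x = L q x) \<and> L p a \<noteq> L q a"
        if "p \<in> X2" "q \<in> X2" "p \<noteq> q" "a \<in> A" "\<kappa> a p = \<kappa> a q" for p q a
        by (rule sep) (use that un(1) in blast)+
    qed
    have l1: "log 2 (card X1) + 1 \<le> log 2 (card O')"
    proof -
      have "log 2 (card X1) + 1 = log 2 (2 * card X1)" using c1 by (simp add: log_mult)
      also have "\<dots> \<le> log 2 (card O')" using c1 half by (subst log_le_cancel_iff) auto
      finally show ?thesis .
    qed
    have l2: "log 2 (card X2) \<le> log 2 (card O')" using c1 c2 c by (subst log_le_cancel_iff) auto
    have "card X1 * log 2 (card X1) + card X2 * log 2 (card X2) + card X1
        = card X1 * (log 2 (card X1) + 1) + card X2 * log 2 (card X2)" by (simp add: algebra_simps)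
    also have "\<dots> \<le> card X1 * log 2 (card O') + card X2 * log 2 (card O')"
      by (intro add_mono mult_left_mono l1 l2) auto
    also have "\<dots> = card O' * log 2 (card O')" by (simp add: c algebra_simps)
    finally show ?thesis using le i1 i2 by linarith
  qed
qed

lemma card_spaced_le:
  fixes P :: "nat set"
  assumes "P \<subseteq> {..n}" "\<And>p q. p \<in> P \<Longrightarrow> q \<in> P \<Longrightarrow> p < q \<Longrightarrow> d \<le> q - p" "0 < d"
  shows "card P \<le> n div d + 1"
proof -
  have "inj_on (\<lambda>p. p div d) P"
  proof (rule inj_onI)
    fix p q assume pq: "p \<in> P" "q \<in> P" "p div d = q div d"
    have ne: "a div d \<noteq> b div d" if "a \<in> P" "b \<in> P" "a < b" for a b
    proof -
      have "a + d \<le> b" using assms(2)[OF that] that by linarith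
      then have "(a + d) div d \<le> b div d" by (rule div_le_mono)
      then show ?thesis using assms(3) by simp
    qed
    show "p = q" using ne pq by (metis linorder_neqE_nat)
  qed
  then have "card P = card ((\<lambda>p. p div d) ` P)" by (simp add: card_image)
  also have "\<dots> \<le> card {..n div d}"
    by (rule card_mono) (use assms(1) div_le_mono in auto)
  finally show ?thesis by simp
qed

locale factor_distinct =
  fixes y :: "nat \<Rightarrow> 'a" and K E :: nat
  assumes K1: "1 \<le> K"
    and distinct_factors: "\<And>i j. i < E \<Longrightarrow> j < E \<Longrightarrow> (\<And>x. x \<le> K \<Longrightarrow> y (i + x) = y (j + x)) \<Longrightarrow> i = j"
begin

definition win :: "nat \<Rightarrow> 'a list" where "win i = map (\<lambda>x. y (i + x)) [0..<K]"

lemma win_eq_iff: "win i = win j \<longleftrightarrow> (\<forall>x<K. y (i + x) = y (j + x))"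
  by (auto simp: win_def)

definition pi :: nat where "pi = K div 8"
definition H :: nat where "H = K div 2"
definition M :: nat where "M = (E + K) div (pi + 1) + 1"

lemma anchor_bound:
  fixes cls :: "nat \<Rightarrow> 'c"
  assumes O: "O' \<subseteq> {..E + K}" and A: "A \<subseteq> {..K}" and X: "X \<subseteq> {..E}"
    and spaced: "\<And>p q. p \<in> O' \<Longrightarrow> q \<in> O' \<Longrightarrow> p < q \<Longrightarrow> cls p = cls q \<Longrightarrow> pi + 1 \<le> q - p"
    and cont: "\<And>i j a. i \<in> X \<Longrightarrow> j \<in> X \<Longrightarrow> a \<in> A \<Longrightarrow> win i = win j \<Longrightarrow> i + a \<in> O' \<Longrightarrow>
                 j + a \<in> O' \<and> cls (i + a) = cls (j + a)"
    and enough: "\<And>i. i \<in> X \<Longrightarrow> k0 \<le> card {a \<in> A. i + a \<in> O'}"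
  shows "real (k0 * defect win X) \<le> card O' * log 2 M"
proof -
  have fin: "finite O'" "finite A" "finite X" using O A X finite_subset by blast+
  define \<kappa> where "\<kappa> a p = (if a \<le> p \<and> p - a \<in> X then Inl (win (p - a)) else Inr p)" for a p
  define Oc where "Oc c = {p \<in> O'. cls p = c}" for c
  define Xa where "Xa a = {i \<in> X. i + a \<in> O'}" for a
  define Xv where "Xv v = {i \<in> X. win i = v}" for v
  have X_UN: "X = (\<Union>v\<in>win ` X. Xv v)" by (auto simp: Xv_def)
  have fXv: "finite (Xv v)" for v using fin by (simp add: Xv_def)
  have disjv: "win ` Xv u \<inter> win ` Xv v = {}" if "u \<noteq> v" for u v using that by (auto simp: Xv_def)
  have dX: "defect win X = (\<Sum>v\<in>win ` X. defect win (Xv v))"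
    by (subst X_UN, rule defect_UN_disjoint_images) (use fin fXv disjv in auto)
  have dXa: "defect win (Xa a) = (\<Sum>v\<in>win ` X. if (\<exists>i\<in>Xv v. i + a \<in> O') then defect win (Xv v) else 0)"
    if a: "a \<in> A" for a
  proof -
    let ?V = "{v \<in> win ` X. \<exists>i\<in>Xv v. i + a \<in> O'}"
    have "Xa a = (\<Union>v\<in>?V. Xv v)" 
    proof
      show "Xa a \<subseteq> (\<Union>v\<in>?V. Xv v)" by (auto simp: Xa_def Xv_def)
      show "(\<Union>v\<in>?V. Xv v) \<subseteq> Xa a"
      proof
        fix j assume "j \<in> (\<Union>v\<in>?V. Xv v)"
        then obtain v i where "i \<in> Xv v" "i + a \<in> O'" "j \<in> Xv v" by blast
        then show "j \<in> Xa a" using cont[of i j a] a by (simp add: Xa_def Xv_def)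
      qed
    qed
    then have "defect win (Xa a) = (\<Sum>v\<in>?V. defect win (Xv v))"
      using defect_UN_disjoint_images[of ?V Xv win] fin fXv disjv by simp
    also have "\<dots> = (\<Sum>v\<in>win ` X. if (\<exists>i\<in>Xv v. i + a \<in> O') then defect win (Xv v) else 0)"
      using fin by (simp add: sum.inter_filter)
    finally show ?thesis .
  qed
  have "k0 * defect win X \<le> (\<Sum>v\<in>win ` X. card {a \<in> A. \<exists>i\<in>Xv v. i + a \<in> O'} * defect win (Xv v))"
    unfolding dX sum_distrib_left
  proof (rule sum_mono)
    fix v assume "v \<in> win ` X"
    then obtain i where i: "i \<in> X" "win i = v" by blast
    have "k0 \<le> card {a \<in> A. i + a \<in> O'}" using enough i by blast
    also have "\<dots> \<le> card {a \<in> A. \<exists>i\<in>Xv v. i + a \<in> O'}"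
      by (rule card_mono) (use fin i in \<open>auto simp: Xv_def\<close>)
    finally show "k0 * defect win (Xv v) \<le> card {a \<in> A. \<exists>i\<in>Xv v. i + a \<in> O'} * defect win (Xv v)" by simp
  qed
  also have "\<dots> = (\<Sum>v\<in>win ` X. \<Sum>a\<in>A. if (\<exists>i\<in>Xv v. i + a \<in> O') then defect win (Xv v) else 0)"
    using fin by (simp add: sum.inter_filter[symmetric])
  also have "\<dots> = (\<Sum>a\<in>A. defect win (Xa a))"
    by (subst sum.swap) (use dXa in simp)
  finally have s1: "k0 * defect win X \<le> (\<Sum>a\<in>A. defect win (Xa a))" .
  have s2: "defect win (Xa a) \<le> (\<Sum>c\<in>cls ` O'. defect (\<kappa> a) (Oc c))" if a: "a \<in> A" for a
  proof -
    define Z where "Z c = {i \<in> Xa a. cls (i + a) = c}" for c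
    have fZ: "finite (Z c)" for c using fin by (simp add: Z_def Xa_def)
    have "Xa a = (\<Union>c\<in>cls ` O'. Z c)" by (auto simp: Z_def Xa_def)
    moreover have "win ` Z c \<inter> win ` Z d = {}" if "c \<noteq> d" for c d
    proof -
      have False if "i \<in> Z c" "j \<in> Z d" "win i = win j" for i j
        using cont[of i j a] that a \<open>c \<noteq> d\<close> by (auto simp: Z_def Xa_def)
      then show ?thesis by blast
    qed
    ultimately have "defect win (Xa a) = (\<Sum>c\<in>cls ` O'. defect win (Z c))"
      using defect_UN_disjoint_images[of "cls ` O'" Z win] fin fZ by simp
    also have "\<dots> \<le> (\<Sum>c\<in>cls ` O'. defect (\<kappa> a) (Oc c))"
    proof (rule sum_mono)
      fix c
      have "defect win (Z c) = defect (\<kappa> a) ((\<lambda>i. i + a) ` Z c)"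
        by (rule defect_image_cong) (use fZ in \<open>auto simp: \<kappa>_def Z_def Xa_def\<close>)
      also have "\<dots> \<le> defect (\<kappa> a) (Oc c)"
        by (rule defect_mono) (use fin in \<open>auto simp: Oc_def Z_def Xa_def\<close>)
      finally show "defect win (Z c) \<le> defect (\<kappa> a) (Oc c)" .
    qed
    finally show ?thesis .
  qed
  have s3: "real (\<Sum>a\<in>A. defect (\<kappa> a) (Oc c)) \<le> card (Oc c) * log 2 M" for c
  proof -
    define L where "L p x = (if x < p then Some (y (p - 1 - x)) else None)" for p x :: nat
    have "real (\<Sum>a\<in>A. defect (\<kappa> a) (Oc c)) \<le> card (Oc c) * log 2 (card (Oc c))"
    proof (rule defect_tree_bound[where L = L])
      show "finite (Oc c)" "finite A" using fin by (auto simp: Oc_def)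
      fix p q assume "p \<in> Oc c" "q \<in> Oc c" and pq: "p \<noteq> q"
      show "\<exists>x. L p x \<noteq> L q x"
        by (rule exI[of _ "min p q"]) (use pq in \<open>auto simp: L_def min_def\<close>)
      fix a assume a: "a \<in> A" and eq: "\<kappa> a p = \<kappa> a q"
      from eq pq have v: "a \<le> p" "p - a \<in> X" "a \<le> q" "q - a \<in> X" "win (p - a) = win (q - a)"
        by (auto simp: \<kappa>_def split: if_splits)
      have aK: "a \<le> K" using a A by auto
      have w: "y (p - a + x) = y (q - a + x)" if "x < K" for x using v(5) that by (simp add: win_eq_iff)
      show "(\<forall>x<a. L p x = L q x) \<and> L p a \<noteq> L q a"
      proof
        show "\<forall>x<a. L p x = L q x"
        proof (intro allI impI)
          fix x assume x: "x < a"
          have "y (p - a + (a - 1 - x)) = y (q - a + (a - 1 - x))" by (rule w) (use x aK in linarith)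
          moreover have "p - a + (a - 1 - x) = p - 1 - x" "q - a + (a - 1 - x) = q - 1 - x"
            using x v by linarith+
          ultimately show "L p x = L q x" using x v by (simp add: L_def)
        qed
        show "L p a \<noteq> L q a"
        proof
          assume e: "L p a = L q a"
          then have ap: "a < p" "a < q" using v pq by (auto simp: L_def split: if_splits)
          with e have y0: "y (p - 1 - a) = y (q - 1 - a)" by (simp add: L_def)
          have "p - 1 - a = q - 1 - a"
          proof (rule distinct_factors)
            show "p - 1 - a < E" "q - 1 - a < E" using v X ap by auto
            fix x assume x: "x \<le> K"
            show "y (p - 1 - a + x) = y (q - 1 - a + x)"
            proof (cases x)
              case 0 then show ?thesis using y0 by simp
            next
              case (Suc z)
              have "p - 1 - a + x = p - a + z" "q - 1 - a + x = q - a + z" using Suc ap by linarith+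
              then show ?thesis using w[of z] Suc x by (simp only:)
            qed
          qed
          then show False using ap pq by linarith
        qed
      qed
    qed
    also have "\<dots> \<le> card (Oc c) * log 2 M"
    proof (cases "card (Oc c) = 0")
      case False
      have "card (Oc c) \<le> M" unfolding M_def
      proof (rule card_spaced_le)
        show "Oc c \<subseteq> {..E + K}" using O by (auto simp: Oc_def)
        show "pi + 1 \<le> q - p" if "p \<in> Oc c" "q \<in> Oc c" "p < q" for p q
          by (rule spaced) (use that in \<open>simp_all add: Oc_def\<close>)
      qed simp
      then have "log 2 (card (Oc c)) \<le> log 2 M" using False by (subst log_le_cancel_iff) auto
      then show ?thesis by (simp add: mult_left_mono)
    qed simp
    finally show ?thesis .
  qed
  have "real (k0 * defect win X) \<le> real (\<Sum>a\<in>A. \<Sum>c\<in>cls ` O'. defect (\<kappa> a) (Oc c))"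
    using order_trans[OF s1 sum_mono[OF s2]] by (simp only: of_nat_le_iff)
  also have "\<dots> = (\<Sum>c\<in>cls ` O'. real (\<Sum>a\<in>A. defect (\<kappa> a) (Oc c)))"
    by (subst sum.swap) simp
  also have "\<dots> \<le> (\<Sum>c\<in>cls ` O'. card (Oc c) * log 2 M)" by (rule sum_mono) (rule s3)
  also have "\<dots> = real (\<Sum>c\<in>cls ` O'. card (Oc c)) * log 2 M" by (simp add: sum_distrib_right)
  also have "(\<Sum>c\<in>cls ` O'. card (Oc c)) = card O'"
    using sum.image_gen[OF fin(1), of "\<lambda>_. 1::nat" cls] by (simp add: Oc_def)
  finally show ?thesis .
qed

definition per :: "nat \<Rightarrow> nat \<Rightarrow> bool" where
  "per i l \<longleftrightarrow> (\<exists>d. 1 \<le> d \<and> d \<le> pi \<and> (\<forall>x. i \<le> x \<and> x + d < i + l \<longrightarrow> y x = y (x + d)))"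

lemma pi_H: "4 * pi \<le> H" "2 * H \<le> K" "8 * pi \<le> K"
  unfolding pi_def H_def by linarith+

lemma per_sub: "per i l \<Longrightarrow> i \<le> j \<Longrightarrow> j + l' \<le> i + l \<Longrightarrow> per j l'"
proof -
  assume p: "per i l" and ij: "i \<le> j" "j + l' \<le> i + l"
  obtain d where d: "1 \<le> d" "d \<le> pi" "\<And>x. i \<le> x \<Longrightarrow> x + d < i + l \<Longrightarrow> y x = y (x + d)"
    using p unfolding per_def by blast
  have "y x = y (x + d)" if "j \<le> x" "x + d < j + l'" for x
    by (rule d(3)) (use that ij in linarith)+
  then show ?thesis unfolding per_def using d(1,2) by blast
qed

lemma per_extend_left:
  assumes "per p l" "per q l'" "p < q" "q - p + 2 * pi \<le> l" "2 * pi \<le> l'"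
  shows "per (q - 1) (l' + 1)"
proof -
  obtain d where d: "1 \<le> d" "d \<le> pi" "\<And>x. p \<le> x \<Longrightarrow> x + d < p + l \<Longrightarrow> y x = y (x + d)"
    using assms(1) unfolding per_def by blast
  obtain d' where d': "1 \<le> d'" "d' \<le> pi" "\<And>x. q \<le> x \<Longrightarrow> x + d' < q + l' \<Longrightarrow> y x = y (x + d')"
    using assms(2) unfolding per_def by blast
  have e1: "y (q - 1 + d') = y (q - 1 + d' + d)" by (rule d(3)) (use d d' assms in linarith)+
  have e2: "y (q - 1 + d) = y (q - 1 + d + d')" by (rule d'(3)) (use d d' assms in linarith)+
  have e3: "y (q - 1) = y (q - 1 + d)" by (rule d(3)) (use d d' assms in linarith)+
  have e: "y (q - 1) = y (q - 1 + d')" using e1 e2 e3 by (simp add: add.commute add.left_commute)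
  have "y x = y (x + d')" if "q - 1 \<le> x" "x + d' < q - 1 + (l' + 1)" for x
  proof (cases "q \<le> x")
    case True then show ?thesis using d'(3) that assms by simp
  next
    case False
    then have "x = q - 1" using that by linarith
    then show ?thesis using e by simp
  qed
  then show ?thesis unfolding per_def using d'(1,2) by blast
qed

lemma per_extend_right:
  assumes "per p l" "per q l'" "p < q" "q - p + 2 * pi \<le> l" "p + l < q + l'"
  shows "per p (l + 1)"
proof -
  obtain d where d: "1 \<le> d" "d \<le> pi" "\<And>x. p \<le> x \<Longrightarrow> x + d < p + l \<Longrightarrow> y x = y (x + d)"
    using assms(1) unfolding per_def by blast
  obtain d' where d': "1 \<le> d'" "d' \<le> pi" "\<And>x. q \<le> x \<Longrightarrow> x + d' < q + l' \<Longrightarrow> y x = y (x + d')"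
    using assms(2) unfolding per_def by blast
  define z where "z = p + l"
  have e1: "y (z - d') = y (z - d' + d')" by (rule d'(3)) (use d d' assms z_def in linarith)+
  have e2: "y (z - d' - d) = y (z - d' - d + d)" by (rule d(3)) (use d d' assms z_def in linarith)+
  have e3: "y (z - d - d') = y (z - d - d' + d')" by (rule d'(3)) (use d d' assms z_def in linarith)+
  have i: "z - d' + d' = z" "z - d' - d + d = z - d'" "z - d - d' + d' = z - d" "z - d' - d = z - d - d'"
    using d d' assms z_def by linarith+
  have e: "y (z - d) = y z" using e1[unfolded i(1)] e2[unfolded i(2)] e3[unfolded i(3)] unfolding i(4) by simp
  have "y x = y (x + d)" if "p \<le> x" "x + d < p + (l + 1)" for x
  proof (cases "x + d < p + l")
    case True then show ?thesis using d(3) that by blast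
  next
    case False
    then have "x = z - d" "x + d = z" using that z_def by linarith+
    then show ?thesis using e by simp
  qed
  then show ?thesis unfolding per_def using d(1,2) by blast
qed

lemma per_cong:
  assumes "\<And>x. x < l \<Longrightarrow> y (i + x) = y (j + x)"
  shows "per i l \<longleftrightarrow> per j l"
proof -
  have imp: "per b l" if pa: "per a l" and ab: "\<And>x. x < l \<Longrightarrow> y (a + x) = y (b + x)" for a b
  proof -
    obtain d where d: "1 \<le> d" "d \<le> pi" "\<And>x. a \<le> x \<Longrightarrow> x + d < a + l \<Longrightarrow> y x = y (x + d)"
      using pa unfolding per_def by blast
    have "y x = y (x + d)" if x: "b \<le> x" "x + d < b + l" for x
    proof -
      define z where "z = x - b"
      have z: "x = b + z" using x by (simp add: z_def)
      have "y (b + z) = y (a + z)" by (rule ab[symmetric]) (use x z in linarith)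
      also have "\<dots> = y (a + z + d)" by (rule d(3)) (use x z in linarith)+
      also have "\<dots> = y (a + (z + d))" by (simp only: add.assoc)
      also have "\<dots> = y (b + (z + d))" by (rule ab) (use x z in linarith)
      finally show ?thesis by (simp only: z add.assoc)
    qed
    then show ?thesis unfolding per_def using d(1,2) by blast
  qed
  show ?thesis
  proof
    show "per j l" if "per i l" by (rule imp[OF that]) (rule assms)
    show "per i l" if "per j l" by (rule imp[OF that]) (rule assms[symmetric])
  qed
qed

lemma win_sub:
  assumes "win i = win j" "a + l \<le> K" "x < l"
  shows "y (i + a + x) = y (j + a + x)"
  using assms by (simp add: win_eq_iff add.assoc)

lemma per_win_cong:
  assumes "win i = win j" "a + l \<le> K"
  shows "per (i + a) l \<longleftrightarrow> per (j + a) l"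
  by (rule per_cong) (rule win_sub[OF assms])

definition starts :: "nat set" where
  "starts = {p. 1 \<le> p \<and> p \<le> E + K \<and> per p H \<and> \<not> per (p - 1) (H + 1)}"
definition ends :: "nat set" where
  "ends = {p. p \<le> E + K \<and> per p H \<and> \<not> per p (H + 1)}"
definition aper :: "nat set" where
  "aper = {p. p \<le> E + K \<and> \<not> per p H}"

definition typS :: "nat set" where "typS = {i. i \<le> E \<and> (\<exists>a. 1 \<le> a \<and> a + H \<le> K \<and> i + a \<in> starts)}"
definition typE :: "nat set" where "typE = {i. i \<le> E \<and> (\<exists>a. a + H < K \<and> i + a \<in> ends)}"
definition typP :: "nat set" where "typP = {i. i \<le> E \<and> per i K}"
definition typN :: "nat set" where "typN = {i. i \<le> E \<and> (\<forall>a. a + H \<le> K \<longrightarrow> i + a \<in> aper)}"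

lemma finite_typ: "finite typS" "finite typE" "finite typP" "finite typN"
  by (auto simp: typS_def typE_def typP_def typN_def)

lemma starts_cong:
  assumes "win i = win j" "i \<le> E" "j \<le> E" "1 \<le> a" "a + H \<le> K" "i + a \<in> starts"
  shows "j + a \<in> starts"
proof -
  have "per (j + a) H" using per_win_cong[OF assms(1,5)] assms(6) by (simp add: starts_def)
  moreover have "per (i + (a - 1)) (H + 1) \<longleftrightarrow> per (j + (a - 1)) (H + 1)"
    by (rule per_win_cong) (use assms in linarith)+
  moreover have "i + (a - 1) = i + a - 1" "j + (a - 1) = j + a - 1" using assms(4) by linarith+
  ultimately show ?thesis using assms by (simp add: starts_def)
qed

lemma ends_cong:
  assumes "win i = win j" "i \<le> E" "j \<le> E" "a + H < K" "i + a \<in> ends"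
  shows "j + a \<in> ends"
proof -
  have "per (i + a) H \<longleftrightarrow> per (j + a) H" by (rule per_win_cong) (use assms in linarith)+
  moreover have "per (i + a) (H + 1) \<longleftrightarrow> per (j + a) (H + 1)" by (rule per_win_cong) (use assms in linarith)+
  ultimately show ?thesis using assms by (simp add: ends_def)
qed

lemma typ_cover: "{..E} \<subseteq> typS \<union> typE \<union> typP \<union> typN"
proof
  fix i assume "i \<in> {..E}"
  then have i: "i \<le> E" by simp
  show "i \<in> typS \<union> typE \<union> typP \<union> typN"
  proof (rule ccontr)
    assume "i \<notin> typS \<union> typE \<union> typP \<union> typN"
    then have nS: "i \<notin> typS" and nE: "i \<notin> typE" and nP: "i \<notin> typP" and nN: "i \<notin> typN" by blast+
    have HK: "H \<le> K" using pi_H by linarith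
    obtain a where a: "a + H \<le> K" "per (i + a) H"
      using nN i by (auto simp: typN_def aper_def)
    have down: "per (i + (b - 1)) (H + 1)" if "1 \<le> b" "b + H \<le> K" "per (i + b) H" for b
    proof -
      have "i + b \<notin> starts" using nS i that unfolding typS_def by blast
      then have "per (i + b - 1) (H + 1)" using that i by (simp add: starts_def)
      moreover have "i + b - 1 = i + (b - 1)" using that by linarith
      ultimately show ?thesis by simp
    qed
    have "per i H" using a
    proof (induction a)
      case 0 then show ?case by simp
    next
      case (Suc a)
      have "per (i + a) (H + 1)" using down[of "Suc a"] Suc.prems by simp
      then have "per (i + a) H" by (rule per_sub) auto
      then show ?case using Suc by simp
    qed
    have up: "per (i + b) (H + 1)" if "b + H < K" "per (i + b) H" for b
    proof -
      have "i + b \<notin> ends" using nE i that unfolding typE_def by blast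
      then show ?thesis using that i by (simp add: ends_def)
    qed
    have all: "per (i + b) H" if "b + H \<le> K" for b
      using that
    proof (induction b)
      case 0 then show ?case using \<open>per i H\<close> by simp
    next
      case (Suc b)
      have "per (i + b) (H + 1)" by (rule up) (use Suc in simp_all)
      then show ?case by (rule per_sub) auto
    qed
    have "per i (H + c)" if "H + c \<le> K" for c
      using that
    proof (induction c)
      case 0 then show ?case using \<open>per i H\<close> by simp
    next
      case (Suc c)
      have p: "per i (H + c)" using Suc by simp
      have u: "per (i + c) (H + 1)" by (rule up) (use Suc.prems all in simp_all)
      show ?case
      proof (cases "c = 0")
        case True then show ?thesis using u by simp
      next
        case False
        have "per i (H + c + 1)"
          by (rule per_extend_right[OF p u]) (use False pi_H in linarith)+
        then show ?thesis by simp
      qed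
    qed
    from this[of "K - H"] have "per i K" using HK by simp
    then show False using nP i by (simp add: typP_def)
  qed
qed

lemma M_pos: "1 \<le> M" by (simp add: M_def)

lemma starts_spaced:
  assumes "p \<in> starts" "q \<in> starts" "p < q"
  shows "pi + 1 \<le> q - p"
proof (rule ccontr)
  assume "\<not> pi + 1 \<le> q - p"
  then have "q - p \<le> pi" by linarith
  have "per (q - 1) (H + 1)"
    by (rule per_extend_left[of p H]) (use assms pi_H \<open>q - p \<le> pi\<close> in \<open>auto simp: starts_def\<close>)
  then show False using assms by (simp add: starts_def)
qed

lemma ends_spaced:
  assumes "p \<in> ends" "q \<in> ends" "p < q"
  shows "pi + 1 \<le> q - p"
proof (rule ccontr)
  assume "\<not> pi + 1 \<le> q - p"
  then have "q - p \<le> pi" by linarith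
  have "per p (H + 1)"
    by (rule per_extend_right[of p H q H]) (use assms pi_H \<open>q - p \<le> pi\<close> in \<open>auto simp: ends_def\<close>)
  then show False using assms by (simp add: ends_def)
qed

lemma defect_typS: "real (defect win typS) \<le> M * log 2 M"
proof -
  have "real (1 * defect win typS) \<le> card starts * log 2 M"
  proof (rule anchor_bound[where A = "{a. 1 \<le> a \<and> a + H \<le> K}" and cls = "\<lambda>_. ()"])
    show "starts \<subseteq> {..E + K}" "{a. 1 \<le> a \<and> a + H \<le> K} \<subseteq> {..K}" "typS \<subseteq> {..E}"
      by (auto simp: starts_def typS_def)
    show "pi + 1 \<le> q - p" if "p \<in> starts" "q \<in> starts" "p < q" for p q by (rule starts_spaced[OF that])
    show "j + a \<in> starts \<and> () = ()" if "i \<in> typS" "j \<in> typS" "a \<in> {a. 1 \<le> a \<and> a + H \<le> K}"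
      "win i = win j" "i + a \<in> starts" for i j a
      using starts_cong[OF that(4), of a] that by (simp add: typS_def)
    show "1 \<le> card {a \<in> {a. 1 \<le> a \<and> a + H \<le> K}. i + a \<in> starts}" if iS: "i \<in> typS" for i
    proof -
      have "finite {a \<in> {a. 1 \<le> a \<and> a + H \<le> K}. i + a \<in> starts}" by (rule finite_subset[of _ "{..K}"]) auto
      moreover obtain a where "1 \<le> a" "a + H \<le> K" "i + a \<in> starts" using iS unfolding typS_def by blast
      ultimately have "0 < card {a \<in> {a. 1 \<le> a \<and> a + H \<le> K}. i + a \<in> starts}"
        unfolding card_gt_0_iff by blast
      then show ?thesis by simp
    qed
  qed
  moreover have "card starts \<le> M" unfolding M_def
    by (rule card_spaced_le) (use starts_spaced in \<open>auto simp: starts_def\<close>)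
  then have "card starts * log 2 M \<le> M * log 2 M" using M_pos by (intro mult_right_mono) auto
  ultimately show ?thesis by simp
qed

lemma defect_typE: "real (defect win typE) \<le> M * log 2 M"
proof -
  have "real (1 * defect win typE) \<le> card ends * log 2 M"
  proof (rule anchor_bound[where A = "{a. a + H < K}" and cls = "\<lambda>_. ()"])
    show "ends \<subseteq> {..E + K}" "{a. a + H < K} \<subseteq> {..K}" "typE \<subseteq> {..E}"
      by (auto simp: ends_def typE_def)
    show "pi + 1 \<le> q - p" if "p \<in> ends" "q \<in> ends" "p < q" for p q by (rule ends_spaced[OF that])
    show "j + a \<in> ends \<and> () = ()" if "i \<in> typE" "j \<in> typE" "a \<in> {a. a + H < K}"
      "win i = win j" "i + a \<in> ends" for i j a
      using ends_cong[OF that(4), of a] that by (simp add: typE_def)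
    show "1 \<le> card {a \<in> {a. a + H < K}. i + a \<in> ends}" if iE: "i \<in> typE" for i
    proof -
      have "finite {a \<in> {a. a + H < K}. i + a \<in> ends}" by (rule finite_subset[of _ "{..K}"]) auto
      moreover obtain a where "a + H < K" "i + a \<in> ends" using iE unfolding typE_def by blast
      ultimately have "0 < card {a \<in> {a. a + H < K}. i + a \<in> ends}"
        unfolding card_gt_0_iff by blast
      then show ?thesis by simp
    qed
  qed
  moreover have "card ends \<le> M" unfolding M_def
    by (rule card_spaced_le) (use ends_spaced in \<open>auto simp: ends_def\<close>)
  then have "card ends * log 2 M \<le> M * log 2 M" using M_pos by (intro mult_right_mono) auto
  ultimately show ?thesis by simp
qed

lemma defect_typN: "real (defect win typN) \<le> (M + 1) * log 2 M"
proof -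
  define cls where "cls p = map (\<lambda>x. y (p + x)) [0..<H]" for p
  have cls_eq: "cls p = cls q \<longleftrightarrow> (\<forall>x<H. y (p + x) = y (q + x))" for p q by (auto simp: cls_def)
  have b: "real ((K - H + 1) * defect win typN) \<le> card aper * log 2 M"
  proof (rule anchor_bound[where A = "{..K - H}" and cls = cls])
    show "aper \<subseteq> {..E + K}" "{..K - H} \<subseteq> {..K}" "typN \<subseteq> {..E}"
      by (auto simp: aper_def typN_def)
    have HK: "H \<le> K" using pi_H by linarith
    show "pi + 1 \<le> q - p" if pq: "p \<in> aper" "q \<in> aper" "p < q" "cls p = cls q" for p q
    proof (rule ccontr)
      assume "\<not> pi + 1 \<le> q - p"
      then have d: "1 \<le> q - p" "q - p \<le> pi" using pq(3) by linarith+
      have "y x = y (x + (q - p))" if x: "p \<le> x" "x + (q - p) < p + H" for x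
      proof -
        define z where "z = x - p"
        have "z < H" using x pq(3) unfolding z_def by linarith
        then have "y (p + z) = y (q + z)" using pq(4) unfolding cls_eq by blast
        moreover have "x = p + z" "x + (q - p) = q + z" using x pq(3) by (simp_all add: z_def)
        ultimately show ?thesis by (simp only:)
      qed
      then have "per p H" unfolding per_def using d by blast
      then show False using pq(1) by (simp add: aper_def)
    qed
    show "j + a \<in> aper \<and> cls (i + a) = cls (j + a)" if "i \<in> typN" "j \<in> typN" "a \<in> {..K - H}"
      "win i = win j" "i + a \<in> aper" for i j a
    proof -
      have "a + H \<le> K" using that HK by simp
      then show ?thesis using that win_sub[OF that(4), of a H] by (simp add: typN_def cls_eq)
    qed
    show "K - H + 1 \<le> card {a \<in> {..K - H}. i + a \<in> aper}" if "i \<in> typN" for i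
    proof -
      have "{a \<in> {..K - H}. i + a \<in> aper} = {..K - H}" using that HK by (auto simp: typN_def)
      then show ?thesis by simp
    qed
  qed
  have "card aper \<le> E + K + 1"
    using card_mono[of "{..E + K}" aper] by (auto simp: aper_def)
  moreover have "E + K + 1 \<le> (K - H + 1) * (M + 1)"
  proof -
    have "E + K < (pi + 1) * ((E + K) div (pi + 1) + 1)"
      using dividend_less_times_div[of "pi + 1" "E + K"] by (simp add: algebra_simps)
    then have "E + K + 1 \<le> (pi + 1) * M" by (simp add: M_def)
    also have "\<dots> \<le> (K - H + 1) * (M + 1)" by (rule mult_le_mono) (use pi_H in linarith)+
    finally show ?thesis .
  qed
  ultimately have "card aper \<le> (K - H + 1) * (M + 1)" by linarith
  then have "real (card aper) \<le> real ((K - H + 1) * (M + 1))" by (simp only: of_nat_le_iff)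
  then have "card aper * log 2 M \<le> real ((K - H + 1) * (M + 1)) * log 2 M"
    using M_pos by (intro mult_right_mono) auto
  with b have "real (K - H + 1) * real (defect win typN) \<le> real (K - H + 1) * ((M + 1) * log 2 M)"
    by (simp only: of_nat_mult mult.assoc)
  then show ?thesis by (subst (asm) mult_le_cancel_left_pos) auto
qed

lemma defect_typP: "defect win typP \<le> M + 1"
proof -
  define Q where "Q = {i \<in> typP. i < E \<and> i + 1 \<in> typP}"
  have K8: "2 * pi < K" using pi_H K1 by linarith
  have "inj_on win Q"
  proof (rule inj_onI)
    fix i j assume i: "i \<in> Q" and j: "j \<in> Q" and eq: "win i = win j"
    have w: "y (i + x) = y (j + x)" if "x < K" for x using eq that by (simp add: win_eq_iff)
    obtain d where d: "1 \<le> d" "d \<le> pi" "\<And>x. i + 1 \<le> x \<Longrightarrow> x + d < i + 1 + K \<Longrightarrow> y x = y (x + d)"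
      using i unfolding Q_def typP_def per_def by blast
    obtain e where e: "1 \<le> e" "e \<le> pi" "\<And>x. j + 1 \<le> x \<Longrightarrow> x + e < j + 1 + K \<Longrightarrow> y x = y (x + e)"
      using j unfolding Q_def typP_def per_def by blast
    have "y (i + K) = y (i + (K - d))" using d(3)[of "i + (K - d)"] d(1,2) K8 by simp
    also have "\<dots> = y (j + (K - d))" by (rule w) (use d K8 in linarith)
    also have "\<dots> = y (j + (K - d - e))" using e(3)[of "j + (K - d - e)"] d(1,2) e(1,2) K8 by simp
    also have "\<dots> = y (i + (K - d - e))" by (rule w[symmetric]) (use d K8 in linarith)
    also have "\<dots> = y (i + (K - e))" using d(3)[of "i + (K - d - e)"] d(1,2) e(1,2) K8 by simp
    also have "\<dots> = y (j + (K - e))" by (rule w) (use e K8 in linarith)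
    also have "\<dots> = y (j + K)" using e(3)[of "j + (K - e)"] e(1,2) K8 by simp
    finally have "y (i + K) = y (j + K)" .
    then have "y (i + x) = y (j + x)" if "x \<le> K" for x using w that by (cases "x = K") auto
    then show "i = j" by (intro distinct_factors) (use i j in \<open>auto simp: Q_def\<close>)
  qed
  then have Q0: "defect win Q = 0" by (simp add: defect_def card_image)
  define R where "R = {i \<in> typP. i < E \<and> i + 1 \<notin> typP}"
  have "card R \<le> M" unfolding M_def
  proof (rule card_spaced_le)
    show "R \<subseteq> {..E + K}" by (auto simp: R_def)
    show "pi + 1 \<le> q - p" if pq: "p \<in> R" "q \<in> R" "p < q" for p q
    proof (rule ccontr)
      assume "\<not> pi + 1 \<le> q - p"
      then have "q - p \<le> pi" by linarith
      have "per p (K + 1)"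
        by (rule per_extend_right[of p K q K])
          (use pq pi_H \<open>q - p \<le> pi\<close> K8 in \<open>auto simp: R_def typP_def\<close>)
      then have "per (p + 1) K" by (rule per_sub) auto
      then show False using pq(1) by (auto simp: R_def typP_def)
    qed
  qed simp
  have "typP = (R \<union> (typP \<inter> {E})) \<union> Q" by (auto simp: Q_def R_def typP_def)
  moreover have f: "finite R" "finite Q" using finite_typ by (auto simp: R_def Q_def)
  ultimately have "defect win typP \<le> card (R \<union> (typP \<inter> {E})) + defect win Q"
    using defect_Un_le[of "R \<union> (typP \<inter> {E})" Q win] by simp
  also have "card (R \<union> (typP \<inter> {E})) \<le> card R + card (typP \<inter> {E})" by (rule card_Un_le)
  also have "card (typP \<inter> {E}) \<le> 1" using card_mono[of "{E}" "typP \<inter> {E}"] by simp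
  finally show ?thesis using Q0 \<open>card R \<le> M\<close> by simp
qed

lemma defect_cover:
  assumes "finite A" "finite B" "\<And>i j. i \<in> A \<union> B \<Longrightarrow> j \<in> A \<union> B \<Longrightarrow> f i = f j \<Longrightarrow> i \<in> A \<Longrightarrow> j \<in> A"
  shows "defect f (A \<union> B) \<le> defect f A + defect f B"
proof -
  have "A \<union> B = A \<union> (B - A)" by blast
  also have "defect f \<dots> = defect f A + defect f (B - A)"
    by (rule defect_Un_disjoint_images) (use assms in blast)+
  also have "defect f (B - A) \<le> defect f B" by (rule defect_mono) (use assms in auto)
  finally show ?thesis by simp
qed

lemma defect_win_bound: "real (defect win {..E}) \<le> (3 * M + 1) * log 2 M + (M + 1)"
proof -
  have le: "typS \<subseteq> {..E}" "typE \<subseteq> {..E}" "typP \<subseteq> {..E}" "typN \<subseteq> {..E}"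
    by (auto simp: typS_def typE_def typP_def typN_def)
  have cS: "j \<in> typS" if iS: "i \<in> typS" and j: "j \<le> E" and ij: "win i = win j" for i j
  proof -
    obtain a where "1 \<le> a" "a + H \<le> K" "i + a \<in> starts" "i \<le> E" using iS unfolding typS_def by blast
    then show ?thesis using starts_cong[OF ij, of a] j unfolding typS_def by blast
  qed
  have cE: "j \<in> typE" if iE: "i \<in> typE" and j: "j \<le> E" and ij: "win i = win j" for i j
  proof -
    obtain a where "a + H < K" "i + a \<in> ends" "i \<le> E" using iE unfolding typE_def by blast
    then show ?thesis using ends_cong[OF ij, of a] j unfolding typE_def by blast
  qed
  have cP: "j \<in> typP" if "i \<in> typP" "j \<le> E" "win i = win j" for i j
    using per_win_cong[OF that(3), of 0 K] that by (simp add: typP_def)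
  have "defect win {..E} \<le> defect win (typS \<union> (typE \<union> (typP \<union> typN)))"
    by (rule defect_mono) (use typ_cover finite_typ in auto)
  also have "\<dots> \<le> defect win typS + defect win (typE \<union> (typP \<union> typN))"
    by (rule defect_cover) (use finite_typ cS le in blast)+
  also have "\<dots> \<le> defect win typS + (defect win typE + defect win (typP \<union> typN))"
    by (intro add_left_mono defect_cover) (use finite_typ cE le in blast)+
  also have "\<dots> \<le> defect win typS + (defect win typE + (defect win typP + defect win typN))"
    by (intro add_left_mono defect_cover) (use finite_typ cP le in blast)+
  finally have "real (defect win {..E}) \<le> real (defect win typS) + real (defect win typE)
      + real (defect win typP) + real (defect win typN)" by linarith
  moreover have "real (defect win typP) \<le> M + 1" using defect_typP by linarith
  ultimately show ?thesis
    using defect_typS defect_typE defect_typN by (simp add: algebra_simps)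
qed

lemma repeated_win_bound:
  assumes "M < 2 ^ b"
  shows "card {i. i \<le> E \<and> (\<exists>j\<le>E. j \<noteq> i \<and> win j = win i)} \<le> 12 * M * b"
proof -
  have b1: "1 \<le> b" using assms M_pos by (cases b) auto
  have "log 2 M < b" using assms M_pos by (simp add: log_less_iff flip: powr_realpow) (metis of_nat_less_iff of_nat_numeral of_nat_power powr_realpow zero_less_numeral)
  then have "real (3 * M + 1) * log 2 M \<le> real (4 * M) * real b" using M_pos by (intro mult_mono) auto
  moreover have "real (M + 1) \<le> real (2 * M * b)"
  proof -
    have "M * 1 \<le> M * b" using b1 by (rule mult_le_mono2)
    then have "M + 1 \<le> 2 * M * b" using M_pos by linarith
    then show ?thesis by (simp only: of_nat_le_iff)
  qed
  ultimately have "real (defect win {..E}) \<le> real (6 * M * b)"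
    using defect_win_bound by simp
  then have d: "defect win {..E} \<le> 6 * M * b" by (simp only: of_nat_le_iff)
  have "{i. i \<le> E \<and> (\<exists>j\<le>E. j \<noteq> i \<and> win j = win i)} = {i \<in> {..E}. \<exists>j\<in>{..E}. j \<noteq> i \<and> win j = win i}" by auto
  then show ?thesis using card_repeated_le_defect[of "{..E}" win] d by simp
qed

end

section \<open>Walks respecting release times and deadlines\<close>

fun bitlen :: "nat \<Rightarrow> nat" where
  "bitlen n = (if n = 0 then 0 else Suc (bitlen (n div 2)))"

declare bitlen.simps [simp del]

lemma less_two_power_bitlen: "n < 2 ^ bitlen n"
proof (induction n rule: bitlen.induct)
  case (1 n)
  then show ?case by (subst bitlen.simps) (auto simp: algebra_simps)
qed

lemma two_power_bitlen_le: "n \<noteq> 0 \<Longrightarrow> 2 ^ bitlen n \<le> 2 * n"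
proof (induction n rule: bitlen.induct)
  case (1 n)
  then show ?case by (subst bitlen.simps) (cases "n div 2 = 0"; simp add: bitlen.simps[of 0])
qed

lemma bitlen_le: "bitlen n \<le> n"
proof (induction n rule: bitlen.induct)
  case (1 n)
  then show ?case by (subst bitlen.simps) auto
qed

lemma card_lists_le_prod:
  assumes "finite S" "\<And>l. l \<in> S \<Longrightarrow> length l = r"
    and "\<And>l i. l \<in> S \<Longrightarrow> i < r \<Longrightarrow> card {l' ! i | l'. l' \<in> S \<and> take i l' = take i l} \<le> B i"
  shows "card S \<le> (\<Prod>i<r. B i)"
proof -
  have "card (take j ` S) \<le> (\<Prod>i<j. B i)" if "j \<le> r" for j
    using that
  proof (induction j)
    case 0
    have "take 0 ` S \<subseteq> {[]}" by auto
    then have "card (take 0 ` S) \<le> card {[] :: 'a list}" by (rule card_mono[rotated]) simp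
    then show ?case by simp
  next
    case (Suc j)
    define X where "X u = {l' ! j | l'. l' \<in> S \<and> take j l' = u}" for u
    have "take (Suc j) ` S \<subseteq> (\<lambda>(u, x). u @ [x]) ` (SIGMA u : take j ` S. X u)"
    proof
      fix z assume "z \<in> take (Suc j) ` S"
      then obtain l where l: "l \<in> S" "z = take (Suc j) l" by blast
      have "z = take j l @ [l ! j]" using l assms(2) Suc.prems by (simp add: take_Suc_conv_app_nth)
      then show "z \<in> (\<lambda>(u, x). u @ [x]) ` (SIGMA u : take j ` S. X u)"
        using l by (auto simp: X_def image_iff)
    qed
    moreover have fX: "finite (X u)" for u
      by (rule finite_subset[of _ "(\<lambda>l. l ! j) ` S"]) (use assms(1) in \<open>auto simp: X_def\<close>)
    then have fin: "finite (SIGMA u : take j ` S. X u)" using assms(1) by auto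
    ultimately have "card (take (Suc j) ` S) \<le> card ((\<lambda>(u, x). u @ [x]) ` (SIGMA u : take j ` S. X u))"
      by (intro card_mono) auto
    also have "\<dots> \<le> card (SIGMA u : take j ` S. X u)" by (rule card_image_le[OF fin])
    also have "\<dots> = (\<Sum>u\<in>take j ` S. card (X u))" using fX assms(1) by (simp add: card_SigmaI)
    also have "\<dots> \<le> (\<Sum>u\<in>take j ` S. B j)"
    proof (rule sum_mono)
      fix u assume "u \<in> take j ` S"
      then show "card (X u) \<le> B j" using assms(3)[of _ j] Suc.prems by (auto simp: X_def)
    qed
    also have "\<dots> = card (take j ` S) * B j" by simp
    also have "\<dots> \<le> (\<Prod>i<j. B i) * B j" using Suc by simp
    finally show ?case by simp
  qed
  from this[of r] have "card (take r ` S) \<le> (\<Prod>i<r. B i)" by simp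
  moreover have "take r ` S = S" using assms(2) by (force simp: image_iff)
  ultimately show ?thesis by simp
qed

locale timed_graph =
  fixes m w :: nat and src dst lo hi :: "nat \<Rightarrow> nat"
begin

definition walk :: "nat list \<Rightarrow> bool" where
  "walk p \<longleftrightarrow> set p \<subseteq> {..<m} \<and> (\<forall>i<length p. lo (p ! i) \<le> Suc i \<and> Suc i \<le> hi (p ! i))
     \<and> (\<forall>i. Suc i < length p \<longrightarrow> dst (p ! i) = src (p ! Suc i))"

definition good :: "nat \<Rightarrow> nat list \<Rightarrow> bool" where
  "good t p \<longleftrightarrow> walk p \<and> distinct p \<and> length p = t"

definition entering :: "nat \<Rightarrow> nat set" where
  "entering e = {f. f < m \<and> dst f = src e \<and> lo f \<le> hi e \<and> lo e \<le> Suc (hi f)}"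

definition leaving :: "nat \<Rightarrow> nat set" where
  "leaving e = {f. f < m \<and> src f = src e \<and> lo f \<le> hi e \<and> lo e \<le> Suc (hi f)}"

text \<open>An arc with nonempty interval belongs to its own \<open>leaving\<close> set, so for such arcs the
  condition says that one of the two sets has at least two elements.\<close>

definition crit :: "nat \<Rightarrow> bool" where
  "crit e \<longleftrightarrow> 4 \<le> card (entering e) + 2 * card (leaving e)"

lemma finite_entering_leaving [simp]: "finite (entering e)" "finite (leaving e)"
  by (auto simp: entering_def leaving_def)

lemma crit_if_entering:
  assumes "f \<in> entering e" "g \<in> entering e" "f \<noteq> g" "e < m" "lo e \<le> hi e"
  shows "crit e"
proof -
  have "card {f, g} \<le> card (entering e)" by (rule card_mono) (use assms in auto)
  moreover have "card {e} \<le> card (leaving e)"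
    by (rule card_mono) (use assms in \<open>auto simp: leaving_def\<close>)
  ultimately show ?thesis using assms by (simp add: crit_def)
qed

lemma crit_if_leaving:
  assumes "f \<in> leaving e" "g \<in> leaving e" "f \<noteq> g"
  shows "crit e"
proof -
  have "card {f, g} \<le> card (leaving e)" by (rule card_mono) (use assms in auto)
  then show ?thesis using assms by (simp add: crit_def)
qed

text \<open>The list is reversed in every step because the program copies it from top to bottom.\<close>

definition push :: "nat \<Rightarrow> nat \<Rightarrow> nat list \<Rightarrow> nat list" where
  "push t e l = rev (filter (\<lambda>f. t < hi f) l) @ (if (crit e \<or> t = 1) \<and> t < hi e then [e] else [])"

fun stackr :: "nat list \<Rightarrow> nat list" where
  "stackr [] = []"
| "stackr (e # q) = push (Suc (length q)) e (stackr q)"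

definition stack :: "nat list \<Rightarrow> nat list" where "stack p = stackr (rev p)"

lemma stack_Nil [simp]: "stack [] = []" by (simp add: stack_def)
lemma stack_snoc [simp]: "stack (p @ [e]) = push (Suc (length p)) e (stack p)" by (simp add: stack_def)

definition succs :: "nat \<Rightarrow> nat \<times> nat list \<Rightarrow> (nat \<times> nat list) set" where
  "succs t s = {(dst e, push t e (snd s)) | e.
     e < m \<and> src e = fst s \<and> lo e \<le> t \<and> t \<le> hi e \<and> e \<notin> set (snd s)}"

fun St :: "nat \<Rightarrow> (nat \<times> nat list) set" where
  "St 0 = {(src e, []) | e. e < m}"
| "St (Suc t) = (\<Union>s\<in>St t. succs (Suc t) s)"

lemma walk_take:
  assumes "walk p" shows "walk (take n p)"
proof -
  have w: "set p \<subseteq> {..<m}" "\<And>i. i < length p \<Longrightarrow> lo (p ! i) \<le> Suc i \<and> Suc i \<le> hi (p ! i)"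
    "\<And>i. Suc i < length p \<Longrightarrow> dst (p ! i) = src (p ! Suc i)"
    using assms unfolding walk_def by blast+
  show ?thesis unfolding walk_def
  proof (intro conjI allI impI)
    show "set (take n p) \<subseteq> {..<m}" using w(1) set_take_subset[of n p] by blast
    fix i assume "i < length (take n p)"
    then show "lo (take n p ! i) \<le> Suc i" "Suc i \<le> hi (take n p ! i)" using w(2)[of i] by simp_all
  next
    fix i assume "Suc i < length (take n p)"
    then show "dst (take n p ! i) = src (take n p ! Suc i)" using w(3)[of i] by simp
  qed
qed

lemma walk_butlast: "walk (p @ [e]) \<Longrightarrow> walk p"
  using walk_take[of "p @ [e]" "length p"] by simp

lemma stack_single: "stack [e] = push 1 e []"
  using stack_snoc[of "[]" e] by simp

lemma set_stack:
  assumes "walk p"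
  shows "set (stack p) = {f \<in> set p. length p < hi f \<and> (crit f \<or> f = p ! 0)}"
  using assms
proof (induction p rule: rev_induct)
  case Nil then show ?case by simp
next
  case (snoc e p)
  have wp: "walk p" by (rule walk_butlast[OF snoc.prems])
  have IH: "set (stack p) = {f \<in> set p. length p < hi f \<and> (crit f \<or> f = p ! 0)}"
    by (rule snoc.IH[OF wp])
  show ?case
  proof (cases "p = []")
    case True then show ?thesis by (auto simp: stack_single push_def)
  next
    case False
    have h0: "(p @ [e]) ! 0 = p ! 0" using False by (simp add: nth_append)
    have "p ! 0 \<in> set p" using False by simp
    have "set (stack (p @ [e])) = {f \<in> set (stack p). Suc (length p) < hi f}
        \<union> (if crit e \<and> Suc (length p) < hi e then {e} else {})"
      using False by (auto simp: push_def)
    also have "\<dots> = {f \<in> set (p @ [e]). length (p @ [e]) < hi f \<and> (crit f \<or> f = p ! 0)}"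
      unfolding IH using \<open>p ! 0 \<in> set p\<close> by auto
    finally show ?thesis unfolding h0 .
  qed
qed

lemma walk_snoc:
  "walk (p @ [e]) \<longleftrightarrow> walk p \<and> e < m \<and> lo e \<le> Suc (length p) \<and> Suc (length p) \<le> hi e
     \<and> (p \<noteq> [] \<longrightarrow> dst (last p) = src e)"
proof
  assume a: "walk (p @ [e])"
  have "dst (last p) = src e" if "p \<noteq> []"
  proof -
    have "Suc (length p - 1) < length (p @ [e])" using that by simp
    then have "dst ((p @ [e]) ! (length p - 1)) = src ((p @ [e]) ! Suc (length p - 1))"
      using a unfolding walk_def by blast
    then show ?thesis using that by (simp add: nth_append last_conv_nth)
  qed
  moreover have "lo ((p @ [e]) ! length p) \<le> Suc (length p) \<and> Suc (length p) \<le> hi ((p @ [e]) ! length p)"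
    using a unfolding walk_def by (metis length_append_singleton lessI)
  ultimately show "walk p \<and> e < m \<and> lo e \<le> Suc (length p) \<and> Suc (length p) \<le> hi e
     \<and> (p \<noteq> [] \<longrightarrow> dst (last p) = src e)"
    using walk_butlast[OF a] a by (auto simp: walk_def)
next
  assume a: "walk p \<and> e < m \<and> lo e \<le> Suc (length p) \<and> Suc (length p) \<le> hi e
     \<and> (p \<noteq> [] \<longrightarrow> dst (last p) = src e)"
  show "walk (p @ [e])" unfolding walk_def
  proof (intro conjI allI impI)
    show "set (p @ [e]) \<subseteq> {..<m}" using a by (auto simp: walk_def)
    fix i assume i: "i < length (p @ [e])"
    show "lo ((p @ [e]) ! i) \<le> Suc i" "Suc i \<le> hi ((p @ [e]) ! i)"
      using a i by (auto simp: walk_def nth_append less_Suc_eq)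
  next
    fix i assume i: "Suc i < length (p @ [e])"
    show "dst ((p @ [e]) ! i) = src ((p @ [e]) ! Suc i)"
    proof (cases "Suc i < length p")
      case True then show ?thesis using a by (auto simp: walk_def nth_append)
    next
      case False
      then have "i = length p - 1" "p \<noteq> []" using i by auto
      then show ?thesis using a by (simp add: nth_append last_conv_nth)
    qed
  qed
qed

text \<open>The two visits preceding the earliest repetition enter its tail along different arcs, so a
  repetition always involves a critical arc or the first arc.\<close>

lemma repetition_detected:
  assumes "walk (p @ [e])" "distinct p" "e \<in> set p"
  shows "e \<in> set (stack p)"
proof -
  have we: "walk p" "e < m" "lo e \<le> Suc (length p)" "Suc (length p) \<le> hi e" "p \<noteq> []"
      "dst (last p) = src e"
    using assms walk_snoc by auto
  obtain s where s: "s < length p" "p ! s = e" using assms(3) by (auto simp: in_set_conv_nth)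
  have "crit e \<or> e = p ! 0"
  proof (cases "s = 0")
    case True then show ?thesis using s by simp
  next
    case False
    define f where "f = p ! (s - 1)"
    define g where "g = last p"
    have "Suc (s - 1) < length p" using s False by simp
    then have "dst (p ! (s - 1)) = src (p ! Suc (s - 1))" using we(1) unfolding walk_def by blast
    then have f1: "dst f = src e" using s False by (simp add: f_def)
    have lh: "lo (p ! i) \<le> Suc i \<and> Suc i \<le> hi (p ! i) \<and> p ! i < m" if "i < length p" for i
      using we(1) that unfolding walk_def by (auto simp: subset_iff)
    have g: "g = p ! (length p - 1)" using we(5) by (simp add: g_def last_conv_nth)
    have "f \<noteq> g"
    proof
      assume "f = g"
      then have "s - 1 = length p - 1" using assms(2) s we(5) unfolding f_def g
        by (subst (asm) nth_eq_iff_index_eq) auto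
      then show False using s False by linarith
    qed
    moreover have "f \<in> entering e"
    proof -
      have "s - 1 < length p" using s(1) by linarith
      then have "lo f \<le> s" "s \<le> hi f" "f < m" using lh[of "s - 1"] False by (auto simp: f_def)
      moreover have "lo e \<le> Suc s" "Suc s \<le> hi e" using lh[OF s(1)] s(2) by auto
      ultimately show ?thesis unfolding entering_def using f1 by auto
    qed
    moreover have "g \<in> entering e"
    proof -
      have "length p - 1 < length p" using we(5) by simp
      then have "lo g \<le> length p" "length p \<le> hi g" "g < m" using lh[of "length p - 1"] we(5) by (auto simp: g)
      then show ?thesis unfolding entering_def using we(3,4,6) by (auto simp: g_def)
    qed
    ultimately have "crit e" using crit_if_entering we(2,3,4) by auto
    then show ?thesis by simp
  qed
  then show ?thesis using set_stack[OF we(1)] assms(3) we(4) by auto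
qed

lemma good_snoc:
  "good (Suc t) (p @ [e]) \<longleftrightarrow> good t p \<and> e < m \<and> lo e \<le> Suc t \<and> Suc t \<le> hi e
     \<and> (p \<noteq> [] \<longrightarrow> dst (last p) = src e) \<and> e \<notin> set (stack p)"
proof
  assume "good (Suc t) (p @ [e])"
  then show "good t p \<and> e < m \<and> lo e \<le> Suc t \<and> Suc t \<le> hi e
     \<and> (p \<noteq> [] \<longrightarrow> dst (last p) = src e) \<and> e \<notin> set (stack p)"
    unfolding good_def walk_snoc by (auto simp: set_stack)
next
  assume a: "good t p \<and> e < m \<and> lo e \<le> Suc t \<and> Suc t \<le> hi e
     \<and> (p \<noteq> [] \<longrightarrow> dst (last p) = src e) \<and> e \<notin> set (stack p)"
  then have w: "walk (p @ [e])" unfolding good_def walk_snoc by auto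
  have "e \<notin> set p" using repetition_detected[OF w] a unfolding good_def by blast
  then show "good (Suc t) (p @ [e])" using w a by (auto simp: good_def)
qed

lemma good_SucE:
  assumes "good (Suc t) q"
  obtains p e where "q = p @ [e]" "good (Suc t) (p @ [e])"
proof (cases q rule: rev_cases)
  case Nil then show ?thesis using assms by (simp add: good_def)
next
  case (snoc p e) then show ?thesis using assms that by blast
qed

lemma St_Suc: "St (Suc t) = {(dst (last p), stack p) | p. good (Suc t) p}"
proof (induction t)
  case 0
  have g0: "good 0 p \<longleftrightarrow> p = []" for p by (auto simp: good_def walk_def)
  show ?case
  proof (intro set_eqI iffI)
    fix z assume "z \<in> St (Suc 0)"
    then obtain e where e: "e < m" "lo e \<le> 1" "1 \<le> hi e" "z = (dst e, push 1 e [])"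
      by (auto simp: succs_def)
    have "good (Suc 0) ([] @ [e])" unfolding good_snoc using e g0 by simp
    moreover have "z = (dst (last ([] @ [e])), stack ([] @ [e]))" unfolding stack_snoc e(4) by simp
    ultimately show "z \<in> {(dst (last p), stack p) | p. good (Suc 0) p}" by blast
  next
    fix z assume "z \<in> {(dst (last p), stack p) | p. good (Suc 0) p}"
    then obtain q where "z = (dst (last q), stack q)" "good (Suc 0) q" by blast
    then obtain p e where z: "z = (dst (last (p @ [e])), stack (p @ [e]))" and g: "good (Suc 0) (p @ [e])"
      by (blast elim: good_SucE)
    have p: "p = []" and e: "e < m" "lo e \<le> 1" "1 \<le> hi e" using g g0 unfolding good_snoc by auto
    have "z \<in> succs (Suc 0) (src e, [])" using e unfolding z p stack_snoc succs_def by auto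
    then show "z \<in> St (Suc 0)" using e by auto
  qed
next
  case (Suc t)
  have ne: "p \<noteq> []" if "good (Suc n) p" for p n using that by (auto simp: good_def)
  show ?case
  proof (intro set_eqI iffI)
    fix z assume "z \<in> St (Suc (Suc t))"
    then obtain p e where p: "good (Suc t) p" and e: "e < m" "src e = dst (last p)" "lo e \<le> Suc (Suc t)"
      "Suc (Suc t) \<le> hi e" "e \<notin> set (stack p)" "z = (dst e, push (Suc (Suc t)) e (stack p))"
      unfolding St.simps(2)[of "Suc t"] Suc by (auto simp: succs_def)
    have "good (Suc (Suc t)) (p @ [e])" using p e unfolding good_snoc[of "Suc t"] by simp
    moreover have "z = (dst (last (p @ [e])), stack (p @ [e]))" using p e by (simp add: good_def)
    ultimately show "z \<in> {(dst (last p), stack p) | p. good (Suc (Suc t)) p}" by blast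
  next
    fix z assume "z \<in> {(dst (last p), stack p) | p. good (Suc (Suc t)) p}"
    then obtain q where "z = (dst (last q), stack q)" "good (Suc (Suc t)) q" by blast
    then obtain p e where z: "z = (dst (last (p @ [e])), stack (p @ [e]))" and g: "good (Suc (Suc t)) (p @ [e])"
      by (blast elim: good_SucE)
    have p: "good (Suc t) p" using g unfolding good_snoc[of "Suc t"] by blast
    have "z \<in> succs (Suc (Suc t)) (dst (last p), stack p)"
      using g ne[OF p] p unfolding good_snoc[of "Suc t"] z by (auto simp: succs_def good_def)
    then show "z \<in> St (Suc (Suc t))" unfolding St.simps(2)[of "Suc t"] Suc using p by blast
  qed
qed

lemma finite_good: "finite {p. good t p}"
proof (rule finite_subset)
  show "{p. good t p} \<subseteq> {p. set p \<subseteq> {..<m} \<and> length p = t}" by (auto simp: good_def walk_def)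
qed (simp add: finite_lists_length_eq)

lemma finite_St: "finite (St t)"
proof (cases t)
  case 0
  have "St 0 = (\<lambda>e. (src e, [])) ` {..<m}" by auto
  then show ?thesis using 0 by simp
next
  case (Suc n)
  have "St (Suc n) = (\<lambda>p. (dst (last p), stack p)) ` {p. good (Suc n) p}" unfolding St_Suc by blast
  then show ?thesis using Suc finite_good by simp
qed

lemma good_length_le: "good t p \<Longrightarrow> t \<le> m"
  unfolding good_def walk_def using card_mono[of "{..<m}" "set p"] distinct_card[of p] by auto

lemma distinct_stack: "distinct p \<Longrightarrow> distinct (stack p)"
proof -
  have "distinct p \<Longrightarrow> distinct (stack p) \<and> set (stack p) \<subseteq> set p"
  proof (induction p rule: rev_induct)
    case (snoc e p)
    then have "distinct (stack p)" "set (stack p) \<subseteq> set p" "e \<notin> set p" by auto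
    then show ?case by (auto simp: push_def)
  qed simp
  then show "distinct p \<Longrightarrow> distinct (stack p)" by blast
qed

definition releases_bounded :: bool where
  "releases_bounded \<longleftrightarrow> (\<forall>t. 1 \<le> t \<longrightarrow> t \<le> m \<longrightarrow> card {e. e < m \<and> lo e \<le> t} + 1 \<le> t + w)"

definition critical_bounded :: "nat \<Rightarrow> bool" where
  "critical_bounded D \<longleftrightarrow>
     (\<forall>t. 1 \<le> t \<longrightarrow> t \<le> m \<longrightarrow> card {e. e < m \<and> crit e \<and> lo e \<le> t \<and> t \<le> hi e + w} \<le> D)"

end

lemma card_image_factor_le:
  assumes "finite A" "\<And>p q. p \<in> A \<Longrightarrow> q \<in> A \<Longrightarrow> g p = g q \<Longrightarrow> f p = f q"
  shows "card (f ` A) \<le> card (g ` A)"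
proof -
  define h where "h z = f (SOME x. x \<in> A \<and> g x = z)" for z
  have "f x = h (g x)" if "x \<in> A" for x
  proof -
    define z where "z = (SOME y. y \<in> A \<and> g y = g x)"
    have "z \<in> A \<and> g z = g x"
      unfolding z_def by (rule someI[of "\<lambda>y. y \<in> A \<and> g y = g x" x]) (use that in simp)
    then have "f x = f z" using assms(2)[of x z] that by simp
    then show ?thesis unfolding h_def z_def .
  qed
  then have "f ` A = (\<lambda>x. h (g x)) ` A" by (rule image_cong[OF refl])
  then have "f ` A = h ` g ` A" by (simp only: image_image)
  then show ?thesis using card_image_le[of "g ` A" h] assms(1) by simp
qed

lemma card_lists_le:
  assumes "finite A" "card A \<le> n"
  shows "finite {xs. set xs \<subseteq> A \<and> distinct xs}" "card {xs. set xs \<subseteq> A \<and> distinct xs} \<le> (n + 1) ^ n"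
proof -
  have sub: "{xs. set xs \<subseteq> A \<and> distinct xs} \<subseteq> {xs. set xs \<subseteq> A \<and> length xs \<le> n}"
    using assms card_mono distinct_card by (metis (mono_tags, lifting) Collect_mono le_trans)
  show "finite {xs. set xs \<subseteq> A \<and> distinct xs}"
    by (rule finite_subset[OF sub finite_lists_length_le[OF assms(1)]])
  have "card {xs. set xs \<subseteq> A \<and> distinct xs} \<le> card {xs. set xs \<subseteq> A \<and> length xs \<le> n}"
    by (rule card_mono[OF finite_lists_length_le[OF assms(1)] sub])
  also have "\<dots> = (\<Sum>i\<le>n. card A ^ i)" by (rule card_lists_length_le[OF assms(1)])
  also have "\<dots> \<le> (\<Sum>i\<le>n. n ^ i)" by (intro sum_mono power_mono) (use assms in auto)
  also have "\<dots> \<le> (\<Sum>i\<le>n. (n choose i) * n ^ i)"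
  proof (rule sum_mono)
    fix i assume "i \<in> {..n}"
    then have "1 \<le> n choose i" by (simp add: Suc_leI)
    then show "n ^ i \<le> (n choose i) * n ^ i" by simp
  qed
  also have "\<dots> = (n + 1) ^ n" using binomial[of n 1 n] by simp
  finally show "card {xs. set xs \<subseteq> A \<and> distinct xs} \<le> (n + 1) ^ n" .
qed

locale timed_debruijn = timed_graph +
  fixes K :: nat and wd :: "nat \<Rightarrow> 'a list"
  assumes K1: "1 \<le> K" and w1: "1 \<le> w"
    and width: "\<And>e. e < m \<Longrightarrow> hi e < lo e + w"
    and length_wd: "\<And>e. e < m \<Longrightarrow> length (wd e) = Suc K"
    and inj_wd: "inj_on wd {..<m}"
    and wd_step: "\<And>e f x. e < m \<Longrightarrow> f < m \<Longrightarrow> dst e = src f \<Longrightarrow> x < K \<Longrightarrow> wd e ! Suc x = wd f ! x"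
    and wd_src: "\<And>e f x. e < m \<Longrightarrow> f < m \<Longrightarrow> src e = src f \<Longrightarrow> x < K \<Longrightarrow> wd e ! x = wd f ! x"
begin

lemma walkD:
  assumes "walk p" "i < length p"
  shows "p ! i < m" "lo (p ! i) \<le> Suc i" "Suc i \<le> hi (p ! i)"
  using assms nth_mem[OF assms(2)] unfolding walk_def by blast+

lemma wd_shift:
  assumes "walk p" "i + d < length p" "d \<le> x" "x \<le> K"
  shows "wd (p ! i) ! x = wd (p ! (i + d)) ! (x - d)"
  using assms(2-)
proof (induction d)
  case 0 then show ?case by simp
next
  case (Suc d)
  have "wd (p ! i) ! x = wd (p ! (i + d)) ! (x - d)" using Suc by simp
  also have "x - d = Suc (x - Suc d)" using Suc.prems by simp
  also have "wd (p ! (i + d)) ! Suc (x - Suc d) = wd (p ! (i + Suc d)) ! (x - Suc d)"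
  proof (rule wd_step)
    show "p ! (i + d) < m" "p ! (i + Suc d) < m" using walkD(1)[OF assms(1)] Suc.prems by simp_all
    have "Suc (i + d) < length p" using Suc.prems by simp
    then have "dst (p ! (i + d)) = src (p ! Suc (i + d))" using assms(1) unfolding walk_def by blast
    then show "dst (p ! (i + d)) = src (p ! (i + Suc d))" by simp
    show "x - Suc d < K" using Suc.prems by simp
  qed
  finally show ?case .
qed

lemma agree_between:
  assumes "walk p" "walk q" "length q = length p" "j2 < length p" "j1 \<le> i" "i \<le> j2" "j2 \<le> j1 + Suc K"
    "p ! j1 = q ! j1" "p ! j2 = q ! j2"
  shows "p ! i = q ! i"
proof (cases "i = j2")
  case True then show ?thesis using assms by simp
next
  case False
  then have i: "i < j2" using assms by simp
  have m: "p ! i < m" "q ! i < m" using walkD(1) assms i by auto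
  have "wd (p ! i) = wd (q ! i)"
  proof (rule nth_equalityI)
    show "length (wd (p ! i)) = length (wd (q ! i))" using length_wd m by simp
    fix x assume "x < length (wd (p ! i))"
    then have x: "x \<le> K" using length_wd m by simp
    show "wd (p ! i) ! x = wd (q ! i) ! x"
    proof (cases "i + x \<le> j1 + K")
      case True
      have s: "wd (r ! j1) ! (i - j1 + x) = wd (r ! i) ! x" if "walk r" "length r = length p" for r
        using wd_shift[of r j1 "i - j1" "i - j1 + x"] that assms i True by simp
      show ?thesis using s[of p] s[of q] assms by simp
    next
      case False
      have s: "wd (r ! i) ! x = wd (r ! j2) ! (x - (j2 - i))" if "walk r" "length r = length p" for r
        using wd_shift[of r i "j2 - i" x] that assms i False x by simp
      show ?thesis using s[of p] s[of q] assms by simp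
    qed
  qed
  then show ?thesis using inj_wd m unfolding inj_on_def by blast
qed

lemma filter_stack_determined:
  assumes "walk p" "walk q" "length p = t" "length q = t" "t \<le> h"
    "\<And>i. i < t \<Longrightarrow> h < i + w \<Longrightarrow> p ! i = q ! i"
  shows "filter (\<lambda>f. h < hi f) (stack p) = filter (\<lambda>f. h < hi f) (stack q)"
  using assms
proof (induction t arbitrary: p q)
  case 0 then show ?case by simp
next
  case (Suc t)
  obtain p' e where p: "p = p' @ [e]" using Suc.prems(3) by (cases p rule: rev_cases) auto
  obtain q' f where q: "q = q' @ [f]" using Suc.prems(4) by (cases q rule: rev_cases) auto
  have len: "length p' = t" "length q' = t" using Suc.prems p q by auto
  have wp: "walk p'" "walk q'" using Suc.prems p q walk_butlast by blast+
  have IH: "filter (\<lambda>f. h < hi f) (stack p') = filter (\<lambda>f. h < hi f) (stack q')"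
  proof (rule Suc.IH[OF wp len])
    show "t \<le> h" using Suc.prems by simp
    fix i assume i: "i < t" "h < i + w"
    then have "p ! i = q ! i" using Suc.prems(6) by simp
    then show "p' ! i = q' ! i" using i len by (simp add: p q nth_append)
  qed
  have F: "filter (\<lambda>f. h < hi f) (push (Suc t) e l)
      = rev (filter (\<lambda>f. h < hi f) l) @ (if (crit e \<or> t = 0) \<and> h < hi e then [e] else [])" for e l
  proof -
    have "filter (\<lambda>f. h < hi f) (filter (\<lambda>f. Suc t < hi f) l) = filter (\<lambda>f. h < hi f) l"
      using Suc.prems(5) by (simp add: filter_filter) (rule filter_cong, auto)
    then show ?thesis using Suc.prems(5) by (auto simp: push_def rev_filter[symmetric])
  qed
  have "(if (crit e \<or> t = 0) \<and> h < hi e then [e] else []) = (if (crit f \<or> t = 0) \<and> h < hi f then [f] else [])"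
  proof (cases "h < t + w")
    case True
    have "p ! t = q ! t" using Suc.prems(6)[of t] True by simp
    then have "e = f" using len by (simp add: p q nth_append)
    then show ?thesis by simp
  next
    case False
    have "p ! t = e" "q ! t = f" using len by (simp_all add: p q nth_append)
    then have "lo e \<le> Suc t" "lo f \<le> Suc t" "e < m" "f < m"
      using walkD(1,2)[OF Suc.prems(1), of t] walkD(1,2)[OF Suc.prems(2), of t] Suc.prems(3,4) by auto
    then have "hi e \<le> t + w" "hi f \<le> t + w" using width[of e] width[of f] by linarith+
    then show ?thesis using False by simp
  qed
  then show ?case using IH len unfolding p q stack_snoc len F by simp
qed

lemma stack_determined:
  assumes "walk p" "walk q" "length p = t" "length q = t" "\<And>i. i < t \<Longrightarrow> t < i + w \<Longrightarrow> p ! i = q ! i"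
  shows "stack p = stack q"
proof -
  have all: "filter (\<lambda>f. t < hi f) (stack r) = stack r" if "walk r" "length r = t" for r
    by (rule filter_True) (use set_stack[OF that(1)] that(2) in auto)
  have "filter (\<lambda>f. t < hi f) (stack p) = filter (\<lambda>f. t < hi f) (stack q)"
    by (rule filter_stack_determined[OF assms(1-4)]) (use assms in auto)
  then show ?thesis using all assms by simp
qed

lemma length_stack_le:
  assumes "good t p" shows "length (stack p) \<le> w"
proof -
  have wp: "walk p" "distinct p" "length p = t" using assms by (auto simp: good_def)
  have "set (stack p) \<subseteq> (\<lambda>i. p ! i) ` {t + 1 - w..<t}"
  proof
    fix f assume "f \<in> set (stack p)"
    then have f: "f \<in> set p" "t < hi f" using set_stack[OF wp(1)] wp(3) by auto
    then obtain i where i: "i < t" "p ! i = f" using wp(3) by (auto simp: in_set_conv_nth)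
    have "lo f \<le> Suc i" "f < m" using walkD[OF wp(1), of i] i wp(3) by auto
    then have "t < i + w" using f(2) width[of f] by linarith
    then have "t + 1 - w \<le> i" by linarith
    then have "i \<in> {t + 1 - w..<t}" using i(1) by simp
    then show "f \<in> (\<lambda>i. p ! i) ` {t + 1 - w..<t}" using i(2) by blast
  qed
  then have "card (set (stack p)) \<le> card {t + 1 - w..<t}"
    by (rule surj_card_le[rotated]) simp
  then show ?thesis using distinct_card[OF distinct_stack[OF wp(2)]] w1 by simp
qed

definition chk :: "nat \<Rightarrow> nat \<Rightarrow> nat \<Rightarrow> nat" where
  "chk t r i = (t - 1) - (r - i) * Suc K"

lemma chk_step: "i < r \<Longrightarrow> chk t r i \<le> chk t r (Suc i) \<and> chk t r (Suc i) \<le> chk t r i + Suc K"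
proof -
  assume "i < r"
  then have "r - i = Suc (r - Suc i)" by simp
  then have "(r - i) * Suc K = (r - Suc i) * Suc K + Suc K" by simp
  then show ?thesis unfolding chk_def by linarith
qed

lemma chk_last: "chk t r r = t - 1" by (simp add: chk_def)
lemma chk_less: "1 \<le> t \<Longrightarrow> chk t r i < t" by (simp add: chk_def)

lemma agree_checkpoints:
  assumes "good t p" "good t q" "1 \<le> t" "i \<le> r" "\<And>j. j \<le> i \<Longrightarrow> p ! chk t r j = q ! chk t r j"
    "chk t r 0 \<le> x" "x \<le> chk t r i"
  shows "p ! x = q ! x"
  using assms(4-)
proof (induction i)
  case 0 then show ?case by (metis le_antisym order_refl)
next
  case (Suc i)
  have pq: "walk p" "walk q" "length p = t" "length q = t" using assms by (auto simp: good_def)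
  show ?case
  proof (cases "x \<le> chk t r i")
    case True then show ?thesis using Suc by simp
  next
    case False
    show ?thesis
      by (rule agree_between[OF pq(1,2), of "chk t r (Suc i)" "chk t r i"])
        (use pq Suc.prems False chk_step[of i r t] chk_less[OF assms(3), of r "Suc i"] in auto)
  qed
qed

lemma card_St_le_prod:
  assumes t: "1 \<le> t" and r: "w \<le> 2 + r * Suc K"
    and B: "\<And>p i. good t p \<Longrightarrow> i \<le> r \<Longrightarrow>
       card {q ! chk t r i | q. good t q \<and> (\<forall>x. i > 0 \<longrightarrow> chk t r 0 \<le> x \<longrightarrow> x \<le> chk t r (i - 1) \<longrightarrow> q ! x = p ! x)} \<le> B i"
  shows "card (St t) \<le> (\<Prod>i<Suc r. B i)"
proof -
  define tup where "tup p = map (\<lambda>i. p ! chk t r i) [0..<Suc r]" for p :: "nat list"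
  define F where "F p = (dst (last p), stack p)" for p
  have St: "St t = F ` {p. good t p}" using St_Suc[of "t - 1"] t unfolding F_def by auto
  have tup_nth: "tup p ! i = p ! chk t r i" if "i \<le> r" for p i
    using that unfolding tup_def by (simp del: upt_Suc)
  have len: "length (tup p) = Suc r" for p by (simp add: tup_def)
  have "card (St t) \<le> card (tup ` {p. good t p})"
    unfolding St
  proof (rule card_image_factor_le[OF finite_good])
    fix p q assume "p \<in> {p. good t p}" "q \<in> {p. good t p}" and eq: "tup p = tup q"
    then have g: "good t p" "good t q" by auto
    then have pq: "walk p" "walk q" "length p = t" "length q = t" by (auto simp: good_def)
    have e: "p ! chk t r j = q ! chk t r j" if "j \<le> r" for j using eq tup_nth that by metis
    have ag: "p ! x = q ! x" if "chk t r 0 \<le> x" "x < t" for x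
      by (rule agree_checkpoints[OF g t order_refl]) (use e that chk_last t in auto)
    have "stack p = stack q"
    proof (rule stack_determined[OF pq])
      fix i assume i: "i < t" "t < i + w"
      have "chk t r 0 \<le> i" using i r unfolding chk_def by simp
      then show "p ! i = q ! i" using ag i by blast
    qed
    moreover have "last p = last q" 
    proof -
      have "p \<noteq> []" "q \<noteq> []" using pq t by auto
      then show ?thesis using e[of r] pq by (simp add: last_conv_nth chk_last)
    qed
    ultimately show "F p = F q" by (simp add: F_def)
  qed
  also have "\<dots> \<le> (\<Prod>i<Suc r. B i)"
  proof (rule card_lists_le_prod)
    show "finite (tup ` {p. good t p})" using finite_good by simp
    show "length l = Suc r" if "l \<in> tup ` {p. good t p}" for l using that len by auto
    fix l i assume l: "l \<in> tup ` {p. good t p}" and i: "i < Suc r"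
    then obtain p where p: "good t p" "l = tup p" by blast
    let ?A = "{l' ! i | l'. l' \<in> tup ` {p. good t p} \<and> take i l' = take i l}"
    let ?B = "{q ! chk t r i | q. good t q \<and> (\<forall>x. i > 0 \<longrightarrow> chk t r 0 \<le> x \<longrightarrow> x \<le> chk t r (i - 1) \<longrightarrow> q ! x = p ! x)}"
    have "?A \<subseteq> ?B"
    proof
      fix z assume "z \<in> ?A"
      then obtain q where q: "good t q" "z = tup q ! i" "take i (tup q) = take i (tup p)" using p by auto
      have "q ! x = p ! x" if x: "i > 0" "chk t r 0 \<le> x" "x \<le> chk t r (i - 1)" for x
      proof (rule agree_checkpoints[OF q(1) p(1) t _ _ x(2,3)])
        show "i - 1 \<le> r" using i by simp
        fix j assume "j \<le> i - 1"
        then have j: "j < i" using x by simp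
        then have "tup q ! j = tup p ! j" using q(3) by (metis nth_take)
        then show "q ! chk t r j = p ! chk t r j" using tup_nth j i by simp
      qed
      then show "z \<in> ?B" using q tup_nth i by auto
    qed
    moreover have "finite ?B"
      by (rule finite_subset[of _ "(\<lambda>q. q ! chk t r i) ` {p. good t p}"]) (use finite_good in auto)
    ultimately have "card ?A \<le> card ?B" by (rule card_mono[rotated])
    also have "\<dots> \<le> B i" using B[OF p(1)] i by simp
    finally show "card ?A \<le> B i" .
  qed
  finally show ?thesis .
qed

definition opts :: "nat \<Rightarrow> bool" where
  "opts L \<longleftrightarrow> (\<forall>t p j N. good t p \<longrightarrow> j < t \<longrightarrow> N \<subseteq> {..<j} \<longrightarrow>
      card {q ! j | q. good t q \<and> (\<forall>x\<in>N. q ! x = p ! x)} + card {x \<in> N. j < x + w} \<le> L)"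

lemma known_excluded:
  assumes "good t p" "good t q" "j < t" "N \<subseteq> {..<j}" "\<forall>x\<in>N. q ! x = p ! x" "x \<in> N"
  shows "q ! j \<noteq> p ! x"
proof -
  have "x < j" using assms by auto
  moreover have "q ! x = p ! x" using assms by blast
  moreover have "q ! j \<noteq> q ! x"
    using nth_eq_iff_index_eq[of q j x] assms(2,3) \<open>x < j\<close> by (simp add: good_def)
  ultimately show ?thesis by simp
qed

lemma inj_nth: "good t p \<Longrightarrow> A \<subseteq> {..<t} \<Longrightarrow> inj_on (\<lambda>x. p ! x) A"
proof (rule inj_onI)
  fix x y assume "good t p" "A \<subseteq> {..<t}" "x \<in> A" "y \<in> A" "p ! x = p ! y"
  then show "x = y" using nth_eq_iff_index_eq[of p x y] by (auto simp: good_def)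
qed

lemma opts_total:
  assumes "m \<le> L" shows "opts L"
  unfolding opts_def
proof (intro allI impI)
  fix t p j N assume a: "good t p" "j < t" "N \<subseteq> {..<j}"
  let ?O = "{q ! j | q. good t q \<and> (\<forall>x\<in>N. q ! x = p ! x)}"
  have fN: "finite N" using a finite_subset by blast
  have Nt: "N \<subseteq> {..<t}" using a by auto
  have sub: "?O \<subseteq> {..<m}" "(\<lambda>x. p ! x) ` N \<subseteq> {..<m}"
    using a Nt walkD(1) by (auto simp: good_def)
  have dis: "?O \<inter> (\<lambda>x. p ! x) ` N = {}" using known_excluded[OF a(1) _ a(2,3)] by blast
  have "card ?O + card ((\<lambda>x. p ! x) ` N) = card (?O \<union> (\<lambda>x. p ! x) ` N)"
    using dis sub finite_subset[OF sub(1)] finite_subset[OF sub(2)] by (simp add: card_Un_disjoint)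
  also have "\<dots> \<le> card {..<m}" by (rule card_mono) (use sub in auto)
  finally have "card ?O + card N \<le> m" using card_image[OF inj_nth[OF a(1) Nt]] by simp
  moreover have "card {x \<in> N. j < x + w} \<le> card N" by (rule card_mono) (use fN in auto)
  ultimately show "card ?O + card {x \<in> N. j < x + w} \<le> L" using assms by linarith
qed

text \<open>At time \<open>t\<close> exactly \<open>t - 1\<close> of the released arcs have been used, hence at most \<open>w\<close> are still
  available; every other active arc was used during the last \<open>w - 1\<close> steps.\<close>

lemma opts_released:
  assumes "releases_bounded" shows "opts (2 * w - 1)"
  unfolding opts_def
proof (intro allI impI)
  fix t p j N assume a: "good t p" "j < t" "N \<subseteq> {..<j}"
  let ?O = "{q ! j | q. good t q \<and> (\<forall>x\<in>N. q ! x = p ! x)}"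
  let ?N = "{x \<in> N. j < x + w}"
  define R where "R = {e. e < m \<and> lo e \<le> Suc j}"
  define U where "U = (\<lambda>x. p ! x) ` {..<j}"
  define Q where "Q = {x. x < j \<and> j < x + w}"
  have wp: "walk p" "length p = t" using a by (auto simp: good_def)
  have UR: "U \<subseteq> R" 
  proof
    fix z assume "z \<in> U"
    then obtain x where "x < j" "z = p ! x" by (auto simp: U_def)
    then show "z \<in> R" using walkD[OF wp(1), of x] wp(2) a(2) by (simp add: R_def)
  qed
  have fR: "finite R" by (simp add: R_def)
  have cU: "card U = j" unfolding U_def using card_image[OF inj_nth[OF a(1), of "{..<j}"]] a(2) by simp
  have "t \<le> m" using good_length_le a by blast
  then have cR: "card R \<le> j + w" 
  proof -
    have "1 \<le> Suc j" "Suc j \<le> m" using a(2) \<open>t \<le> m\<close> by simp_all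
    then have "card R + 1 \<le> Suc j + w" using assms unfolding releases_bounded_def R_def by blast
    then show ?thesis by simp
  qed
  have c1: "card (R - U) \<le> w" 
    using card_Diff_subset[of U R] UR finite_subset[OF UR fR] cU cR by simp
  have "?O \<subseteq> (\<lambda>x. p ! x) ` (Q - ?N) \<union> (R - U)"
  proof
    fix z assume "z \<in> ?O"
    then obtain q where q: "good t q" "\<forall>x\<in>N. q ! x = p ! x" "z = q ! j" by blast
    have z: "z < m" "lo z \<le> Suc j" "Suc j \<le> hi z" using walkD[of q j] q a(2) by (auto simp: good_def)
    show "z \<in> (\<lambda>x. p ! x) ` (Q - ?N) \<union> (R - U)"
    proof (cases "z \<in> U")
      case False then show ?thesis using z by (simp add: R_def)
    next
      case True
      then obtain x where x: "x < j" "z = p ! x" by (auto simp: U_def)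
      have "lo z \<le> Suc x" using walkD(2)[OF wp(1), of x] x wp(2) a(2) by simp
      then have "j < x + w" using z width[of z] by linarith
      moreover have "x \<notin> N" using known_excluded[OF a(1) q(1) a(2,3) q(2), of x] q(3) x by blast
      ultimately show ?thesis using x by (auto simp: Q_def)
    qed
  qed
  moreover have fQ: "finite Q" by (simp add: Q_def)
  ultimately have "card ?O \<le> card ((\<lambda>x. p ! x) ` (Q - ?N) \<union> (R - U))" using fR by (intro card_mono) auto
  also have "\<dots> \<le> card ((\<lambda>x. p ! x) ` (Q - ?N)) + card (R - U)" by (rule card_Un_le)
  also have "card ((\<lambda>x. p ! x) ` (Q - ?N)) \<le> card (Q - ?N)" using fQ by (simp add: card_image_le)
  also have "card (Q - ?N) = card Q - card ?N"
  proof (rule card_Diff_subset)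
    show "?N \<subseteq> Q" using a(3) by (auto simp: Q_def)
    then show "finite ?N" using fQ by (rule finite_subset)
  qed
  finally have "card ?O \<le> card Q - card ?N + w" using c1 by linarith
  moreover have "card ?N \<le> card Q" by (rule card_mono) (use a fQ in \<open>auto simp: Q_def\<close>)
  moreover have "card Q \<le> w - 1"
  proof -
    have "Q \<subseteq> {j + 1 - w..<j}" by (auto simp: Q_def)
    then have "card Q \<le> card {j + 1 - w..<j}" by (rule card_mono[rotated]) simp
    then show ?thesis using w1 by simp
  qed
  ultimately show "card ?O + card ?N \<le> 2 * w - 1" using w1 by linarith
qed

end

context timed_debruijn
begin

lemma optsD:
  assumes "opts L" "good t p" "j < t" "N \<subseteq> {..<j}"
  shows "card {q ! j | q. good t q \<and> (\<forall>x\<in>N. q ! x = p ! x)} + card {x \<in> N. j < x + w} \<le> L"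
  using assms unfolding opts_def by blast

lemma chk_mono: "i \<le> j \<Longrightarrow> chk t r i \<le> chk t r j"
  unfolding chk_def by (intro diff_le_mono2 mult_le_mono1)

lemma opts_checkpoint:
  assumes "opts L" "good t p" "1 \<le> t" "1 \<le> i" "i \<le> r" "chk t r (i - 1) < chk t r i"
  shows "card {q ! chk t r i | q. good t q \<and>
       (\<forall>x. i > 0 \<longrightarrow> chk t r 0 \<le> x \<longrightarrow> x \<le> chk t r (i - 1) \<longrightarrow> q ! x = p ! x)}
     + card {x. chk t r 0 \<le> x \<and> x \<le> chk t r (i - 1) \<and> chk t r i < x + w} \<le> L"
proof -
  let ?N = "{x. chk t r 0 \<le> x \<and> x \<le> chk t r (i - 1)}"
  have "card {q ! chk t r i | q. good t q \<and> (\<forall>x\<in>?N. q ! x = p ! x)} + card {x \<in> ?N. chk t r i < x + w} \<le> L"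
    by (rule optsD[OF assms(1,2)]) (use assms chk_less[OF assms(3)] in auto)
  moreover have "{q ! chk t r i | q. good t q \<and> (\<forall>x\<in>?N. q ! x = p ! x)}
    = {q ! chk t r i | q. good t q \<and>
       (\<forall>x. i > 0 \<longrightarrow> chk t r 0 \<le> x \<longrightarrow> x \<le> chk t r (i - 1) \<longrightarrow> q ! x = p ! x)}" using assms(4) by auto
  moreover have "{x \<in> ?N. chk t r i < x + w}
    = {x. chk t r 0 \<le> x \<and> x \<le> chk t r (i - 1) \<and> chk t r i < x + w}" by auto
  ultimately show ?thesis by simp
qed

lemma opts_checkpoint_le:
  assumes "opts L" "good t p" "1 \<le> t" "i \<le> r"
  shows "card {q ! chk t r i | q. good t q \<and>
       (\<forall>x. i > 0 \<longrightarrow> chk t r 0 \<le> x \<longrightarrow> x \<le> chk t r (i - 1) \<longrightarrow> q ! x = p ! x)} \<le> L"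
    (is "card ?A \<le> L")
proof -
  let ?B = "{q ! chk t r i | q. good t q \<and> (\<forall>x\<in>{}. q ! x = p ! x)}"
  have "card ?B + card {x \<in> {}. chk t r i < x + w} \<le> L"
    by (rule optsD[OF assms(1,2) chk_less[OF assms(3)]]) simp
  moreover have "card ?A \<le> card ?B"
  proof (rule card_mono)
    show "finite ?B"
      by (rule finite_subset[of _ "(\<lambda>q. q ! chk t r i) ` {p. good t p}"]) (use finite_good in auto)
  qed auto
  ultimately show ?thesis by simp
qed

lemma card_St_pow:
  assumes "opts L" "1 \<le> t" "w \<le> 2 + r * Suc K"
  shows "card (St t) \<le> L ^ Suc r"
proof -
  have "card (St t) \<le> (\<Prod>i<Suc r. L)"
    by (rule card_St_le_prod[OF assms(2,3)]) (rule opts_checkpoint_le[OF assms(1) _ assms(2)])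
  then show ?thesis by simp
qed

lemma card_St_late:
  assumes L: "opts L" and t: "1 \<le> t" "3 * w \<le> 4 * (t - 1)" and r: "w \<le> 2 + r * Suc K"
    and w: "4 * Suc K \<le> w" and s: "s = w div (4 * Suc K)"
  shows "card (St t) \<le> L ^ (Suc r - s) * (L - w div 4) ^ s"
proof -
  define k where "k = Suc K"
  have sk: "4 * (s * k) \<le> w" unfolding s k_def using times_div_less_eq_dividend[of "4 * Suc K" w]
    by (simp add: algebra_simps)
  have w8: "8 \<le> w" using w K1 by simp
  have rk: "w \<le> 2 + r * k" using r by (simp add: k_def)
  have wk: "4 * k \<le> w" using w by (simp add: k_def)
  have sr: "s < r"
  proof (rule ccontr)
    assume "\<not> s < r"
    then have "r * k \<le> s * k" by (intro mult_le_mono1) simp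
    then show False using sk rk w8 by linarith
  qed
  define B where "B i = (if i \<in> {Suc r - s..<Suc r} then L - w div 4 else L)" for i
  have "card (St t) \<le> (\<Prod>i<Suc r. B i)"
  proof (rule card_St_le_prod[OF t(1) r])
    fix p i assume p: "good t p" and i: "i \<le> r"
    show "card {q ! chk t r i | q. good t q \<and>
       (\<forall>x. i > 0 \<longrightarrow> chk t r 0 \<le> x \<longrightarrow> x \<le> chk t r (i - 1) \<longrightarrow> q ! x = p ! x)} \<le> B i"
    proof (cases "i \<in> {Suc r - s..<Suc r}")
      case False
      then have "B i = L" unfolding B_def by (rule if_not_P)
      then show ?thesis using opts_checkpoint_le[OF L p t(1) i] by (simp only:)
    next
      case True
      then have Bi: "B i = L - w div 4" unfolding B_def by (rule if_P)
      from True have i1: "1 \<le> i" "Suc (r - i) \<le> s" using sr by auto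
      define d where "d = r - i"
      have e: "r - (i - 1) = Suc d" using i1 i by (simp add: d_def)
      have dk: "Suc d * k \<le> s * k" using i1 unfolding d_def by (intro mult_le_mono1) simp
      have tk: "Suc d * k \<le> t - 1" using dk sk t(2) by linarith
      have Sd: "Suc d * k = d * k + k" by simp
      have c: "chk t r i = t - 1 - d * k" "chk t r (i - 1) = t - 1 - Suc d * k" "chk t r 0 = t - 1 - r * k"
        unfolding chk_def d_def[symmetric] e k_def[symmetric] by simp_all
      have lt: "chk t r (i - 1) < chk t r i" unfolding c using tk Sd by (simp add: k_def)
      let ?X = "{x. chk t r 0 \<le> x \<and> x \<le> chk t r (i - 1) \<and> chk t r i < x + w}"
      have "{t - 1 - Suc d * k + 1 - w div 4..t - 1 - Suc d * k} \<subseteq> ?X"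
      proof
        fix x assume "x \<in> {t - 1 - Suc d * k + 1 - w div 4..t - 1 - Suc d * k}"
        then have x: "t - 1 - Suc d * k + 1 - w div 4 \<le> x" "x \<le> t - 1 - Suc d * k" by auto
        have w4: "4 * (w div 4) \<le> w" by simp
        have "t - 1 - r * k \<le> x" using x(1) rk dk sk t(2) w8 w4 by linarith
        moreover have "t - 1 - d * k < x + w" using x(1) wk w4 Sd w8 by linarith
        ultimately show "x \<in> ?X" unfolding c using x by simp
      qed
      then have "card {t - 1 - Suc d * k + 1 - w div 4..t - 1 - Suc d * k} \<le> card ?X"
        by (rule card_mono[rotated]) (rule finite_subset[of _ "{..chk t r (i - 1)}"], auto)
      moreover have "card {t - 1 - Suc d * k + 1 - w div 4..t - 1 - Suc d * k} \<ge> w div 4"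
      proof -
        have "w div 4 \<le> t - 1 - Suc d * k + 1" using dk sk t(2) by linarith
        then show ?thesis by simp
      qed
      ultimately have "w div 4 \<le> card ?X" by linarith
      then show ?thesis using opts_checkpoint[OF L p t(1) i1(1) i lt] unfolding Bi by linarith
    qed
  qed
  also have "(\<Prod>i<Suc r. B i) = L ^ (Suc r - s) * (L - w div 4) ^ s"
  proof -
    have "(\<Prod>i<Suc r. B i) = (\<Prod>i<Suc r - s. B i) * (\<Prod>i\<in>{Suc r - s..<Suc r}. B i)"
      using prod.atLeastLessThan_concat[of 0 "Suc r - s" "Suc r" B] by (simp only: lessThan_atLeast0)
    also have "(\<Prod>i<Suc r - s. B i) = (\<Prod>i<Suc r - s. L)" by (rule prod.cong) (auto simp: B_def)
    also have "(\<Prod>i\<in>{Suc r - s..<Suc r}. B i) = (\<Prod>i\<in>{Suc r - s..<Suc r}. L - w div 4)"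
      by (rule prod.cong) (auto simp: B_def)
    finally show ?thesis using sr by simp
  qed
  finally show ?thesis .
qed

lemma card_St_early:
  assumes L: "opts L" "1 \<le> L" and t: "1 \<le> t" "4 * (t - 1) < 3 * w"
  shows "card (St t) \<le> L ^ (3 * w div (4 * Suc K) + 2)"
proof -
  define k where "k = Suc K"
  define r where "r = w"
  have r: "w \<le> 2 + r * Suc K" by (simp add: r_def)
  define Z where "Z = {i. i < Suc r \<and> (i = 0 \<or> 0 < chk t r i)}"
  define B where "B i = (if i \<in> Z then L else 1)" for i
  have "card (St t) \<le> (\<Prod>i<Suc r. B i)"
  proof (rule card_St_le_prod[OF t(1) r])
    fix p i assume p: "good t p" and i: "i \<le> r"
    let ?A = "{q ! chk t r i | q. good t q \<and>
       (\<forall>x. i > 0 \<longrightarrow> chk t r 0 \<le> x \<longrightarrow> x \<le> chk t r (i - 1) \<longrightarrow> q ! x = p ! x)}"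
    show "card ?A \<le> B i"
    proof (cases "i \<in> Z")
      case True
      then show ?thesis using opts_checkpoint_le[OF L(1) p t(1) i] by (simp add: B_def)
    next
      case False
      then have i0: "0 < i" "chk t r i = 0" using i by (auto simp: Z_def)
      then have "chk t r 0 = 0" using chk_mono[of 0 i t r] by simp
      then have "?A \<subseteq> {p ! 0}" using i0 by auto
      then have "card ?A \<le> card {p ! 0}" by (rule card_mono[rotated]) simp
      then show ?thesis using False by (simp add: B_def)
    qed
  qed
  also have "\<dots> = L ^ card Z"
  proof -
    have "(\<Prod>i<Suc r. B i) = (\<Prod>i\<in>{..<Suc r} \<inter> Z. L)"
      unfolding B_def by (subst prod.inter_restrict) auto
    also have "{..<Suc r} \<inter> Z = Z" by (auto simp: Z_def)
    finally show ?thesis by simp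
  qed
  also have "\<dots> \<le> L ^ (3 * w div (4 * Suc K) + 2)"
  proof (rule power_increasing[OF _ L(2)])
    define c where "c = 3 * w div (4 * k)"
    have "Z \<subseteq> insert 0 {r - c..r}"
    proof
      fix i assume "i \<in> Z"
      then have i: "i \<le> r" "i = 0 \<or> 0 < chk t r i" by (auto simp: Z_def)
      show "i \<in> insert 0 {r - c..r}"
      proof (cases "i = 0")
        case False
        then have "(r - i) * k < t - 1" using i by (auto simp: chk_def k_def)
        then have "(r - i) * (4 * k) < 3 * w" using t by (simp add: algebra_simps)
        then have "r - i \<le> c" unfolding c_def by (simp add: less_eq_div_iff_mult_less_eq k_def)
        then show ?thesis using i by auto
      qed simp
    qed
    then have "card Z \<le> card (insert 0 {r - c..r})" by (rule card_mono[rotated]) simp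
    also have "\<dots> \<le> Suc (card {r - c..r})" by (rule card_insert_le_m1) auto
    also have "\<dots> \<le> c + 2" by simp
    finally show "card Z \<le> 3 * w div (4 * Suc K) + 2" by (simp add: c_def k_def)
  qed
  finally show ?thesis .
qed

lemma walk_determined:
  assumes "walk p" "walk q" "length p = length q" "p ! 0 = q ! 0" "filter crit p = filter crit q"
  shows "p = q"
proof (rule ccontr)
  assume "p \<noteq> q"
  then have ex: "\<exists>i. i < length p \<and> p ! i \<noteq> q ! i" using assms(3) by (metis nth_equalityI)
  define i where "i = (LEAST i. i < length p \<and> p ! i \<noteq> q ! i)"
  have i: "i < length p" "p ! i \<noteq> q ! i" using LeastI_ex[OF ex] by (auto simp: i_def)
  have before: "p ! j = q ! j" if "j < i" for j
    using not_less_Least[of j "\<lambda>i. i < length p \<and> p ! i \<noteq> q ! i"] that i(1) unfolding i_def by auto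
  have "0 < i" using i assms(4) by (cases i) auto
  then obtain j where j: "i = Suc j" by (cases i) auto
  have "dst (p ! j) = src (p ! i)" "dst (q ! j) = src (q ! i)"
    using assms(1,2,3) i j unfolding walk_def by auto
  then have src: "src (p ! i) = src (q ! i)" using before[of j] j by simp
  note P = walkD[OF assms(1) i(1)] and Q = walkD[OF assms(2), of i]
  have iq: "i < length q" using i assms by simp
  have "p ! i \<in> leaving (p ! i)" "q ! i \<in> leaving (p ! i)"
    using P Q[OF iq] src by (auto simp: leaving_def)
  then have c1: "crit (p ! i)" using i(2) by (rule crit_if_leaving)
  have "p ! i \<in> leaving (q ! i)" "q ! i \<in> leaving (q ! i)"
    using P Q[OF iq] src by (auto simp: leaving_def)
  then have c2: "crit (q ! i)" using i(2) by (rule crit_if_leaving)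
  have tk: "take i p = take i q" by (rule nth_equalityI) (use before i assms(3) in auto)
  have "filter crit p = filter crit (take i p) @ p ! i # filter crit (drop (Suc i) p)"
    using arg_cong[OF id_take_nth_drop[OF i(1)], of "filter crit"] c1 by simp
  moreover have "filter crit q = filter crit (take i q) @ q ! i # filter crit (drop (Suc i) q)"
    using arg_cong[OF id_take_nth_drop[OF iq], of "filter crit"] c2 by simp
  ultimately show False using assms(5) tk i(2) by simp
qed

lemma card_St_crit:
  assumes rel: "releases_bounded" and cb: "critical_bounded D" and t: "1 \<le> t" "t \<le> m" and wm: "w \<le> m"
  shows "card (St t) \<le> 2 * w * (D + 1) ^ D"
proof -
  have St: "St t = (\<lambda>p. (dst (last p), stack p)) ` {p. good t p}"
    using St_Suc[of "t - 1"] t by auto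
  show ?thesis
  proof (cases "t < w")
    case True
    define C where "C = {e. e < m \<and> crit e \<and> lo e \<le> w \<and> w \<le> hi e + w}"
    define R where "R = {e. e < m \<and> lo e \<le> 1}"
    have fin: "finite C" "finite R" by (auto simp: C_def R_def)
    have cC: "card C \<le> D" using cb wm w1 unfolding critical_bounded_def C_def by blast
    have "1 \<le> m" using t by simp
    then have cR: "card R \<le> w" using rel unfolding releases_bounded_def R_def by (metis Suc_eq_plus1 Suc_le_mono plus_1_eq_Suc order_refl)
    let ?T = "R \<times> {xs. set xs \<subseteq> C \<and> distinct xs}"
    have "card (St t) \<le> card {p. good t p}" unfolding St using finite_good by (rule card_image_le)
    also have "\<dots> \<le> card ?T"
    proof (rule card_inj_on_le)
      show "inj_on (\<lambda>p. (p ! 0, filter crit p)) {p. good t p}"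
        by (rule inj_onI) (auto simp: good_def intro: walk_determined)
      show "(\<lambda>p. (p ! 0, filter crit p)) ` {p. good t p} \<subseteq> ?T"
      proof clarify
        fix p assume p: "good t p"
        then have wp: "walk p" "length p = t" "distinct p" by (auto simp: good_def)
        have "p ! 0 \<in> R" using walkD[OF wp(1), of 0] wp(2) t by (simp add: R_def)
        moreover have "x \<in> C" if xp: "x \<in> set p" and xc: "crit x" for x
        proof -
          obtain i where "i < t" "x = p ! i" using xp wp by (auto simp: in_set_conv_nth)
          then show ?thesis using walkD[OF wp(1), of i] wp(2) xc True by (simp add: C_def)
        qed
        ultimately show "p ! 0 \<in> R \<and> filter crit p \<in> {xs. set xs \<subseteq> C \<and> distinct xs}"
          using wp by auto
      qed
      show "finite ?T" using fin card_lists_le(1)[OF fin(1) cC] by simp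
    qed
    also have "\<dots> = card R * card {xs. set xs \<subseteq> C \<and> distinct xs}" by (rule card_cartesian_product)
    also have "\<dots> \<le> w * (D + 1) ^ D" by (rule mult_le_mono[OF cR card_lists_le(2)[OF fin(1) cC]])
    finally show ?thesis by simp
  next
    case False
    define C where "C = {e. e < m \<and> crit e \<and> lo e \<le> t \<and> t \<le> hi e + w}"
    have fin: "finite C" by (auto simp: C_def)
    have cC: "card C \<le> D" using cb t unfolding critical_bounded_def C_def by blast
    define A where "A = {q ! (t - 1) | q. good t q}"
    let ?T = "dst ` A \<times> {xs. set xs \<subseteq> C \<and> distinct xs}"
    have fA: "finite A" unfolding A_def
      by (rule finite_subset[of _ "(\<lambda>q. q ! (t - 1)) ` {p. good t p}"]) (use finite_good in auto)
    have cA: "card A \<le> 2 * w - 1"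
    proof (cases "A = {}")
      case False
      then obtain p where "good t p" by (auto simp: A_def)
      then show ?thesis using optsD[OF opts_released[OF rel], of t p "t - 1" "{}"] t by (simp add: A_def)
    qed simp
    have "St t \<subseteq> ?T"
      unfolding St
    proof clarify
      fix p assume p: "good t p"
      then have wp: "walk p" "length p = t" "distinct p" by (auto simp: good_def)
      have "p \<noteq> []" using wp t by auto
      then have "last p = p ! (t - 1)" using wp(2) by (simp add: last_conv_nth)
      then have "last p \<in> A" unfolding A_def using p by blast
      then have "dst (last p) \<in> dst ` A" by (rule imageI)
      moreover have "x \<in> C" if x: "x \<in> set (stack p)" for x
      proof -
        have x': "x \<in> set p" "t < hi x" "crit x \<or> x = p ! 0" using x set_stack[OF wp(1)] wp(2) by auto
        have "hi (p ! 0) \<le> w" using walkD[OF wp(1), of 0] width[of "p ! 0"] wp(2) t by simp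
        then have "crit x" using x' False by auto
        moreover obtain i where "i < t" "x = p ! i" using x' wp by (auto simp: in_set_conv_nth)
        ultimately show ?thesis using walkD[OF wp(1), of i] wp(2) x' by (simp add: C_def)
      qed
      ultimately show "dst (last p) \<in> dst ` A \<and> stack p \<in> {xs. set xs \<subseteq> C \<and> distinct xs}"
        using distinct_stack[OF wp(3)] by auto
    qed
    then have "card (St t) \<le> card ?T"
      by (rule card_mono[rotated]) (use fA card_lists_le(1)[OF fin cC] in simp)
    also have "\<dots> = card (dst ` A) * card {xs. set xs \<subseteq> C \<and> distinct xs}" by (rule card_cartesian_product)
    also have "\<dots> \<le> (2 * w) * (D + 1) ^ D"
    proof (rule mult_le_mono[OF _ card_lists_le(2)[OF fin cC]])
      show "card (dst ` A) \<le> 2 * w" using card_image_le[OF fA, of dst] cA by linarith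
    qed
    finally show ?thesis .
  qed
qed

lemma length_stack_crit:
  assumes cb: "critical_bounded D" and p: "good t p" and t: "1 \<le> t"
  shows "length (stack p) \<le> D + 1"
proof -
  have wp: "walk p" "length p = t" "distinct p" using p by (auto simp: good_def)
  have tm: "t \<le> m" using good_length_le[OF p] .
  define C where "C = {e. e < m \<and> crit e \<and> lo e \<le> t \<and> t \<le> hi e + w}"
  have fin: "finite C" by (auto simp: C_def)
  have cC: "card C \<le> D" using cb t tm unfolding critical_bounded_def C_def by blast
  have "set (stack p) \<subseteq> insert (p ! 0) C"
  proof
    fix x assume x: "x \<in> set (stack p)"
    have x': "x \<in> set p" "t < hi x" "crit x \<or> x = p ! 0" using x set_stack[OF wp(1)] wp(2) by auto
    obtain i where "i < t" "x = p ! i" using x' wp by (auto simp: in_set_conv_nth)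
    then have "x < m" "lo x \<le> t" using walkD[OF wp(1), of i] wp(2) by auto
    then show "x \<in> insert (p ! 0) C" using x' by (auto simp: C_def)
  qed
  then have "card (set (stack p)) \<le> card (insert (p ! 0) C)" by (rule card_mono[rotated]) (use fin in simp)
  also have "\<dots> \<le> Suc (card C)" by (rule card_insert_le_m1) auto
  finally show ?thesis using distinct_card[OF distinct_stack[OF wp(3)]] cC by simp
qed

end

context timed_debruijn
begin

definition windows :: nat where "windows = (6 * w + K) div (K div 8 + 1) + 1"

definition critical_max :: nat where "critical_max = 12 * windows * bitlen windows"

lemma set_complete: "good m p \<Longrightarrow> set p = {..<m}"
  using card_subset_eq[of "{..<m}" "set p"] distinct_card[of p] by (auto simp: good_def walk_def)

lemma releases_bounded_necessary:
  assumes "good m p" shows "releases_bounded"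
  unfolding releases_bounded_def
proof (intro allI impI)
  fix t assume t: "1 \<le> t" "t \<le> m"
  have wp: "walk p" "length p = m" using assms by (auto simp: good_def)
  have "{e. e < m \<and> lo e \<le> t} \<subseteq> (\<lambda>i. p ! i) ` {..<t + w - 1}"
  proof
    fix e assume "e \<in> {e. e < m \<and> lo e \<le> t}"
    then have e: "e < m" "lo e \<le> t" by auto
    then have "e \<in> set p" using set_complete[OF assms] by auto
    then obtain i where i: "i < m" "p ! i = e" using wp by (auto simp: in_set_conv_nth)
    have "Suc i \<le> hi e" using walkD[OF wp(1), of i] i wp by simp
    then have "i < t + w - 1" using e width[OF e(1)] by linarith
    then show "e \<in> (\<lambda>i. p ! i) ` {..<t + w - 1}" using i by blast
  qed
  then have "card {e. e < m \<and> lo e \<le> t} \<le> card {..<t + w - 1}" by (rule surj_card_le[rotated]) simp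
  then show "card {e. e < m \<and> lo e \<le> t} + 1 \<le> t + w" using t by simp
qed

text \<open>In a solution, an arc that is critical near time \<open>t\<close> starts in a vertex occurring twice within a
  window of \<open>O(w)\<close> steps, and the words of the solution have no repeated factor of length \<open>K + 1\<close>.\<close>

lemma critical_bounded_necessary:
  assumes g: "good m p" shows "critical_bounded critical_max"
  unfolding critical_bounded_def
proof (intro allI impI)
  fix t assume t: "1 \<le> t" "t \<le> m"
  have wp: "walk p" "length p = m" "distinct p" using g by (auto simp: good_def)
  define letter where "letter z = (if z < m then wd (p ! z) ! 0 else wd (p ! (m - 1)) ! (z - (m - 1)))" for z
  have letter: "letter (i + x) = wd (p ! i) ! x" if "i < m" "x \<le> K" for i x
  proof (cases "i + x < m")
    case True
    then show ?thesis using wd_shift[OF wp(1), of i x x] wp that by (simp add: letter_def)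
  next
    case False
    have "wd (p ! i) ! x = wd (p ! (i + (m - 1 - i))) ! (x - (m - 1 - i))"
      by (rule wd_shift[OF wp(1)]) (use wp that False in auto)
    moreover have "i + (m - 1 - i) = m - 1" "x - (m - 1 - i) = i + x - (m - 1)" using that False by auto
    ultimately show ?thesis using False by (simp add: letter_def)
  qed
  define a where "a = t - (3 * w + 1)"
  define b where "b = min m (t + 2 * w)"
  have ab: "a \<le> b" using t by (auto simp: a_def b_def)
  define E where "E = b - a"
  define y where "y x = letter (a + x)" for x
  interpret F: factor_distinct y K E
  proof
    show "1 \<le> K" by (rule K1)
    fix i j assume ij: "i < E" "j < E" and eq: "\<And>x. x \<le> K \<Longrightarrow> y (i + x) = y (j + x)"
    have im: "a + i < m" "a + j < m" using ij by (auto simp: E_def b_def)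
    have pm: "p ! (a + i) < m" "p ! (a + j) < m" using walkD(1)[OF wp(1)] im wp by auto
    have "wd (p ! (a + i)) = wd (p ! (a + j))"
    proof (rule nth_equalityI)
      show "length (wd (p ! (a + i))) = length (wd (p ! (a + j)))" using length_wd pm by simp
      fix x assume "x < length (wd (p ! (a + i)))"
      then have x: "x \<le> K" using length_wd pm by simp
      then show "wd (p ! (a + i)) ! x = wd (p ! (a + j)) ! x"
        using eq[of x] letter im unfolding y_def by (simp add: add.assoc[symmetric])
    qed
    then have "p ! (a + i) = p ! (a + j)" using inj_wd pm unfolding inj_on_def by blast
    then have "a + i = a + j" using wp im by (simp add: nth_eq_iff_index_eq)
    then show "i = j" by simp
  qed
  have M: "F.M \<le> windows"
  proof -
    have "E + K \<le> 6 * w + K" using w1 unfolding E_def a_def b_def by linarith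
    then have "(E + K) div (K div 8 + 1) \<le> (6 * w + K) div (K div 8 + 1)" by (rule div_le_mono)
    then show ?thesis unfolding F.M_def F.pi_def windows_def by simp
  qed
  define Rep where "Rep = {i. i \<le> E \<and> (\<exists>j\<le>E. j \<noteq> i \<and> F.win j = F.win i)}"
  have "card Rep \<le> 12 * F.M * bitlen windows" unfolding Rep_def
    by (rule F.repeated_win_bound) (use M less_two_power_bitlen[of windows] in linarith)
  also have "\<dots> \<le> critical_max" unfolding critical_max_def using M by (intro mult_le_mono) auto
  finally have cRep: "card Rep \<le> critical_max" .
  have winI: "F.win (Suc i - a) = F.win (j - a)"
    if "i < m" "j < m" "dst (p ! i) = src (p ! j)" "a \<le> Suc i" "a \<le> j" for i j
  proof -
    have "letter (Suc i + x) = letter (j + x)" if x: "x < K" for x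
    proof -
      have "letter (Suc i + x) = letter (i + Suc x)" by simp
      also have "\<dots> = wd (p ! i) ! Suc x" by (rule letter) (use \<open>i < m\<close> x in auto)
      also have "\<dots> = wd (p ! j) ! x"
        by (rule wd_step) (use walkD(1)[OF wp(1)] \<open>i < m\<close> \<open>j < m\<close> wp \<open>dst (p ! i) = src (p ! j)\<close> x in auto)
      also have "\<dots> = letter (j + x)" by (rule letter[symmetric]) (use \<open>j < m\<close> x in auto)
      finally show ?thesis .
    qed
    then show ?thesis using that unfolding F.win_eq_iff y_def by simp
  qed
  have winO: "F.win (i - a) = F.win (j - a)"
    if "i < m" "j < m" "src (p ! i) = src (p ! j)" "a \<le> i" "a \<le> j" for i j
  proof -
    have "letter (i + x) = letter (j + x)" if x: "x < K" for x
      using letter[of i x] letter[of j x] wd_src[of "p ! i" "p ! j" x] walkD(1)[OF wp(1)] wp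
        \<open>i < m\<close> \<open>j < m\<close> \<open>src (p ! i) = src (p ! j)\<close> x by simp
    then show ?thesis using that unfolding F.win_eq_iff y_def by simp
  qed
  define C where "C = {e. e < m \<and> crit e \<and> lo e \<le> t \<and> t \<le> hi e + w}"
  define idx where "idx e = (THE i. i < m \<and> p ! i = e)" for e
  have idx: "idx e < m" "p ! idx e = e" if "e < m" for e
  proof -
    have "e \<in> set p" using set_complete[OF g] that by simp
    then obtain i where i: "i < m" "p ! i = e" using wp by (auto simp: in_set_conv_nth)
    have "idx e = i" unfolding idx_def
      by (rule the_equality) (use i wp in \<open>auto simp: nth_eq_iff_index_eq\<close>)
    then show "idx e < m" "p ! idx e = e" using i by auto
  qed
  have tm: "lo e \<le> Suc (idx e)" "Suc (idx e) \<le> hi e" if "e < m" for e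
    using walkD[OF wp(1), of "idx e"] idx[OF that] wp by auto
  have "(\<lambda>e. idx e - a) ` C \<subseteq> Rep \<and> inj_on (\<lambda>e. idx e - a) C"
  proof
    have near: "a \<le> idx e" "idx e \<le> b" if "e \<in> C" for e
    proof -
      have e: "e < m" "lo e \<le> t" "t \<le> hi e + w" using that by (auto simp: C_def)
      note l = tm[OF e(1)] idx(1)[OF e(1)] width[OF e(1)]
      show "a \<le> idx e" unfolding a_def using l e w1 by linarith
      have "idx e \<le> m" "idx e \<le> t + 2 * w" using l e by linarith+
      then show "idx e \<le> b" by (simp add: b_def)
    qed
    show "inj_on (\<lambda>e. idx e - a) C"
    proof (rule inj_onI)
      fix e f assume "e \<in> C" "f \<in> C" "idx e - a = idx f - a"
      then have "idx e = idx f" using near[of e] near[of f] by linarith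
      moreover have "e < m" "f < m" using \<open>e \<in> C\<close> \<open>f \<in> C\<close> by (simp_all add: C_def)
      ultimately show "e = f" using idx(2)[of e] idx(2)[of f] by metis
    qed
    show "(\<lambda>e. idx e - a) ` C \<subseteq> Rep"
    proof clarify
      fix e assume eC: "e \<in> C"
      then have e: "e < m" "crit e" "lo e \<le> t" "t \<le> hi e + w" by (auto simp: C_def)
      have i: "idx e < m" "p ! idx e = e" using idx[OF e(1)] by auto
      have rep: "idx e - a \<in> Rep" if j: "a \<le> j" "j \<le> b" "j \<noteq> idx e" "F.win (j - a) = F.win (idx e - a)" for j
      proof -
        have "idx e - a \<le> E" "j - a \<le> E" "j - a \<noteq> idx e - a" using j near[OF eC] unfolding E_def by linarith+
        then show ?thesis unfolding Rep_def using j(4) by blast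
      qed
      have far: "a \<le> idx f" "Suc (idx f) \<le> b" if f: "f < m" "lo f \<le> hi e" "lo e \<le> Suc (hi f)" for f
      proof -
        note l = tm[OF f(1)] idx(1)[OF f(1)] width[OF f(1)] width[OF e(1)]
        show "a \<le> idx f" unfolding a_def using l e f w1 by linarith
        have "Suc (idx f) \<le> m" "Suc (idx f) \<le> t + 2 * w" using l e f by linarith+
        then show "Suc (idx f) \<le> b" by (simp add: b_def)
      qed
      show "idx e - a \<in> Rep"
      proof (cases "card (leaving e) \<le> 1")
        case True
        then have "2 \<le> card (entering e)" using e(2) by (simp add: crit_def)
        then obtain f f' where f: "f \<in> entering e" "f' \<in> entering e" "f \<noteq> f'"
          using card_le_Suc0_iff_eq[OF finite_entering_leaving(1), of e] by fastforce
        have fm: "f < m" "f' < m" using f by (auto simp: entering_def)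
        have "Suc (idx f) \<noteq> idx e \<or> Suc (idx f') \<noteq> idx e"
          using idx(2)[OF fm(1)] idx(2)[OF fm(2)] f(3) by (metis Suc_inject)
        then obtain h where h: "h \<in> entering e" "Suc (idx h) \<noteq> idx e" using f by blast
        have hm: "h < m" "dst h = src e" "lo h \<le> hi e" "lo e \<le> Suc (hi h)" using h by (auto simp: entering_def)
        show ?thesis
        proof (rule rep[of "Suc (idx h)"])
          show "a \<le> Suc (idx h)" "Suc (idx h) \<le> b" using far[OF hm(1,3,4)] by simp_all
          show "Suc (idx h) \<noteq> idx e" by (rule h)
          show "F.win (Suc (idx h) - a) = F.win (idx e - a)"
            by (rule winI) (use far(1)[OF hm(1,3,4)] idx[OF hm(1)] i hm near[OF eC] in simp_all)
        qed
      next
        case False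
        have "\<exists>h\<in>leaving e. h \<noteq> e"
        proof (rule ccontr)
          assume "\<not> ?thesis"
          then have "leaving e \<subseteq> {e}" by auto
          then have "card (leaving e) \<le> card {e}" by (rule card_mono[rotated]) simp
          then show False using False by simp
        qed
        then obtain h where h: "h \<in> leaving e" "h \<noteq> e" by blast
        have hm: "h < m" "src h = src e" "lo h \<le> hi e" "lo e \<le> Suc (hi h)" using h by (auto simp: leaving_def)
        have "idx h \<noteq> idx e" using idx(2)[OF hm(1)] i(2) h(2) by metis
        show ?thesis
        proof (rule rep[of "idx h"])
          show "a \<le> idx h" "idx h \<le> b" using far[OF hm(1,3,4)] by simp_all
          show "idx h \<noteq> idx e" by fact
          show "F.win (idx h - a) = F.win (idx e - a)"
            by (rule winO) (use far(1)[OF hm(1,3,4)] idx[OF hm(1)] i hm near[OF eC] in simp_all)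
        qed
      qed
    qed
  qed
  then have "card C \<le> card Rep"
    by (intro card_inj_on_le[of "\<lambda>e. idx e - a"]) (auto simp: Rep_def)
  then show "card {e. e < m \<and> crit e \<and> lo e \<le> t \<and> t \<le> hi e + w} \<le> critical_max"
    using cRep by (simp add: C_def)
qed

lemma solution_iff:
  assumes "1 \<le> m"
  shows "(\<exists>p. good m p) \<longleftrightarrow> releases_bounded \<and> critical_bounded critical_max \<and> St m \<noteq> {}"
proof
  assume "\<exists>p. good m p"
  then obtain p where p: "good m p" by blast
  have "St m = {(dst (last p), stack p) | p. good m p}" using St_Suc[of "m - 1"] assms by simp
  then have "St m \<noteq> {}" using p by blast
  then show "releases_bounded \<and> critical_bounded critical_max \<and> St m \<noteq> {}"
    using releases_bounded_necessary[OF p] critical_bounded_necessary[OF p] by blast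
next
  assume a: "releases_bounded \<and> critical_bounded critical_max \<and> St m \<noteq> {}"
  have "St m = {(dst (last p), stack p) | p. good m p}" using St_Suc[of "m - 1"] assms by simp
  then show "\<exists>p. good m p" using a by blast
qed

end

section \<open>Reasoning about word RAM programs\<close>

definition runs :: "nat \<Rightarrow> com \<Rightarrow> (nat \<Rightarrow> nat) \<Rightarrow> (nat \<Rightarrow> nat) \<Rightarrow> nat \<Rightarrow> ((nat \<Rightarrow> nat) \<Rightarrow> (nat \<Rightarrow> nat) \<Rightarrow> bool) \<Rightarrow> bool" where
  "runs W P \<rho> \<mu> T Q \<longleftrightarrow>
     (\<exists>t \<rho>' \<mu>'. exec W P \<lparr>reg = \<rho>, mem = \<mu>\<rparr> t \<lparr>reg = \<rho>', mem = \<mu>'\<rparr> \<and> t \<le> T \<and> Q \<rho>' \<mu>')"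

fun loop_free :: "com \<Rightarrow> bool" where
  "loop_free (Seq P Q) \<longleftrightarrow> loop_free P \<and> loop_free Q"
| "loop_free (Cond b P Q) \<longleftrightarrow> loop_free P \<and> loop_free Q"
| "loop_free (While b P) \<longleftrightarrow> False"
| "loop_free _ \<longleftrightarrow> True"

fun csize :: "com \<Rightarrow> nat" where
  "csize (Seq P Q) = csize P + csize Q"
| "csize (Cond b P Q) = Suc (csize P + csize Q)"
| "csize (While b P) = Suc (csize P)"
| "csize _ = 1"

fun tst :: "test \<Rightarrow> (nat \<Rightarrow> nat) \<Rightarrow> bool" where
  "tst (Eq i j) \<rho> \<longleftrightarrow> \<rho> i = \<rho> j"
| "tst (Less i j) \<rho> \<longleftrightarrow> \<rho> i < \<rho> j"

lemma test_val_tst: "test_val b s \<longleftrightarrow> tst b (reg s)" by (cases b) auto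

fun step :: "nat \<Rightarrow> com \<Rightarrow> (nat \<Rightarrow> nat) \<times> (nat \<Rightarrow> nat) \<Rightarrow> (nat \<Rightarrow> nat) \<times> (nat \<Rightarrow> nat)" where
  "step W (Const r n) (\<rho>, \<mu>) = (\<rho>(r := n mod 2 ^ W), \<mu>)"
| "step W (Op f r i j) (\<rho>, \<mu>) = (\<rho>(r := binop_val W f (\<rho> i) (\<rho> j)), \<mu>)"
| "step W (Load r i) (\<rho>, \<mu>) = (\<rho>(r := \<mu> (\<rho> i)), \<mu>)"
| "step W (Store i r) (\<rho>, \<mu>) = (\<rho>, \<mu>(\<rho> i := \<rho> r))"
| "step W (Seq P Q) \<sigma> = step W Q (step W P \<sigma>)"
| "step W (Cond b P Q) \<sigma> = (if tst b (fst \<sigma>) then step W P \<sigma> else step W Q \<sigma>)"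
| "step W _ \<sigma> = \<sigma>"

lemma exec_step:
  "loop_free P \<Longrightarrow> \<exists>t. exec W P \<lparr>reg = fst \<sigma>, mem = snd \<sigma>\<rparr> t \<lparr>reg = fst (step W P \<sigma>), mem = snd (step W P \<sigma>)\<rparr> \<and> t \<le> csize P"
proof (induction P arbitrary: \<sigma>)
  case Skip
  show ?case using exec.Skip[of W "\<lparr>reg = fst \<sigma>, mem = snd \<sigma>\<rparr>"] by (intro exI[of _ 1]) simp
next
  case (Const r n)
  show ?case using exec.Const[of W r n "\<lparr>reg = fst \<sigma>, mem = snd \<sigma>\<rparr>"]
    by (cases \<sigma>) (auto simp: fun_upd_def intro!: exI[of _ "Suc 0"])
next
  case (Op f r i j)
  show ?case using exec.Op[of W f r i j "\<lparr>reg = fst \<sigma>, mem = snd \<sigma>\<rparr>"]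
    by (cases \<sigma>) (auto simp: fun_upd_def intro!: exI[of _ "Suc 0"])
next
  case (Load r i)
  show ?case using exec.Load[of W r i "\<lparr>reg = fst \<sigma>, mem = snd \<sigma>\<rparr>"]
    by (cases \<sigma>) (auto simp: fun_upd_def intro!: exI[of _ "Suc 0"])
next
  case (Store i r)
  show ?case using exec.Store[of W i r "\<lparr>reg = fst \<sigma>, mem = snd \<sigma>\<rparr>"]
    by (cases \<sigma>) (auto simp: fun_upd_def intro!: exI[of _ "Suc 0"])
next
  case (Seq P Q)
  obtain t where t: "exec W P \<lparr>reg = fst \<sigma>, mem = snd \<sigma>\<rparr> t \<lparr>reg = fst (step W P \<sigma>), mem = snd (step W P \<sigma>)\<rparr>" "t \<le> csize P"
    using Seq.IH(1)[of \<sigma>] Seq.prems by auto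
  obtain u where u: "exec W Q \<lparr>reg = fst (step W P \<sigma>), mem = snd (step W P \<sigma>)\<rparr> u
      \<lparr>reg = fst (step W Q (step W P \<sigma>)), mem = snd (step W Q (step W P \<sigma>))\<rparr>" "u \<le> csize Q"
    using Seq.IH(2)[of "step W P \<sigma>"] Seq.prems by auto
  show ?case using exec.Seq[OF t(1) u(1)] t(2) u(2) by (intro exI[of _ "t + u"]) simp
next
  case (Cond b P Q)
  show ?case
  proof (cases "tst b (fst \<sigma>)")
    case True
    obtain t where t: "exec W P \<lparr>reg = fst \<sigma>, mem = snd \<sigma>\<rparr> t \<lparr>reg = fst (step W P \<sigma>), mem = snd (step W P \<sigma>)\<rparr>" "t \<le> csize P"
      using Cond.IH(1)[of \<sigma>] Cond.prems by auto
    show ?thesis using exec.CondTrue[OF _ t(1), of b Q] True t(2)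
      by (intro exI[of _ "Suc t"]) (simp add: test_val_tst)
  next
    case False
    obtain t where t: "exec W Q \<lparr>reg = fst \<sigma>, mem = snd \<sigma>\<rparr> t \<lparr>reg = fst (step W Q \<sigma>), mem = snd (step W Q \<sigma>)\<rparr>" "t \<le> csize Q"
      using Cond.IH(2)[of \<sigma>] Cond.prems by auto
    show ?thesis using exec.CondFalse[OF _ t(1), of b P] False t(2)
      by (intro exI[of _ "Suc t"]) (simp add: test_val_tst)
  qed
next
  case (While b P)
  then show ?case by simp
qed

lemma runs_step:
  assumes "loop_free P" "step W P (\<rho>, \<mu>) = (\<rho>', \<mu>')" "Q \<rho>' \<mu>'"
  shows "runs W P \<rho> \<mu> (csize P) Q"
proof -
  obtain t where "exec W P \<lparr>reg = \<rho>, mem = \<mu>\<rparr> t \<lparr>reg = \<rho>', mem = \<mu>'\<rparr>" "t \<le> csize P"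
    using exec_step[OF assms(1), of W "(\<rho>, \<mu>)"] unfolding assms(2) fst_conv snd_conv by blast
  then show ?thesis unfolding runs_def using assms(3) by blast
qed

lemma runs_loop_free:
  assumes "loop_free P" "case step W P (\<rho>, \<mu>) of (\<rho>', \<mu>') \<Rightarrow> Q \<rho>' \<mu>'"
  shows "runs W P \<rho> \<mu> (csize P) Q"
  using assms runs_step[OF assms(1)] by (auto split: prod.splits)

lemma runs_Seq:
  assumes "runs W P \<rho> \<mu> T R" "\<And>\<rho>' \<mu>'. R \<rho>' \<mu>' \<Longrightarrow> runs W P' \<rho>' \<mu>' T' Q"
  shows "runs W (Seq P P') \<rho> \<mu> (T + T') Q"
proof -
  obtain t \<rho>' \<mu>' where t: "exec W P \<lparr>reg = \<rho>, mem = \<mu>\<rparr> t \<lparr>reg = \<rho>', mem = \<mu>'\<rparr>" "t \<le> T" "R \<rho>' \<mu>'"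
    using assms(1) unfolding runs_def by blast
  obtain u \<rho>'' \<mu>'' where u: "exec W P' \<lparr>reg = \<rho>', mem = \<mu>'\<rparr> u \<lparr>reg = \<rho>'', mem = \<mu>''\<rparr>" "u \<le> T'" "Q \<rho>'' \<mu>''"
    using assms(2)[OF t(3)] unfolding runs_def by blast
  show ?thesis unfolding runs_def
    using exec.Seq[OF t(1) u(1)] add_mono[OF t(2) u(2)] u(3) by blast
qed

lemma runs_mono:
  assumes "runs W P \<rho> \<mu> T R" "T \<le> T'" "\<And>\<rho>' \<mu>'. R \<rho>' \<mu>' \<Longrightarrow> Q \<rho>' \<mu>'"
  shows "runs W P \<rho> \<mu> T' Q"
proof -
  obtain t \<rho>' \<mu>' where "exec W P \<lparr>reg = \<rho>, mem = \<mu>\<rparr> t \<lparr>reg = \<rho>', mem = \<mu>'\<rparr>" "t \<le> T" "R \<rho>' \<mu>'"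
    using assms(1) unfolding runs_def by blast
  then show ?thesis unfolding runs_def using assms(2) assms(3)[of \<rho>' \<mu>'] le_trans[of t T T'] by blast
qed

lemma runs_Cond:
  assumes "tst b \<rho> \<Longrightarrow> runs W P \<rho> \<mu> T Q" "\<not> tst b \<rho> \<Longrightarrow> runs W P' \<rho> \<mu> T Q"
  shows "runs W (Cond b P P') \<rho> \<mu> (Suc T) Q"
proof -
  define P0 where "P0 = (if tst b \<rho> then P else P')"
  have "runs W P0 \<rho> \<mu> T Q" using assms by (simp add: P0_def)
  then obtain t \<rho>' \<mu>' where t: "exec W P0 \<lparr>reg = \<rho>, mem = \<mu>\<rparr> t \<lparr>reg = \<rho>', mem = \<mu>'\<rparr>" "t \<le> T" "Q \<rho>' \<mu>'"
    unfolding runs_def by blast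
  have "exec W (Cond b P P') \<lparr>reg = \<rho>, mem = \<mu>\<rparr> (Suc t) \<lparr>reg = \<rho>', mem = \<mu>'\<rparr>"
  proof (cases "tst b \<rho>")
    case True
    show ?thesis by (rule exec.CondTrue) (use True t(1) in \<open>simp_all add: test_val_tst P0_def\<close>)
  next
    case False
    show ?thesis by (rule exec.CondFalse) (use False t(1) in \<open>simp_all add: test_val_tst P0_def\<close>)
  qed
  moreover have "Suc t \<le> Suc T" using t(2) by simp
  ultimately show ?thesis unfolding runs_def using t(3) by blast
qed

lemma runs_While:
  assumes "I 0 \<rho> \<mu>"
    and "\<And>i \<rho> \<mu>. i < n \<Longrightarrow> I i \<rho> \<mu> \<Longrightarrow> tst b \<rho> \<and> runs W P \<rho> \<mu> (C i) (I (Suc i))"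
    and "\<And>\<rho> \<mu>. I n \<rho> \<mu> \<Longrightarrow> \<not> tst b \<rho>"
  shows "runs W (While b P) \<rho> \<mu> (Suc (\<Sum>i<n. Suc (C i))) (I n)"
proof -
  have "runs W (While b P) \<rho> \<mu> (Suc (\<Sum>i\<in>{j..<n}. Suc (C i))) (I n)" if "j \<le> n" "I j \<rho> \<mu>" for j \<rho> \<mu>
    using that
  proof (induction "n - j" arbitrary: j \<rho> \<mu>)
    case 0
    then have j: "j = n" by simp
    have "exec W (While b P) \<lparr>reg = \<rho>, mem = \<mu>\<rparr> 1 \<lparr>reg = \<rho>, mem = \<mu>\<rparr>"
      by (rule exec.WhileFalse) (use assms(3) 0 j in \<open>simp add: test_val_tst\<close>)
    then have "exec W (While b P) \<lparr>reg = \<rho>, mem = \<mu>\<rparr> 1 \<lparr>reg = \<rho>, mem = \<mu>\<rparr> \<and> 1 \<le> Suc 0 \<and> I n \<rho> \<mu>"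
      using 0 j by simp
    then show ?case unfolding runs_def j by auto
  next
    case (Suc d)
    then have jn: "j < n" by simp
    have b: "tst b \<rho>" and r: "runs W P \<rho> \<mu> (C j) (I (Suc j))" using assms(2)[OF jn Suc.prems(2)] by auto
    obtain t \<rho>' \<mu>' where t: "exec W P \<lparr>reg = \<rho>, mem = \<mu>\<rparr> t \<lparr>reg = \<rho>', mem = \<mu>'\<rparr>" "t \<le> C j" "I (Suc j) \<rho>' \<mu>'"
      using r unfolding runs_def by blast
    have "runs W (While b P) \<rho>' \<mu>' (Suc (\<Sum>i\<in>{Suc j..<n}. Suc (C i))) (I n)"
      by (rule Suc.hyps(1)) (use Suc jn t in auto)
    then obtain u \<rho>'' \<mu>'' where u: "exec W (While b P) \<lparr>reg = \<rho>', mem = \<mu>'\<rparr> u \<lparr>reg = \<rho>'', mem = \<mu>''\<rparr>"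
      "u \<le> Suc (\<Sum>i\<in>{Suc j..<n}. Suc (C i))" "I n \<rho>'' \<mu>''"
      unfolding runs_def by blast
    have e: "exec W (While b P) \<lparr>reg = \<rho>, mem = \<mu>\<rparr> (Suc (t + u)) \<lparr>reg = \<rho>'', mem = \<mu>''\<rparr>"
      by (rule exec.WhileTrue[OF _ t(1) u(1)]) (use b in \<open>simp add: test_val_tst\<close>)
    have "(\<Sum>i\<in>{j..<n}. Suc (C i)) = Suc (C j) + (\<Sum>i\<in>{Suc j..<n}. Suc (C i))"
      using jn by (simp add: sum.atLeast_Suc_lessThan)
    then have "Suc (t + u) \<le> Suc (\<Sum>i\<in>{j..<n}. Suc (C i))" using t(2) u(2) by linarith
    then show ?case unfolding runs_def using e u(3) by blast
  qed
  from this[of 0] show ?thesis using assms(1) by (simp add: lessThan_atLeast0)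
qed

lemma runs_While_const:
  assumes "I 0 \<rho> \<mu>"
    and "\<And>i \<rho> \<mu>. i < n \<Longrightarrow> I i \<rho> \<mu> \<Longrightarrow> tst b \<rho> \<and> runs W P \<rho> \<mu> c (I (Suc i))"
    and "\<And>\<rho> \<mu>. I n \<rho> \<mu> \<Longrightarrow> \<not> tst b \<rho>"
  shows "runs W (While b P) \<rho> \<mu> (Suc (n * Suc c)) (I n)"
proof -
  have "runs W (While b P) \<rho> \<mu> (Suc (\<Sum>i<n. Suc c)) (I n)"
    by (rule runs_While[where C = "\<lambda>_. c", OF assms])
  then show ?thesis by simp
qed

text \<open>Above the base address held in register 7, sixteen tables are interleaved: cell \<open>x\<close> of table \<open>i\<close>
  has address \<open>base + 16 * x + i\<close>.  Registers 46 and 47 are scratch space for address computations.\<close>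

definition addr :: "nat \<Rightarrow> nat \<Rightarrow> com" where
  "addr i x = Seq (Const 47 16) (Seq (Op Mul 46 x 47) (Seq (Op Add 46 46 7) (Seq (Const 47 i) (Op Add 46 46 47))))"

definition get :: "nat \<Rightarrow> nat \<Rightarrow> nat \<Rightarrow> com" where "get r i x = Seq (addr i x) (Load r 46)"
definition put :: "nat \<Rightarrow> nat \<Rightarrow> nat \<Rightarrow> com" where "put i x r = Seq (addr i x) (Store 46 r)"

definition fld :: "nat \<Rightarrow> nat \<Rightarrow> nat \<Rightarrow> com" where
  "fld r j x = Seq (Const 47 4) (Seq (Op Mul 46 x 47) (Seq (Const 47 (5 + j)) (Seq (Op Add 46 46 47) (Load r 46))))"

definition mov :: "nat \<Rightarrow> nat \<Rightarrow> com" where "mov r x = Op Add r x 9"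

definition inc :: "nat \<Rightarrow> com" where "inc r = Op Add r r 8"

lemma loop_free_macros [simp]:
  "loop_free (get r i x)" "loop_free (put i x r)" "loop_free (fld r j x)" "loop_free (mov r x)" "loop_free (inc r)"
  by (simp_all add: get_def put_def addr_def fld_def mov_def inc_def)

locale memory =
  fixes W B Z m :: nat
  assumes base: "5 + 4 * m \<le> B" and room: "B + 16 * Z + 16 \<le> 2 ^ W"
begin

definition tb :: "(nat \<Rightarrow> nat) \<Rightarrow> nat \<Rightarrow> nat \<Rightarrow> nat" where "tb \<mu> i x = \<mu> (B + 16 * x + i)"
definition st :: "(nat \<Rightarrow> nat) \<Rightarrow> nat \<Rightarrow> nat \<Rightarrow> nat \<Rightarrow> nat \<Rightarrow> nat" where "st \<mu> i x v = \<mu>(B + 16 * x + i := v)"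
definition fd :: "(nat \<Rightarrow> nat) \<Rightarrow> nat \<Rightarrow> nat \<Rightarrow> nat" where "fd \<mu> j e = \<mu> (5 + 4 * e + j)"

lemma tb_st [simp]: "i < 16 \<Longrightarrow> j < 16 \<Longrightarrow> tb (st \<mu> i x v) j y = (if i = j \<and> x = y then v else tb \<mu> j y)"
proof -
  assume ij: "i < 16" "j < 16"
  have "B + 16 * x + i = B + 16 * y + j \<longleftrightarrow> i = j \<and> x = y"
  proof
    assume "B + 16 * x + i = B + 16 * y + j"
    then have e: "16 * x + i = 16 * y + j" by simp
    have "(16 * x + i) div 16 = x" "(16 * y + j) div 16 = y" using ij by simp_all
    then have "x = y" using e by metis
    then show "i = j \<and> x = y" using e by simp
  qed simp
  then show ?thesis by (auto simp: tb_def st_def)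
qed

lemma fd_st [simp]: "e < m \<Longrightarrow> j < 4 \<Longrightarrow> fd (st \<mu> i x v) j e = fd \<mu> j e"
  using base by (auto simp: fd_def st_def)

lemma step_get [simp]:
  assumes "\<rho> 7 = B" "\<rho> x < Z" "i < 16" "x \<noteq> 46" "x \<noteq> 47"
  shows "step W (get r i x) (\<rho>, \<mu>) = (\<rho>(47 := i, 46 := B + 16 * \<rho> x + i, r := tb \<mu> i (\<rho> x)), \<mu>)"
proof -
  have "B + 16 * \<rho> x + i < 2 ^ W" "16 < (2::nat) ^ W" using assms room by linarith+
  then have "\<rho> x * 16 mod 2 ^ W = 16 * \<rho> x" "(16 * \<rho> x + B) mod 2 ^ W = B + 16 * \<rho> x" "i mod 2 ^ W = i"
    "(B + 16 * \<rho> x + i) mod 2 ^ W = B + 16 * \<rho> x + i" "16 mod 2 ^ W = (16::nat)" by simp_all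
  then show ?thesis using assms by (simp add: get_def addr_def tb_def fun_eq_iff)
qed

lemma step_put [simp]:
  assumes "\<rho> 7 = B" "\<rho> x < Z" "i < 16" "x \<noteq> 46" "x \<noteq> 47" "r \<noteq> 46" "r \<noteq> 47"
  shows "step W (put i x r) (\<rho>, \<mu>) = (\<rho>(47 := i, 46 := B + 16 * \<rho> x + i), st \<mu> i (\<rho> x) (\<rho> r))"
proof -
  have "B + 16 * \<rho> x + i < 2 ^ W" "16 < (2::nat) ^ W" using assms room by linarith+
  then have "\<rho> x * 16 mod 2 ^ W = 16 * \<rho> x" "(16 * \<rho> x + B) mod 2 ^ W = B + 16 * \<rho> x" "i mod 2 ^ W = i"
    "(B + 16 * \<rho> x + i) mod 2 ^ W = B + 16 * \<rho> x + i" "16 mod 2 ^ W = (16::nat)" by simp_all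
  then show ?thesis using assms by (simp add: put_def addr_def st_def fun_eq_iff)
qed

lemma step_fld [simp]:
  assumes "\<rho> x < m" "j < 4" "x \<noteq> 46" "x \<noteq> 47"
  shows "step W (fld r j x) (\<rho>, \<mu>) = (\<rho>(47 := 5 + j, 46 := 5 + 4 * \<rho> x + j, r := fd \<mu> j (\<rho> x)), \<mu>)"
proof -
  have "5 + 4 * \<rho> x + j < 2 ^ W" "5 + j < (2::nat) ^ W" "4 < (2::nat) ^ W" using assms room base by linarith+
  then have "\<rho> x * 4 mod 2 ^ W = 4 * \<rho> x" "(5 + j) mod 2 ^ W = 5 + j"
    "(4 * \<rho> x + (5 + j)) mod 2 ^ W = 5 + 4 * \<rho> x + j" "4 mod 2 ^ W = (4::nat)" by simp_all
  then show ?thesis using assms(3,4) by (simp add: fld_def fd_def fun_eq_iff)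
qed

lemma step_mov [simp]: "\<rho> 9 = 0 \<Longrightarrow> \<rho> x < 2 ^ W \<Longrightarrow> step W (mov r x) (\<rho>, \<mu>) = (\<rho>(r := \<rho> x), \<mu>)"
  by (simp add: mov_def)

lemma step_inc [simp]: "\<rho> 8 = 1 \<Longrightarrow> \<rho> r + 1 < 2 ^ W \<Longrightarrow> step W (inc r) (\<rho>, \<mu>) = (\<rho>(r := \<rho> r + 1), \<mu>)"
  by (simp add: inc_def)

end

section \<open>The program\<close>

abbreviation Seq_infix :: "com \<Rightarrow> com \<Rightarrow> com" (infixr ";;" 60) where "P ;; Q \<equiv> Seq P Q"

text \<open>Registers 3 to 9 hold \<open>m\<close>, \<open>w\<close>, \<open>K\<close>, the number of vertices, the base address, 1 and 0.  The tables are: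
  0 and 6, for each vertex the linked list of its outgoing arcs (an arc \<open>e\<close> is stored as \<open>e + 1\<close>, and 0
  ends the list); 2, the number of intervals beginning at a given time; 3, the number of arcs entering
  plus twice the number of arcs leaving the tail of an arc; 4 and 5, the numbers of critical arcs whose
  interval begins at a given time, or ended \<open>w\<close> steps before; 7, 8 and 9, child, parent and label in a
  forest whose paths represent the lists of the states; 10, marks for the pairs of a node and a vertex
  already found; 13 and 14, vertex and node of the states in the order of their discovery.\<close>

definition setup_code :: com where
  "setup_code = Const 8 1 ;; Load 3 9 ;; Load 4 8 ;; Const 10 2 ;; Load 5 10 ;; Op Sub 5 5 8 ;;
    Const 10 4 ;; Load 6 10 ;; Op Mul 7 3 10 ;; Op Mul 10 6 5 ;; Op Add 7 7 10 ;;
    Const 10 5 ;; Op Add 7 7 10 ;; Const 10 0"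

definition adj_body :: com where
  "adj_body = fld 11 0 10 ;; get 12 0 11 ;; put 6 10 12 ;; Op Add 13 10 8 ;; put 0 11 13 ;;
    fld 14 2 10 ;; get 15 2 14 ;; inc 15 ;; put 2 14 15 ;; put 13 10 11 ;; put 14 10 8 ;; inc 10"

definition relax_body :: com where
  "relax_body = Op Sub 13 12 8 ;; fld 14 2 13 ;; fld 15 3 13 ;;
    Cond (Less 15 16) Skip (Cond (Less 17 14) Skip (get 19 3 13 ;; Op Add 19 19 18 ;; put 3 13 19)) ;;
    get 12 6 13"

definition relax :: com where "relax = get 12 0 11 ;; While (Less 9 12) relax_body"

definition count_body :: com where
  "count_body = (fld 16 2 10 ;; fld 17 3 10 ;; inc 17 ;; fld 11 1 10 ;; Const 18 1) ;;
    relax ;; (fld 11 0 10 ;; Const 18 2) ;; relax ;; inc 10"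

definition hist_body :: com where
  "hist_body = get 11 3 10 ;; Const 12 4 ;;
    Cond (Less 11 12) Skip
      (fld 13 2 10 ;; get 14 4 13 ;; inc 14 ;; put 4 13 14 ;;
       fld 13 3 10 ;; Op Add 13 13 4 ;; get 14 5 13 ;; inc 14 ;; put 5 13 14) ;;
    inc 10"

definition bound_code :: com where
  "bound_code = Const 10 6 ;; Op Mul 20 4 10 ;; Op Add 20 20 5 ;; Const 10 8 ;; Op Div 21 5 10 ;;
    inc 21 ;; Op Div 20 20 21 ;; inc 20 ;; mov 22 20 ;; Const 23 0 ;; Const 24 2"

definition bitlen_body :: com where "bitlen_body = Op Div 22 22 24 ;; inc 23"

definition check_init :: com where
  "check_init = Const 25 12 ;; Op Mul 25 25 20 ;; Op Mul 25 25 23 ;; Const 10 1 ;; Const 26 0 ;;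
    Const 27 0 ;; Const 28 0 ;; Const 29 1 ;; Op Add 30 3 8"

definition check_body :: com where
  "check_body = get 11 2 10 ;; Op Add 26 26 11 ;; get 11 4 10 ;; Op Add 27 27 11 ;;
    Op Add 11 26 8 ;; Op Add 12 10 4 ;; Cond (Less 12 11) (Const 29 0) Skip ;;
    Op Add 11 25 28 ;; Cond (Less 11 27) (Const 29 0) Skip ;;
    get 11 5 10 ;; Op Add 28 28 11 ;; inc 10"

locale prog = memory W B Z m + timed_graph m w src dst lo hi
  for W B Z m w :: nat and src dst lo hi :: "nat \<Rightarrow> nat" +
  fixes K nV dg :: nat
  assumes lo1: "\<And>e. e < m \<Longrightarrow> 1 \<le> lo e" and lohi: "\<And>e. e < m \<Longrightarrow> lo e \<le> Suc (hi e)"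
    and him: "\<And>e. e < m \<Longrightarrow> hi e \<le> m"
    and srcV: "\<And>e. e < m \<Longrightarrow> src e < nV" and dstV: "\<And>e. e < m \<Longrightarrow> dst e < nV"
    and m1: "1 \<le> m" and w1': "1 \<le> w" and wm: "w \<le> m"
    and deg: "\<And>v. card {e. e < m \<and> src e = v} \<le> dg"
    and Dbig: "12 * ((6 * w + K) div (K div 8 + 1) + 1) * bitlen ((6 * w + K) div (K div 8 + 1) + 1) + 6 * w + K + m + 20 \<le> Z"
    and Zbig: "nV + 4 * m + w + K + 4 \<le> Z"
begin

fun linked :: "(nat \<Rightarrow> nat) \<Rightarrow> nat \<Rightarrow> nat list \<Rightarrow> bool" where
  "linked \<mu> a [] \<longleftrightarrow> a = 0"
| "linked \<mu> a (e # l) \<longleftrightarrow> a = Suc e \<and> linked \<mu> (tb \<mu> 6 e) l"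

lemma linked_st_other [simp]: "i < 16 \<Longrightarrow> i \<noteq> 6 \<Longrightarrow> linked (st \<mu> i x v) a l = linked \<mu> a l"
  by (induction l arbitrary: a) auto

lemma linked_st_fresh: "x \<notin> set l \<Longrightarrow> linked (st \<mu> 6 x v) a l = linked \<mu> a l"
  by (induction l arbitrary: a) auto

lemma linked_cong: "(\<And>e. tb \<mu>' 6 e = tb \<mu> 6 e) \<Longrightarrow> linked \<mu>' a l = linked \<mu> a l"
  by (induction l arbitrary: a) auto

definition outs :: "nat \<Rightarrow> nat \<Rightarrow> nat list" where "outs i v = rev (filter (\<lambda>e. src e = v) [0..<i])"

lemma outs_0 [simp]: "outs 0 v = []" by (simp add: outs_def)
lemma outs_Suc [simp]: "outs (Suc i) v = (if src i = v then i # outs i v else outs i v)" by (simp add: outs_def)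
lemma set_outs: "set (outs i v) = {e. e < i \<and> src e = v}" by (auto simp: outs_def)
lemma distinct_outs: "distinct (outs i v)" by (simp add: outs_def)

lemma length_outs: "length (outs m v) \<le> dg"
  using distinct_card[OF distinct_outs[of m v]] deg[of v] by (simp add: set_outs)

definition input :: "(nat \<Rightarrow> nat) \<Rightarrow> bool" where
  "input \<mu> \<longleftrightarrow> (\<forall>e<m. fd \<mu> 0 e = src e \<and> fd \<mu> 1 e = dst e \<and> fd \<mu> 2 e = lo e \<and> fd \<mu> 3 e = hi e)"

lemma inputD: "input \<mu> \<Longrightarrow> e < m \<Longrightarrow> fd \<mu> 0 e = src e \<and> fd \<mu> 1 e = dst e \<and> fd \<mu> 2 e = lo e \<and> fd \<mu> 3 e = hi e"
  by (simp add: input_def)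

lemma input_st [simp]: "input (st \<mu> i x v) = input \<mu>" by (simp add: input_def)

definition regs :: "(nat \<Rightarrow> nat) \<Rightarrow> bool" where
  "regs \<rho> \<longleftrightarrow> \<rho> 3 = m \<and> \<rho> 4 = w \<and> \<rho> 5 = K \<and> \<rho> 6 = nV \<and> \<rho> 7 = B \<and> \<rho> 8 = 1 \<and> \<rho> 9 = 0"

lemma regsD: "regs \<rho> \<Longrightarrow> \<rho> 3 = m" "regs \<rho> \<Longrightarrow> \<rho> 4 = w" "regs \<rho> \<Longrightarrow> \<rho> 5 = K" "regs \<rho> \<Longrightarrow> \<rho> 6 = nV"
  "regs \<rho> \<Longrightarrow> \<rho> 7 = B" "regs \<rho> \<Longrightarrow> \<rho> 8 = 1" "regs \<rho> \<Longrightarrow> \<rho> 9 = 0"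
  by (auto simp: regs_def)

lemma regs_upd [simp]: "r \<notin> {3..9} \<Longrightarrow> regs (\<rho>(r := v)) = regs \<rho>" by (auto simp: regs_def)

lemma ZW: "16 * Z + 16 \<le> 2 ^ W" "Z < 2 ^ W" using room by linarith+

lemma W_pos [simp]: "0 < W"
proof (rule ccontr)
  assume "\<not> 0 < W"
  then show False using ZW(1) by simp
qed

definition adj_inv :: "nat \<Rightarrow> (nat \<Rightarrow> nat) \<Rightarrow> (nat \<Rightarrow> nat) \<Rightarrow> bool" where
  "adj_inv i \<rho> \<mu> \<longleftrightarrow> regs \<rho> \<and> input \<mu> \<and> \<rho> 10 = i \<and> (\<forall>v<nV. linked \<mu> (tb \<mu> 0 v) (outs i v))
     \<and> (\<forall>x. tb \<mu> 2 x = card {e. e < i \<and> lo e = x}) \<and> (\<forall>e<i. tb \<mu> 13 e = src e \<and> tb \<mu> 14 e = 1)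
     \<and> (\<forall>x. \<forall>j\<in>{3,4,5,7,8,9,10}. tb \<mu> j x = 0)"

lemma card_less_Suc_eq: "card {e. e < Suc i \<and> P e} = (if P i then 1 else 0) + card {e::nat. e < i \<and> P e}"
proof -
  have "{e. e < Suc i \<and> P e} = (if P i then insert i {e. e < i \<and> P e} else {e. e < i \<and> P e})"
    by (auto simp: less_Suc_eq)
  then show ?thesis by simp
qed

lemma card_less_le: "card {e::nat. e < i \<and> P e} \<le> i"
  using card_mono[of "{..<i}" "{e. e < i \<and> P e}"] by auto

lemma adj_step:
  assumes "i < m" "adj_inv i \<rho> \<mu>"
  shows "runs W adj_body \<rho> \<mu> (csize adj_body) (adj_inv (Suc i))"
proof (rule runs_loop_free)
  show "loop_free adj_body" by (simp add: adj_body_def)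
  have I: "regs \<rho>" "input \<mu>" "\<rho> 10 = i" "\<forall>v<nV. linked \<mu> (tb \<mu> 0 v) (outs i v)"
    "\<forall>x. tb \<mu> 2 x = card {e. e < i \<and> lo e = x}" "\<forall>e<i. tb \<mu> 13 e = src e \<and> tb \<mu> 14 e = 1"
    "\<forall>x. \<forall>j\<in>{3,4,5,7,8,9,10}. tb \<mu> j x = 0"
    using assms(2) by (auto simp: adj_inv_def)
  note R = regsD[OF I(1)] and inp = inputD[OF I(2) assms(1)]
  have b: "i < Z" "src i < Z" "lo i < Z" "i + 1 < 2 ^ W" "m < 2 ^ W" "src i < nV"
    using assms Zbig ZW srcV[OF assms(1)] lohi[OF assms(1)] him[OF assms(1)] by linarith+
  have c: "card {e. e < i \<and> lo e = lo i} + 1 < 2 ^ W" using card_less_le[of i "\<lambda>e. lo e = lo i"] b assms(1) ZW Zbig by linarith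
  have ni: "i \<notin> set (outs i v)" for v by (simp add: set_outs)
  show "case step W adj_body (\<rho>, \<mu>) of (\<rho>', \<mu>') \<Rightarrow> adj_inv (Suc i) \<rho>' \<mu>'"
    using R b c I assms(1) ni
    by (simp add: adj_body_def inp adj_inv_def linked_st_fresh card_less_Suc_eq all_conj_distrib All_less_Suc)
qed


lemma sub_one:
  assumes "Suc e < 2 ^ W" shows "(Suc e + (2 ^ W - Suc 0)) mod 2 ^ W = e"
proof -
  have "Suc e + (2 ^ W - Suc 0) = e + 2 ^ W" by simp
  then show ?thesis using assms by simp
qed

definition compat :: "nat \<Rightarrow> nat \<Rightarrow> bool" where "compat f e \<longleftrightarrow> lo f \<le> hi e \<and> lo e \<le> Suc (hi f)"

lemma relax_runs:
  assumes I: "regs \<rho>" "input \<mu>" "\<rho> 11 = v" "v < nV" "\<rho> 16 = lo f" "\<rho> 17 = Suc (hi f)" "\<rho> 18 = d"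
    "linked \<mu> (tb \<mu> 0 v) (outs m v)" "\<And>e. e < m \<Longrightarrow> tb \<mu> 3 e + d < 2 ^ W"
  shows "runs W relax \<rho> \<mu> (csize (get 12 0 11) + Suc (length (outs m v) * Suc (csize relax_body)))
    (\<lambda>\<rho>' \<mu>'. regs \<rho>' \<and> input \<mu>' \<and> (\<forall>r\<in>{10,16,17}. \<rho>' r = \<rho> r) \<and>
       (\<forall>j x. j < 16 \<longrightarrow> j \<noteq> 3 \<longrightarrow> tb \<mu>' j x = tb \<mu> j x) \<and>
       (\<forall>e<m. tb \<mu>' 3 e = tb \<mu> 3 e + (if src e = v \<and> compat f e then d else 0)))"
proof -
  define l where "l = outs m v"
  define Inv where "Inv j \<rho>' \<mu>' \<longleftrightarrow> regs \<rho>' \<and> input \<mu>' \<and> \<rho>' 10 = \<rho> 10 \<and> \<rho>' 16 = lo f \<and> \<rho>' 17 = Suc (hi f) \<and> \<rho>' 18 = d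
      \<and> linked \<mu>' (\<rho>' 12) (drop j l) \<and> (\<forall>j x. j < 16 \<longrightarrow> j \<noteq> 3 \<longrightarrow> tb \<mu>' j x = tb \<mu> j x)
      \<and> (\<forall>e<m. tb \<mu>' 3 e = tb \<mu> 3 e + (if e \<in> set (take j l) \<and> compat f e then d else 0))" for j \<rho>' \<mu>'
  note R = regsD[OF I(1)]
  have lm: "e < m" if "e \<in> set l" for e using that by (simp add: l_def set_outs)
  have dl: "distinct l" by (simp add: l_def distinct_outs)
  show ?thesis unfolding relax_def
  proof (rule runs_Seq[where R = "Inv 0"])
    have "v < Z" using I(4) Zbig by linarith
    then show "runs W (get 12 0 11) \<rho> \<mu> (csize (get 12 0 11)) (Inv 0)"
      by (intro runs_loop_free) (use I R in \<open>simp_all add: Inv_def l_def\<close>)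
    fix \<rho>1 \<mu>1 assume I0: "Inv 0 \<rho>1 \<mu>1"
    have "runs W (While (Less 9 12) relax_body) \<rho>1 \<mu>1 (Suc (length l * Suc (csize relax_body))) (Inv (length l))"
    proof (rule runs_While_const[where I = Inv, OF I0])
      fix \<rho>' \<mu>' assume "Inv (length l) \<rho>' \<mu>'"
      then show "\<not> tst (Less 9 12) \<rho>'" by (simp add: Inv_def)
    next
      fix j \<rho>' \<mu>' assume j: "j < length l" and J: "Inv j \<rho>' \<mu>'"
      define e where "e = l ! j"
      have e: "e < m" "drop j l = e # drop (Suc j) l" using j lm by (auto simp: e_def Cons_nth_drop_Suc)
      have eT: "e \<notin> set (take j l)" "set (take (Suc j) l) = insert e (set (take j l))"
      proof -
        have s: "take (Suc j) l = take j l @ [e]" using j by (simp add: e_def take_Suc_conv_app_nth)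
        have "distinct (take (Suc j) l)" using dl by (rule distinct_take)
        then show "e \<notin> set (take j l)" unfolding s by simp
        show "set (take (Suc j) l) = insert e (set (take j l))" unfolding s by simp
      qed
      have P: "regs \<rho>'" "input \<mu>'" "\<rho>' 10 = \<rho> 10" "\<rho>' 16 = lo f" "\<rho>' 17 = Suc (hi f)" "\<rho>' 18 = d"
        "\<rho>' 12 = Suc e" "linked \<mu>' (tb \<mu>' 6 e) (drop (Suc j) l)"
        "\<forall>j x. j < 16 \<longrightarrow> j \<noteq> 3 \<longrightarrow> tb \<mu>' j x = tb \<mu> j x"
        "\<forall>e<m. tb \<mu>' 3 e = tb \<mu> 3 e + (if e \<in> set (take j l) \<and> compat f e then d else 0)"
        using J e(2) unfolding Inv_def by auto
      note R' = regsD[OF P(1)] and inp = inputD[OF P(2) e(1)]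
      have b: "e < Z" "Suc e < 2 ^ W" using e(1) Zbig ZW by linarith+
      have t3: "tb \<mu>' 3 e = tb \<mu> 3 e" "tb \<mu> 3 e + d < 2 ^ W" using P(10) eT(1) e(1) I(9) by auto
      have sub: "(Suc e + (2 ^ W - Suc 0)) mod 2 ^ W = e" by (rule sub_one) (rule b)
      have t: "tst (Less 9 12) \<rho>'" using P(7) R' by simp
      have "runs W relax_body \<rho>' \<mu>' (csize relax_body) (Inv (Suc j))"
      proof (rule runs_loop_free)
        show "loop_free relax_body" by (simp add: relax_body_def)
        show "case step W relax_body (\<rho>', \<mu>') of (\<rho>'', \<mu>'') \<Rightarrow> Inv (Suc j) \<rho>'' \<mu>''"
        proof (cases "compat f e")
          case True
          then have c: "\<not> hi e < lo f" "\<not> Suc (hi f) < lo e" by (auto simp: compat_def)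
          show ?thesis using R' P b t3 e(1) c sub True eT
            by (simp add: relax_body_def inp Inv_def)
        next
          case False
          then have c: "hi e < lo f \<or> Suc (hi f) < lo e" by (auto simp: compat_def)
          show ?thesis using R' P b t3 e(1) sub False eT
            by (cases "hi e < lo f"; use c in \<open>simp add: relax_body_def inp Inv_def\<close>)
        qed
      qed
      then show "tst (Less 9 12) \<rho>' \<and> runs W relax_body \<rho>' \<mu>' (csize relax_body) (Inv (Suc j))" using t by blast
    qed
    then show "runs W (While (Less 9 12) relax_body) \<rho>1 \<mu>1 (Suc (length (outs m v) * Suc (csize relax_body)))
      (\<lambda>\<rho>' \<mu>'. regs \<rho>' \<and> input \<mu>' \<and> (\<forall>r\<in>{10,16,17}. \<rho>' r = \<rho> r) \<and>
       (\<forall>j x. j < 16 \<longrightarrow> j \<noteq> 3 \<longrightarrow> tb \<mu>' j x = tb \<mu> j x) \<and>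
       (\<forall>e<m. tb \<mu>' 3 e = tb \<mu> 3 e + (if src e = v \<and> compat f e then d else 0)))"
      by (rule runs_mono) (auto simp: l_def Inv_def I set_outs)
  qed
qed

definition stat :: "(nat \<Rightarrow> nat) \<Rightarrow> bool" where
  "stat \<mu> \<longleftrightarrow> (\<forall>v<nV. linked \<mu> (tb \<mu> 0 v) (outs m v)) \<and> (\<forall>x. tb \<mu> 2 x = card {e. e < m \<and> lo e = x})
     \<and> (\<forall>e<m. tb \<mu> 13 e = src e \<and> tb \<mu> 14 e = 1) \<and> (\<forall>x. \<forall>j\<in>{7,8,9,10}. tb \<mu> j x = 0)"

lemma stat_cong:
  assumes "stat \<mu>" "\<And>j x. j < 16 \<Longrightarrow> j \<noteq> 3 \<Longrightarrow> j \<noteq> 4 \<Longrightarrow> j \<noteq> 5 \<Longrightarrow> tb \<mu>' j x = tb \<mu> j x"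
  shows "stat \<mu>'"
proof -
  have "linked \<mu>' a l = linked \<mu> a l" for a l by (rule linked_cong) (rule assms(2), auto)
  then show ?thesis using assms by (simp add: stat_def)
qed

lemma stat_st [simp]: "j = 3 \<or> j = 4 \<or> j = 5 \<Longrightarrow> stat \<mu> \<Longrightarrow> stat (st \<mu> j x v)"
  by (rule stat_cong[of \<mu>]) auto

definition relax_cost :: nat where
  "relax_cost = csize (get 12 0 11) + Suc (dg * Suc (csize relax_body))"

definition count_inv :: "nat \<Rightarrow> (nat \<Rightarrow> nat) \<Rightarrow> (nat \<Rightarrow> nat) \<Rightarrow> bool" where
  "count_inv i \<rho> \<mu> \<longleftrightarrow> regs \<rho> \<and> input \<mu> \<and> \<rho> 10 = i \<and> stat \<mu> \<and> (\<forall>x. tb \<mu> 4 x = 0 \<and> tb \<mu> 5 x = 0)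
     \<and> (\<forall>e<m. tb \<mu> 3 e = card {f. f < i \<and> dst f = src e \<and> compat f e} + 2 * card {f. f < i \<and> src f = src e \<and> compat f e})"

definition count_cost :: nat where
  "count_cost = csize (fld 16 2 10 ;; fld 17 3 10 ;; inc 17 ;; fld 11 1 10 ;; Const 18 1) +
     (relax_cost + (csize (fld 11 0 10 ;; Const 18 2) + (relax_cost + csize (inc 10))))"

lemma relax_runs':
  assumes I: "regs \<rho>" "input \<mu>" "\<rho> 11 = v" "v < nV" "\<rho> 16 = lo f" "\<rho> 17 = Suc (hi f)" "\<rho> 18 = d"
    "stat \<mu>" "\<And>e. e < m \<Longrightarrow> tb \<mu> 3 e + d < 2 ^ W"
  shows "runs W relax \<rho> \<mu> relax_cost
    (\<lambda>\<rho>' \<mu>'. regs \<rho>' \<and> input \<mu>' \<and> \<rho>' 10 = \<rho> 10 \<and> \<rho>' 16 = \<rho> 16 \<and> \<rho>' 17 = \<rho> 17 \<and> stat \<mu>' \<and>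
       (\<forall>x. tb \<mu>' 4 x = tb \<mu> 4 x \<and> tb \<mu>' 5 x = tb \<mu> 5 x) \<and>
       (\<forall>e<m. tb \<mu>' 3 e = tb \<mu> 3 e + (if src e = v \<and> compat f e then d else 0)))"
proof (rule runs_mono[OF relax_runs[OF I(1-7)]])
  show "linked \<mu> (tb \<mu> 0 v) (outs m v)" using I(4,8) by (simp add: stat_def)
  show "tb \<mu> 3 e + d < 2 ^ W" if "e < m" for e using I(9) that by blast
  show "csize (get 12 0 11) + Suc (length (outs m v) * Suc (csize relax_body)) \<le> relax_cost"
    unfolding relax_cost_def using mult_le_mono1[OF length_outs[of v]] by (simp only: add_le_cancel_left Suc_le_mono)
  fix \<rho>' \<mu>' assume a: "regs \<rho>' \<and> input \<mu>' \<and> (\<forall>r\<in>{10, 16, 17}. \<rho>' r = \<rho> r) \<and>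
       (\<forall>j x. j < 16 \<longrightarrow> j \<noteq> 3 \<longrightarrow> tb \<mu>' j x = tb \<mu> j x) \<and>
       (\<forall>e<m. tb \<mu>' 3 e = tb \<mu> 3 e + (if src e = v \<and> compat f e then d else 0))"
  have "stat \<mu>'" by (rule stat_cong[OF I(8)]) (use a in simp)
  then show "regs \<rho>' \<and> input \<mu>' \<and> \<rho>' 10 = \<rho> 10 \<and> \<rho>' 16 = \<rho> 16 \<and> \<rho>' 17 = \<rho> 17 \<and> stat \<mu>' \<and>
       (\<forall>x. tb \<mu>' 4 x = tb \<mu> 4 x \<and> tb \<mu>' 5 x = tb \<mu> 5 x) \<and>
       (\<forall>e<m. tb \<mu>' 3 e = tb \<mu> 3 e + (if src e = v \<and> compat f e then d else 0))"
    using a by simp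
qed

lemma count_step:
  assumes f: "f < m" and I: "count_inv f \<rho> \<mu>"
  shows "runs W count_body \<rho> \<mu> count_cost (count_inv (Suc f))"
proof -
  have P: "regs \<rho>" "input \<mu>" "\<rho> 10 = f" "stat \<mu>" "\<forall>x. tb \<mu> 4 x = 0 \<and> tb \<mu> 5 x = 0"
    "\<forall>e<m. tb \<mu> 3 e = card {g. g < f \<and> dst g = src e \<and> compat g e} + 2 * card {g. g < f \<and> src g = src e \<and> compat g e}"
    using I by (auto simp: count_inv_def)
  note R = regsD[OF P(1)] and inp = inputD[OF P(2) f]
  have bd: "tb \<mu> 3 e + 3 < 2 ^ W" if "e < m" for e
  proof -
    have "tb \<mu> 3 e \<le> f + 2 * f"
      using P(6) that card_less_le[of f "\<lambda>g. dst g = src e \<and> compat g e"] card_less_le[of f "\<lambda>g. src g = src e \<and> compat g e"]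
      by (simp add: add_mono)
    then show ?thesis using f Zbig ZW by linarith
  qed
  have b: "hi f + 1 < 2 ^ W" "2 < (2::nat) ^ W" "f + 1 < 2 ^ W" using him[OF f] f Zbig ZW by linarith+
  define Q1 where "Q1 \<rho>' \<mu>' \<longleftrightarrow> regs \<rho>' \<and> \<mu>' = \<mu> \<and> \<rho>' 10 = f \<and> \<rho>' 16 = lo f \<and> \<rho>' 17 = Suc (hi f) \<and> \<rho>' 11 = dst f \<and> \<rho>' 18 = 1"
    for \<rho>' \<mu>'
  define Q2 where "Q2 \<rho>' \<mu>' \<longleftrightarrow> regs \<rho>' \<and> input \<mu>' \<and> \<rho>' 10 = f \<and> \<rho>' 16 = lo f \<and> \<rho>' 17 = Suc (hi f) \<and> stat \<mu>'
      \<and> (\<forall>x. tb \<mu>' 4 x = 0 \<and> tb \<mu>' 5 x = 0)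
      \<and> (\<forall>e<m. tb \<mu>' 3 e = tb \<mu> 3 e + (if src e = dst f \<and> compat f e then 1 else 0))" for \<rho>' \<mu>'
  define Q3 where "Q3 \<rho>' \<mu>' \<longleftrightarrow> Q2 \<rho>' \<mu>' \<and> \<rho>' 11 = src f \<and> \<rho>' 18 = 2" for \<rho>' \<mu>'
  define Q4 where "Q4 \<rho>' \<mu>' \<longleftrightarrow> regs \<rho>' \<and> input \<mu>' \<and> \<rho>' 10 = f \<and> stat \<mu>'
      \<and> (\<forall>x. tb \<mu>' 4 x = 0 \<and> tb \<mu>' 5 x = 0)
      \<and> (\<forall>e<m. tb \<mu>' 3 e = tb \<mu> 3 e + (if src e = dst f \<and> compat f e then 1 else 0)
            + (if src e = src f \<and> compat f e then 2 else 0))" for \<rho>' \<mu>'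
  show ?thesis unfolding count_body_def count_cost_def
  proof (intro runs_Seq)
    show "runs W (fld 16 2 10 ;; fld 17 3 10 ;; inc 17 ;; fld 11 1 10 ;; Const 18 1) \<rho> \<mu>
      (csize (fld 16 2 10 ;; fld 17 3 10 ;; inc 17 ;; fld 11 1 10 ;; Const 18 1)) Q1"
      by (rule runs_loop_free) (use P R inp b f in \<open>simp_all add: Q1_def\<close>)
  next
    fix \<rho>1 \<mu>1 assume q: "Q1 \<rho>1 \<mu>1"
    have "tb \<mu>1 3 e + 1 < 2 ^ W" if "e < m" for e
      using q bd[OF that] by (simp add: Q1_def)
    then show "runs W relax \<rho>1 \<mu>1 relax_cost Q2"
      by (intro runs_mono[OF relax_runs'[of \<rho>1 \<mu>1 "dst f" f 1]])
        (use q P dstV[OF f] in \<open>auto simp: Q1_def Q2_def\<close>)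
  next
    fix \<rho>1 \<mu>1 assume q: "Q2 \<rho>1 \<mu>1"
    have "regs \<rho>1" "input \<mu>1" using q by (auto simp: Q2_def)
    note R' = regsD[OF this(1)] and inp' = inputD[OF this(2) f]
    show "runs W (fld 11 0 10 ;; Const 18 2) \<rho>1 \<mu>1 (csize (fld 11 0 10 ;; Const 18 2)) Q3"
      by (rule runs_loop_free) (use q R' inp' b f in \<open>simp_all add: Q2_def Q3_def\<close>)
  next
    fix \<rho>1 \<mu>1 assume q: "Q3 \<rho>1 \<mu>1"
    have "tb \<mu>1 3 e + 2 < 2 ^ W" if "e < m" for e
      using q bd[OF that] that by (auto simp: Q2_def Q3_def)
    then show "runs W relax \<rho>1 \<mu>1 relax_cost Q4"
      by (intro runs_mono[OF relax_runs'[of \<rho>1 \<mu>1 "src f" f 2]])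
        (use q srcV[OF f] in \<open>auto simp: Q2_def Q3_def Q4_def\<close>)
  next
    fix \<rho>1 \<mu>1 assume q: "Q4 \<rho>1 \<mu>1"
    then have "regs \<rho>1" by (simp add: Q4_def)
    note R' = regsD[OF this]
    have e1: "src f = src e \<longleftrightarrow> src e = src f" "dst f = src e \<longleftrightarrow> src e = dst f" for e by auto
    show "runs W (inc 10) \<rho>1 \<mu>1 (csize (inc 10)) (count_inv (Suc f))"
      by (rule runs_loop_free) (use q R' b P(6) in \<open>simp_all add: Q4_def count_inv_def card_less_Suc_eq e1\<close>)
  qed
qed

definition hist_inv :: "nat \<Rightarrow> (nat \<Rightarrow> nat) \<Rightarrow> (nat \<Rightarrow> nat) \<Rightarrow> bool" where
  "hist_inv i \<rho> \<mu> \<longleftrightarrow> regs \<rho> \<and> input \<mu> \<and> \<rho> 10 = i \<and> stat \<mu> \<and> (\<forall>e<m. 4 \<le> tb \<mu> 3 e \<longleftrightarrow> crit e)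
     \<and> (\<forall>x. tb \<mu> 4 x = card {e. e < i \<and> crit e \<and> lo e = x}) \<and> (\<forall>x. tb \<mu> 5 x = card {e. e < i \<and> crit e \<and> hi e + w = x})"

lemma crit_iff: "crit e \<longleftrightarrow>
    4 \<le> card {f. f < m \<and> dst f = src e \<and> compat f e} + 2 * card {f. f < m \<and> src f = src e \<and> compat f e}"
  by (simp add: crit_def entering_def leaving_def compat_def)

lemma hist_step:
  assumes f: "f < m" and I: "hist_inv f \<rho> \<mu>"
  shows "runs W hist_body \<rho> \<mu> (csize hist_body) (hist_inv (Suc f))"
proof (rule runs_loop_free)
  show "loop_free hist_body" by (simp add: hist_body_def)
  have P: "regs \<rho>" "input \<mu>" "\<rho> 10 = f" "stat \<mu>" "\<forall>e<m. 4 \<le> tb \<mu> 3 e \<longleftrightarrow> crit e"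
     "\<forall>x. tb \<mu> 4 x = card {e. e < f \<and> crit e \<and> lo e = x}" "\<forall>x. tb \<mu> 5 x = card {e. e < f \<and> crit e \<and> hi e + w = x}"
    using I by (auto simp: hist_inv_def)
  note R = regsD[OF P(1)] and inp = inputD[OF P(2) f]
  have b: "f < Z" "lo f < Z" "hi f + w < Z" "hi f + w < 2 ^ W" "f + 1 < 2 ^ W" "(4::nat) < 2 ^ W"
    using him[OF f] lohi[OF f] f Zbig ZW by linarith+
  have c: "card {e. e < f \<and> crit e \<and> lo e = lo f} + 1 < 2 ^ W" "card {e. e < f \<and> crit e \<and> hi e + w = hi f + w} + 1 < 2 ^ W"
    using card_less_le[of f "\<lambda>e. crit e \<and> lo e = lo f"] card_less_le[of f "\<lambda>e. crit e \<and> hi e + w = hi f + w"] b by linarith+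
  show "case step W hist_body (\<rho>, \<mu>) of (\<rho>', \<mu>') \<Rightarrow> hist_inv (Suc f) \<rho>' \<mu>'"
  proof (cases "crit f")
    case True
    then have "\<not> tb \<mu> 3 f < 4" using P(5) f by auto
    then show ?thesis using True R P b c inp f by (simp add: hist_body_def hist_inv_def card_less_Suc_eq)
  next
    case False
    then have "tb \<mu> 3 f < 4" using P(5) f by auto
    then show ?thesis using False R P b c inp f by (simp add: hist_body_def hist_inv_def card_less_Suc_eq)
  qed
qed

definition wn :: nat where "wn = (6 * w + K) div (K div 8 + 1) + 1"
definition D :: nat where "D = 12 * wn * bitlen wn"

lemma D_le: "D + 6 * w + K + m + 20 \<le> Z" using Dbig by (simp add: D_def wn_def)

lemma wn_le: "wn \<le> 6 * w + K + 1" unfolding wn_def by simp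

lemma bitlen_pos: "n \<noteq> 0 \<Longrightarrow> bitlen n = Suc (bitlen (n div 2))" by (subst bitlen.simps) simp
lemma bitlen_0 [simp]: "bitlen 0 = 0" by (subst bitlen.simps) simp
lemma bitlen_eq_0 [simp]: "bitlen n = 0 \<longleftrightarrow> n = 0" by (subst bitlen.simps) simp

definition hist_ok :: "(nat \<Rightarrow> nat) \<Rightarrow> bool" where
  "hist_ok \<mu> \<longleftrightarrow> input \<mu> \<and> stat \<mu> \<and> (\<forall>e<m. 4 \<le> tb \<mu> 3 e \<longleftrightarrow> crit e)
     \<and> (\<forall>x. tb \<mu> 4 x = card {e. e < m \<and> crit e \<and> lo e = x}) \<and> (\<forall>x. tb \<mu> 5 x = card {e. e < m \<and> crit e \<and> hi e + w = x})"

definition check_inv :: "nat \<Rightarrow> (nat \<Rightarrow> nat) \<Rightarrow> (nat \<Rightarrow> nat) \<Rightarrow> bool" where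
  "check_inv i \<rho> \<mu> \<longleftrightarrow> regs \<rho> \<and> hist_ok \<mu> \<and> \<rho> 10 = Suc i \<and> \<rho> 25 = D \<and> \<rho> 30 = Suc m
     \<and> \<rho> 26 = card {e. e < m \<and> lo e \<le> i} \<and> \<rho> 27 = card {e. e < m \<and> crit e \<and> lo e \<le> i}
     \<and> \<rho> 28 = card {e. e < m \<and> crit e \<and> hi e + w \<le> i}
     \<and> \<rho> 29 = (if (\<forall>t. 1 \<le> t \<longrightarrow> t \<le> i \<longrightarrow> card {e. e < m \<and> lo e \<le> t} + 1 \<le> t + w
           \<and> card {e. e < m \<and> crit e \<and> lo e \<le> t \<and> t \<le> hi e + w} \<le> D) then 1 else 0)"

lemma bound_runs:
  assumes "regs \<rho>" "hist_ok \<mu>"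
  shows "runs W (bound_code ;; While (Less 9 22) bitlen_body ;; check_init) \<rho> \<mu>
    (csize bound_code + (Suc (bitlen wn * Suc (csize bitlen_body)) + csize check_init)) (check_inv 0)"
proof (intro runs_Seq)
  note R = regsD[OF assms(1)]
  have b: "6 * w + K + 1 < 2 ^ W" "wn < 2 ^ W" "K + 1 < 2 ^ W" "6 * w < 2 ^ W" "(6::nat) < 2 ^ W" "(8::nat) < 2 ^ W"
    "K div 8 + 1 < 2 ^ W" "(2::nat) < 2 ^ W"
    using D_le ZW wn_le div_le_dividend[of K 8] by linarith+
  define Q where "Q j \<rho>' \<mu>' \<longleftrightarrow> regs \<rho>' \<and> \<mu>' = \<mu> \<and> \<rho>' 20 = wn \<and> j + bitlen (\<rho>' 22) = bitlen wn \<and> \<rho>' 23 = j \<and> \<rho>' 24 = 2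
     " for j :: nat and \<rho>' \<mu>' :: "nat \<Rightarrow> nat"
  have wq: "Suc ((w * 6 + K) div Suc (K div 8)) = wn" by (simp add: wn_def mult.commute)
  show "runs W bound_code \<rho> \<mu> (csize bound_code) (Q 0)"
    by (rule runs_loop_free) (use R b assms(1) wq in \<open>simp_all add: bound_code_def Q_def\<close>)
  fix \<rho>1 \<mu>1 assume q: "Q 0 \<rho>1 \<mu>1"
  show "runs W (While (Less 9 22) bitlen_body) \<rho>1 \<mu>1 (Suc (bitlen wn * Suc (csize bitlen_body))) (Q (bitlen wn))"
  proof (rule runs_While_const[where I = Q, OF q])
    fix j \<rho>' \<mu>' assume j: "j < bitlen wn" and Qj: "Q j \<rho>' \<mu>'"
    have P: "regs \<rho>'" "\<mu>' = \<mu>" "\<rho>' 20 = wn" "j + bitlen (\<rho>' 22) = bitlen wn" "\<rho>' 23 = j" "\<rho>' 24 = 2" using Qj by (auto simp: Q_def)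
    note R' = regsD[OF P(1)]
    have nz: "\<rho>' 22 \<noteq> 0"
    proof
      assume "\<rho>' 22 = 0"
      then show False using P(4) j by simp
    qed
    have bj: "Suc j < 2 ^ W" using j bitlen_le[of wn] wn_le b by linarith
    show "tst (Less 9 22) \<rho>' \<and> runs W bitlen_body \<rho>' \<mu>' (csize bitlen_body) (Q (Suc j))"
    proof
      show "tst (Less 9 22) \<rho>'" using nz R' by simp
      show "runs W bitlen_body \<rho>' \<mu>' (csize bitlen_body) (Q (Suc j))"
        by (rule runs_loop_free) (use R' P bj bitlen_pos[OF nz] in \<open>simp_all add: bitlen_body_def Q_def\<close>)
    qed
  next
    fix \<rho>' \<mu>' assume "Q (bitlen wn) \<rho>' \<mu>'"
    then show "\<not> tst (Less 9 22) \<rho>'" by (auto simp: Q_def regs_def)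
  qed
next
  fix \<rho>1 \<mu>1
  let ?Q = "\<lambda>\<rho>' \<mu>'. regs \<rho>' \<and> \<mu>' = \<mu> \<and> \<rho>' 20 = wn \<and> bitlen wn + bitlen (\<rho>' 22) = bitlen wn \<and> \<rho>' 23 = bitlen wn \<and> \<rho>' 24 = 2"
  assume q: "?Q \<rho>1 \<mu>1"
  then have P: "regs \<rho>1" "\<mu>1 = \<mu>" "\<rho>1 20 = wn" "\<rho>1 23 = bitlen wn" by auto
  note R = regsD[OF P(1)]
  have b: "12 * wn < 2 ^ W" "12 * wn * bitlen wn < 2 ^ W" "(12::nat) < 2 ^ W" "Suc m < 2 ^ W"
  proof -
    have "1 \<le> bitlen wn" using bitlen_pos[of wn] by (simp add: wn_def)
    then have "12 * wn * 1 \<le> 12 * wn * bitlen wn" by (rule mult_le_mono2)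
    then show "12 * wn < 2 ^ W" "12 * wn * bitlen wn < 2 ^ W" "(12::nat) < 2 ^ W" "Suc m < 2 ^ W"
      using D_le ZW unfolding D_def by linarith+
  qed
  have z: "{e. e < m \<and> lo e = 0} = {}" "{e. e < m \<and> crit e \<and> lo e = 0} = {}" using lo1 by fastforce+
  have ws: "w \<noteq> 0" using w1' by simp
  show "runs W check_init \<rho>1 \<mu>1 (csize check_init) (check_inv 0)"
    by (rule runs_loop_free) (use R P b z assms(2) ws in \<open>simp_all add: check_init_def check_inv_def D_def\<close>)
qed

lemma card_le_Suc_split: "card {e. e < m \<and> P e \<and> g e \<le> Suc i} = card {e. e < m \<and> P e \<and> g e \<le> i} + card {e. e < m \<and> P e \<and> g e = Suc i}"
proof -
  have "{e. e < m \<and> P e \<and> g e \<le> Suc i} = {e. e < m \<and> P e \<and> g e \<le> i} \<union> {e. e < m \<and> P e \<and> g e = Suc i}" by auto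
  moreover have "card \<dots> = card {e. e < m \<and> P e \<and> g e \<le> i} + card {e. e < m \<and> P e \<and> g e = Suc i}"
    by (rule card_Un_disjoint) auto
  ultimately show ?thesis by simp
qed

lemma check_step:
  assumes i: "i < m" and I: "check_inv i \<rho> \<mu>"
  shows "runs W check_body \<rho> \<mu> (csize check_body) (check_inv (Suc i))"
proof (rule runs_loop_free)
  show "loop_free check_body" by (simp add: check_body_def)
  define ok where "ok i \<longleftrightarrow> (\<forall>t. 1 \<le> t \<longrightarrow> t \<le> i \<longrightarrow> card {e. e < m \<and> lo e \<le> t} + 1 \<le> t + w
           \<and> card {e. e < m \<and> crit e \<and> lo e \<le> t \<and> t \<le> hi e + w} \<le> D)" for i
  define N1 where "N1 i = card {e. e < m \<and> lo e \<le> i}" for i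
  define N2 where "N2 i = card {e. e < m \<and> crit e \<and> lo e \<le> i}" for i
  define N3 where "N3 i = card {e. e < m \<and> crit e \<and> hi e + w \<le> i}" for i
  have P: "regs \<rho>" "hist_ok \<mu>" "\<rho> 10 = Suc i" "\<rho> 25 = D" "\<rho> 30 = Suc m" "\<rho> 26 = N1 i" "\<rho> 27 = N2 i"
     "\<rho> 28 = N3 i" "\<rho> 29 = (if ok i then 1 else 0)"
    using I unfolding check_inv_def ok_def N1_def N2_def N3_def by blast+
  note R = regsD[OF P(1)]
  have T: "tb \<mu> 2 (Suc i) = card {e. e < m \<and> lo e = Suc i}" "tb \<mu> 4 (Suc i) = card {e. e < m \<and> crit e \<and> lo e = Suc i}"
    "tb \<mu> 5 (Suc i) = card {e. e < m \<and> crit e \<and> hi e + w = Suc i}"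
    using P(2) by (auto simp: hist_ok_def stat_def)
  have S: "N1 i + tb \<mu> 2 (Suc i) = N1 (Suc i)" "N2 i + tb \<mu> 4 (Suc i) = N2 (Suc i)" "N3 i + tb \<mu> 5 (Suc i) = N3 (Suc i)"
    unfolding T N1_def N2_def N3_def
    using card_le_Suc_split[of "\<lambda>_. True" lo i] card_le_Suc_split[of crit lo i] card_le_Suc_split[of crit "\<lambda>e. hi e + w" i]
    by simp_all
  have le: "N1 j \<le> m" "N2 j \<le> m" "N3 j \<le> m" for j
    unfolding N1_def N2_def N3_def by (rule card_less_le)+
  have b: "Suc i < Z" "N1 (Suc i) + 1 < 2 ^ W" "N2 (Suc i) < 2 ^ W" "N3 (Suc i) < 2 ^ W" "Suc i + w < 2 ^ W" "D + N3 i < 2 ^ W" "Suc (Suc i) < 2 ^ W"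
    using i le[of "Suc i"] le[of i] Zbig ZW D_le by linarith+
  have dis: "card {e. e < m \<and> crit e \<and> lo e \<le> Suc i \<and> Suc i \<le> hi e + w} + N3 i = N2 (Suc i)"
  proof -
    have "{e. e < m \<and> crit e \<and> lo e \<le> Suc i} = {e. e < m \<and> crit e \<and> lo e \<le> Suc i \<and> Suc i \<le> hi e + w} \<union> {e. e < m \<and> crit e \<and> hi e + w \<le> i}"
      using lohi w1' by fastforce
    moreover have "card \<dots> = card {e. e < m \<and> crit e \<and> lo e \<le> Suc i \<and> Suc i \<le> hi e + w} + card {e. e < m \<and> crit e \<and> hi e + w \<le> i}"
      by (rule card_Un_disjoint) auto
    ultimately show ?thesis by (simp add: N2_def N3_def)
  qed
  have okS: "ok (Suc i) \<longleftrightarrow> ok i \<and> \<not> (Suc i + w < N1 (Suc i) + 1) \<and> \<not> (D + N3 i < N2 (Suc i))"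
  proof -
    have "ok (Suc i) \<longleftrightarrow> ok i \<and> card {e. e < m \<and> lo e \<le> Suc i} + 1 \<le> Suc i + w
           \<and> card {e. e < m \<and> crit e \<and> lo e \<le> Suc i \<and> Suc i \<le> hi e + w} \<le> D"
      unfolding ok_def by (auto simp: le_Suc_eq)
    then show ?thesis using dis unfolding N1_def by linarith
  qed
  have "case step W check_body (\<rho>, \<mu>) of (\<rho>', \<mu>') \<Rightarrow> regs \<rho>' \<and> hist_ok \<mu>' \<and> \<rho>' 10 = Suc (Suc i) \<and> \<rho>' 25 = D \<and> \<rho>' 30 = Suc m
     \<and> \<rho>' 26 = N1 (Suc i) \<and> \<rho>' 27 = N2 (Suc i) \<and> \<rho>' 28 = N3 (Suc i) \<and> \<rho>' 29 = (if ok (Suc i) then 1 else 0)"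
    using R P b S by (simp add: check_body_def okS)
  then show "case step W check_body (\<rho>, \<mu>) of (\<rho>', \<mu>') \<Rightarrow> check_inv (Suc i) \<rho>' \<mu>'"
    unfolding check_inv_def N1_def N2_def N3_def ok_def by blast
qed

lemma setup_runs:
  assumes "\<mu> 0 = m" "\<mu> 1 = w" "\<mu> 2 = Suc K" "\<mu> 4 = nV" "B = 5 + 4 * m + nV * K"
  shows "runs W setup_code (\<lambda>_. 0) \<mu> (csize setup_code) (\<lambda>\<rho>' \<mu>'. regs \<rho>' \<and> \<mu>' = \<mu> \<and> \<rho>' 10 = 0)"
proof (rule runs_loop_free)
  show "loop_free setup_code" by (simp add: setup_code_def)
  have b: "(2::nat) < 2 ^ W" "(4::nat) < 2 ^ W" "(5::nat) < 2 ^ W" "m * 4 < 2 ^ W" "nV * K < 2 ^ W" "m * 4 + nV * K < 2 ^ W"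
    "B < 2 ^ W" "Suc K < 2 ^ W" and e: "m * 4 + nV * K + 5 = B"
    using ZW assms(5) room Zbig by linarith+
  show "case step W setup_code (\<lambda>_. 0, \<mu>) of (\<rho>', \<mu>') \<Rightarrow> regs \<rho>' \<and> \<mu>' = \<mu> \<and> \<rho>' 10 = 0"
    using assms(1-4) b sub_one[OF b(8)] e by (simp add: setup_code_def regs_def)
qed

end

definition push_code :: com where
  "push_code = Op Mul 43 37 3 ;; Op Add 43 43 39 ;; get 44 7 43 ;;
    Cond (Eq 44 9) (mov 44 33 ;; inc 33 ;; put 7 43 44 ;; put 8 44 37 ;; put 9 44 39) Skip ;; mov 37 44"

definition stack_body :: com where
  "stack_body = (get 39 9 40 ;; Cond (Eq 39 13) (Const 38 0) Skip ;; fld 42 3 39) ;;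
    Cond (Less 10 42) push_code Skip ;; (mov 40 41 ;; get 41 8 40)"

definition pre_code :: com where
  "pre_code = (mov 37 34 ;; Const 38 1 ;; get 16 3 13 ;; Const 17 4 ;; Cond (Eq 10 8) (Const 16 4) Skip) ;;
    Cond (Less 16 17) Skip (Cond (Less 10 15) (mov 39 13 ;; push_code) Skip) ;; (mov 40 36 ;; get 41 8 40)"

definition fin_code :: com where
  "fin_code = fld 42 1 13 ;; Op Mul 43 37 6 ;; Op Add 43 43 42 ;; get 44 10 43 ;;
    Cond (Eq 44 9) (put 10 43 8 ;; put 13 32 42 ;; put 14 32 37 ;; inc 32) Skip"

definition proc_code :: com where
  "proc_code = pre_code ;; While (Less 9 41) stack_body ;; Cond (Eq 38 8) fin_code Skip"

definition arc_body :: com where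
  "arc_body = (Op Sub 13 12 8 ;; fld 14 2 13 ;; fld 15 3 13) ;;
    Cond (Less 10 14) Skip (Cond (Less 15 10) Skip proc_code) ;; get 12 6 13"

definition state_body :: com where
  "state_body = (get 11 13 31 ;; get 36 14 31 ;; inc 31 ;; get 12 0 11) ;; While (Less 9 12) arc_body"

definition time_body :: com where
  "time_body = (mov 34 33 ;; inc 33 ;; mov 35 32) ;; While (Less 31 35) state_body ;; inc 10"

definition main_code :: com where
  "main_code = (Const 10 1 ;; Const 31 0 ;; mov 32 3 ;; Const 33 2) ;;
    While (Less 10 30) time_body ;; Cond (Less 31 32) (Const 0 1) (Const 0 0)"

context prog
begin

fun path :: "(nat \<Rightarrow> nat) \<Rightarrow> nat \<Rightarrow> nat \<Rightarrow> nat list \<Rightarrow> bool" where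
  "path \<mu> R n [] \<longleftrightarrow> n = R \<and> tb \<mu> 8 n = 0"
| "path \<mu> R n (f # l) \<longleftrightarrow> tb \<mu> 8 n \<noteq> 0 \<and> tb \<mu> 9 n = f \<and> path \<mu> R (tb \<mu> 8 n) l"

definition trie :: "(nat \<Rightarrow> nat) \<Rightarrow> nat \<Rightarrow> bool" where
  "trie \<mu> N \<longleftrightarrow>
     (\<forall>p f. f < m \<longrightarrow> tb \<mu> 7 (p * m + f) \<noteq> 0 \<longrightarrow> tb \<mu> 7 (p * m + f) < N \<and> p < N \<and> p \<noteq> 0
        \<and> tb \<mu> 8 (tb \<mu> 7 (p * m + f)) = p \<and> tb \<mu> 9 (tb \<mu> 7 (p * m + f)) = f)
   \<and> (\<forall>n. tb \<mu> 8 n \<noteq> 0 \<longrightarrow> n < N \<and> n \<noteq> 0 \<and> tb \<mu> 8 n < N \<and> tb \<mu> 9 n < m \<and> tb \<mu> 7 (tb \<mu> 8 n * m + tb \<mu> 9 n) = n)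
   \<and> (\<forall>n v. N \<le> n \<longrightarrow> v < nV \<longrightarrow> tb \<mu> 10 (n * nV + v) = 0)"

lemma trieD1:
  assumes "trie \<mu> N" "f < m" "tb \<mu> 7 (p * m + f) \<noteq> 0"
  shows "tb \<mu> 7 (p * m + f) < N" "p < N" "p \<noteq> 0" "tb \<mu> 8 (tb \<mu> 7 (p * m + f)) = p" "tb \<mu> 9 (tb \<mu> 7 (p * m + f)) = f"
  using assms unfolding trie_def by blast+

lemma trieD2:
  assumes "trie \<mu> N" "tb \<mu> 8 n \<noteq> 0"
  shows "n < N" "n \<noteq> 0" "tb \<mu> 8 n < N" "tb \<mu> 9 n < m" "tb \<mu> 7 (tb \<mu> 8 n * m + tb \<mu> 9 n) = n"
  using assms unfolding trie_def by blast+

lemma trieD3: "trie \<mu> N \<Longrightarrow> N \<le> n \<Longrightarrow> v < nV \<Longrightarrow> tb \<mu> 10 (n * nV + v) = 0"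
  unfolding trie_def by blast

lemma path_node: "trie \<mu> N \<Longrightarrow> R < N \<Longrightarrow> path \<mu> R n l \<Longrightarrow> n < N"
  by (cases l) (auto dest: trieD2(1))

lemma path_inj: "trie \<mu> N \<Longrightarrow> path \<mu> R n l \<Longrightarrow> path \<mu> R n' l \<Longrightarrow> n = n'"
proof (induction l arbitrary: n n')
  case (Cons f l)
  have nz: "tb \<mu> 8 n \<noteq> 0" "tb \<mu> 8 n' \<noteq> 0" using Cons.prems by auto
  have "tb \<mu> 8 n = tb \<mu> 8 n'" using Cons by auto
  moreover have "tb \<mu> 9 n = tb \<mu> 9 n'" using Cons.prems by auto
  ultimately show ?case using trieD2(5)[OF Cons.prems(1) nz(1)] trieD2(5)[OF Cons.prems(1) nz(2)] by metis
qed simp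

lemma path_det: "path \<mu> R n l \<Longrightarrow> path \<mu> R n l' \<Longrightarrow> l = l'"
proof (induction l arbitrary: n l')
  case Nil then show ?case by (cases l') auto
next
  case (Cons f l) then show ?case by (cases l') auto
qed

definition grow :: "(nat \<Rightarrow> nat) \<Rightarrow> nat \<Rightarrow> (nat \<Rightarrow> nat) \<Rightarrow> nat \<Rightarrow> bool" where
  "grow \<mu> N \<mu>' N' \<longleftrightarrow> N \<le> N' \<and> trie \<mu> N \<and> trie \<mu>' N' \<and> input \<mu>'
     \<and> (\<forall>x<N. tb \<mu>' 8 x = tb \<mu> 8 x \<and> tb \<mu>' 9 x = tb \<mu> 9 x)
     \<and> (\<forall>j x. j < 16 \<longrightarrow> j \<noteq> 7 \<longrightarrow> j \<noteq> 8 \<longrightarrow> j \<noteq> 9 \<longrightarrow> tb \<mu>' j x = tb \<mu> j x)"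

lemma grow_refl: "trie \<mu> N \<Longrightarrow> input \<mu> \<Longrightarrow> grow \<mu> N \<mu> N" by (simp add: grow_def)

lemma grow_trans: "grow \<mu> N \<mu>' N' \<Longrightarrow> grow \<mu>' N' \<mu>'' N'' \<Longrightarrow> grow \<mu> N \<mu>'' N''"
  unfolding grow_def by simp

lemma grow_tb: "grow \<mu> N \<mu>' N' \<Longrightarrow> j < 16 \<Longrightarrow> j \<noteq> 7 \<Longrightarrow> j \<noteq> 8 \<Longrightarrow> j \<noteq> 9 \<Longrightarrow> tb \<mu>' j x = tb \<mu> j x"
  unfolding grow_def by simp

lemma grow_path_iff:
  assumes "grow \<mu> N \<mu>' N'" "n < N"
  shows "path \<mu>' R n l \<longleftrightarrow> path \<mu> R n l"
  using assms(2)
proof (induction l arbitrary: n)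
  case Nil then show ?case using assms(1) by (simp add: grow_def)
next
  case (Cons f l)
  have e: "tb \<mu>' 8 n = tb \<mu> 8 n" "tb \<mu>' 9 n = tb \<mu> 9 n" using assms(1) Cons.prems by (auto simp: grow_def)
  show ?case
  proof (cases "tb \<mu> 8 n = 0")
    case False
    have t: "trie \<mu> N" using assms(1) by (simp add: grow_def)
    show ?thesis using Cons.IH[OF trieD2(3)[OF t False]] by (simp add: e)
  qed (simp add: e)
qed

lemma pair_index:
  assumes "f < (k::nat)" "f' < k" shows "p * k + f = p' * k + f' \<longleftrightarrow> p = p' \<and> f = f'"
proof
  assume e: "p * k + f = p' * k + f'"
  have "(p * k + f) div k = p" "(p' * k + f') div k = p'" using assms by simp_all
  then have "p = p'" using e by metis
  then show "p = p' \<and> f = f'" using e by simp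
qed simp

definition cap :: "nat \<Rightarrow> bool" where "cap N \<longleftrightarrow> (N + 2) * (nV + m + 1) \<le> Z"

lemma capD:
  assumes "cap N" "n \<le> N"
  shows "f < m \<Longrightarrow> n * m + f < Z" "v < nV \<Longrightarrow> n * nV + v < Z" "n * m < Z" "n * nV < Z" "n + 2 \<le> Z"
proof -
  have z: "(n + 2) * (nV + m + 1) \<le> Z" using assms le_trans[OF mult_le_mono1] unfolding cap_def by (meson add_le_mono1)
  have e: "(n + 2) * (nV + m + 1) = n * nV + n * m + n + 2 * nV + 2 * m + 2" by (simp add: algebra_simps)
  show "f < m \<Longrightarrow> n * m + f < Z" "v < nV \<Longrightarrow> n * nV + v < Z" "n * m < Z" "n * nV < Z" "n + 2 \<le> Z"
    using z unfolding e by linarith+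
qed

lemma push_runs:
  assumes I: "regs \<rho>" "input \<mu>" "trie \<mu> (\<rho> 33)" "\<rho> 37 < \<rho> 33" "\<rho> 37 \<noteq> 0" "\<rho> 39 < m" "cap (\<rho> 33)"
  shows "runs W push_code \<rho> \<mu> (csize push_code) (\<lambda>\<rho>' \<mu>'.
     (\<forall>r. r \<notin> {33,37,43,44,46,47} \<longrightarrow> \<rho>' r = \<rho> r) \<and> grow \<mu> (\<rho> 33) \<mu>' (\<rho>' 33) \<and> \<rho>' 33 \<le> \<rho> 33 + 1
     \<and> \<rho>' 37 < \<rho>' 33 \<and> tb \<mu>' 8 (\<rho>' 37) = \<rho> 37 \<and> tb \<mu>' 9 (\<rho>' 37) = \<rho> 39)"
proof (rule runs_loop_free)
  show "loop_free push_code" by (simp add: push_code_def)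
  note R = regsD[OF I(1)]
  define N n f where "N = \<rho> 33" and "n = \<rho> 37" and "f = \<rho> 39"
  have nf: "\<rho> 33 = N" "\<rho> 37 = n" "\<rho> 39 = f" by (simp_all add: N_def n_def f_def)
  have a: "trie \<mu> N" "n < N" "n \<noteq> 0" "f < m" "cap N" using I by (simp_all add: N_def n_def f_def)
  have b: "n * m < 2 ^ W" "n * m + f < 2 ^ W" "n * m + f < Z" "N < 2 ^ W" "N + 1 < 2 ^ W" "N < Z" "n < 2 ^ W"
    using capD(1)[OF a(5) less_imp_le[OF a(2)] a(4)] capD(3)[OF a(5) less_imp_le[OF a(2)]] capD(5)[OF a(5) order_refl] a(2) ZW
    by linarith+
  define y where "y = tb \<mu> 7 (n * m + f)"
  show "case step W push_code (\<rho>, \<mu>) of (\<rho>', \<mu>') \<Rightarrow>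
     (\<forall>r. r \<notin> {33,37,43,44,46,47} \<longrightarrow> \<rho>' r = \<rho> r) \<and> grow \<mu> (\<rho> 33) \<mu>' (\<rho>' 33) \<and> \<rho>' 33 \<le> \<rho> 33 + 1
     \<and> \<rho>' 37 < \<rho>' 33 \<and> tb \<mu>' 8 (\<rho>' 37) = \<rho> 37 \<and> tb \<mu>' 9 (\<rho>' 37) = \<rho> 39"
  proof (cases "y = 0")
    case False
    then have d: "y < N" "tb \<mu> 8 y = n" "tb \<mu> 9 y = f" using trieD1[OF a(1,4), of n] by (simp_all add: y_def)
    have "y < 2 ^ W" using d b by linarith
    then show ?thesis using R nf b d False y_def[symmetric] grow_refl[OF a(1) I(2)] by (simp add: push_code_def)
  next
    case True
    have z8: "tb \<mu> 8 N = 0"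
    proof (rule ccontr)
      assume "tb \<mu> 8 N \<noteq> 0"
      then have "N < N" by (rule trieD2(1)[OF a(1)])
      then show False by simp
    qed
    define \<mu>' where "\<mu>' = st (st (st \<mu> 7 (n * m + f) N) 8 N n) 9 N f"
    have N0: "N \<noteq> 0" using a by simp
    have T7: "tb \<mu>' 7 x = (if x = n * m + f then N else tb \<mu> 7 x)" for x by (simp add: \<mu>'_def)
    have T8: "tb \<mu>' 8 x = (if x = N then n else tb \<mu> 8 x)" for x by (simp add: \<mu>'_def)
    have T9: "tb \<mu>' 9 x = (if x = N then f else tb \<mu> 9 x)" for x by (simp add: \<mu>'_def)
    have T: "tb \<mu>' j x = tb \<mu> j x" if "j < 16" "j \<noteq> 7" "j \<noteq> 8" "j \<noteq> 9" for j x using that by (simp add: \<mu>'_def)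
    have "trie \<mu>' (Suc N)"
      unfolding trie_def
    proof (intro conjI allI impI)
      fix p g assume g: "g < m" and nz: "tb \<mu>' 7 (p * m + g) \<noteq> 0"
      have "tb \<mu>' 7 (p * m + g) < Suc N \<and> p < Suc N \<and> p \<noteq> 0 \<and> tb \<mu>' 8 (tb \<mu>' 7 (p * m + g)) = p \<and> tb \<mu>' 9 (tb \<mu>' 7 (p * m + g)) = g"
      proof (cases "p = n \<and> g = f")
        case True then show ?thesis using a by (simp add: T7 T8 T9)
      next
        case False
        then have "p * m + g \<noteq> n * m + f" using pair_index[OF g a(4), of p n] by blast
        then have e: "tb \<mu>' 7 (p * m + g) = tb \<mu> 7 (p * m + g)" unfolding T7 by (rule if_not_P)
        note h = trieD1[OF a(1) g nz[unfolded e]]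
        then show ?thesis unfolding e by (simp add: T8 T9)
      qed
      then show "tb \<mu>' 7 (p * m + g) < Suc N" "p < Suc N" "p \<noteq> 0" "tb \<mu>' 8 (tb \<mu>' 7 (p * m + g)) = p" "tb \<mu>' 9 (tb \<mu>' 7 (p * m + g)) = g" by blast+
    next
      fix x assume nz: "tb \<mu>' 8 x \<noteq> 0"
      have "x < Suc N \<and> x \<noteq> 0 \<and> tb \<mu>' 8 x < Suc N \<and> tb \<mu>' 9 x < m \<and> tb \<mu>' 7 (tb \<mu>' 8 x * m + tb \<mu>' 9 x) = x"
      proof (cases "x = N")
        case True then show ?thesis using a N0 by (simp add: T7 T8 T9)
      next
        case False
        then have nz': "tb \<mu> 8 x \<noteq> 0" using nz by (simp add: T8)
        note h = trieD2[OF a(1) nz']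
        have "tb \<mu> 8 x * m + tb \<mu> 9 x \<noteq> n * m + f"
        proof
          assume "tb \<mu> 8 x * m + tb \<mu> 9 x = n * m + f"
          then have "x = y" using h(5) by (simp add: y_def)
          then show False using h(2) \<open>y = 0\<close> by simp
        qed
        then show ?thesis using h False by (simp add: T7 T8 T9)
      qed
      then show "x < Suc N" "x \<noteq> 0" "tb \<mu>' 8 x < Suc N" "tb \<mu>' 9 x < m" "tb \<mu>' 7 (tb \<mu>' 8 x * m + tb \<mu>' 9 x) = x" by blast+
    next
      fix x v assume "Suc N \<le> x" "v < nV"
      then show "tb \<mu>' 10 (x * nV + v) = 0" using trieD3[OF a(1), of x v] by (simp add: T)
    qed
    then have G: "grow \<mu> N \<mu>' (Suc N)" using a I(2) by (simp add: grow_def T8 T9 T) (simp add: \<mu>'_def)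
    show ?thesis using R nf b True y_def[symmetric] G T8[of N] T9[of N]
      by (simp add: push_code_def \<mu>'_def[symmetric])
  qed
qed

end

context prog
begin

lemma cap_mono: "cap N \<Longrightarrow> n \<le> N \<Longrightarrow> cap n"
  unfolding cap_def by (meson add_le_mono1 le_trans mult_le_mono1)

lemma cap_less: "cap N \<Longrightarrow> n \<le> N \<Longrightarrow> n < Z \<and> n + 1 < 2 ^ W"
  using capD(5)[of N n] ZW by linarith

lemma grow_trie: "grow \<mu> N \<mu>' N' \<Longrightarrow> trie \<mu>' N'" "grow \<mu> N \<mu>' N' \<Longrightarrow> input \<mu>'" "grow \<mu> N \<mu>' N' \<Longrightarrow> N \<le> N'"
  by (simp_all add: grow_def)

definition sb_first :: com where "sb_first = get 39 9 40 ;; Cond (Eq 39 13) (Const 38 0) Skip ;; fld 42 3 39"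
definition sb_last :: com where "sb_last = mov 40 41 ;; get 41 8 40"
definition sb_cost :: nat where "sb_cost = csize sb_first + (Suc (csize push_code + csize Skip) + csize sb_last)"

definition stack_inv :: "(nat \<Rightarrow> nat) \<Rightarrow> (nat \<Rightarrow> nat) \<Rightarrow> nat \<Rightarrow> nat \<Rightarrow> nat \<Rightarrow> nat list \<Rightarrow> nat list \<Rightarrow> nat \<Rightarrow> (nat \<Rightarrow> nat) \<Rightarrow> (nat \<Rightarrow> nat) \<Rightarrow> bool" where
  "stack_inv \<rho> \<mu> R0 R e l base j \<rho>' \<mu>' \<longleftrightarrow> regs \<rho>' \<and> (\<forall>r\<in>{10,13,30,31,32,34,35,36}. \<rho>' r = \<rho> r) \<and> \<rho>' 13 = e
     \<and> grow \<mu> (\<rho> 33) \<mu>' (\<rho>' 33) \<and> \<rho>' 33 \<le> \<rho> 33 + 1 + j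
     \<and> path \<mu>' R0 (\<rho>' 40) (drop j l) \<and> \<rho>' 41 = tb \<mu>' 8 (\<rho>' 40) \<and> \<rho>' 37 < \<rho>' 33 \<and> \<rho>' 37 \<noteq> 0
     \<and> path \<mu>' R (\<rho>' 37) (rev (filter (\<lambda>f. \<rho> 10 < hi f) (take j l)) @ base)
     \<and> \<rho>' 38 = (if e \<in> set (take j l) then 0 else 1)"

lemma stack_loop:
  assumes I0: "stack_inv \<rho> \<mu> R0 R e l base 0 \<rho>1 \<mu>1" and R0: "R0 < \<rho> 33" and em: "e < m"
    and c: "cap (\<rho> 33 + length l + 2)"
  shows "runs W (While (Less 9 41) stack_body) \<rho>1 \<mu>1 (Suc (length l * Suc sb_cost)) (stack_inv \<rho> \<mu> R0 R e l base (length l))"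
proof (rule runs_While_const[where I = "stack_inv \<rho> \<mu> R0 R e l base", OF I0])
  fix \<rho>' \<mu>' assume "stack_inv \<rho> \<mu> R0 R e l base (length l) \<rho>' \<mu>'"
  then show "\<not> tst (Less 9 41) \<rho>'" by (auto simp: stack_inv_def regs_def)
next
  fix j \<rho>' \<mu>' assume j: "j < length l" and J: "stack_inv \<rho> \<mu> R0 R e l base j \<rho>' \<mu>'"
  define f where "f = l ! j"
  define t where "t = \<rho> 10"
  have dr: "drop j l = f # drop (Suc j) l" using j by (simp add: f_def Cons_nth_drop_Suc)
  have tk: "take (Suc j) l = take j l @ [f]" using j by (simp add: f_def take_Suc_conv_app_nth)
  have P: "regs \<rho>'" "\<forall>r\<in>{10,13,30,31,32,34,35,36}. \<rho>' r = \<rho> r" "\<rho>' 13 = e" "grow \<mu> (\<rho> 33) \<mu>' (\<rho>' 33)" "\<rho>' 33 \<le> \<rho> 33 + 1 + j"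
    "tb \<mu>' 8 (\<rho>' 40) \<noteq> 0" "tb \<mu>' 9 (\<rho>' 40) = f" "path \<mu>' R0 (tb \<mu>' 8 (\<rho>' 40)) (drop (Suc j) l)"
    "\<rho>' 41 = tb \<mu>' 8 (\<rho>' 40)" "\<rho>' 37 < \<rho>' 33" "\<rho>' 37 \<noteq> 0"
    "path \<mu>' R (\<rho>' 37) (rev (filter (\<lambda>f. t < hi f) (take j l)) @ base)" "\<rho>' 38 = (if e \<in> set (take j l) then 0 else 1)"
    using J dr unfolding stack_inv_def t_def by auto
  note tr = grow_trie[OF P(4)]
  note T2 = trieD2[OF tr(1) P(6)]
  note R = regsD[OF P(1)]
  have fm: "f < m" using T2(4) P(7) by simp
  note inp = inputD[OF tr(2) fm]
  have c': "cap (\<rho>' 33)" "cap (\<rho>' 33 + 1)" using cap_mono[OF c] P(5) j by auto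
  have b: "\<rho>' 40 < Z" "\<rho>' 41 < Z" "\<rho>' 41 < 2 ^ W" "(1::nat) < 2 ^ W"
    using cap_less[OF c'(1) order_refl] T2(1,3) P(9) ZW by linarith+
  have r10: "\<rho>' 10 = t" using P(2) by (simp add: t_def)
  define Q1 where "Q1 \<rho>2 \<mu>2 \<longleftrightarrow> \<mu>2 = \<mu>' \<and> (\<forall>r. r \<notin> {38,39,42,46,47} \<longrightarrow> \<rho>2 r = \<rho>' r) \<and> \<rho>2 39 = f \<and> \<rho>2 42 = hi f
     \<and> \<rho>2 38 = (if e \<in> set (take (Suc j) l) then 0 else 1)" for \<rho>2 \<mu>2 :: "nat \<Rightarrow> nat"
  define Q2 where "Q2 \<rho>2 \<mu>2 \<longleftrightarrow> regs \<rho>2 \<and> (\<forall>r\<in>{10,13,30,31,32,34,35,36}. \<rho>2 r = \<rho> r) \<and> \<rho>2 13 = e \<and> \<rho>2 41 = \<rho>' 41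
     \<and> grow \<mu>' (\<rho>' 33) \<mu>2 (\<rho>2 33) \<and> \<rho>2 33 \<le> \<rho>' 33 + 1 \<and> \<rho>2 37 < \<rho>2 33 \<and> \<rho>2 37 \<noteq> 0
     \<and> path \<mu>2 R (\<rho>2 37) (rev (filter (\<lambda>f. t < hi f) (take (Suc j) l)) @ base)
     \<and> \<rho>2 38 = (if e \<in> set (take (Suc j) l) then 0 else 1)" for \<rho>2 \<mu>2 :: "nat \<Rightarrow> nat"
  have s1: "runs W sb_first \<rho>' \<mu>' (csize sb_first) Q1"
  proof (rule runs_loop_free)
    show "loop_free sb_first" by (simp add: sb_first_def)
    have m8: "\<rho>' 13 = e" by (rule P(3))
    show "case step W sb_first (\<rho>', \<mu>') of (\<rho>2, \<mu>2) \<Rightarrow> Q1 \<rho>2 \<mu>2"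
    proof (cases "f = e")
      case True then show ?thesis using R b P fm inp by (simp add: sb_first_def Q1_def tk)
    next
      case False then show ?thesis using R b P fm inp by (simp add: sb_first_def Q1_def tk)
    qed
  qed
  have s2: "runs W (Cond (Less 10 42) push_code Skip) \<rho>2 \<mu>2 (Suc (csize push_code + csize Skip)) Q2" if q: "Q1 \<rho>2 \<mu>2" for \<rho>2 \<mu>2
  proof (rule runs_Cond)
    have e: "\<mu>2 = \<mu>'" "\<rho>2 39 = f" "\<rho>2 42 = hi f" "\<rho>2 38 = (if e \<in> set (take (Suc j) l) then 0 else 1)"
      "\<And>r. r \<notin> {38,39,42,46,47} \<Longrightarrow> \<rho>2 r = \<rho>' r" using q unfolding Q1_def by blast+
    have r: "\<rho>2 33 = \<rho>' 33" "\<rho>2 37 = \<rho>' 37" "\<rho>2 10 = t" "\<rho>2 41 = \<rho>' 41" "\<rho>2 13 = e" using e(5) r10 P(3) by auto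
    have rg: "regs \<rho>2" using P(1) e(5) by (auto simp: regs_def)
    have k: "\<forall>r\<in>{10,13,30,31,32,34,35,36}. \<rho>2 r = \<rho> r" using P(2) e(5) by auto
    {
      assume "tst (Less 10 42) \<rho>2"
      then have live: "t < hi f" using e r by simp
      show "runs W push_code \<rho>2 \<mu>2 (csize push_code + csize Skip) Q2"
      proof (rule runs_mono[OF push_runs])
        show "regs \<rho>2" by (rule rg)
        show "input \<mu>2" "trie \<mu>2 (\<rho>2 33)" "\<rho>2 37 < \<rho>2 33" "\<rho>2 37 \<noteq> 0" "\<rho>2 39 < m" "cap (\<rho>2 33)"
          using tr P(10,11) fm c' by (simp_all add: e r)
        fix \<rho>3 \<mu>3 assume a: "(\<forall>r. r \<notin> {33,37,43,44,46,47} \<longrightarrow> \<rho>3 r = \<rho>2 r) \<and> grow \<mu>2 (\<rho>2 33) \<mu>3 (\<rho>3 33) \<and> \<rho>3 33 \<le> \<rho>2 33 + 1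
          \<and> \<rho>3 37 < \<rho>3 33 \<and> tb \<mu>3 8 (\<rho>3 37) = \<rho>2 37 \<and> tb \<mu>3 9 (\<rho>3 37) = \<rho>2 39"
        have a': "\<And>r. r \<notin> {33,37,43,44,46,47} \<Longrightarrow> \<rho>3 r = \<rho>2 r" "grow \<mu>' (\<rho>' 33) \<mu>3 (\<rho>3 33)" "\<rho>3 33 \<le> \<rho>' 33 + 1"
          "\<rho>3 37 < \<rho>3 33" "tb \<mu>3 8 (\<rho>3 37) = \<rho>' 37" "tb \<mu>3 9 (\<rho>3 37) = f" using a e r by auto
        have nz: "tb \<mu>3 8 (\<rho>3 37) \<noteq> 0" using a'(5) P(11) by simp
        have "\<rho>3 37 \<noteq> 0" by (rule trieD2(2)[OF grow_trie(1)[OF a'(2)] nz])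
        moreover have "path \<mu>3 R (\<rho>' 37) (rev (filter (\<lambda>f. t < hi f) (take j l)) @ base)"
          using grow_path_iff[OF a'(2) P(10)] P(12) by simp
        then have "path \<mu>3 R (\<rho>3 37) (rev (filter (\<lambda>f. t < hi f) (take (Suc j) l)) @ base)"
          using nz a'(5,6) live by (simp add: tk)
        moreover have "regs \<rho>3" using rg a'(1) by (auto simp: regs_def)
        moreover have "\<forall>r\<in>{10,13,30,31,32,34,35,36}. \<rho>3 r = \<rho> r" using k a'(1) by auto
        ultimately show "Q2 \<rho>3 \<mu>3" unfolding Q2_def using a' e(4) r(4,5) by simp
      qed simp
    next
      assume "\<not> tst (Less 10 42) \<rho>2"
      then have dead: "\<not> t < hi f" using e r by simp
      have "Q2 \<rho>2 \<mu>2" unfolding Q2_def using rg k r e(1,4) grow_refl[OF tr(1,2)] P(10-12) dead by (simp add: tk)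
      then have "runs W Skip \<rho>2 \<mu>2 (csize Skip) Q2" by (intro runs_loop_free) auto
      then show "runs W Skip \<rho>2 \<mu>2 (csize push_code + csize Skip) Q2" by (rule runs_mono) auto
    }
  qed
  have s3: "runs W sb_last \<rho>2 \<mu>2 (csize sb_last) (stack_inv \<rho> \<mu> R0 R e l base (Suc j))" if q: "Q2 \<rho>2 \<mu>2" for \<rho>2 \<mu>2
  proof (rule runs_loop_free)
    show "loop_free sb_last" by (simp add: sb_last_def)
    have e: "regs \<rho>2" "\<forall>r\<in>{10,13,30,31,32,34,35,36}. \<rho>2 r = \<rho> r" "\<rho>2 13 = e" "\<rho>2 41 = \<rho>' 41"
      "grow \<mu>' (\<rho>' 33) \<mu>2 (\<rho>2 33)" "\<rho>2 33 \<le> \<rho>' 33 + 1" "\<rho>2 37 < \<rho>2 33" "\<rho>2 37 \<noteq> 0"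
      "path \<mu>2 R (\<rho>2 37) (rev (filter (\<lambda>f. t < hi f) (take (Suc j) l)) @ base)"
      "\<rho>2 38 = (if e \<in> set (take (Suc j) l) then 0 else 1)"
      using q unfolding Q2_def by blast+
    have g: "grow \<mu> (\<rho> 33) \<mu>2 (\<rho>2 33)" by (rule grow_trans[OF P(4) e(5)])
    have p: "path \<mu>2 R0 (\<rho>' 41) (drop (Suc j) l)"
      using grow_path_iff[OF e(5), of "\<rho>' 41"] T2(3) P(8,9) by simp
    show "case step W sb_last (\<rho>2, \<mu>2) of (\<rho>3, \<mu>3) \<Rightarrow> stack_inv \<rho> \<mu> R0 R e l base (Suc j) \<rho>3 \<mu>3"
      using regsD[OF e(1)] b e g p P(5) by (simp add: sb_last_def stack_inv_def t_def)
  qed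
  have "runs W stack_body \<rho>' \<mu>' sb_cost (stack_inv \<rho> \<mu> R0 R e l base (Suc j))"
    unfolding stack_body_def sb_cost_def sb_first_def[symmetric] sb_last_def[symmetric]
    by (rule runs_Seq[OF s1]) (rule runs_Seq[OF s2 s3])
  moreover have "tst (Less 9 41) \<rho>'" using R P(6,9) by simp
  ultimately show "tst (Less 9 41) \<rho>' \<and> runs W stack_body \<rho>' \<mu>' sb_cost (stack_inv \<rho> \<mu> R0 R e l base (Suc j))" by blast
qed

definition pc_first :: com where
  "pc_first = mov 37 34 ;; Const 38 1 ;; get 16 3 13 ;; Const 17 4 ;; Cond (Eq 10 8) (Const 16 4) Skip"
definition pc_last :: com where "pc_last = mov 40 36 ;; get 41 8 40"
definition pc_cost :: nat where
  "pc_cost = csize pc_first + (Suc (Suc (csize (mov 39 13) + csize push_code + csize Skip)) + csize pc_last)"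

lemma pre_runs:
  assumes I: "regs \<rho>" "input \<mu>" "trie \<mu> (\<rho> 33)" "\<rho> 34 = R" "R < \<rho> 33" "R \<noteq> 0" "tb \<mu> 8 R = 0" "\<rho> 36 < \<rho> 33"
    "path \<mu> R0 (\<rho> 36) l" "R0 < \<rho> 33" "\<rho> 13 = e" "e < m" "\<rho> 15 = hi e" "\<forall>e<m. 4 \<le> tb \<mu> 3 e \<longleftrightarrow> crit e" "cap (\<rho> 33 + 1)"
  shows "runs W pre_code \<rho> \<mu> pc_cost (stack_inv \<rho> \<mu> R0 R e l (if (crit e \<or> \<rho> 10 = 1) \<and> \<rho> 10 < hi e then [e] else []) 0)"
proof -
  note R = regsD[OF I(1)]
  define t where "t = \<rho> 10"
  define base where "base = (if (crit e \<or> t = 1) \<and> t < hi e then [e] else [])"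
  have b: "R < 2 ^ W" "e < Z" "e < 2 ^ W" "\<rho> 36 < Z" "\<rho> 36 < 2 ^ W" "(4::nat) < 2 ^ W"
    using cap_less[OF I(15), of "\<rho> 33"] I(5,8,12) Zbig ZW by linarith+
  define Q1 where "Q1 \<rho>2 \<mu>2 \<longleftrightarrow> \<mu>2 = \<mu> \<and> (\<forall>r. r \<notin> {16,17,37,38,46,47} \<longrightarrow> \<rho>2 r = \<rho> r) \<and> \<rho>2 37 = R \<and> \<rho>2 38 = 1
     \<and> \<rho>2 17 = 4 \<and> (4 \<le> \<rho>2 16 \<longleftrightarrow> crit e \<or> t = 1)" for \<rho>2 \<mu>2 :: "nat \<Rightarrow> nat"
  define Q2 where "Q2 \<rho>2 \<mu>2 \<longleftrightarrow> regs \<rho>2 \<and> (\<forall>r\<in>{10,13,30,31,32,34,35,36}. \<rho>2 r = \<rho> r) \<and> grow \<mu> (\<rho> 33) \<mu>2 (\<rho>2 33)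
     \<and> \<rho>2 33 \<le> \<rho> 33 + 1 \<and> \<rho>2 37 < \<rho>2 33 \<and> \<rho>2 37 \<noteq> 0 \<and> path \<mu>2 R (\<rho>2 37) base \<and> \<rho>2 38 = 1" for \<rho>2 \<mu>2 :: "nat \<Rightarrow> nat"
  have s1: "runs W pc_first \<rho> \<mu> (csize pc_first) Q1"
  proof (rule runs_loop_free)
    show "loop_free pc_first" by (simp add: pc_first_def)
    have c: "4 \<le> tb \<mu> 3 e \<longleftrightarrow> crit e" using I by blast
    show "case step W pc_first (\<rho>, \<mu>) of (\<rho>2, \<mu>2) \<Rightarrow> Q1 \<rho>2 \<mu>2"
    proof (cases "t = 1")
      case True then show ?thesis using R b I c by (simp add: pc_first_def Q1_def t_def)
    next
      case False then show ?thesis using R b I c by (simp add: pc_first_def Q1_def t_def)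
    qed
  qed
  have s2: "runs W (Cond (Less 16 17) Skip (Cond (Less 10 15) (mov 39 13 ;; push_code) Skip)) \<rho>2 \<mu>2
      (Suc (Suc (csize (mov 39 13) + csize push_code + csize Skip))) Q2" if q: "Q1 \<rho>2 \<mu>2" for \<rho>2 \<mu>2
  proof -
    have e: "\<mu>2 = \<mu>" "\<rho>2 37 = R" "\<rho>2 38 = 1" "\<rho>2 17 = 4" "4 \<le> \<rho>2 16 \<longleftrightarrow> crit e \<or> t = 1"
      "\<And>r. r \<notin> {16,17,37,38,46,47} \<Longrightarrow> \<rho>2 r = \<rho> r" using q unfolding Q1_def by blast+
    have r: "\<rho>2 33 = \<rho> 33" "\<rho>2 10 = t" "\<rho>2 13 = e" "\<rho>2 15 = hi e" using e(6) I by (auto simp: t_def)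
    have rg: "regs \<rho>2" using I(1) e(6) by (auto simp: regs_def)
    have k: "\<forall>r\<in>{10,13,30,31,32,34,35,36}. \<rho>2 r = \<rho> r" using e(6) by auto
    have skip: "runs W Skip \<rho>2 \<mu>2 T Q2" if "base = []" "1 \<le> T" for T
    proof -
      have "Q2 \<rho>2 \<mu>2" unfolding Q2_def using rg k e(1-3) r that(1) grow_refl[OF I(3,2)] I(5,6,7) by simp
      then have "runs W Skip \<rho>2 \<mu>2 (csize Skip) Q2" by (intro runs_loop_free) auto
      then show ?thesis by (rule runs_mono) (use that in auto)
    qed
    show ?thesis
    proof (rule runs_Cond)
      assume "tst (Less 16 17) \<rho>2"
      then have "base = []" using e by (simp add: base_def)
      then show "runs W Skip \<rho>2 \<mu>2 (Suc (csize (mov 39 13) + csize push_code + csize Skip)) Q2" by (rule skip) simp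
    next
      assume "\<not> tst (Less 16 17) \<rho>2"
      then have ce: "crit e \<or> t = 1" using e by simp
      show "runs W (Cond (Less 10 15) (mov 39 13 ;; push_code) Skip) \<rho>2 \<mu>2 (Suc (csize (mov 39 13) + csize push_code + csize Skip)) Q2"
      proof (rule runs_Cond)
        assume "\<not> tst (Less 10 15) \<rho>2"
        then have "base = []" using r by (simp add: base_def)
        then show "runs W Skip \<rho>2 \<mu>2 (csize (mov 39 13) + csize push_code + csize Skip) Q2" by (rule skip) simp
      next
        assume "tst (Less 10 15) \<rho>2"
        then have be: "base = [e]" using r ce by (simp add: base_def)
        have "runs W (mov 39 13 ;; push_code) \<rho>2 \<mu>2 (csize (mov 39 13) + csize push_code) Q2"
        proof (rule runs_Seq[where R = "\<lambda>\<rho>3 \<mu>3. \<mu>3 = \<mu> \<and> \<rho>3 = \<rho>2(39 := e)"])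
          show "runs W (mov 39 13) \<rho>2 \<mu>2 (csize (mov 39 13)) (\<lambda>\<rho>3 \<mu>3. \<mu>3 = \<mu> \<and> \<rho>3 = \<rho>2(39 := e))"
            by (rule runs_loop_free) (use regsD[OF rg] r b e in simp_all)
          fix \<rho>3 \<mu>3 assume q3: "\<mu>3 = \<mu> \<and> \<rho>3 = \<rho>2(39 := e)"
          show "runs W push_code \<rho>3 \<mu>3 (csize push_code) Q2"
          proof (rule runs_mono[OF push_runs])
            show "regs \<rho>3" "input \<mu>3" "trie \<mu>3 (\<rho>3 33)" "\<rho>3 37 < \<rho>3 33" "\<rho>3 37 \<noteq> 0" "\<rho>3 39 < m" "cap (\<rho>3 33)"
              using q3 rg I r e cap_mono[OF I(15), of "\<rho> 33"] by simp_all
            fix \<rho>4 \<mu>4 assume a: "(\<forall>r. r \<notin> {33,37,43,44,46,47} \<longrightarrow> \<rho>4 r = \<rho>3 r) \<and> grow \<mu>3 (\<rho>3 33) \<mu>4 (\<rho>4 33) \<and> \<rho>4 33 \<le> \<rho>3 33 + 1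
              \<and> \<rho>4 37 < \<rho>4 33 \<and> tb \<mu>4 8 (\<rho>4 37) = \<rho>3 37 \<and> tb \<mu>4 9 (\<rho>4 37) = \<rho>3 39"
            have a': "\<And>r. r \<notin> {33,37,43,44,46,47} \<Longrightarrow> \<rho>4 r = \<rho>3 r" "grow \<mu> (\<rho> 33) \<mu>4 (\<rho>4 33)" "\<rho>4 33 \<le> \<rho> 33 + 1"
              "\<rho>4 37 < \<rho>4 33" "tb \<mu>4 8 (\<rho>4 37) = R" "tb \<mu>4 9 (\<rho>4 37) = e" using a q3 r e by auto
            have a1: "\<rho>4 r = \<rho>2 r" if "r \<notin> {33,37,39,43,44,46,47}" for r using a'(1)[of r] q3 that by simp
            have nz: "tb \<mu>4 8 (\<rho>4 37) \<noteq> 0" using a'(5) I(6) by simp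
            have "\<rho>4 37 \<noteq> 0" by (rule trieD2(2)[OF grow_trie(1)[OF a'(2)] nz])
            moreover have "path \<mu>4 R R []" using grow_path_iff[OF a'(2) I(5), of R "[]"] I(7) by simp
            then have "path \<mu>4 R (\<rho>4 37) base" using nz a'(5,6) unfolding be by simp
            moreover have "regs \<rho>4" using rg a1 by (auto simp: regs_def)
            moreover have "\<forall>r\<in>{10,13,30,31,32,34,35,36}. \<rho>4 r = \<rho> r" using k a1 by auto
            ultimately show "Q2 \<rho>4 \<mu>4" unfolding Q2_def using a' a1[of 38] e(3) by simp
          qed simp
        qed
        then show "runs W (mov 39 13 ;; push_code) \<rho>2 \<mu>2 (csize (mov 39 13) + csize push_code + csize Skip) Q2"
          by (rule runs_mono) auto
      qed
    qed
  qed
  have s3: "runs W pc_last \<rho>2 \<mu>2 (csize pc_last) (stack_inv \<rho> \<mu> R0 R e l base 0)" if q: "Q2 \<rho>2 \<mu>2" for \<rho>2 \<mu>2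
  proof (rule runs_loop_free)
    show "loop_free pc_last" by (simp add: pc_last_def)
    have e: "regs \<rho>2" "\<forall>r\<in>{10,13,30,31,32,34,35,36}. \<rho>2 r = \<rho> r"
      "grow \<mu> (\<rho> 33) \<mu>2 (\<rho>2 33)" "\<rho>2 33 \<le> \<rho> 33 + 1" "\<rho>2 37 < \<rho>2 33" "\<rho>2 37 \<noteq> 0"
      "path \<mu>2 R (\<rho>2 37) base" "\<rho>2 38 = 1"
      using q unfolding Q2_def by blast+
    have p: "path \<mu>2 R0 (\<rho> 36) l" using grow_path_iff[OF e(3) I(8)] I(9) by simp
    show "case step W pc_last (\<rho>2, \<mu>2) of (\<rho>3, \<mu>3) \<Rightarrow> stack_inv \<rho> \<mu> R0 R e l base 0 \<rho>3 \<mu>3"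
      using regsD[OF e(1)] b e p I(11) by (simp add: pc_last_def stack_inv_def)
  qed
  show ?thesis
    unfolding pre_code_def pc_cost_def pc_first_def[symmetric] pc_last_def[symmetric] base_def[symmetric] t_def[symmetric]
    by (rule runs_Seq[OF s1]) (rule runs_Seq[OF s2 s3])
qed

end

locale run = prog W B Z m w src dst lo hi K nV dg
  for W B Z m w :: nat and src dst lo hi :: "nat \<Rightarrow> nat" and K nV dg :: nat +
  fixes nmax ll :: nat
  assumes card_St: "\<And>t. 1 \<le> t \<Longrightarrow> t \<le> m \<Longrightarrow> card (St t) \<le> nmax"
    and length_St: "\<And>t v l. (v, l) \<in> St t \<Longrightarrow> t \<le> m \<Longrightarrow> length l \<le> ll"
    and capN: "cap (6 + m + ll + (m + m * nmax) * (dg * (ll + 1)))"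
    and capQ: "m + m * nmax + 1 < Z"
begin

definition core :: "(nat \<Rightarrow> nat) \<Rightarrow> bool" where
  "core \<mu> \<longleftrightarrow> (\<forall>v<nV. linked \<mu> (tb \<mu> 0 v) (outs m v)) \<and> (\<forall>e<m. 4 \<le> tb \<mu> 3 e \<longleftrightarrow> crit e)"

definition front :: "(nat \<Rightarrow> nat) \<Rightarrow> nat \<Rightarrow> nat \<Rightarrow> (nat \<times> nat list) list \<Rightarrow> bool" where
  "front \<mu> R q ss \<longleftrightarrow> (\<forall>j<length ss. tb \<mu> 13 (q + j) = fst (ss ! j) \<and> path \<mu> R (tb \<mu> 14 (q + j)) (snd (ss ! j)))"

definition seen :: "(nat \<Rightarrow> nat) \<Rightarrow> nat \<Rightarrow> (nat \<times> nat list) set \<Rightarrow> bool" where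
  "seen \<mu> R X \<longleftrightarrow> (\<forall>n v l. v < nV \<longrightarrow> path \<mu> R n l \<longrightarrow> (tb \<mu> 10 (n * nV + v) \<noteq> 0 \<longleftrightarrow> (v, l) \<in> X))"

lemma core_grow: "grow \<mu> N \<mu>' N' \<Longrightarrow> core \<mu> \<Longrightarrow> core \<mu>'"
proof -
  assume g: "grow \<mu> N \<mu>' N'" and c: "core \<mu>"
  have "linked \<mu>' a l = linked \<mu> a l" for a l by (rule linked_cong) (rule grow_tb[OF g], auto)
  then show "core \<mu>'" using c grow_tb[OF g] by (simp add: core_def)
qed

lemma front_grow: "grow \<mu> N \<mu>' N' \<Longrightarrow> R < N \<Longrightarrow> front \<mu> R q ss \<Longrightarrow> front \<mu>' R q ss"
proof -
  assume g: "grow \<mu> N \<mu>' N'" and R: "R < N" and f: "front \<mu> R q ss"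
  have tr: "trie \<mu> N" using g by (simp add: grow_def)
  show "front \<mu>' R q ss" unfolding front_def
  proof (intro allI impI)
    fix j assume "j < length ss"
    then have a: "tb \<mu> 13 (q + j) = fst (ss ! j)" "path \<mu> R (tb \<mu> 14 (q + j)) (snd (ss ! j))" using f by (auto simp: front_def)
    then show "tb \<mu>' 13 (q + j) = fst (ss ! j) \<and> path \<mu>' R (tb \<mu>' 14 (q + j)) (snd (ss ! j))"
      using grow_path_iff[OF g path_node[OF tr R a(2)]] grow_tb[OF g] by simp
  qed
qed

lemma seen_grow:
  assumes g: "grow \<mu> N \<mu>' N'" and R: "R < N" and f: "front \<mu> R q ss" and s: "seen \<mu> R (set ss)"
  shows "seen \<mu>' R (set ss)"
  unfolding seen_def
proof (intro allI impI)
  fix n v l assume v: "v < nV" and p: "path \<mu>' R n l"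
  have tr: "trie \<mu> N" "trie \<mu>' N'" using g by (auto simp: grow_def)
  have t10: "tb \<mu>' 10 (n * nV + v) = tb \<mu> 10 (n * nV + v)" by (rule grow_tb[OF g]) auto
  show "tb \<mu>' 10 (n * nV + v) \<noteq> 0 \<longleftrightarrow> (v, l) \<in> set ss"
  proof (cases "n < N")
    case True
    then show ?thesis using s v p grow_path_iff[OF g True] t10 by (simp add: seen_def)
  next
    case False
    have "(v, l) \<notin> set ss"
    proof
      assume "(v, l) \<in> set ss"
      then obtain j where j: "j < length ss" "ss ! j = (v, l)" by (auto simp: in_set_conv_nth)
      then have q: "path \<mu> R (tb \<mu> 14 (q + j)) l" using f by (auto simp: front_def)
      have lt: "tb \<mu> 14 (q + j) < N" by (rule path_node[OF tr(1) R q])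
      have "n = tb \<mu> 14 (q + j)" by (rule path_inj[OF tr(2) p]) (use grow_path_iff[OF g lt] q in simp)
      then show False using lt False by simp
    qed
    then show ?thesis using trieD3[OF tr(1), of n v] False v t10 by simp
  qed
qed

definition MI :: "nat \<Rightarrow> nat \<Rightarrow> nat \<Rightarrow> nat \<Rightarrow> (nat \<times> nat list) list \<Rightarrow> (nat \<times> nat list) list \<Rightarrow> (nat \<Rightarrow> nat) \<Rightarrow> (nat \<Rightarrow> nat) \<Rightarrow> bool" where
  "MI t R0 R q cur acc \<rho> \<mu> \<longleftrightarrow> regs \<rho> \<and> input \<mu> \<and> trie \<mu> (\<rho> 33) \<and> core \<mu> \<and> \<rho> 10 = t \<and> \<rho> 30 = Suc m \<and> \<rho> 34 = R
     \<and> R < \<rho> 33 \<and> R \<noteq> 0 \<and> tb \<mu> 8 R = 0 \<and> R0 < \<rho> 33 \<and> front \<mu> R0 q cur \<and> \<rho> 35 = q + length cur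
     \<and> \<rho> 32 = q + length cur + length acc \<and> front \<mu> R (q + length cur) acc \<and> seen \<mu> R (set acc) \<and> distinct acc
     \<and> set acc \<subseteq> St t"

lemma acc_length:
  assumes "MI t R0 R q cur acc \<rho> \<mu>" "1 \<le> t" "t \<le> m"
  shows "length acc \<le> nmax"
proof -
  have "length acc = card (set acc)" using assms(1) by (simp add: MI_def distinct_card)
  also have "\<dots> \<le> card (St t)" by (rule card_mono[OF finite_St]) (use assms(1) in \<open>simp add: MI_def\<close>)
  also have "\<dots> \<le> nmax" by (rule card_St[OF assms(2,3)])
  finally show ?thesis .
qed

lemma fin_runs:
  assumes M: "MI t R0 R q cur acc \<rho> \<mu>" and e: "\<rho> 13 = e" "e < m" and n: "\<rho> 37 < \<rho> 33" "path \<mu> R (\<rho> 37) L"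
    and St: "(dst e, L) \<in> St t" and c: "cap (\<rho> 33)" and Q: "\<rho> 32 + 1 < Z"
  shows "runs W fin_code \<rho> \<mu> (csize fin_code) (\<lambda>\<rho>' \<mu>'. (\<exists>acc'. MI t R0 R q cur acc' \<rho>' \<mu>' \<and> set acc' = insert (dst e, L) (set acc))
      \<and> \<rho>' 33 = \<rho> 33 \<and> \<rho>' 31 = \<rho> 31 \<and> \<rho>' 36 = \<rho> 36 \<and> \<rho>' 13 = \<rho> 13 \<and> (\<forall>x l'. path \<mu>' R0 x l' = path \<mu> R0 x l'))"
  (is "runs _ _ _ _ _ ?Q")
proof (rule runs_loop_free)
  show "loop_free fin_code" by (simp add: fin_code_def)
  have P: "regs \<rho>" "input \<mu>" "trie \<mu> (\<rho> 33)" "core \<mu>" "\<rho> 10 = t" "\<rho> 30 = Suc m" "\<rho> 34 = R"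
     "R < \<rho> 33" "R \<noteq> 0" "tb \<mu> 8 R = 0" "R0 < \<rho> 33" "front \<mu> R0 q cur" "\<rho> 35 = q + length cur"
     "\<rho> 32 = q + length cur + length acc" "front \<mu> R (q + length cur) acc" "seen \<mu> R (set acc)" "distinct acc" "set acc \<subseteq> St t"
    using M unfolding MI_def by blast+
  note Rg = regsD[OF P(1)] and inp = inputD[OF P(2) e(2)]
  define n where "n = \<rho> 37"
  define v where "v = dst e"
  define qe where "qe = \<rho> 32"
  have v: "v < nV" using dstV[OF e(2)] by (simp add: v_def)
  have nN: "n < \<rho> 33" and pn: "path \<mu> R n L" using n by (simp_all add: n_def)
  have b: "n * nV < 2 ^ W" "n * nV + v < 2 ^ W" "n * nV + v < Z" "qe < Z" "qe + 1 < 2 ^ W" "(1::nat) < 2 ^ W"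
    using capD(2)[OF c less_imp_le[OF nN] v] Q ZW unfolding qe_def by linarith+
  have rr: "\<rho> 37 = n" "\<rho> 32 = qe" "dst e = v" by (simp_all add: n_def qe_def v_def)
  define Post where "Post = ?Q"
  have "case step W fin_code (\<rho>, \<mu>) of (\<rho>', \<mu>') \<Rightarrow> Post \<rho>' \<mu>'"
  proof (cases "tb \<mu> 10 (n * nV + v) = 0")
    case False
    then have "(v, L) \<in> set acc" using P(16) v pn unfolding seen_def by blast
    then have i: "insert (v, L) (set acc) = set acc" by blast
    have M': "MI t R0 R q cur acc \<rho>' \<mu>" if "regs \<rho>'" "\<forall>r\<in>{10,13,30,31,32,33,34,35,36}. \<rho>' r = \<rho> r" for \<rho>'
      unfolding MI_def using that P by simp
    have "Post \<rho>' \<mu>" if "regs \<rho>'" "\<forall>r\<in>{10,13,30,31,32,33,34,35,36}. \<rho>' r = \<rho> r" for \<rho>'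
      unfolding Post_def using M'[OF that] i[folded v_def] that(2) by (auto simp: v_def)
    then show ?thesis using Rg b inp e rr False P(1) by (simp add: fin_code_def)
  next
    case True
    then have new: "(v, L) \<notin> set acc" using P(16) v pn unfolding seen_def by blast
    define \<mu>' where "\<mu>' = st (st (st \<mu> 10 (n * nV + v) 1) 13 qe v) 14 qe n"
    have T10: "tb \<mu>' 10 x = (if x = n * nV + v then 1 else tb \<mu> 10 x)" for x by (simp add: \<mu>'_def)
    have T13: "tb \<mu>' 13 x = (if x = qe then v else tb \<mu> 13 x)" for x by (simp add: \<mu>'_def)
    have T14: "tb \<mu>' 14 x = (if x = qe then n else tb \<mu> 14 x)" for x by (simp add: \<mu>'_def)
    have T: "tb \<mu>' j x = tb \<mu> j x" if "j < 16" "j \<noteq> 10" "j \<noteq> 13" "j \<noteq> 14" for j x using that by (simp add: \<mu>'_def)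
    have pth: "path \<mu>' r x l = path \<mu> r x l" for r x l by (induction l arbitrary: x) (simp_all add: T)
    have lk: "linked \<mu>' a l = linked \<mu> a l" for a l by (rule linked_cong) (simp add: T)
    have T789: "tb \<mu>' 7 x = tb \<mu> 7 x" "tb \<mu>' 8 x = tb \<mu> 8 x" "tb \<mu>' 9 x = tb \<mu> 9 x" for x by (simp_all add: T)
    have z10: "tb \<mu>' 10 (x * nV + u) = 0" if x: "\<rho> 33 \<le> x" "u < nV" for x u
    proof -
      have "x \<noteq> n" using nN x(1) by linarith
      then have "x * nV + u \<noteq> n * nV + v" using pair_index[OF x(2) v, of x n] by blast
      then show ?thesis using trieD3[OF P(3) x] by (simp add: T10)
    qed
    have tr: "trie \<mu>' (\<rho> 33)" using P(3) z10 unfolding trie_def T789 by blast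
    have co: "core \<mu>'" using P(4) by (simp add: core_def lk T)
    have f0: "front \<mu>' R0 q cur" using P(12,14) by (simp add: front_def T13 T14 pth qe_def)
    have f1: "front \<mu>' R (q + length cur) (acc @ [(v, L)])"
      using P(15,14) pn unfolding front_def by (auto simp: T13 T14 pth qe_def nth_append less_Suc_eq)
    have sn: "seen \<mu>' R (set (acc @ [(v, L)]))"
      unfolding seen_def
    proof (intro allI impI)
      fix n' v' l' assume v': "v' < nV" and p': "path \<mu>' R n' l'"
      have p: "path \<mu> R n' l'" using p' by (simp add: pth)
      show "tb \<mu>' 10 (n' * nV + v') \<noteq> 0 \<longleftrightarrow> (v', l') \<in> set (acc @ [(v, L)])"
      proof (cases "n' = n \<and> v' = v")
        case True
        then have "l' = L" using path_det[OF p] pn by simp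
        then show ?thesis using True by (simp add: T10)
      next
        case False
        then have "n' * nV + v' \<noteq> n * nV + v" using pair_index[OF v' v, of n' n] by blast
        moreover have "(v', l') \<noteq> (v, L)" using False path_inj[OF P(3) p, of n] pn by blast
        ultimately show ?thesis using P(16) v' p unfolding seen_def by (auto simp: T10)
      qed
    qed
    have inp': "input \<mu>'" using P(2) by (simp add: \<mu>'_def)
    have M': "MI t R0 R q cur (acc @ [(v, L)]) \<rho>' \<mu>'" if "regs \<rho>'" "\<forall>r\<in>{10,13,30,31,33,34,35,36}. \<rho>' r = \<rho> r" "\<rho>' 32 = Suc qe" for \<rho>'
      unfolding MI_def using that P inp' tr co f0 f1 sn new St by (simp add: T v_def qe_def)
    have "Post \<rho>' \<mu>'" if "regs \<rho>'" "\<forall>r\<in>{10,13,30,31,33,34,35,36}. \<rho>' r = \<rho> r" "\<rho>' 32 = Suc qe" for \<rho>'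
      unfolding Post_def using M'[OF that] that(2) pth by (intro conjI exI[of _ "acc @ [(v, L)]"]) (simp_all add: v_def)
    then show ?thesis using Rg b inp e rr True P(1) unfolding \<mu>'_def by (simp add: fin_code_def)
  qed
  then show "case step W fin_code (\<rho>, \<mu>) of (\<rho>', \<mu>') \<Rightarrow> ?Q \<rho>' \<mu>'" unfolding Post_def .
qed

lemma MI_grow:
  assumes M: "MI t R0 R q cur acc \<rho> \<mu>" and g: "grow \<mu> (\<rho> 33) \<mu>' (\<rho>' 33)" and r: "regs \<rho>'"
    and k: "\<And>r. r \<in> {10,30,32,34,35} \<Longrightarrow> \<rho>' r = \<rho> r"
  shows "MI t R0 R q cur acc \<rho>' \<mu>'"
proof -
  have P: "regs \<rho>" "input \<mu>" "trie \<mu> (\<rho> 33)" "core \<mu>" "\<rho> 10 = t" "\<rho> 30 = Suc m" "\<rho> 34 = R"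
     "R < \<rho> 33" "R \<noteq> 0" "tb \<mu> 8 R = 0" "R0 < \<rho> 33" "front \<mu> R0 q cur" "\<rho> 35 = q + length cur"
     "\<rho> 32 = q + length cur + length acc" "front \<mu> R (q + length cur) acc" "seen \<mu> R (set acc)" "distinct acc" "set acc \<subseteq> St t"
    using M unfolding MI_def by blast+
  have "tb \<mu>' 8 R = 0" using g P(8,10) by (simp add: grow_def)
  moreover have "\<rho> 33 \<le> \<rho>' 33" using grow_trie(3)[OF g] .
  ultimately show ?thesis unfolding MI_def
    using P(5-9,11,13,14,17,18) r k grow_trie(1,2)[OF g] core_grow[OF g P(4)] front_grow[OF g P(11,12)] front_grow[OF g P(8,15)]
      seen_grow[OF g P(8,15,16)] by simp
qed

definition proc_cost :: nat where "proc_cost = pc_cost + (Suc (ll * Suc sb_cost) + Suc (csize fin_code + csize Skip))"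

lemma proc_runs:
  assumes M: "MI t R0 R q cur acc \<rho> \<mu>" and t: "1 \<le> t" "t \<le> m" and e: "\<rho> 13 = e" "e < m" "\<rho> 15 = hi e" "lo e \<le> t" "t \<le> hi e"
    and s: "path \<mu> R0 (\<rho> 36) l" "(src e, l) \<in> St (t - 1)" and c: "cap (\<rho> 33 + ll + 2)" and Q: "q + length cur + nmax + 1 < Z"
  shows "runs W proc_code \<rho> \<mu> proc_cost (\<lambda>\<rho>' \<mu>'.
      (\<exists>acc'. MI t R0 R q cur acc' \<rho>' \<mu>' \<and> set acc' = set acc \<union> (if e \<in> set l then {} else {(dst e, push t e l)}))
      \<and> \<rho>' 33 \<le> \<rho> 33 + (ll + 1) \<and> \<rho>' 31 = \<rho> 31 \<and> \<rho>' 36 = \<rho> 36 \<and> \<rho>' 13 = \<rho> 13 \<and> path \<mu>' R0 (\<rho> 36) l)"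
proof -
  have P: "regs \<rho>" "input \<mu>" "trie \<mu> (\<rho> 33)" "core \<mu>" "\<rho> 10 = t" "\<rho> 34 = R"
     "R < \<rho> 33" "R \<noteq> 0" "tb \<mu> 8 R = 0" "R0 < \<rho> 33"
    using M unfolding MI_def by blast+
  have ln: "length l \<le> ll" by (rule length_St[OF s(2)]) (use t in simp)
  define base where "base = (if (crit e \<or> \<rho> 10 = 1) \<and> \<rho> 10 < hi e then [e] else [])"
  have s1: "runs W pre_code \<rho> \<mu> pc_cost (stack_inv \<rho> \<mu> R0 R e l base 0)"
    unfolding base_def
    by (rule pre_runs[OF P(1-3,6-9) path_node[OF P(3,10) s(1)] s(1) P(10) e(1-3)])
      (use P(4) cap_mono[OF c] in \<open>auto simp: core_def\<close>)
  have s2: "runs W (While (Less 9 41) stack_body) \<rho>1 \<mu>1 (Suc (ll * Suc sb_cost)) (stack_inv \<rho> \<mu> R0 R e l base (length l))"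
    if "stack_inv \<rho> \<mu> R0 R e l base 0 \<rho>1 \<mu>1" for \<rho>1 \<mu>1
  proof -
    have c': "cap (\<rho> 33 + length l + 2)" by (rule cap_mono[OF c]) (use ln in simp)
    show ?thesis
      by (rule runs_mono[OF stack_loop[OF that P(10) e(2) c']])
        (use mult_le_mono1[OF ln] in \<open>simp_all only: Suc_le_mono\<close>)
  qed
  have s3: "runs W (Cond (Eq 38 8) fin_code Skip) \<rho>1 \<mu>1 (Suc (csize fin_code + csize Skip)) (\<lambda>\<rho>' \<mu>'.
      (\<exists>acc'. MI t R0 R q cur acc' \<rho>' \<mu>' \<and> set acc' = set acc \<union> (if e \<in> set l then {} else {(dst e, push t e l)}))
      \<and> \<rho>' 33 \<le> \<rho> 33 + (ll + 1) \<and> \<rho>' 31 = \<rho> 31 \<and> \<rho>' 36 = \<rho> 36 \<and> \<rho>' 13 = \<rho> 13 \<and> path \<mu>' R0 (\<rho> 36) l)"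
    (is "runs _ _ _ _ _ ?Q")
    if S: "stack_inv \<rho> \<mu> R0 R e l base (length l) \<rho>1 \<mu>1" for \<rho>1 \<mu>1
  proof -
    have a: "regs \<rho>1" "\<forall>r\<in>{10,13,30,31,32,34,35,36}. \<rho>1 r = \<rho> r" "\<rho>1 13 = e" "grow \<mu> (\<rho> 33) \<mu>1 (\<rho>1 33)" "\<rho>1 33 \<le> \<rho> 33 + 1 + length l"
      "\<rho>1 37 < \<rho>1 33" "path \<mu>1 R (\<rho>1 37) (rev (filter (\<lambda>f. \<rho> 10 < hi f) l) @ base)" "\<rho>1 38 = (if e \<in> set l then 0 else 1)"
      using S unfolding stack_inv_def by auto
    have M1: "MI t R0 R q cur acc \<rho>1 \<mu>1" by (rule MI_grow[OF M a(4,1)]) (use a(2) in auto)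
    have p: "path \<mu>1 R (\<rho>1 37) (push t e l)" using a(7) P(5) by (simp add: push_def base_def)
    have N: "\<rho>1 33 \<le> \<rho> 33 + (ll + 1)" using a(5) ln by simp
    have pl: "path \<mu>1 R0 (\<rho> 36) l" using grow_path_iff[OF a(4) path_node[OF P(3,10) s(1)]] s(1) by simp
    show ?thesis
    proof (rule runs_Cond)
      assume "\<not> tst (Eq 38 8) \<rho>1"
      then have "e \<in> set l" using a(8) regsD(6)[OF a(1)] by (simp split: if_splits)
      then have "?Q \<rho>1 \<mu>1" using M1 N a(2) pl by auto
      then have "runs W Skip \<rho>1 \<mu>1 (csize Skip) ?Q" by (intro runs_loop_free) auto
      then show "runs W Skip \<rho>1 \<mu>1 (csize fin_code + csize Skip) ?Q" by (rule runs_mono) auto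
    next
      assume "tst (Eq 38 8) \<rho>1"
      then have "\<rho>1 38 = 1" unfolding tst.simps regsD(6)[OF a(1)] .
      then have el: "e \<notin> set l" unfolding a(8) by (cases "e \<in> set l") simp_all
      have "(dst e, push t e l) \<in> succs t (src e, l)" using e el by (auto simp: succs_def)
      then have St: "(dst e, push t e l) \<in> St t" using s(2) t St.simps(2)[of "t - 1"] by auto
      have q: "\<rho>1 32 + 1 < Z" using acc_length[OF M1 t] M1 Q by (simp add: MI_def)
      have c1: "cap (\<rho>1 33)" by (rule cap_mono[OF c]) (use N in simp)
      show "runs W fin_code \<rho>1 \<mu>1 (csize fin_code + csize Skip) ?Q"
        by (rule runs_mono[OF fin_runs[OF M1 a(3) e(2) a(6) p St c1 q]]) (use el N a(2) pl in auto)
    qed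
  qed
  show ?thesis unfolding proc_code_def proc_cost_def
    by (rule runs_Seq[OF s1]) (rule runs_Seq[OF s2 s3])
qed

definition ab_first :: com where "ab_first = Op Sub 13 12 8 ;; fld 14 2 13 ;; fld 15 3 13"
definition arc_cost :: nat where "arc_cost = csize ab_first + (Suc (Suc (proc_cost + 1)) + csize (get 12 6 13))"

definition arc_inv :: "nat \<Rightarrow> nat \<Rightarrow> nat \<Rightarrow> nat \<Rightarrow> (nat \<times> nat list) list \<Rightarrow> (nat \<times> nat list) set \<Rightarrow> nat \<times> nat list \<Rightarrow> nat \<Rightarrow> nat \<Rightarrow> nat \<Rightarrow> nat \<Rightarrow> (nat \<Rightarrow> nat) \<Rightarrow> (nat \<Rightarrow> nat) \<Rightarrow> bool" where
  "arc_inv t R0 R q cur X s N r31 r36 j \<rho> \<mu> \<longleftrightarrow>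
     (\<exists>acc. MI t R0 R q cur acc \<rho> \<mu> \<and> set acc = X \<union> {(dst e, push t e (snd s)) | e. e \<in> set (take j (outs m (fst s)))
         \<and> lo e \<le> t \<and> t \<le> hi e \<and> e \<notin> set (snd s)})
     \<and> linked \<mu> (\<rho> 12) (drop j (outs m (fst s))) \<and> \<rho> 33 \<le> N + j * (ll + 1) \<and> \<rho> 31 = r31 \<and> \<rho> 36 = r36 \<and> path \<mu> R0 r36 (snd s)"

lemma linked_drop: "linked \<mu> a l \<Longrightarrow> j < length l \<Longrightarrow> linked \<mu> (tb \<mu> 6 (l ! j)) (drop (Suc j) l)"
proof (induction l arbitrary: a j)
  case (Cons f l) then show ?case by (cases j) auto
qed simp

lemma arc_step:
  assumes A: "arc_inv t R0 R q cur X s N r31 r36 j \<rho> \<mu>" and t: "1 \<le> t" "t \<le> m" and j: "j < length (outs m (fst s))"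
    and s: "s \<in> St (t - 1)" and c: "cap (N + dg * (ll + 1) + ll + 2)" and Q: "q + length cur + nmax + 1 < Z"
  shows "tst (Less 9 12) \<rho> \<and> runs W arc_body \<rho> \<mu> arc_cost (arc_inv t R0 R q cur X s N r31 r36 (Suc j))"
proof -
  obtain v l where vl: "s = (v, l)" by (cases s)
  define e where "e = outs m v ! j"
  have jl: "j < length (outs m v)" using j vl by simp
  have em: "e < m" "src e = v" using nth_mem[OF jl] by (auto simp: e_def set_outs)
  have vV: "v < nV" using srcV[OF em(1)] em(2) by simp
  have dr: "drop j (outs m v) = e # drop (Suc j) (outs m v)" using jl by (simp add: e_def Cons_nth_drop_Suc)
  have tk: "set (take (Suc j) (outs m v)) = insert e (set (take j (outs m v)))" using jl by (simp add: e_def take_Suc_conv_app_nth)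
  define G where "G E = {(dst e, push t e l) | e. e \<in> E \<and> lo e \<le> t \<and> t \<le> hi e \<and> e \<notin> set l}" for E
  obtain acc where M: "MI t R0 R q cur acc \<rho> \<mu>" and acc: "set acc = X \<union> G (set (take j (outs m v)))"
    and lk: "\<rho> 12 = Suc e" "linked \<mu> (tb \<mu> 6 e) (drop (Suc j) (outs m v))" and N: "\<rho> 33 \<le> N + j * (ll + 1)"
    and r: "\<rho> 31 = r31" "\<rho> 36 = r36" and p: "path \<mu> R0 r36 l"
    using A unfolding arc_inv_def vl fst_conv snd_conv dr G_def by auto
  have P: "regs \<rho>" "input \<mu>" "\<rho> 10 = t" "R0 < \<rho> 33" "trie \<mu> (\<rho> 33)" using M by (auto simp: MI_def)
  note Rg = regsD[OF P(1)] and inp = inputD[OF P(2) em(1)]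
  have b: "e < Z" "Suc e < 2 ^ W" using em(1) Zbig ZW by linarith+
  note sub = sub_one[OF b(2)]
  have jd: "Suc j \<le> dg" using jl length_outs[of v] by simp
  have jm: "j * (ll + 1) + (ll + 1) \<le> dg * (ll + 1)" using mult_le_mono1[OF jd, of "ll + 1"] by simp
  have c': "cap (\<rho> 33 + ll + 2)" by (rule cap_mono[OF c]) (use N jm in linarith)
  define X' where "X' = X \<union> G (set (take (Suc j) (outs m v)))"
  define Q1 where "Q1 \<rho>' \<mu>' \<longleftrightarrow> \<mu>' = \<mu> \<and> (\<forall>r. r \<notin> {13,14,15,46,47} \<longrightarrow> \<rho>' r = \<rho> r) \<and> \<rho>' 13 = e \<and> \<rho>' 14 = lo e \<and> \<rho>' 15 = hi e" for \<rho>' \<mu>' :: "nat \<Rightarrow> nat"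
  define Q2 where "Q2 \<rho>' \<mu>' \<longleftrightarrow> (\<exists>acc'. MI t R0 R q cur acc' \<rho>' \<mu>' \<and> set acc' = X')
      \<and> \<rho>' 33 \<le> \<rho> 33 + (ll + 1) \<and> \<rho>' 31 = r31 \<and> \<rho>' 36 = r36 \<and> \<rho>' 13 = e \<and> path \<mu>' R0 r36 l" for \<rho>' \<mu>' :: "nat \<Rightarrow> nat"
  have s1: "runs W ab_first \<rho> \<mu> (csize ab_first) Q1"
    by (rule runs_loop_free) (use Rg b sub lk(1) em inp in \<open>simp_all add: ab_first_def Q1_def\<close>)
  have s2: "runs W (Cond (Less 10 14) Skip (Cond (Less 15 10) Skip proc_code)) \<rho>1 \<mu>1 (Suc (Suc (proc_cost + 1))) Q2" if q1: "Q1 \<rho>1 \<mu>1" for \<rho>1 \<mu>1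
  proof -
    have a: "\<mu>1 = \<mu>" "\<And>r. r \<notin> {13,14,15,46,47} \<Longrightarrow> \<rho>1 r = \<rho> r" "\<rho>1 13 = e" "\<rho>1 14 = lo e" "\<rho>1 15 = hi e" using q1 unfolding Q1_def by blast+
    have "regs \<rho>1" using P(1) a(2) by (simp add: regs_def)
    then have M1: "MI t R0 R q cur acc \<rho>1 \<mu>" using M a(2) by (simp add: MI_def)
    have t1: "\<rho>1 10 = t" "\<rho>1 33 = \<rho> 33" "\<rho>1 31 = r31" "\<rho>1 36 = r36" using a(2) P(3) r by auto
    have skip: "runs W Skip \<rho>1 \<mu>1 T Q2" if "\<not> (lo e \<le> t \<and> t \<le> hi e)" "1 \<le> T" for T
    proof -
      have "X' = set acc" using that(1) unfolding X'_def acc tk G_def by auto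
      then have "Q2 \<rho>1 \<mu>1" unfolding Q2_def using M1 a(1,3) t1 p by auto
      then have "runs W Skip \<rho>1 \<mu>1 (csize Skip) Q2" by (intro runs_loop_free) auto
      then show ?thesis by (rule runs_mono) (use that in auto)
    qed
    show ?thesis
    proof (rule runs_Cond)
      assume "tst (Less 10 14) \<rho>1"
      then show "runs W Skip \<rho>1 \<mu>1 (Suc (proc_cost + 1)) Q2" by (intro skip) (use a t1 in auto)
    next
      assume n1: "\<not> tst (Less 10 14) \<rho>1"
      show "runs W (Cond (Less 15 10) Skip proc_code) \<rho>1 \<mu>1 (Suc (proc_cost + 1)) Q2"
      proof (rule runs_Cond)
        assume "tst (Less 15 10) \<rho>1"
        then show "runs W Skip \<rho>1 \<mu>1 (proc_cost + 1) Q2" by (intro skip) (use a t1 in auto)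
      next
        assume n2: "\<not> tst (Less 15 10) \<rho>1"
        have act: "lo e \<le> t" "t \<le> hi e" using n1 n2 a t1 by auto
        have X: "X' = set acc \<union> (if e \<in> set l then {} else {(dst e, push t e l)})"
          using act unfolding X'_def acc tk G_def by auto
        have M1': "MI t R0 R q cur acc \<rho>1 \<mu>1" using M1 a(1) by simp
        have p': "path \<mu>1 R0 (\<rho>1 36) l" using p t1 a(1) by simp
        have sl: "(src e, l) \<in> St (t - 1)" using s vl em(2) by simp
        have c1: "cap (\<rho>1 33 + ll + 2)" using c' t1(2) by simp
        show "runs W proc_code \<rho>1 \<mu>1 (proc_cost + 1) Q2"
          by (rule runs_mono[OF proc_runs[OF M1' t a(3) em(1) a(5) act p' sl c1 Q]])
            (use X t1 a(3) in \<open>auto simp: Q2_def\<close>)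
      qed
    qed
  qed
  have s3: "runs W (get 12 6 13) \<rho>1 \<mu>1 (csize (get 12 6 13)) (arc_inv t R0 R q cur X s N r31 r36 (Suc j))" if q2: "Q2 \<rho>1 \<mu>1" for \<rho>1 \<mu>1
  proof (rule runs_loop_free)
    obtain acc' where a: "MI t R0 R q cur acc' \<rho>1 \<mu>1" "set acc' = X'" "\<rho>1 33 \<le> \<rho> 33 + (ll + 1)" "\<rho>1 31 = r31" "\<rho>1 36 = r36" "\<rho>1 13 = e" "path \<mu>1 R0 r36 l"
      using q2 unfolding Q2_def by blast
    have b1: "regs \<rho>1" "core \<mu>1" using a(1) by (auto simp: MI_def)
    have "linked \<mu>1 (tb \<mu>1 0 v) (outs m v)" using b1(2) vV by (simp add: core_def)
    then have ln: "linked \<mu>1 (tb \<mu>1 6 e) (drop (Suc j) (outs m v))" using linked_drop[OF _ jl] by (simp add: e_def)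
    have N': "\<rho>1 33 \<le> N + Suc j * (ll + 1)" using a(3) N by simp
    define Post where "Post = arc_inv t R0 R q cur X s N r31 r36 (Suc j)"
    have M': "MI t R0 R q cur acc' \<rho>' \<mu>1" if "regs \<rho>'" "\<forall>r\<in>{10,30,32,33,34,35}. \<rho>' r = \<rho>1 r" for \<rho>'
      using a(1) that by (simp add: MI_def)
    have "Post \<rho>' \<mu>1" if "regs \<rho>'" "\<forall>r\<in>{10,30,31,32,33,34,35,36}. \<rho>' r = \<rho>1 r" "\<rho>' 12 = tb \<mu>1 6 e" for \<rho>'
    proof -
      have "MI t R0 R q cur acc' \<rho>' \<mu>1" by (rule M'[OF that(1)]) (use that(2) in simp)
      moreover have "set acc' = X \<union> {(dst e, push t e l) | e. e \<in> set (take (Suc j) (outs m v)) \<and> lo e \<le> t \<and> t \<le> hi e \<and> e \<notin> set l}"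
        unfolding a(2) X'_def G_def ..
      ultimately show ?thesis unfolding Post_def arc_inv_def vl fst_conv snd_conv
        using that ln N' a(4,5,7) by auto
    qed
    then have "case step W (get 12 6 13) (\<rho>1, \<mu>1) of (\<rho>', \<mu>') \<Rightarrow> Post \<rho>' \<mu>'" using regsD[OF b1(1)] b a(6) b1(1) by simp
    then show "case step W (get 12 6 13) (\<rho>1, \<mu>1) of (\<rho>', \<mu>') \<Rightarrow> arc_inv t R0 R q cur X s N r31 r36 (Suc j) \<rho>' \<mu>'" unfolding Post_def .
  qed simp
  have "tst (Less 9 12) \<rho>" using Rg lk(1) by simp
  moreover have "runs W arc_body \<rho> \<mu> arc_cost (arc_inv t R0 R q cur X s N r31 r36 (Suc j))"
    unfolding arc_body_def arc_cost_def ab_first_def[symmetric]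
    by (rule runs_Seq[OF s1]) (rule runs_Seq[OF s2 s3])
  ultimately show ?thesis by blast
qed

end

context run
begin

definition state_first :: com where "state_first = get 11 13 31 ;; get 36 14 31 ;; inc 31 ;; get 12 0 11"
definition state_cost :: nat where "state_cost = csize state_first + Suc (dg * Suc arc_cost)"

lemma St_vertex: "s \<in> St t \<Longrightarrow> fst s < nV"
  by (cases t) (auto simp: succs_def intro: srcV dstV)

lemma succs_outs: "succs t s = {(dst e, push t e (snd s)) | e. e \<in> set (outs m (fst s)) \<and> lo e \<le> t \<and> t \<le> hi e \<and> e \<notin> set (snd s)}"
  by (auto simp: succs_def set_outs)

definition state_inv :: "nat \<Rightarrow> nat \<Rightarrow> nat \<Rightarrow> nat \<Rightarrow> (nat \<times> nat list) list \<Rightarrow> nat \<Rightarrow> nat \<Rightarrow> (nat \<Rightarrow> nat) \<Rightarrow> (nat \<Rightarrow> nat) \<Rightarrow> bool" where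
  "state_inv t R0 R q cur N i \<rho> \<mu> \<longleftrightarrow>
     (\<exists>acc. MI t R0 R q cur acc \<rho> \<mu> \<and> set acc = (\<Union>j<i. succs t (cur ! j))) \<and> \<rho> 31 = q + i \<and> \<rho> 33 \<le> N + i * (dg * (ll + 1))"

lemma state_step:
  assumes A: "state_inv t R0 R q cur N i \<rho> \<mu>" and t: "1 \<le> t" "t \<le> m" and i: "i < length cur"
    and s: "set cur \<subseteq> St (t - 1)" and c: "cap (N + length cur * (dg * (ll + 1)) + ll + 2)" and Q: "q + length cur + nmax + 1 < Z"
  shows "tst (Less 31 35) \<rho> \<and> runs W state_body \<rho> \<mu> state_cost (state_inv t R0 R q cur N (Suc i))"
proof -
  obtain acc where M: "MI t R0 R q cur acc \<rho> \<mu>" and acc: "set acc = (\<Union>j<i. succs t (cur ! j))"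
    and r31: "\<rho> 31 = q + i" and N: "\<rho> 33 \<le> N + i * (dg * (ll + 1))"
    using A unfolding state_inv_def by blast
  obtain v l where vl: "cur ! i = (v, l)" by (cases "cur ! i")
  have sS: "(v, l) \<in> St (t - 1)" using s nth_mem[OF i] vl by auto
  have vV: "v < nV" using St_vertex[OF sS] by simp
  have P: "regs \<rho>" "core \<mu>" "front \<mu> R0 q cur" "\<rho> 35 = q + length cur" using M by (simp_all add: MI_def)
  have f: "tb \<mu> 13 (q + i) = v" "path \<mu> R0 (tb \<mu> 14 (q + i)) l" using P(3) i vl by (auto simp: front_def)
  have lk: "linked \<mu> (tb \<mu> 0 v) (outs m v)" using P(2) vV by (simp add: core_def)
  have b: "q + i < Z" "v < Z" "q + i + 1 < 2 ^ W" using Q i vV Zbig ZW by linarith+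
  define X where "X = (\<Union>j<i. succs t (cur ! j))"
  define N1 where "N1 = \<rho> 33"
  define r where "r = tb \<mu> 14 (q + i)"
  define n where "n = length (outs m v)"
  have nd: "n \<le> dg" unfolding n_def by (rule length_outs)
  define AI where "AI = arc_inv t R0 R q cur X (v, l) N1 (q + Suc i) r"
  have s1: "runs W state_first \<rho> \<mu> (csize state_first) (AI 0)"
  proof (rule runs_loop_free)
    show "loop_free state_first" by (simp add: state_first_def)
    have "AI 0 \<rho>' \<mu>" if "regs \<rho>'" "\<forall>r\<in>{10,30,32,33,34,35}. \<rho>' r = \<rho> r" "\<rho>' 31 = q + Suc i" "\<rho>' 36 = r" "\<rho>' 12 = tb \<mu> 0 v" for \<rho>'
    proof -
      have "MI t R0 R q cur acc \<rho>' \<mu>" using M that(1,2) by (simp add: MI_def)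
      then show ?thesis unfolding AI_def arc_inv_def using acc that lk f(2) by (auto simp: X_def N1_def r_def)
    qed
    then show "case step W state_first (\<rho>, \<mu>) of (\<rho>', \<mu>') \<Rightarrow> AI 0 \<rho>' \<mu>'"
      using regsD[OF P(1)] b r31 f(1) P(1) r_def[symmetric] by (simp add: state_first_def)
  qed
  have c1: "cap (N1 + dg * (ll + 1) + ll + 2)"
  proof (rule cap_mono[OF c])
    have "Suc i * (dg * (ll + 1)) \<le> length cur * (dg * (ll + 1))" using i by (intro mult_le_mono1) simp
    then show "N1 + dg * (ll + 1) + ll + 2 \<le> N + length cur * (dg * (ll + 1)) + ll + 2" using N by (simp add: N1_def)
  qed
  have s2: "runs W (While (Less 9 12) arc_body) \<rho>1 \<mu>1 (Suc (dg * Suc arc_cost)) (state_inv t R0 R q cur N (Suc i))" if a0: "AI 0 \<rho>1 \<mu>1" for \<rho>1 \<mu>1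
  proof (rule runs_mono)
    show "runs W (While (Less 9 12) arc_body) \<rho>1 \<mu>1 (Suc (n * Suc arc_cost)) (AI n)"
    proof (rule runs_While_const[where I = AI, OF a0])
      fix j \<rho>2 \<mu>2 assume j: "j < n" and a: "AI j \<rho>2 \<mu>2"
      have j': "j < length (outs m (fst (v, l)))" using j by (simp add: n_def)
      show "tst (Less 9 12) \<rho>2 \<and> runs W arc_body \<rho>2 \<mu>2 arc_cost (AI (Suc j))"
        unfolding AI_def by (rule arc_step[OF a[unfolded AI_def] t j' sS c1 Q])
    next
      fix \<rho>2 \<mu>2 assume a: "AI n \<rho>2 \<mu>2"
      then have "\<rho>2 12 = 0" unfolding AI_def arc_inv_def by (simp add: n_def)
      then show "\<not> tst (Less 9 12) \<rho>2" by simp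
    qed
    show "Suc (n * Suc arc_cost) \<le> Suc (dg * Suc arc_cost)" using mult_le_mono1[OF nd] by (simp only: Suc_le_mono)
  next
    fix \<rho>2 \<mu>2 assume a: "AI n \<rho>2 \<mu>2"
    obtain acc' where M': "MI t R0 R q cur acc' \<rho>2 \<mu>2" and acc': "set acc' = X \<union> succs t (v, l)"
      and r': "\<rho>2 33 \<le> N1 + n * (ll + 1)" "\<rho>2 31 = q + Suc i"
      using a unfolding AI_def arc_inv_def n_def succs_outs by auto
    have "set acc' = (\<Union>j<Suc i. succs t (cur ! j))" unfolding acc' X_def lessThan_Suc using vl by auto
    moreover have "\<rho>2 33 \<le> N + Suc i * (dg * (ll + 1))"
      using r'(1) N mult_le_mono1[OF nd, of "ll + 1"] by (simp add: N1_def)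
    ultimately show "state_inv t R0 R q cur N (Suc i) \<rho>2 \<mu>2" unfolding state_inv_def using M' r'(2) by blast
  qed
  have "tst (Less 31 35) \<rho>" using r31 P(4) i by simp
  moreover have "runs W state_body \<rho> \<mu> state_cost (state_inv t R0 R q cur N (Suc i))"
    unfolding state_body_def state_cost_def state_first_def[symmetric] by (rule runs_Seq[OF s1 s2])
  ultimately show ?thesis by blast
qed

definition time_first :: com where "time_first = mov 34 33 ;; inc 33 ;; mov 35 32"

definition size_at :: "nat \<Rightarrow> nat" where "size_at i = (if i = 0 then m else nmax)"

definition time_cost :: "nat \<Rightarrow> nat" where
  "time_cost i = csize time_first + (Suc (size_at i * Suc state_cost) + csize (inc 10))"

definition time_inv :: "nat \<Rightarrow> (nat \<Rightarrow> nat) \<Rightarrow> (nat \<Rightarrow> nat) \<Rightarrow> bool" where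
  "time_inv i \<rho> \<mu> \<longleftrightarrow> (\<exists>R0 q cur. regs \<rho> \<and> input \<mu> \<and> trie \<mu> (\<rho> 33) \<and> core \<mu> \<and> \<rho> 10 = Suc i \<and> \<rho> 30 = Suc m \<and> \<rho> 31 = q
     \<and> \<rho> 32 = q + length cur \<and> R0 < \<rho> 33 \<and> front \<mu> R0 q cur \<and> set cur = St i \<and> length cur \<le> size_at i
     \<and> q + length cur \<le> m + i * nmax \<and> \<rho> 33 \<le> 2 + i + q * (dg * (ll + 1)))"

lemma path_root: "trie \<mu> N \<Longrightarrow> path \<mu> R n l \<Longrightarrow> n < N \<Longrightarrow> R < N"
  by (induction l arbitrary: n) (auto dest: trieD2(3))

lemma trie_mono:
  assumes T: "trie \<mu> N" and N: "N \<le> N'" shows "trie \<mu> N'"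
  unfolding trie_def
proof (intro conjI allI impI)
  fix p f assume a: "f < m" "tb \<mu> 7 (p * m + f) \<noteq> 0"
  note h = trieD1[OF T a]
  show "tb \<mu> 7 (p * m + f) < N'" "p < N'" "p \<noteq> 0" "tb \<mu> 8 (tb \<mu> 7 (p * m + f)) = p" "tb \<mu> 9 (tb \<mu> 7 (p * m + f)) = f"
    using h N by (blast intro: less_le_trans)+
next
  fix n assume a: "tb \<mu> 8 n \<noteq> 0"
  note h = trieD2[OF T a]
  show "n < N'" "n \<noteq> 0" "tb \<mu> 8 n < N'" "tb \<mu> 9 n < m" "tb \<mu> 7 (tb \<mu> 8 n * m + tb \<mu> 9 n) = n"
    using h N by (blast intro: less_le_trans)+
next
  fix n v assume "N' \<le> n" "v < nV"
  then show "tb \<mu> 10 (n * nV + v) = 0" using trieD3[OF T] N le_trans by blast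
qed

lemma time_step:
  assumes A: "time_inv i \<rho> \<mu>" and i: "i < m"
  shows "tst (Less 10 30) \<rho> \<and> runs W time_body \<rho> \<mu> (time_cost i) (time_inv (Suc i))"
proof -
  obtain R0 q cur where P: "regs \<rho>" "input \<mu>" "trie \<mu> (\<rho> 33)" "core \<mu>" "\<rho> 10 = Suc i" "\<rho> 30 = Suc m" "\<rho> 31 = q"
     "\<rho> 32 = q + length cur" "R0 < \<rho> 33" "front \<mu> R0 q cur" "set cur = St i" "length cur \<le> size_at i"
     "q + length cur \<le> m + i * nmax" "\<rho> 33 \<le> 2 + i + q * (dg * (ll + 1))"
    using A unfolding time_inv_def by blast
  define N where "N = \<rho> 33"
  define t where "t = Suc i"
  define d where "d = dg * (ll + 1)"
  define sz where "sz = length cur"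
  have t: "1 \<le> t" "t \<le> m" using i by (auto simp: t_def)
  have inm: "i * nmax + nmax \<le> m * nmax" using mult_le_mono1[of "Suc i" m nmax] i by simp
  have qs: "q + sz \<le> m + m * nmax" using P(13) inm unfolding sz_def by linarith
  have qd: "q * d + sz * d \<le> (m + m * nmax) * d" using mult_le_mono1[OF qs, of d] by (simp add: algebra_simps)
  have Nb: "N \<le> 2 + i + q * d" using P(14) by (simp add: N_def d_def)
  have Q: "q + length cur + nmax + 1 < Z" using P(13) inm capQ by linarith
  have c: "cap (Suc N + length cur * (dg * (ll + 1)) + ll + 2)"
  proof (rule cap_mono[OF capN])
    show "Suc N + length cur * (dg * (ll + 1)) + ll + 2 \<le> 6 + m + ll + (m + m * nmax) * (dg * (ll + 1))"
      unfolding d_def[symmetric] sz_def[symmetric] using Nb qd i by linarith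
  qed
  have Nz: "N < Z \<and> N + 1 < 2 ^ W" by (rule cap_less[OF c]) simp
  have qz: "q + length cur < 2 ^ W" "N < 2 ^ W" using Q ZW Nz by linarith+
  have N8: "tb \<mu> 8 N = 0"
  proof (rule ccontr)
    assume "tb \<mu> 8 N \<noteq> 0"
    from trieD2(1)[OF P(3) this] show False by (simp add: N_def)
  qed
  have sn: "seen \<mu> N (set [])"
    unfolding seen_def
  proof (intro allI impI)
    fix n v l assume v: "v < nV" and p: "path \<mu> N n l"
    have "\<rho> 33 \<le> n"
    proof (rule ccontr)
      assume "\<not> \<rho> 33 \<le> n"
      then have "N < \<rho> 33" by (intro path_root[OF P(3) p]) simp
      then show False by (simp add: N_def)
    qed
    then show "tb \<mu> 10 (n * nV + v) \<noteq> 0 \<longleftrightarrow> (v, l) \<in> set []" using trieD3[OF P(3) _ v] by simp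
  qed
  have tr: "trie \<mu> (Suc N)" by (rule trie_mono[OF P(3)]) (simp add: N_def)
  have R0: "R0 < N" using P(9) by (simp add: N_def)
  define SI where "SI = state_inv t R0 N q cur (Suc N)"
  have s1: "runs W time_first \<rho> \<mu> (csize time_first) (SI 0)"
  proof (rule runs_loop_free)
    show "loop_free time_first" by (simp add: time_first_def)
    have "SI 0 \<rho>' \<mu>" if "regs \<rho>'" "\<forall>r\<in>{10,30,31,32}. \<rho>' r = \<rho> r" "\<rho>' 33 = Suc N" "\<rho>' 34 = N" "\<rho>' 35 = q + length cur" for \<rho>'
    proof -
      have "MI t R0 N q cur [] \<rho>' \<mu>"
        using that P(2,4-8,10) tr N8 sn R0 by (simp add: MI_def t_def front_def)
      then show ?thesis unfolding SI_def state_inv_def using that P(7) by (intro conjI exI[of _ "[]"]) simp_all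
    qed
    then show "case step W time_first (\<rho>, \<mu>) of (\<rho>', \<mu>') \<Rightarrow> SI 0 \<rho>' \<mu>'"
      using regsD[OF P(1)] Nz qz P(1,8) N_def[symmetric] by (simp add: time_first_def)
  qed
  have s2: "runs W (While (Less 31 35) state_body) \<rho>1 \<mu>1 (Suc (size_at i * Suc state_cost)) (SI (length cur))" if a0: "SI 0 \<rho>1 \<mu>1" for \<rho>1 \<mu>1
  proof (rule runs_mono)
    show "runs W (While (Less 31 35) state_body) \<rho>1 \<mu>1 (Suc (length cur * Suc state_cost)) (SI (length cur))"
    proof (rule runs_While_const[where I = SI, OF a0])
      fix j \<rho>2 \<mu>2 assume j: "j < length cur" and a: "SI j \<rho>2 \<mu>2"
      have cs: "set cur \<subseteq> St (t - 1)" using P(11) by (simp add: t_def)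
      show "tst (Less 31 35) \<rho>2 \<and> runs W state_body \<rho>2 \<mu>2 state_cost (SI (Suc j))"
        unfolding SI_def by (rule state_step[OF a[unfolded SI_def] t j cs c Q])
    next
      fix \<rho>2 \<mu>2 assume a: "SI (length cur) \<rho>2 \<mu>2"
      then have "\<rho>2 31 = q + length cur" "\<rho>2 35 = q + length cur" unfolding SI_def state_inv_def MI_def by blast+
      then show "\<not> tst (Less 31 35) \<rho>2" by simp
    qed
    show "Suc (length cur * Suc state_cost) \<le> Suc (size_at i * Suc state_cost)" using mult_le_mono1[OF P(12)] by (simp only: Suc_le_mono)
  qed
  have s3: "runs W (inc 10) \<rho>1 \<mu>1 (csize (inc 10)) (time_inv (Suc i))" if a: "SI (length cur) \<rho>1 \<mu>1" for \<rho>1 \<mu>1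
  proof (rule runs_loop_free)
    obtain acc where M: "MI t R0 N q cur acc \<rho>1 \<mu>1" and acc: "set acc = (\<Union>j<length cur. succs t (cur ! j))"
      and r: "\<rho>1 31 = q + length cur" "\<rho>1 33 \<le> Suc N + length cur * (dg * (ll + 1))"
      using a unfolding SI_def state_inv_def by blast
    have S: "set acc = St (Suc i)"
    proof -
      have "(\<Union>j<length cur. succs t (cur ! j)) = (\<Union>s\<in>set cur. succs t s)" by (force simp: in_set_conv_nth)
      then show ?thesis unfolding acc using P(11) by (simp add: t_def)
    qed
    have la: "length acc \<le> nmax" by (rule acc_length[OF M t])
    have p: "regs \<rho>1" "input \<mu>1" "trie \<mu>1 (\<rho>1 33)" "core \<mu>1" "\<rho>1 10 = t" "\<rho>1 30 = Suc m" "N < \<rho>1 33"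
       "\<rho>1 32 = q + length cur + length acc" "front \<mu>1 N (q + length cur) acc"
      using M unfolding MI_def by blast+
    have r33: "\<rho>1 33 \<le> 2 + Suc i + (q + length cur) * (dg * (ll + 1))"
      using r(2) Nb unfolding d_def[symmetric] by (simp add: algebra_simps)
    have tW: "t + 1 < 2 ^ W" using t(2) Zbig ZW by linarith
    have "time_inv (Suc i) \<rho>' \<mu>1" if "regs \<rho>'" "\<forall>r\<in>{30,31,32,33}. \<rho>' r = \<rho>1 r" "\<rho>' 10 = Suc (Suc i)" for \<rho>'
      unfolding time_inv_def using that p r r33 S la P(13)
      by (intro exI[of _ N] exI[of _ "q + length cur"] exI[of _ acc]) (simp add: size_at_def)
    then show "case step W (inc 10) (\<rho>1, \<mu>1) of (\<rho>', \<mu>') \<Rightarrow> time_inv (Suc i) \<rho>' \<mu>'"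
      using regsD[OF p(1)] p(1,5) tW t_def by simp
  qed simp
  have "tst (Less 10 30) \<rho>" using P(5,6) i by simp
  moreover have "runs W time_body \<rho> \<mu> (time_cost i) (time_inv (Suc i))"
    unfolding time_body_def time_cost_def time_first_def[symmetric] by (rule runs_Seq[OF s1]) (rule runs_Seq[OF s2 s3])
  ultimately show ?thesis by blast
qed

definition main_first :: com where "main_first = Const 10 1 ;; Const 31 0 ;; mov 32 3 ;; Const 33 2"

definition main_cost :: nat where
  "main_cost = csize main_first + (Suc (\<Sum>i<m. Suc (time_cost i)) + csize (Cond (Less 31 32) (Const 0 1) (Const 0 0)))"

lemma main_runs:
  assumes P: "regs \<rho>" "input \<mu>" "stat \<mu>" "\<And>e. e < m \<Longrightarrow> 4 \<le> tb \<mu> 3 e \<longleftrightarrow> crit e" "\<rho> 30 = Suc m"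
  shows "runs W main_code \<rho> \<mu> main_cost (\<lambda>\<rho>' \<mu>'. \<rho>' 0 = (if St m \<noteq> {} then 1 else 0))"
proof -
  have s: "\<forall>v<nV. linked \<mu> (tb \<mu> 0 v) (outs m v)" "\<forall>e<m. tb \<mu> 13 e = src e \<and> tb \<mu> 14 e = 1"
    "\<And>x. tb \<mu> 7 x = 0" "\<And>x. tb \<mu> 8 x = 0" "\<And>x. tb \<mu> 9 x = 0" "\<And>x. tb \<mu> 10 x = 0"
    using P(3) by (simp_all add: stat_def)
  have co: "core \<mu>" using s(1) P(4) by (simp add: core_def)
  have tr: "trie \<mu> 2" by (simp add: trie_def s(3-6))
  have fr: "front \<mu> 1 0 (map (\<lambda>e. (src e, [])) [0..<m])" using s(2,4) by (simp add: front_def)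
  have two: "(2::nat) < 2 ^ W" "m < 2 ^ W" using ZW Zbig m1 by linarith+
  have s1: "runs W main_first \<rho> \<mu> (csize main_first) (time_inv 0)"
  proof (rule runs_loop_free)
    show "loop_free main_first" by (simp add: main_first_def)
    have "time_inv 0 \<rho>' \<mu>" if "regs \<rho>'" "\<rho>' 30 = Suc m" "\<rho>' 10 = 1" "\<rho>' 31 = 0" "\<rho>' 32 = m" "\<rho>' 33 = 2" for \<rho>'
      unfolding time_inv_def using that P(2) tr co fr
      by (intro exI[of _ 1] exI[of _ 0] exI[of _ "map (\<lambda>e. (src e, [])) [0..<m]"]) (auto simp: size_at_def)
    then show "case step W main_first (\<rho>, \<mu>) of (\<rho>', \<mu>') \<Rightarrow> time_inv 0 \<rho>' \<mu>'"
      using regsD[OF P(1)] P(1,5) two by (simp add: main_first_def)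
  qed
  have s2: "runs W (While (Less 10 30) time_body) \<rho>1 \<mu>1 (Suc (\<Sum>i<m. Suc (time_cost i))) (time_inv m)" if a0: "time_inv 0 \<rho>1 \<mu>1" for \<rho>1 \<mu>1
  proof (rule runs_While[where I = time_inv and C = time_cost, OF a0])
    show "tst (Less 10 30) \<rho>2 \<and> runs W time_body \<rho>2 \<mu>2 (time_cost i) (time_inv (Suc i))" if "i < m" "time_inv i \<rho>2 \<mu>2" for i \<rho>2 \<mu>2
      by (rule time_step[OF that(2,1)])
    show "\<not> tst (Less 10 30) \<rho>2" if "time_inv m \<rho>2 \<mu>2" for \<rho>2 \<mu>2 using that by (auto simp: time_inv_def)
  qed
  have s3: "runs W (Cond (Less 31 32) (Const 0 1) (Const 0 0)) \<rho>1 \<mu>1 (csize (Cond (Less 31 32) (Const 0 1) (Const 0 0)))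
      (\<lambda>\<rho>' \<mu>'. \<rho>' 0 = (if St m \<noteq> {} then 1 else 0))" if a: "time_inv m \<rho>1 \<mu>1" for \<rho>1 \<mu>1
  proof (rule runs_loop_free)
    obtain q and cur :: "(nat \<times> nat list) list" where "\<rho>1 31 = q" "\<rho>1 32 = q + length cur" "set cur = St m" using a unfolding time_inv_def by blast
    then have "\<rho>1 31 < \<rho>1 32 \<longleftrightarrow> St m \<noteq> {}" by auto
    then show "case step W (Cond (Less 31 32) (Const 0 1) (Const 0 0)) (\<rho>1, \<mu>1) of (\<rho>', \<mu>') \<Rightarrow> \<rho>' 0 = (if St m \<noteq> {} then 1 else 0)"
      using two by simp
  qed simp
  show ?thesis unfolding main_code_def main_cost_def main_first_def[symmetric]
    by (rule runs_Seq[OF s1]) (rule runs_Seq[OF s2 s3])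
qed

end

definition prep_code :: com where
  "prep_code = setup_code ;; While (Less 10 3) adj_body ;; Const 10 0 ;; While (Less 10 3) count_body ;; Const 10 0 ;;
     While (Less 10 3) hist_body ;; (bound_code ;; While (Less 9 22) bitlen_body ;; check_init) ;; While (Less 10 30) check_body"

definition program :: com where "program = prep_code ;; Cond (Eq 29 8) main_code (Const 0 0)"

lemma window_count_le: "(6 * w + K) div (K div 8 + 1) + 1 \<le> 6 * w + (9::nat)"
proof -
  have "K \<le> 8 * (K div 8 + 1)" using div_mult_mod_eq[of K 8] mod_less_divisor[of 8 K] by simp
  moreover have "6 * w \<le> 6 * w * (K div 8 + 1)" by simp
  ultimately have "6 * w + K \<le> (6 * w + 8) * (K div 8 + 1)" by (simp add: algebra_simps)
  then have "(6 * w + K) div (K div 8 + 1) \<le> 6 * w + 8" by (metis Suc_eq_plus1 div_le_mono nonzero_mult_div_cancel_right nat.distinct(1))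
  then show ?thesis by simp
qed

context prog
begin

definition prep_cost :: nat where
  "prep_cost = csize setup_code + (Suc (m * Suc (csize adj_body)) + (csize (Const 10 0) + (Suc (m * Suc count_cost) + (csize (Const 10 0)
     + (Suc (m * Suc (csize hist_body)) + (csize bound_code + (Suc (bitlen wn * Suc (csize bitlen_body)) + csize check_init)
     + Suc (m * Suc (csize check_body))))))))"

lemma prep_runs:
  assumes h: "\<mu> 0 = m" "\<mu> 1 = w" "\<mu> 2 = Suc K" "\<mu> 4 = nV" "B = 5 + 4 * m + nV * K"
    and inp: "input \<mu>" and z: "\<And>x. B \<le> x \<Longrightarrow> \<mu> x = 0"
  shows "runs W prep_code (\<lambda>_. 0) \<mu> prep_cost (check_inv m)"
  unfolding prep_code_def prep_cost_def
proof (rule runs_Seq[OF setup_runs[OF h]], rule runs_Seq)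
  fix \<rho>1 \<mu>1 assume a: "regs \<rho>1 \<and> \<mu>1 = \<mu> \<and> \<rho>1 10 = 0"
  have tz: "tb \<mu> j x = 0" for j x using z by (simp add: tb_def)
  have I0: "adj_inv 0 \<rho>1 \<mu>1" using a inp by (simp add: adj_inv_def tz)
  show "runs W (While (Less 10 3) adj_body) \<rho>1 \<mu>1 (Suc (m * Suc (csize adj_body))) (adj_inv m)"
    by (rule runs_While_const[where I = adj_inv, OF I0]) (use adj_step in \<open>auto simp: adj_inv_def regs_def\<close>)
next
  fix \<rho>1 \<mu>1 assume a: "adj_inv m \<rho>1 \<mu>1"
  have I0: "count_inv 0 (\<rho>1(10 := 0)) \<mu>1" using a by (simp add: adj_inv_def count_inv_def stat_def)
  show "runs W (Const 10 0 ;; While (Less 10 3) count_body ;; Const 10 0 ;;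
     While (Less 10 3) hist_body ;; (bound_code ;; While (Less 9 22) bitlen_body ;; check_init) ;; While (Less 10 30) check_body) \<rho>1 \<mu>1
     (csize (Const 10 0) + (Suc (m * Suc count_cost) + (csize (Const 10 0)
     + (Suc (m * Suc (csize hist_body)) + (csize bound_code + (Suc (bitlen wn * Suc (csize bitlen_body)) + csize check_init)
     + Suc (m * Suc (csize check_body))))))) (check_inv m)"
  proof (rule runs_Seq[where R = "count_inv 0"], rule runs_loop_free)
    show "case step W (Const 10 0) (\<rho>1, \<mu>1) of (\<rho>', \<mu>') \<Rightarrow> count_inv 0 \<rho>' \<mu>'" using I0 by simp
  next
    fix \<rho>2 \<mu>2 assume c0: "count_inv 0 \<rho>2 \<mu>2"
    show "runs W (While (Less 10 3) count_body ;; Const 10 0 ;;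
     While (Less 10 3) hist_body ;; (bound_code ;; While (Less 9 22) bitlen_body ;; check_init) ;; While (Less 10 30) check_body) \<rho>2 \<mu>2
     (Suc (m * Suc count_cost) + (csize (Const 10 0)
     + (Suc (m * Suc (csize hist_body)) + (csize bound_code + (Suc (bitlen wn * Suc (csize bitlen_body)) + csize check_init)
     + Suc (m * Suc (csize check_body)))))) (check_inv m)"
    proof (rule runs_Seq)
      show "runs W (While (Less 10 3) count_body) \<rho>2 \<mu>2 (Suc (m * Suc count_cost)) (count_inv m)"
        by (rule runs_While_const[where I = count_inv, OF c0]) (use count_step in \<open>auto simp: count_inv_def regs_def\<close>)
    next
      fix \<rho>3 \<mu>3 assume c: "count_inv m \<rho>3 \<mu>3"
      have h0: "hist_inv 0 (\<rho>3(10 := 0)) \<mu>3" using c by (simp add: count_inv_def hist_inv_def crit_iff)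
      show "runs W (Const 10 0 ;; While (Less 10 3) hist_body ;; (bound_code ;; While (Less 9 22) bitlen_body ;; check_init) ;; While (Less 10 30) check_body) \<rho>3 \<mu>3
        (csize (Const 10 0) + (Suc (m * Suc (csize hist_body)) + (csize bound_code + (Suc (bitlen wn * Suc (csize bitlen_body)) + csize check_init)
        + Suc (m * Suc (csize check_body))))) (check_inv m)"
      proof (rule runs_Seq[where R = "hist_inv 0"], rule runs_loop_free)
        show "case step W (Const 10 0) (\<rho>3, \<mu>3) of (\<rho>', \<mu>') \<Rightarrow> hist_inv 0 \<rho>' \<mu>'" using h0 by simp
      next
        fix \<rho>4 \<mu>4 assume h0: "hist_inv 0 \<rho>4 \<mu>4"
        show "runs W (While (Less 10 3) hist_body ;; (bound_code ;; While (Less 9 22) bitlen_body ;; check_init) ;; While (Less 10 30) check_body) \<rho>4 \<mu>4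
          (Suc (m * Suc (csize hist_body)) + (csize bound_code + (Suc (bitlen wn * Suc (csize bitlen_body)) + csize check_init)
          + Suc (m * Suc (csize check_body)))) (check_inv m)"
        proof (rule runs_Seq)
          show "runs W (While (Less 10 3) hist_body) \<rho>4 \<mu>4 (Suc (m * Suc (csize hist_body))) (hist_inv m)"
            by (rule runs_While_const[where I = hist_inv, OF h0]) (use hist_step in \<open>auto simp: hist_inv_def regs_def\<close>)
        next
          fix \<rho>5 \<mu>5 assume hm: "hist_inv m \<rho>5 \<mu>5"
          have r: "regs \<rho>5" "hist_ok \<mu>5" using hm by (simp_all add: hist_inv_def hist_ok_def)
          show "runs W ((bound_code ;; While (Less 9 22) bitlen_body ;; check_init) ;; While (Less 10 30) check_body) \<rho>5 \<mu>5
            (csize bound_code + (Suc (bitlen wn * Suc (csize bitlen_body)) + csize check_init) + Suc (m * Suc (csize check_body))) (check_inv m)"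
          proof (rule runs_Seq[OF bound_runs[OF r]])
            fix \<rho>6 \<mu>6 assume k0: "check_inv 0 \<rho>6 \<mu>6"
            show "runs W (While (Less 10 30) check_body) \<rho>6 \<mu>6 (Suc (m * Suc (csize check_body))) (check_inv m)"
              by (rule runs_While_const[where I = check_inv, OF k0]) (use check_step in \<open>auto simp: check_inv_def\<close>)
          qed
        qed
      qed simp
    qed
  qed simp
qed

definition passes :: bool where "passes \<longleftrightarrow> releases_bounded \<and> critical_bounded D"

lemma check_inv_end:
  assumes "check_inv m \<rho> \<mu>"
  shows "regs \<rho>" "hist_ok \<mu>" "\<rho> 30 = Suc m" "\<rho> 29 = (if passes then 1 else 0)"
proof -
  have "passes \<longleftrightarrow> (\<forall>t. 1 \<le> t \<longrightarrow> t \<le> m \<longrightarrow> card {e. e < m \<and> lo e \<le> t} + 1 \<le> t + w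
           \<and> card {e. e < m \<and> crit e \<and> lo e \<le> t \<and> t \<le> hi e + w} \<le> D)"
    unfolding passes_def releases_bounded_def critical_bounded_def by blast
  then show "regs \<rho>" "hist_ok \<mu>" "\<rho> 30 = Suc m" "\<rho> 29 = (if passes then 1 else 0)"
    using assms unfolding check_inv_def by simp_all
qed

lemma wn_le_width: "wn \<le> 6 * w + 9" unfolding wn_def by (rule window_count_le)

lemma prep_cost_le: "prep_cost \<le> 2000 * (m * (1 + dg))"
proof -
  have c: "csize setup_code \<le> 20" "csize adj_body \<le> 100" "csize hist_body \<le> 100" "csize bound_code \<le> 20" "csize bitlen_body \<le> 5"
    "csize check_init \<le> 20" "csize check_body \<le> 60" "csize relax_body \<le> 60"
    by (simp_all add: setup_code_def adj_body_def hist_body_def bound_code_def bitlen_body_def check_init_def check_body_def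
        relax_body_def get_def put_def fld_def addr_def mov_def inc_def)
  have rc: "relax_cost \<le> 10 + dg * 61"
  proof -
    have "dg * Suc (csize relax_body) \<le> dg * 61" using c(8) by (intro mult_le_mono2) simp
    moreover have "csize (get 12 0 11) \<le> 9" by (simp add: get_def addr_def)
    ultimately show ?thesis unfolding relax_cost_def by linarith
  qed
  have cc: "count_cost \<le> 60 + dg * 122"
    unfolding count_cost_def using rc by (simp add: fld_def inc_def)
  have m: "m * Suc (csize adj_body) \<le> m * 101" "m * Suc count_cost \<le> m * (61 + dg * 122)" "m * Suc (csize hist_body) \<le> m * 101"
    "m * Suc (csize check_body) \<le> m * 61"
    by (rule mult_le_mono2, use c cc in linarith)+
  have "bitlen wn \<le> 6 * m + 9" using bitlen_le[of wn] wn_le_width wm by linarith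
  then have b: "bitlen wn * Suc (csize bitlen_body) \<le> (6 * m + 9) * 6" by (rule mult_le_mono) (use c in simp)
  define A1 A2 A3 A4 A5 d where "A1 = m * Suc (csize adj_body)" and "A2 = m * Suc count_cost" and "A3 = m * Suc (csize hist_body)"
    and "A4 = m * Suc (csize check_body)" and "A5 = bitlen wn * Suc (csize bitlen_body)" and "d = m * dg"
  note A = this
  have "A1 \<le> 101 * m" "A2 \<le> 61 * m + 122 * d" "A3 \<le> 101 * m" "A4 \<le> 61 * m" "A5 \<le> 36 * m + 54" "m * (1 + dg) = m + d"
    using m b by (simp_all add: A algebra_simps)
  then show ?thesis unfolding prep_cost_def csize.simps A(1-5)[symmetric] using c(1,4,6) m1 by linarith
qed

end

lemma (in run) main_cost_le: "main_cost \<le> 1000 * (m * (1 + nmax) * (1 + dg) * (ll + 2))"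
proof -
  have c: "csize fin_code \<le> 60" "csize push_code \<le> 60" "csize ab_first \<le> 20" "csize state_first \<le> 30" "csize time_first \<le> 10" "csize main_first \<le> 10"
    by (simp_all add: fin_code_def push_code_def ab_first_def state_first_def time_first_def main_first_def
        get_def put_def fld_def addr_def mov_def inc_def)
  have sb: "Suc sb_cost \<le> 100" unfolding sb_cost_def using c(2) by (simp add: sb_first_def sb_last_def get_def fld_def addr_def mov_def)
  have pc: "pc_cost \<le> 120" unfolding pc_cost_def using c(2) by (simp add: pc_first_def pc_last_def get_def fld_def addr_def mov_def)
  have "ll * Suc sb_cost \<le> ll * 100" using sb by (rule mult_le_mono2)
  then have "proc_cost \<le> 190 + 100 * ll" unfolding proc_cost_def csize.simps using pc c(1) by linarith
  then have ac: "Suc arc_cost \<le> 150 * (ll + 2)" unfolding arc_cost_def using c(3) by (simp add: get_def addr_def)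
  have "dg * Suc arc_cost \<le> dg * (150 * (ll + 2))" using ac by (rule mult_le_mono2)
  then have "Suc state_cost \<le> 32 + dg * (150 * (ll + 2))" unfolding state_cost_def using c(4) by linarith
  also have "\<dots> \<le> 150 * ((1 + dg) * (ll + 2))" by (simp add: algebra_simps)
  finally have sc: "Suc state_cost \<le> 150 * ((1 + dg) * (ll + 2))" .
  define Y where "Y = (1 + dg) * (ll + 2)"
  have Y1: "1 \<le> Y" by (simp add: Y_def)
  have tc: "Suc (time_cost i) \<le> 20 + size_at i * (150 * Y)" for i
  proof -
    have "size_at i * Suc state_cost \<le> size_at i * (150 * Y)" using sc unfolding Y_def by (rule mult_le_mono2)
    moreover have "csize (inc 10) = 1" by (simp add: inc_def)
    ultimately show ?thesis unfolding time_cost_def using c(5) by linarith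
  qed
  have "(\<Sum>i<m. size_at i) \<le> m + m * nmax"
  proof -
    obtain m' where m': "m = Suc m'" using m1 by (cases m) auto
    have "(\<Sum>i<Suc m'. size_at i) = size_at 0 + (\<Sum>i<m'. size_at (Suc i))" by (rule sum.lessThan_Suc_shift)
    then have "(\<Sum>i<Suc m'. size_at i) = m + m' * nmax" unfolding size_at_def by simp
    then show ?thesis unfolding m'[symmetric] using mult_le_mono1[of m' m nmax] m' by simp
  qed
  then have "(\<Sum>i<m. size_at i) * (150 * Y) \<le> (m + m * nmax) * (150 * Y)" by (rule mult_le_mono1)
  moreover have "(\<Sum>i<m. Suc (time_cost i)) \<le> (\<Sum>i<m. 20 + size_at i * (150 * Y))" by (rule sum_mono) (rule tc)
  moreover have "(\<Sum>i<m. 20 + size_at i * (150 * Y)) = m * 20 + (\<Sum>i<m. size_at i) * (150 * Y)"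
    by (simp add: sum.distrib sum_distrib_right)
  ultimately have "(\<Sum>i<m. Suc (time_cost i)) \<le> m * 20 + (m + m * nmax) * (150 * Y)" by linarith
  then have "main_cost \<le> 14 + m * 20 + (m + m * nmax) * (150 * Y)" unfolding main_cost_def csize.simps using c(6) by linarith
  also have "\<dots> \<le> 1000 * (m * (1 + nmax) * Y)"
  proof -
    have "m * 1 \<le> m * Y" using Y1 by (rule mult_le_mono2)
    moreover define a b where "a = m * Y" and "b = m * nmax * Y"
    ultimately have "m * 1 \<le> a" by (simp only:)
    then have h: "14 + m * 20 \<le> 34 * a" using m1 by linarith
    have e: "(m + m * nmax) * (150 * Y) = 150 * a + 150 * b" "m * (1 + nmax) * Y = a + b"
      by (simp_all add: a_def b_def algebra_simps)
    show ?thesis unfolding e using h by simp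
  qed
  finally show ?thesis unfolding Y_def by (simp only: mult.assoc)
qed

lemma (in prog) program_runs:
  assumes h: "\<mu> 0 = m" "\<mu> 1 = w" "\<mu> 2 = Suc K" "\<mu> 4 = nV" "B = 5 + 4 * m + nV * K"
    and inp: "input \<mu>" and z: "\<And>x. B \<le> x \<Longrightarrow> \<mu> x = 0"
    and R: "passes \<Longrightarrow> run W B Z m w src dst lo hi K nV dg nmax ll"
  shows "runs W program (\<lambda>_. 0) \<mu> (3002 * (m * (1 + nmax) * (1 + dg) * (ll + 2))) (\<lambda>\<rho>' \<mu>'. \<rho>' 0 = (if passes \<and> St m \<noteq> {} then 1 else 0))"
proof -
  define Y where "Y = m * (1 + nmax) * (1 + dg) * (ll + 2)"
  have Y1: "1 \<le> Y" using m1 by (simp add: Y_def)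
  have "runs W (Cond (Eq 29 8) main_code (Const 0 0)) \<rho> \<mu>1 (Suc (1000 * Y)) (\<lambda>\<rho>' \<mu>'. \<rho>' 0 = (if passes \<and> St m \<noteq> {} then 1 else 0))"
    if c: "check_inv m \<rho> \<mu>1" for \<rho> \<mu>1
  proof (rule runs_Cond)
    note e = check_inv_end[OF c]
    assume "tst (Eq 29 8) \<rho>"
    then have "(if passes then 1 else 0) = (1::nat)" unfolding tst.simps e(4) regsD(6)[OF e(1)] .
    then have p: passes by (cases passes) simp_all
    interpret run W B Z m w src dst lo hi K nV dg nmax ll by (rule R[OF p])
    have h: "input \<mu>1" "stat \<mu>1" "\<And>e. e < m \<Longrightarrow> 4 \<le> tb \<mu>1 3 e \<longleftrightarrow> crit e" using e(2) by (simp_all add: hist_ok_def)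
    show "runs W main_code \<rho> \<mu>1 (1000 * Y) (\<lambda>\<rho>' \<mu>'. \<rho>' 0 = (if passes \<and> St m \<noteq> {} then 1 else 0))"
      by (rule runs_mono[OF main_runs[OF e(1) h e(3)]]) (use main_cost_le p in \<open>simp_all add: Y_def\<close>)
  next
    note e = check_inv_end[OF c]
    assume "\<not> tst (Eq 29 8) \<rho>"
    then have "(if passes then 1 else 0) \<noteq> (1::nat)" unfolding tst.simps e(4) regsD(6)[OF e(1)] .
    then have p: "\<not> passes" by (cases passes) simp_all
    have "runs W (Const 0 0) \<rho> \<mu>1 (csize (Const 0 0)) (\<lambda>\<rho>' \<mu>'. \<rho>' 0 = (if passes \<and> St m \<noteq> {} then 1 else 0))"
      by (rule runs_loop_free) (use p in simp_all)
    then show "runs W (Const 0 0) \<rho> \<mu>1 (1000 * Y) (\<lambda>\<rho>' \<mu>'. \<rho>' 0 = (if passes \<and> St m \<noteq> {} then 1 else 0))"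
      by (rule runs_mono) (use Y1 in simp_all)
  qed
  from runs_Seq[OF prep_runs[OF h inp z] this]
  have r: "runs W program (\<lambda>_. 0) \<mu> (prep_cost + Suc (1000 * Y)) (\<lambda>\<rho>' \<mu>'. \<rho>' 0 = (if passes \<and> St m \<noteq> {} then 1 else 0))"
    unfolding program_def .
  have "m * (1 + dg) * 1 \<le> m * (1 + dg) * ((1 + nmax) * (ll + 2))" by (rule mult_le_mono2) simp
  then have "m * (1 + dg) \<le> Y" by (simp add: Y_def algebra_simps)
  then have "prep_cost + Suc (1000 * Y) \<le> 3002 * Y" using prep_cost_le Y1 by linarith
  then show ?thesis unfolding Y_def[symmetric] by (rule runs_mono[OF r])
qed

section \<open>Estimates\<close>

lemma blocks_bounds:
  fixes w K r :: nat
  assumes r: "r = (w - 2 + K) div Suc K"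
  shows "w \<le> 2 + r * Suc K" "Suc r * Suc K \<le> Suc (w + 2 * K)" "1 \<le> K \<Longrightarrow> real (Suc r) \<le> real w / real K + 2"
proof -
  have "w - 2 + K < r * Suc K + Suc K" unfolding r using dividend_less_div_times[of "Suc K" "w - 2 + K"] by simp
  then show "w \<le> 2 + r * Suc K" by simp
  have le: "r * Suc K \<le> w - 2 + K" unfolding r by (rule div_times_less_eq_dividend)
  then show b: "Suc r * Suc K \<le> Suc (w + 2 * K)" by simp
  assume K: "1 \<le> K"
  have "r * K \<le> r * Suc K" by simp
  then have "Suc r * K \<le> w + 2 * K" using le by simp
  then have "real (Suc r) * real K \<le> real w + 2 * real K" by (metis of_nat_add of_nat_le_iff of_nat_mult of_nat_numeral)
  then show "real (Suc r) \<le> real w / real K + 2" using K by (simp add: field_simps)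
qed

lemma saving_le:
  fixes L w q s r :: nat and \<rho> :: real
  assumes "real (L - q) \<le> \<rho> * real L" "s \<le> r"
  shows "real (L ^ (r - s) * (L - q) ^ s) \<le> real L ^ r * \<rho> ^ s"
proof -
  have "real (L - q) ^ s \<le> (\<rho> * real L) ^ s" using assms(1) by (intro power_mono) auto
  then have "real L ^ (r - s) * real (L - q) ^ s \<le> real L ^ (r - s) * (\<rho> * real L) ^ s" by (intro mult_left_mono) auto
  also have "\<dots> = real L ^ (r - s + s) * \<rho> ^ s" by (simp add: power_mult_distrib power_add)
  finally show ?thesis using assms(2) by simp
qed

lemma quarter_le: "4 \<le> w \<Longrightarrow> real w / 8 \<le> real (w div 4)"
proof -
  assume "4 \<le> w"
  then have "w \<le> 8 * (w div 4)" by presburger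
  then have "real w \<le> real (8 * (w div 4))" by (rule of_nat_mono)
  then show ?thesis by simp
qed

lemma div_lower: "0 < d \<Longrightarrow> real w / real d - 1 \<le> real (w div d)"
proof -
  assume "0 < d"
  then have "w < (w div d + 1) * d" using dividend_less_div_times[of d w] by (simp add: algebra_simps)
  then have "real w < real ((w div d + 1) * d)" by (simp only: of_nat_less_iff)
  then have "real w < (real (w div d) + 1) * real d" by (simp add: algebra_simps)
  then have "real w / real d < real (w div d) + 1" using \<open>0 < d\<close> by (simp add: pos_divide_less_eq)
  then show ?thesis by simp
qed

lemma estimate_long:
  fixes K w N :: nat
  assumes K: "1 \<le> K" and w: "1 \<le> w" and big: "400 * (real K * log 2 (2 * real w)) \<le> real w"
    and r: "r = (w - 2 + K) div Suc K" and s: "s = w div (4 * Suc K)"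
    and N: "N \<le> max ((2 * w - 1) ^ (Suc r - s) * (2 * w - 1 - w div 4) ^ s) ((2 * w - 1) ^ (3 * w div (4 * Suc K) + 2))"
  shows "real N * real w \<le> real (2 * w - 1) powr (real w / real K + 1)"
proof -
  define L where "L = 2 * w - 1"
  define y where "y = log 2 (2 * real w)"
  define X where "X = real w / real K"
  have Lw: "w \<le> L" "1 \<le> L" "real L \<le> 2 * real w" using w by (auto simp: L_def)
  have y1: "1 \<le> y" using w by (simp add: y_def le_log_iff)
  have Ky: "real K \<le> real K * y" using K y1 by simp
  have X400: "400 * y \<le> X" using big K by (simp add: X_def y_def field_simps)
  have w400: "400 * real K \<le> real w" using big Ky by (simp add: y_def)
  have w4: "4 \<le> w" using w400 K by linarith
  have Lpos: "1 \<le> real L" using Lw by simp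
  have sr: "s \<le> Suc r"
  proof -
    have "s * Suc K \<le> w" unfolding s by (metis div_mult2_eq div_times_less_eq_dividend div_le_dividend le_trans mult.commute mult_le_mono1)
    moreover have "w \<le> 2 + r * Suc K" by (rule blocks_bounds[OF r])
    ultimately have "s * Suc K \<le> Suc r * Suc K" using K by simp
    then show ?thesis by (rule mult_right_le_imp_le) simp
  qed
  have "real N * real w \<le> real L powr (X + 1)" if late: "N \<le> L ^ (Suc r - s) * (L - w div 4) ^ s"
  proof -
    have "real L / 16 \<le> real (w div 4)" using quarter_le[OF w4] Lw(3) by linarith
    moreover have "w div 4 \<le> L" using Lw(1) by simp
    ultimately have rho: "real (L - w div 4) \<le> 15 / 16 * real L" by (simp add: of_nat_diff)
    have "real N \<le> real (L ^ (Suc r - s) * (L - w div 4) ^ s)" using late by (rule of_nat_mono)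
    also have "\<dots> \<le> real L ^ Suc r * (15 / 16) ^ s" by (rule saving_le[OF rho sr])
    finally have n1: "real N \<le> real L ^ Suc r * (15 / 16) ^ s" .
    have "real L ^ Suc r = real L powr real (Suc r)" using Lpos by (subst powr_realpow) auto
    also have "\<dots> \<le> real L powr (X + 1 + 1)" using blocks_bounds(3)[OF r K] Lpos by (intro powr_mono) (auto simp: X_def)
    also have "\<dots> = real L powr (X + 1) * real L" using Lpos by (subst powr_add) auto
    finally have n2: "real L ^ Suc r \<le> real L powr (X + 1) * real L" .
    have s22: "22 * y \<le> real s"
    proof -
      have "real w / real (4 * Suc K) - 1 \<le> real s" unfolding s by (rule div_lower) simp
      moreover have "real w / (8 * real K) \<le> real w / real (4 * Suc K)" using K by (intro divide_left_mono) auto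
      moreover have "real w / (8 * real K) = X / 8" by (simp add: X_def)
      ultimately show ?thesis using X400 y1 by linarith
    qed
    have "(15 / 16 :: real) ^ s = (15 / 16) powr real s" by (simp add: powr_realpow)
    also have "\<dots> \<le> (15 / 16) powr (22 * y)" using s22 by (intro powr_mono') auto
    also have "\<dots> = ((15 / 16) powr 22) powr y" by (rule powr_powr[symmetric])
    also have "(15 / 16 :: real) powr 22 = (15 / 16) ^ 22" using powr_realpow[of "15/16" 22] by simp
    also have "((15 / 16 :: real) ^ 22) powr y \<le> (1 / 4) powr y" using y1 by (intro powr_mono2) (auto simp: power_divide)
    also have "(1 / 4 :: real) powr y = inverse (2 powr y) ^ 2"
    proof -
      have "(1 / 4 :: real) powr y = ((1 / 2) * (1 / 2)) powr y" by simp
      also have "\<dots> = (1 / 2) powr y * (1 / 2) powr y" by (rule powr_mult)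
      also have "(1 / 2 :: real) powr y = inverse (2 powr y)" by (simp add: powr_divide inverse_eq_divide)
      finally show ?thesis by (simp add: power2_eq_square)
    qed
    also have "2 powr y = 2 * real w" using w by (simp add: y_def)
    finally have n3: "(15 / 16 :: real) ^ s \<le> inverse (2 * real w) ^ 2" .
    have "real N * real w \<le> (real L powr (X + 1) * real L * inverse (2 * real w) ^ 2) * real w"
    proof (rule mult_right_mono)
      show "real N \<le> real L powr (X + 1) * real L * inverse (2 * real w) ^ 2"
        by (rule order_trans[OF n1 mult_mono[OF n2 n3]]) auto
    qed simp
    also have "\<dots> = real L powr (X + 1) * (real L * real w * inverse (2 * real w) ^ 2)" by simp
    also have "\<dots> \<le> real L powr (X + 1) * 1"
    proof (rule mult_left_mono)
      have "real L * real w \<le> (2 * real w) * (2 * real w)" using Lw(3) by (intro mult_mono) auto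
      then show "real L * real w * inverse (2 * real w) ^ 2 \<le> 1" using w by (simp add: field_simps power2_eq_square)
    qed simp
    finally show ?thesis by simp
  qed
  moreover have "real N * real w \<le> real L powr (X + 1)" if early: "N \<le> L ^ (3 * w div (4 * Suc K) + 2)"
  proof -
    have "N * w \<le> L ^ (3 * w div (4 * Suc K) + 2) * L" using early Lw(1) by (rule mult_le_mono)
    moreover have "L ^ (x + 2) * L = L ^ (x + 3)" for x by (simp add: eval_nat_numeral)
    ultimately have "N * w \<le> L ^ (3 * w div (4 * Suc K) + 3)" by (simp only:)
    then have "real (N * w) \<le> real (L ^ (3 * w div (4 * Suc K) + 3))" by (rule of_nat_mono)
    then have "real N * real w \<le> real L ^ (3 * w div (4 * Suc K) + 3)" by simp
    also have "\<dots> = real L powr real (3 * w div (4 * Suc K) + 3)" using Lpos by (subst powr_realpow) auto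
    also have "\<dots> \<le> real L powr (X + 1)"
    proof (rule powr_mono)
      have "real (3 * w div (4 * Suc K)) \<le> real (3 * w) / real (4 * Suc K)" by (rule of_nat_div_le_of_nat)
      also have "\<dots> \<le> real (3 * w) / (4 * real K)" using K by (intro divide_left_mono) auto
      also have "\<dots> = 3 * X / 4" by (simp add: X_def)
      finally show "real (3 * w div (4 * Suc K) + 3) \<le> X + 1" using X400 y1 by simp
    qed (rule Lpos)
    finally show ?thesis .
  qed
  ultimately show ?thesis using N unfolding L_def[symmetric] X_def[symmetric] by (auto simp: max_def split: if_splits)
qed

lemma eventually_nat_at_top:
  assumes "eventually P (at_top :: real filter)"
  obtains n :: nat where "\<And>w. n \<le> w \<Longrightarrow> P (real w)"
proof -
  have "eventually (\<lambda>w. P (real w)) sequentially" using assms filterlim_real_sequentially by (rule eventually_compose_filterlim)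
  then show ?thesis using that unfolding eventually_sequentially by blast
qed

lemma estimate_alphabet:
  fixes S :: nat
  shows "\<exists>w0 :: nat. \<forall>\<sigma> K w :: nat. 2 \<le> \<sigma> \<longrightarrow> \<sigma> \<le> S \<longrightarrow> 1 \<le> K \<longrightarrow> \<sigma> ^ K \<le> 2 * w - 1 \<longrightarrow> w0 \<le> w \<longrightarrow> w \<le> \<sigma> ^ Suc K \<longrightarrow>
      4 * Suc K \<le> w \<and> (\<forall>r s N. r = (w - 2 + K) div Suc K \<longrightarrow> s = w div (4 * Suc K) \<longrightarrow>
      N \<le> max ((\<sigma> ^ Suc K) ^ (Suc r - s) * (\<sigma> ^ Suc K - w div 4) ^ s) ((\<sigma> ^ Suc K) ^ (3 * w div (4 * Suc K) + 2)) \<longrightarrow>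
      real N * real w \<le> real \<sigma> ^ (w + K))"
proof (cases "2 \<le> S")
  case False
  then show ?thesis by auto
next
  case True
  define \<rho> where "\<rho> = 1 - 1 / (16 * real S)"
  define c where "c = - ln \<rho>"
  have rho: "0 < \<rho>" "\<rho> < 1" using True by (auto simp: \<rho>_def field_simps)
  have c: "0 < c" using rho by (simp add: c_def ln_less_zero)
  have e1: "eventually (\<lambda>x::real. 4 * (log 2 (2 * x) + 1) \<le> x) at_top" by real_asymp
  have l2: "((\<lambda>x::real. 2 * real S * x * x * exp (- c * (x / (4 * (log 2 (2 * x) + 1)) - 1))) \<longlongrightarrow> 0) at_top"
    using c by real_asymp
  have e2: "eventually (\<lambda>x::real. 2 * real S * x * x * exp (- c * (x / (4 * (log 2 (2 * x) + 1)) - 1)) < 1) at_top"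
    by (rule order_tendstoD(2)[OF l2]) simp
  have l3: "((\<lambda>x::real. x * (2 * x) * real S ^ 2 * 2 powr (- x / 4)) \<longlongrightarrow> 0) at_top" by real_asymp
  have e3: "eventually (\<lambda>x::real. x * (2 * x) * real S ^ 2 * 2 powr (- x / 4) < 1) at_top"
    by (rule order_tendstoD(2)[OF l3]) simp
  have e4: "eventually (\<lambda>x::real. 4 \<le> x) at_top" by (rule eventually_ge_at_top)
  obtain w0 :: nat where w0: "\<And>w. w0 \<le> w \<Longrightarrow> 4 * (log 2 (2 * real w) + 1) \<le> real w \<and>
      2 * real S * real w * real w * exp (- c * (real w / (4 * (log 2 (2 * real w) + 1)) - 1)) < 1 \<and>
      real w * (2 * real w) * real S ^ 2 * 2 powr (- real w / 4) < 1 \<and> 4 \<le> real w"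
    by (rule eventually_nat_at_top[OF eventually_conj[OF e1 eventually_conj[OF e2 eventually_conj[OF e3 e4]]]]) blast
  have Klog: "real K \<le> log 2 (2 * real w)" if "2 \<le> \<sigma>" "\<sigma> ^ K \<le> 2 * w - 1" "w0 \<le> w" for \<sigma> K w :: nat
  proof -
    have "2 ^ K \<le> \<sigma> ^ K" using that(1) by (rule power_mono) simp
    then have "2 ^ K \<le> 2 * w" using that(2) by linarith
    then have "real (2 ^ K) \<le> real (2 * w)" by (rule of_nat_mono)
    then show ?thesis using w0[OF that(3)] by (simp add: le_log_iff powr_realpow)
  qed
  have K4: "4 * Suc K \<le> w" if "2 \<le> \<sigma>" "\<sigma> ^ K \<le> 2 * w - 1" "w0 \<le> w" for \<sigma> K w :: nat
  proof -
    have "real (4 * Suc K) \<le> real w" using Klog[OF that] w0[OF that(3)] by simp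
    then show ?thesis by (simp only: of_nat_le_iff)
  qed
  show ?thesis
  proof (intro exI[of _ w0] allI impI conjI)
    fix \<sigma> K w :: nat
    assume \<sigma>: "2 \<le> \<sigma>" "\<sigma> \<le> S" and K: "1 \<le> K" and L: "\<sigma> ^ K \<le> 2 * w - 1" and w: "w0 \<le> w" and wM: "w \<le> \<sigma> ^ Suc K"
    show "4 * Suc K \<le> w" by (rule K4[OF \<sigma>(1) L w])
    fix r s N
    assume r: "r = (w - 2 + K) div Suc K" and s: "s = w div (4 * Suc K)"
      and N: "N \<le> max ((\<sigma> ^ Suc K) ^ (Suc r - s) * (\<sigma> ^ Suc K - w div 4) ^ s) ((\<sigma> ^ Suc K) ^ (3 * w div (4 * Suc K) + 2))"
    define M where "M = \<sigma> ^ Suc K"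
    define T where "T = real \<sigma> ^ (w + K)"
    have W: "4 * (log 2 (2 * real w) + 1) \<le> real w" "2 * real S * real w * real w * exp (- c * (real w / (4 * (log 2 (2 * real w) + 1)) - 1)) < 1"
      "real w * (2 * real w) * real S ^ 2 * 2 powr (- real w / 4) < 1" "4 \<le> w" using w0[OF w] by auto
    have "real (\<sigma> ^ K) \<le> real (2 * w)" using L by (intro of_nat_mono) simp
    then have sK: "real \<sigma> ^ K \<le> 2 * real w" by simp
    have MS: "real M \<le> 2 * real S * real w"
    proof -
      have "real M = real \<sigma> * real \<sigma> ^ K" by (simp add: M_def)
      also have "\<dots> \<le> real S * (2 * real w)" using \<sigma> sK by (intro mult_mono) auto
      finally show ?thesis by simp
    qed
    have T0: "0 \<le> T" by (simp add: T_def)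
    have "real N * real w \<le> T" if late: "N \<le> M ^ (Suc r - s) * (M - w div 4) ^ s"
    proof -
      have sr: "s \<le> Suc r"
      proof -
        have "s * Suc K \<le> w" unfolding s by (metis div_mult2_eq div_times_less_eq_dividend div_le_dividend le_trans mult.commute mult_le_mono1)
        moreover have "w \<le> 2 + r * Suc K" by (rule blocks_bounds[OF r])
        ultimately have "s * Suc K \<le> Suc r * Suc K" using K by simp
        then show ?thesis by (rule mult_right_le_imp_le) simp
      qed
      have "real M / (16 * real S) \<le> real w / 8" using MS True by (simp add: field_simps)
      then have "real M / (16 * real S) \<le> real (w div 4)" using quarter_le[OF W(4)] by linarith
      moreover have "w div 4 \<le> M" using wM unfolding M_def by linarith
      ultimately have "real (M - w div 4) \<le> \<rho> * real M" by (simp add: of_nat_diff \<rho>_def algebra_simps)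
      from saving_le[OF this sr] have n1: "real N \<le> real M ^ Suc r * \<rho> ^ s"
        using late by (meson of_nat_mono order_trans)
      have "real M ^ Suc r = real \<sigma> ^ (Suc K * Suc r)" unfolding M_def of_nat_power by (rule power_mult[symmetric])
      also have "\<dots> \<le> real \<sigma> ^ (w + K + K + 1)" using blocks_bounds(2)[OF r] \<sigma> by (intro power_increasing) (auto simp: mult.commute)
      also have "\<dots> = T * real \<sigma> ^ K * real \<sigma>" by (simp add: T_def power_add)
      also have "\<dots> \<le> T * (2 * real w) * real S" using sK \<sigma> T0 by (intro mult_mono) auto
      finally have n2: "real M ^ Suc r \<le> T * (2 * real w) * real S" .
      define z where "z = real w / (4 * (log 2 (2 * real w) + 1)) - 1"
      have kl: "real K \<le> log 2 (2 * real w)" by (rule Klog[OF \<sigma>(1) L w])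
      have "real w / (4 * (log 2 (2 * real w) + 1)) \<le> real w / real (4 * Suc K)"
        using kl by (intro divide_left_mono mult_pos_pos) auto
      moreover have "real w / real (4 * Suc K) - 1 \<le> real s" unfolding s by (rule div_lower) simp
      ultimately have zs: "z \<le> real s" unfolding z_def by linarith
      have "\<rho> ^ s = \<rho> powr real s" using rho by (simp add: powr_realpow)
      also have "\<dots> \<le> \<rho> powr z" using zs rho by (intro powr_mono') auto
      also have "\<dots> = exp (- c * z)" using rho by (simp add: powr_def c_def mult.commute)
      finally have n3: "\<rho> ^ s \<le> exp (- c * z)" .
      have "real N * real w \<le> (T * (2 * real w) * real S * exp (- c * z)) * real w"
      proof (rule mult_right_mono)
        show "real N \<le> T * (2 * real w) * real S * exp (- c * z)"
          by (rule order_trans[OF n1 mult_mono[OF n2 n3]]) (use T0 rho in auto)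
      qed simp
      also have "\<dots> = T * (2 * real S * real w * real w * exp (- c * z))" by simp
      also have "\<dots> \<le> T * 1" using W(2) T0 unfolding z_def by (intro mult_left_mono) auto
      finally show ?thesis by simp
    qed
    moreover have "real N * real w \<le> T" if early: "N \<le> M ^ (3 * w div (4 * Suc K) + 2)"
    proof -
      define u where "u = 3 * w div (4 * Suc K)"
      have s1: "1 \<le> real \<sigma>" using \<sigma> by simp
      have "real N \<le> real M ^ (u + 2)" using early unfolding u_def by (metis of_nat_mono of_nat_power)
      also have "\<dots> = real \<sigma> ^ (Suc K * (u + 2))" unfolding M_def of_nat_power by (rule power_mult[symmetric])
      also have "\<dots> = real \<sigma> powr real (Suc K * (u + 2))" using s1 by (subst powr_realpow) auto
      also have "\<dots> \<le> real \<sigma> powr (real (w + K) + real K + 2 - real w / 4)"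
      proof (rule powr_mono)
        have "u * (4 * Suc K) \<le> 3 * w" unfolding u_def by (rule div_times_less_eq_dividend)
        then have "real (u * (4 * Suc K)) \<le> real (3 * w)" by (rule of_nat_mono)
        then show "real (Suc K * (u + 2)) \<le> real (w + K) + real K + 2 - real w / 4" by (simp add: algebra_simps)
      qed (rule s1)
      also have "\<dots> = real \<sigma> powr real (w + K) * (real \<sigma> powr real K) * (real \<sigma> powr 2) * real \<sigma> powr (- real w / 4)"
        by (simp only: powr_add[symmetric]) (simp add: add_ac)
      also have "\<dots> = T * real \<sigma> ^ K * real \<sigma> ^ 2 * real \<sigma> powr (- real w / 4)"
      proof -
        have p: "real \<sigma> powr real x = real \<sigma> ^ x" for x using s1 by (simp add: powr_realpow)
        show ?thesis using p[of 2] unfolding T_def p by simp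
      qed
      also have "\<dots> \<le> T * (2 * real w) * real S ^ 2 * 2 powr (- real w / 4)"
        using sK \<sigma> T0 by (intro mult_mono powr_mono2' power_mono) auto
      finally have "real N * real w \<le> T * (2 * real w) * real S ^ 2 * 2 powr (- real w / 4) * real w" by (rule mult_right_mono) simp
      also have "\<dots> = T * (real w * (2 * real w) * real S ^ 2 * 2 powr (- real w / 4))" by simp
      also have "\<dots> \<le> T * 1" using W(3) T0 by (intro mult_left_mono) auto
      finally show ?thesis by simp
    qed
    ultimately show "real N * real w \<le> real \<sigma> ^ (w + K)" using N unfolding M_def[symmetric] T_def[symmetric]
      by (auto simp: max_def split: if_splits)
  qed
qed

lemma estimate_short:
  "\<exists>C::real. 0 \<le> C \<and> (\<forall>K w wn b D :: nat. 1 \<le> K \<longrightarrow> 1 \<le> w \<longrightarrow> real w < 400 * (real K * log 2 (2 * real w)) \<longrightarrow>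
      wn = (6 * w + K) div (K div 8 + 1) + 1 \<longrightarrow> 2 ^ b \<le> 2 * wn \<longrightarrow> D = 12 * wn * b \<longrightarrow>
      real ((D + 3) ^ (D + 1)) \<le> C * real (2 * w - 1) powr (real w / real K))"
proof -
  define d :: "real \<Rightarrow> real" where "d x = 12 * (48 * x + 9) * (log 2 (48 * x + 9) + 1)" for x
  have "filterlim (\<lambda>x::real. x * ((x / 400 - 1) * ln 2) - (d x + 1) * ln (d x + 3)) at_top at_top"
    unfolding d_def by real_asymp
  then have "eventually (\<lambda>x::real. 0 \<le> x * ((x / 400 - 1) * ln 2) - (d x + 1) * ln (d x + 3)) at_top"
    unfolding filterlim_at_top by (rule spec)
  then obtain X0' where X0': "\<And>x. X0' \<le> x \<Longrightarrow> (d x + 1) * ln (d x + 3) \<le> x * ((x / 400 - 1) * ln 2)"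
    unfolding eventually_at_top_linorder by auto
  define X0 where "X0 = max X0' 0"
  have dmono: "d x \<le> d y" if "0 \<le> x" "x \<le> y" for x y
    unfolding d_def using that by (intro mult_mono add_mono) auto
  have d0: "0 \<le> d x" if "0 \<le> x" for x unfolding d_def using that by (intro mult_nonneg_nonneg add_nonneg_nonneg) auto
  define C where "C = max 1 ((d X0 + 3) powr (d X0 + 1))"
  show ?thesis
  proof (intro exI[of _ C] conjI allI impI)
    show "0 \<le> C" by (simp add: C_def)
    fix K w wn b D :: nat
    assume K: "1 \<le> K" and w: "1 \<le> w" and small: "real w < 400 * (real K * log 2 (2 * real w))"
      and wn: "wn = (6 * w + K) div (K div 8 + 1) + 1" and b: "2 ^ b \<le> 2 * wn" and D: "D = 12 * wn * b"
    define x where "x = real w / real K"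
    have x0: "0 \<le> x" by (simp add: x_def)
    have wnx: "real wn \<le> 48 * x + 9"
    proof -
      have K8: "real K / 8 \<le> real (K div 8 + 1)" using div_lower[of 8 K] by simp
      have "real wn \<le> real (6 * w + K) / real (K div 8 + 1) + 1" unfolding wn using of_nat_div_le_of_nat[of "6 * w + K" "K div 8 + 1", where ?'a = real] by simp
      also have "\<dots> \<le> real (6 * w + K) / (real K / 8) + 1" using K K8 by (intro add_mono divide_left_mono) auto
      also have "\<dots> = 48 * x + 9" using K by (simp add: x_def field_simps)
      finally show ?thesis .
    qed
    have wn1: "1 \<le> wn" by (simp add: wn)
    have bx: "real b \<le> log 2 (48 * x + 9) + 1"
    proof -
      have "real (2 ^ b) \<le> real (2 * wn)" using b by (rule of_nat_mono)
      then have "2 powr real b \<le> 2 * real wn" by (simp add: powr_realpow)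
      then have "real b \<le> log 2 (2 * real wn)" using wn1 by (simp add: le_log_iff)
      also have "\<dots> = log 2 (real wn) + 1" using wn1 by (simp add: log_mult)
      also have "\<dots> \<le> log 2 (48 * x + 9) + 1" using wnx wn1 by simp
      finally show ?thesis .
    qed
    have "real D \<le> d x" unfolding D d_def of_nat_mult of_nat_numeral using wnx bx x0 by (intro mult_mono) auto
    have "real ((D + 3) ^ (D + 1)) = (real D + 3) powr (real D + 1)"
      using powr_realpow[of "real D + 3" "D + 1"] by (simp add: add.commute)
    also have "\<dots> \<le> (d x + 3) powr (real D + 1)" using \<open>real D \<le> d x\<close> by (intro powr_mono2) auto
    also have "\<dots> \<le> (d x + 3) powr (d x + 1)" using \<open>real D \<le> d x\<close> d0[OF x0] by (intro powr_mono) auto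
    finally have lhs: "real ((D + 3) ^ (D + 1)) \<le> (d x + 3) powr (d x + 1)" .
    have L1: "1 \<le> real (2 * w - 1)" using w by simp
    show "real ((D + 3) ^ (D + 1)) \<le> C * real (2 * w - 1) powr (real w / real K)"
    proof (cases "x \<le> X0")
      case True
      have "(d x + 3) powr (d x + 1) \<le> (d X0 + 3) powr (d x + 1)" using dmono[OF x0 True] d0[OF x0] by (intro powr_mono2) auto
      also have "\<dots> \<le> (d X0 + 3) powr (d X0 + 1)" using dmono[OF x0 True] d0[OF x0] by (intro powr_mono) auto
      also have "\<dots> \<le> C * 1" by (simp add: C_def)
      also have "\<dots> \<le> C * real (2 * w - 1) powr (real w / real K)"
        using L1 by (intro mult_left_mono ge_one_powr_ge_zero) (auto simp: C_def)
      finally show ?thesis using lhs by simp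
    next
      case False
      then have "X0' \<le> x" by (simp add: X0_def)
      note h = X0'[OF this]
      have wl: "x / 400 \<le> log 2 (2 * real w)" using small K by (simp add: x_def field_simps)
      have "(x / 400 - 1) * ln 2 \<le> ln (real w)"
      proof -
        have "log 2 (2 * real w) = 1 + log 2 (real w)" using w by (simp add: log_mult)
        then have "x / 400 - 1 \<le> log 2 (real w)" using wl by simp
        then have "(x / 400 - 1) * ln 2 \<le> log 2 (real w) * ln 2" by (rule mult_right_mono) simp
        then show ?thesis by (simp add: log_def)
      qed
      also have "\<dots> \<le> ln (real (2 * w - 1))" using w by simp
      finally have "x * ((x / 400 - 1) * ln 2) \<le> x * ln (real (2 * w - 1))" by (rule mult_left_mono) (rule x0)
      then have "(d x + 1) * ln (d x + 3) \<le> x * ln (real (2 * w - 1))" using h by linarith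
      then have "exp ((d x + 1) * ln (d x + 3)) \<le> exp (x * ln (real (2 * w - 1)))" by simp
      then have "(d x + 3) powr (d x + 1) \<le> real (2 * w - 1) powr x" using d0[OF x0] w by (simp add: powr_def)
      also have "\<dots> \<le> C * real (2 * w - 1) powr x" by (simp add: C_def mult_le_cancel_right1)
      finally show ?thesis using lhs by (simp add: x_def)
    qed
  qed
qed

lemma powr_alphabet:
  assumes "1 \<le> \<sigma>" "1 \<le> K"
  shows "real (\<sigma> ^ K) powr (real w / real K + 1) = real \<sigma> ^ (w + K)"
proof -
  have "real (\<sigma> ^ K) powr (real w / real K + 1) = real \<sigma> powr (real K * (real w / real K + 1))"
    using assms by (simp add: powr_realpow[symmetric] powr_powr)
  also have "real K * (real w / real K + 1) = real (w + K)" using assms by (simp add: field_simps)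
  finally show ?thesis using assms by (simp only: powr_realpow of_nat_0_less_iff)
qed

text \<open>What the counting of states provides, for an alphabet of size \<open>\<sigma>\<close> and words of length \<open>K + 1\<close>:
  \<open>n\<close> bounds the number of states and \<open>l\<close> the length of a stack.\<close>

locale state_counts =
  fixes \<sigma> K w n l D b wn r s :: nat
  assumes \<sigma>1: "1 \<le> \<sigma>" and K1: "1 \<le> K" and w1: "1 \<le> w" and w_le: "w \<le> \<sigma> ^ Suc K"
    and r: "r = (w - 2 + K) div Suc K" and s: "s = w div (4 * Suc K)"
    and n_pow: "\<And>L. L = 2 * w - 1 \<or> L = \<sigma> ^ Suc K \<Longrightarrow> n \<le> L ^ Suc r"
    and n_saving: "\<And>L. L = 2 * w - 1 \<or> L = \<sigma> ^ Suc K \<Longrightarrow> 4 * Suc K \<le> w \<Longrightarrow>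
        n \<le> max (L ^ (Suc r - s) * (L - w div 4) ^ s) (L ^ (3 * w div (4 * Suc K) + 2))"
    and n_crit: "n \<le> 2 * w * (D + 1) ^ D" and l_le: "l \<le> w" "l \<le> D + 1"
    and wn: "wn = (6 * w + K) div (K div 8 + 1) + 1" and b: "2 ^ b \<le> 2 * wn" and D: "D = 12 * wn * b"
begin

lemma n_square: "real n \<le> (real (min (\<sigma> ^ K) (2 * w - 1)) powr (real w / real K + 1)) ^ 2"
proof (cases "\<sigma> ^ K \<le> 2 * w - 1")
  case True
  have "Suc K * Suc r \<le> 2 * (w + K)" using blocks_bounds(2)[OF r] w1 by (simp add: mult.commute)
  have "real n \<le> real ((\<sigma> ^ Suc K) ^ Suc r)" using n_pow by (intro of_nat_mono) simp
  also have "\<dots> = real \<sigma> ^ (Suc K * Suc r)" by (simp only: of_nat_power power_mult)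
  also have "\<dots> \<le> real \<sigma> ^ (2 * (w + K))" using \<sigma>1 \<open>Suc K * Suc r \<le> 2 * (w + K)\<close> by (intro power_increasing) auto
  also have "\<dots> = (real \<sigma> ^ (w + K)) ^ 2" by (simp only: power_mult[symmetric] mult.commute)
  finally show ?thesis using True powr_alphabet[OF \<sigma>1 K1] by simp
next
  case False
  have L1: "1 \<le> real (2 * w - 1)" using w1 by simp
  have "real n \<le> real ((2 * w - 1) ^ Suc r)" using n_pow by (intro of_nat_mono) simp
  also have "\<dots> = real (2 * w - 1) powr real (Suc r)" using L1 by (simp only: of_nat_power powr_realpow)
  also have "\<dots> \<le> real (2 * w - 1) powr (2 * (real w / real K + 1))"
  proof (rule powr_mono)
    have e: "x + 2 \<le> 2 * (x + 1)" if "0 \<le> x" for x :: real using that by simp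
    show "real (Suc r) \<le> 2 * (real w / real K + 1)" by (rule order_trans[OF blocks_bounds(3)[OF r K1] e]) simp
  qed (rule L1)
  also have "\<dots> = (real (2 * w - 1) powr (real w / real K + 1)) ^ 2" by (simp only: power2_eq_square powr_add[symmetric] mult_2)
  finally show ?thesis using False by (simp add: min_def)
qed

lemma n_small: "w \<le> W \<Longrightarrow> n \<le> (2 * W) ^ (W + 2)"
proof -
  assume W: "w \<le> W"
  have "Suc r * Suc K \<le> (w + 2) * Suc K" using blocks_bounds(2)[OF r] by simp
  then have "Suc r \<le> w + 2" by (rule mult_right_le_imp_le) simp
  then have e: "Suc r \<le> W + 2" using W by simp
  have "n \<le> (2 * w - 1) ^ Suc r" using n_pow by simp
  also have "\<dots> \<le> (2 * W) ^ Suc r" using W by (intro power_mono) auto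
  also have "\<dots> \<le> (2 * W) ^ (W + 2)" using e W w1 by (intro power_increasing) auto
  finally show ?thesis .
qed

end

lemma estimate:
  fixes S :: nat
  shows "\<exists>C::real. 0 \<le> C \<and> (\<forall>\<sigma> K w n l D b wn r s. state_counts \<sigma> K w n l D b wn r s \<longrightarrow> \<sigma> \<le> S \<longrightarrow>
      real ((1 + n) * (l + 2)) \<le> C * real (min (\<sigma> ^ K) (2 * w - 1)) powr (real w / real K + 1))"
proof -
  obtain C1 :: real where C1: "0 \<le> C1" and short: "\<forall>K w wn b D :: nat. 1 \<le> K \<longrightarrow> 1 \<le> w \<longrightarrow> real w < 400 * (real K * log 2 (2 * real w)) \<longrightarrow>
      wn = (6 * w + K) div (K div 8 + 1) + 1 \<longrightarrow> 2 ^ b \<le> 2 * wn \<longrightarrow> D = 12 * wn * b \<longrightarrow>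
      real ((D + 3) ^ (D + 1)) \<le> C1 * real (2 * w - 1) powr (real w / real K)"
    using estimate_short by (elim exE conjE)
  obtain w0 :: nat where alphabet: "\<forall>\<sigma> K w :: nat. 2 \<le> \<sigma> \<longrightarrow> \<sigma> \<le> S \<longrightarrow> 1 \<le> K \<longrightarrow> \<sigma> ^ K \<le> 2 * w - 1 \<longrightarrow> w0 \<le> w \<longrightarrow> w \<le> \<sigma> ^ Suc K \<longrightarrow>
      4 * Suc K \<le> w \<and> (\<forall>r s N. r = (w - 2 + K) div Suc K \<longrightarrow> s = w div (4 * Suc K) \<longrightarrow>
      N \<le> max ((\<sigma> ^ Suc K) ^ (Suc r - s) * (\<sigma> ^ Suc K - w div 4) ^ s) ((\<sigma> ^ Suc K) ^ (3 * w div (4 * Suc K) + 2)) \<longrightarrow>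
      real N * real w \<le> real \<sigma> ^ (w + K))"
    using estimate_alphabet[of S] by (elim exE)
  define C2 where "C2 = real ((1 + (2 * w0) ^ (w0 + 2)) * (w0 + 2))"
  define C where "C = max 6 (max (3 * C1) C2)"
  show ?thesis
  proof (intro exI[of _ C] conjI allI impI)
    show "0 \<le> C" by (simp add: C_def)
    fix \<sigma> K w n l D b wn r s
    assume "state_counts \<sigma> K w n l D b wn r s" and \<sigma>S: "\<sigma> \<le> S"
    then interpret state_counts \<sigma> K w n l D b wn r s by simp
    define lam where "lam = min (\<sigma> ^ K) (2 * w - 1)"
    define T where "T = real lam powr (real w / real K + 1)"
    have lam1: "1 \<le> lam" using \<sigma>1 w1 by (simp add: lam_def)
    have T1: "1 \<le> T" unfolding T_def using lam1 by (intro ge_one_powr_ge_zero) auto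
    define N where "N = max 1 n"
    have via_N: "real ((1 + n) * (l + 2)) \<le> C * T" if "real N * real w \<le> T"
    proof -
      have "(1 + n) * (l + 2) \<le> (2 * N) * (3 * w)" using l_le(1) w1 by (intro mult_le_mono) (auto simp: N_def)
      then have "real ((1 + n) * (l + 2)) \<le> real ((2 * N) * (3 * w))" by (rule of_nat_mono)
      then have "real ((1 + n) * (l + 2)) \<le> 6 * T" using that by simp
      also have "\<dots> \<le> C * T" using T1 by (intro mult_right_mono) (auto simp: C_def)
      finally show ?thesis .
    qed
    have N_saving: "N \<le> max (L ^ (Suc r - s) * (L - w div 4) ^ s) (L ^ (3 * w div (4 * Suc K) + 2))"
      if "L = 2 * w - 1 \<or> L = \<sigma> ^ Suc K" "4 * Suc K \<le> w" for L
    proof -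
      have "1 \<le> L" using that(1) w1 \<sigma>1 by auto
      then have "1 \<le> L ^ (3 * w div (4 * Suc K) + 2)" by (rule one_le_power)
      then show ?thesis using n_saving[OF that] unfolding N_def by linarith
    qed
    have "real ((1 + n) * (l + 2)) \<le> C * T"
    proof (cases "\<sigma> ^ K < 2 * w - 1")
      case True
      then have lamB: "lam = \<sigma> ^ K" by (simp add: lam_def)
      have TB: "T = real \<sigma> ^ (w + K)" unfolding T_def lamB by (rule powr_alphabet[OF \<sigma>1 K1])
      show ?thesis
      proof (cases "w0 \<le> w")
        case w: True
        have \<sigma>2: "2 \<le> \<sigma>"
        proof (rule ccontr)
          assume "\<not> 2 \<le> \<sigma>"
          then have "\<sigma> = 1" using \<sigma>1 by simp
          then show False using w_le True by simp
        qed
        have le: "\<sigma> ^ K \<le> 2 * w - 1" using True by simp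
        note al = alphabet[rule_format, OF \<sigma>2 \<sigma>S K1 le w w_le]
        have "real N * real w \<le> real \<sigma> ^ (w + K)"
          by (rule al[THEN conjunct2, rule_format, OF r s N_saving[OF _ al[THEN conjunct1]]]) simp
        then show ?thesis unfolding TB[symmetric] by (rule via_N)
      next
        case w: False
        then have ww: "w \<le> w0" by simp
        have "(1 + n) * (l + 2) \<le> (1 + (2 * w0) ^ (w0 + 2)) * (w0 + 2)"
          using n_small[OF ww] l_le(1) ww by (intro mult_le_mono) auto
        then have "real ((1 + n) * (l + 2)) \<le> C2" unfolding C2_def by (rule of_nat_mono)
        also have "\<dots> \<le> C * 1" by (simp add: C_def)
        also have "\<dots> \<le> C * T" using T1 by (intro mult_left_mono) (auto simp: C_def)
        finally show ?thesis .
      qed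
    next
      case False
      then have lamA: "lam = 2 * w - 1" by (simp add: lam_def)
      show ?thesis
      proof (cases "400 * (real K * log 2 (2 * real w)) \<le> real w")
        case True
        have "1 \<le> log 2 (2 * real w)" using w1 by (simp add: le_log_iff)
        then have "real K * 1 \<le> real K * log 2 (2 * real w)" by (rule mult_left_mono) simp
        then have "real (400 * K) \<le> real w" using True by simp
        then have "400 * K \<le> w" by (simp only: of_nat_le_iff)
        then have w4: "4 * Suc K \<le> w" using K1 by simp
        have "real N * real w \<le> real (2 * w - 1) powr (real w / real K + 1)"
          by (rule estimate_long[OF K1 w1 True r s N_saving[OF _ w4]]) simp
        then show ?thesis unfolding lamA[symmetric] T_def[symmetric] by (rule via_N)
      next
        case small: False
        have "(1 + n) * (l + 2) \<le> (3 * w * (D + 3) ^ D) * (D + 3)"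
        proof (rule mult_le_mono)
          have a: "(D + 1) ^ D \<le> (D + 3) ^ D" by (rule power_mono) auto
          have "1 \<le> (D + 3) ^ D" by (rule one_le_power) simp
          then have "1 * 1 \<le> w * (D + 3) ^ D" using w1 by (intro mult_le_mono)
          moreover have "2 * w * (D + 1) ^ D \<le> 2 * w * (D + 3) ^ D" using a by (rule mult_le_mono2)
          ultimately show "1 + n \<le> 3 * w * (D + 3) ^ D" using n_crit by linarith
          show "l + 2 \<le> D + 3" using l_le(2) by simp
        qed
        also have "\<dots> = 3 * w * (D + 3) ^ (D + 1)" by simp
        finally have "real ((1 + n) * (l + 2)) \<le> real (3 * w * (D + 3) ^ (D + 1))" by (rule of_nat_mono)
        also have "\<dots> = 3 * real w * real ((D + 3) ^ (D + 1))" by simp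
        also have "\<dots> \<le> 3 * real lam * (C1 * real lam powr (real w / real K))"
        proof (rule mult_mono)
          show "3 * real w \<le> 3 * real lam" using w1 lamA by simp
          show "real ((D + 3) ^ (D + 1)) \<le> C1 * real lam powr (real w / real K)"
            unfolding lamA using small by (intro short[rule_format, OF K1 w1 _ wn b D]) simp
        qed (use lam1 in auto)
        also have "\<dots> = 3 * C1 * T" using lam1 by (simp add: T_def powr_add)
        also have "\<dots> \<le> C * T" using T1 by (intro mult_right_mono) (auto simp: C_def)
        finally show ?thesis .
      qed
    qed
    then show "real ((1 + n) * (l + 2)) \<le> C * real (min (\<sigma> ^ K) (2 * w - 1)) powr (real w / real K + 1)"
      unfolding T_def lam_def .
  qed
qed

section \<open>Encoded instances\<close>

lemma position_less: "x \<in> set xs \<Longrightarrow> position xs x < length xs"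
  by (induction xs) (auto simp: position_def)

lemma nth_position: "x \<in> set xs \<Longrightarrow> xs ! position xs x = x"
  by (induction xs) (auto simp: position_def)

lemma length_concat_const: "(\<And>x. x \<in> set xs \<Longrightarrow> length (f x) = n) \<Longrightarrow> length (concat (map f xs)) = length xs * n"
  by (induction xs) auto

lemma nth_concat_const:
  "(\<And>x. x \<in> set xs \<Longrightarrow> length (f x) = n) \<Longrightarrow> i < length xs \<Longrightarrow> j < n \<Longrightarrow> concat (map f xs) ! (n * i + j) = f (xs ! i) ! j"
proof (induction xs arbitrary: i)
  case (Cons x xs)
  have fx: "length (f x) = n" using Cons.prems by simp
  show ?case
  proof (cases i)
    case 0 then show ?thesis using Cons.prems fx by (simp add: nth_append)
  next
    case (Suc i')
    have "n * i + j = n + (n * i' + j)" by (simp add: Suc)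
    then show ?thesis using Cons fx Suc by (simp add: nth_append)
  qed
qed simp

lemma ex_pcas_iff:
  "(\<exists>v. pcas u p v) \<longleftrightarrow> (p \<noteq> [] \<longrightarrow> fst (p ! 0) = u) \<and> (\<forall>i. Suc i < length p \<longrightarrow> snd (p ! i) = fst (p ! Suc i))"
proof (induction p arbitrary: u)
  case (Cons e p)
  have "(\<exists>v. pcas u (e # p) v) \<longleftrightarrow> fst e = u \<and> (\<exists>v. pcas (snd e) p v)" by auto
  also have "\<dots> \<longleftrightarrow> fst e = u \<and> (p \<noteq> [] \<longrightarrow> fst (p ! 0) = snd e) \<and> (\<forall>i. Suc i < length p \<longrightarrow> snd (p ! i) = fst (p ! Suc i))"
    unfolding Cons.IH ..
  also have "\<dots> \<longleftrightarrow> fst e = u \<and> (\<forall>i. Suc i < length (e # p) \<longrightarrow> snd ((e # p) ! i) = fst ((e # p) ! Suc i))"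
    by (auto simp: less_Suc_eq_0_disj nth_Cons')
  finally show ?case by simp
next
  case Nil
  have "pcas u [] u" by simp
  then show ?case by auto
qed

locale encoded =
  fixes \<Sigma> :: "'a set" and k :: nat and G :: "'a list pair_pre_digraph" and c :: "'a list \<times> 'a list \<Rightarrow> nat set"
    and w :: nat and ls :: "'a list" and vs :: "'a list list" and es :: "('a list \<times> 'a list) list"
  assumes fin: "finite \<Sigma>" and k2: "2 \<le> k" and dB: "de_bruijn_graph k \<Sigma> G"
    and ifun: "interval_function G c" and width_eq: "interval_width G c = w" and w1: "1 \<le> w"
    and ls: "enumerates ls \<Sigma>" and vs: "enumerates vs (pverts G)" and es: "enumerates es (parcs G)"
begin

definition "m = length es"
definition "nV = length vs"
definition "K = k - 1"
definition "\<sigma> = card \<Sigma>"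
definition "src e = position vs (fst (es ! e))"
definition "dst e = position vs (snd (es ! e))"
definition "lo e = encode_interval (c (es ! e)) ! 0"
definition "hi e = encode_interval (c (es ! e)) ! 1"
definition "wd e = fst (es ! e) @ [last (snd (es ! e))]"
definition "xs = encode_instance ls vs es k w c"

lemma set_es: "set es = parcs G" "distinct es" and set_vs: "set vs = pverts G" "distinct vs"
  using es vs by (simp_all add: enumerates_def)

lemma m_eq: "m = card (parcs G)"
  using distinct_card[OF set_es(2)] set_es(1) by (simp add: m_def)

lemma K1: "1 \<le> K" and k_eq: "k = Suc K" using k2 by (auto simp: K_def)

lemma finite_arcs: "finite (parcs G)" using List.finite_set[of es] set_es(1) by simp

lemma es_nth: "e < m \<Longrightarrow> es ! e \<in> parcs G" using nth_mem[of e es] set_es(1) by (simp add: m_def)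

lemma ends: "e \<in> parcs G \<Longrightarrow> fst e \<in> pverts G \<and> snd e \<in> pverts G"
proof -
  assume e: "e \<in> parcs G"
  interpret pair_wf_digraph G using dB unfolding de_bruijn_graph_def by simp
  show ?thesis using arc_fst_in_verts[OF e] arc_snd_in_verts[OF e] by simp
qed

lemma vert: "u \<in> pverts G \<Longrightarrow> length u = K \<and> set u \<subseteq> \<Sigma>"
  using dB unfolding de_bruijn_graph_def by (simp add: K_def)

lemma head_eq: "e \<in> parcs G \<Longrightarrow> snd e = tl (fst e) @ [last (snd e)]"
proof -
  assume e: "e \<in> parcs G"
  have "tl (fst e) = take (k - 2) (snd e)" using dB e unfolding de_bruijn_graph_def by (auto split: prod.splits)
  moreover have l: "length (snd e) = K" using vert ends[OF e] by blast
  have "k - 2 = K - 1" by (simp add: K_def)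
  then have "take (k - 2) (snd e) = butlast (snd e)" by (simp add: butlast_conv_take l)
  moreover have "snd e \<noteq> []" using l K1 by auto
  ultimately show ?thesis by simp
qed

lemma tail_ne: "e \<in> parcs G \<Longrightarrow> fst e \<noteq> []"
proof -
  assume e: "e \<in> parcs G"
  have "length (fst e) = K" using vert ends[OF e] by blast
  then show "fst e \<noteq> []" using K1 by auto
qed

lemma position_eq: "u \<in> pverts G \<Longrightarrow> v \<in> pverts G \<Longrightarrow> position vs u = position vs v \<longleftrightarrow> u = v"
  using nth_position[of u vs] nth_position[of v vs] set_vs(1) by metis

lemma src_eq: "e < m \<Longrightarrow> f < m \<Longrightarrow> src e = src f \<longleftrightarrow> fst (es ! e) = fst (es ! f)"
  unfolding src_def using ends[OF es_nth[of e]] ends[OF es_nth[of f]] by (intro position_eq) simp_all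

lemma dst_src_eq: "e < m \<Longrightarrow> f < m \<Longrightarrow> dst e = src f \<longleftrightarrow> snd (es ! e) = fst (es ! f)"
  unfolding src_def dst_def using ends[OF es_nth[of e]] ends[OF es_nth[of f]] by (intro position_eq) simp_all

lemma position_vert: "u \<in> pverts G \<Longrightarrow> position vs u < nV"
  using position_less[of u vs] set_vs(1) by (simp add: nV_def)

lemma srcV: "e < m \<Longrightarrow> src e < nV" and dstV: "e < m \<Longrightarrow> dst e < nV"
  unfolding src_def dst_def using ends[OF es_nth[of e]] by (simp_all add: position_vert)

lemma interval:
  assumes "e < m"
  shows "1 \<le> lo e" "lo e \<le> Suc (hi e)" "hi e \<le> m" "hi e < lo e + w" "t \<in> c (es ! e) \<longleftrightarrow> lo e \<le> t \<and> t \<le> hi e"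
proof -
  let ?I = "c (es ! e)"
  have e: "es ! e \<in> parcs G" by (rule es_nth[OF assms])
  have "card ?I \<le> w" unfolding width_eq[symmetric] interval_width_def using finite_arcs e by (intro Max_ge) auto
  moreover have "?I \<in> intervals m" using ifun e unfolding interval_function_def m_eq by blast
  ultimately consider "?I = {}" | i j where "?I = {i..j}" "1 \<le> i" "i \<le> j" "j \<le> m" "j < i + w"
    unfolding intervals_def using w1 by fastforce
  then have "1 \<le> lo e \<and> lo e \<le> Suc (hi e) \<and> hi e \<le> m \<and> hi e < lo e + w \<and> (t \<in> ?I \<longleftrightarrow> lo e \<le> t \<and> t \<le> hi e)"
  proof cases
    case 1 then show ?thesis using w1 by (simp add: lo_def hi_def encode_interval_def)
  next
    case 2
    have "Min {i..j} = i" by (rule Min_eqI) (use 2(3) in simp_all)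
    moreover have "Max {i..j} = j" by (rule Max_eqI) (use 2(3) in simp_all)
    moreover have "{i..j} \<noteq> {}" using 2(3) by simp
    ultimately have "lo e = i" "hi e = j" unfolding lo_def hi_def encode_interval_def 2(1) by simp_all
    then show ?thesis using 2 by simp
  qed
  then show "1 \<le> lo e" "lo e \<le> Suc (hi e)" "hi e \<le> m" "hi e < lo e + w" "t \<in> ?I \<longleftrightarrow> lo e \<le> t \<and> t \<le> hi e" by blast+
qed

lemma m1: "1 \<le> m"
proof (rule ccontr)
  assume "\<not> 1 \<le> m"
  then have "length es = 0" unfolding m_def by linarith
  then have "parcs G = {}" using set_es(1) by simp
  then show False using width_eq w1 by (simp add: interval_width_def)
qed

lemma wm: "w \<le> m"
proof -
  have "card (c e) \<le> m" if "e \<in> parcs G" for e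
  proof -
    have "c e \<in> intervals m" using ifun that unfolding interval_function_def m_eq by blast
    then have "c e \<subseteq> {1..m}" by (auto simp: intervals_def)
    then show ?thesis using card_mono[of "{1..m}" "c e"] by simp
  qed
  then show ?thesis unfolding width_eq[symmetric] interval_width_def using finite_arcs by auto
qed

lemma wd_props:
  assumes "e < m" shows "length (wd e) = Suc K" "set (wd e) \<subseteq> \<Sigma>"
proof -
  have e: "es ! e \<in> parcs G" by (rule es_nth[OF assms])
  have u: "length (fst (es ! e)) = K" "set (fst (es ! e)) \<subseteq> \<Sigma>" and v: "length (snd (es ! e)) = K" "set (snd (es ! e)) \<subseteq> \<Sigma>"
    using vert ends[OF e] by blast+
  have "snd (es ! e) \<noteq> []" using v(1) K1 by auto
  then show "length (wd e) = Suc K" "set (wd e) \<subseteq> \<Sigma>" using u v last_in_set by (auto simp: wd_def)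
qed

lemma wd_inj: "e < m \<Longrightarrow> f < m \<Longrightarrow> wd e = wd f \<Longrightarrow> e = f"
proof -
  assume e: "e < m" and f: "f < m" and wd: "wd e = wd f"
  have h: "fst (es ! e) = fst (es ! f)" "last (snd (es ! e)) = last (snd (es ! f))" using wd by (auto simp: wd_def)
  then have "snd (es ! e) = snd (es ! f)" using head_eq[OF es_nth[OF e]] head_eq[OF es_nth[OF f]] by metis
  then have "es ! e = es ! f" using h(1) by (simp add: prod_eq_iff)
  then show "e = f" using e f set_es(2) by (simp add: nth_eq_iff_index_eq m_def)
qed

sublocale timed_debruijn m w src dst lo hi K wd
proof
  show "1 \<le> K" "1 \<le> w" by (rule K1, rule w1)
  show "hi e < lo e + w" if "e < m" for e using that by (rule interval)
  show "length (wd e) = Suc K" if "e < m" for e using that by (rule wd_props)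
  show "inj_on wd {..<m}" by (rule inj_onI) (use wd_inj in auto)
next
  fix e f x assume a: "e < m" "f < m" "dst e = src f" "x < K"
  have h: "snd (es ! e) = fst (es ! f)" using a dst_src_eq by blast
  have v: "length (fst (es ! f)) = K" using vert ends[OF es_nth[OF a(2)]] by blast
  obtain a' u' where u: "fst (es ! e) = a' # u'" using tail_ne[OF es_nth[OF a(1)]] by (cases "fst (es ! e)") auto
  have "wd e ! Suc x = (tl (fst (es ! e)) @ [last (snd (es ! e))]) ! x" by (simp add: wd_def u)
  also have "\<dots> = fst (es ! f) ! x" using head_eq[OF es_nth[OF a(1)]] h by metis
  finally show "wd e ! Suc x = wd f ! x" using a(4) v by (simp add: wd_def nth_append)
next
  fix e f x assume a: "e < m" "f < m" "src e = src f" "x < K"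
  have h: "fst (es ! e) = fst (es ! f)" using a src_eq by blast
  have v: "length (fst (es ! f)) = K" using vert ends[OF es_nth[OF a(2)]] by blast
  show "wd e ! x = wd f ! x" using a(4) h v by (simp add: wd_def nth_append)
qed

lemma m_le: "m \<le> \<sigma> ^ Suc K"
proof -
  have "card (wd ` {..<m}) \<le> card {l. set l \<subseteq> \<Sigma> \<and> length l = Suc K}"
    by (rule card_mono) (use finite_lists_length_eq[OF fin] wd_props in auto)
  then show ?thesis using card_image[OF inj_wd] card_lists_length_eq[OF fin] by (simp add: \<sigma>_def)
qed

lemma deg: "card {e. e < m \<and> src e = v} \<le> min \<sigma> m"
proof -
  have "inj_on (\<lambda>e. last (wd e)) {e. e < m \<and> src e = v}"
  proof (rule inj_onI)
    fix e f assume a: "e \<in> {e. e < m \<and> src e = v}" "f \<in> {e. e < m \<and> src e = v}" "last (wd e) = last (wd f)"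
    have ev: "e < m" "src e = v" using a(1) by simp_all
    have fv: "f < m" "src f = v" using a(2) by simp_all
    have ef: "e < m" "f < m" "src e = src f" using ev fv by (simp_all only:)
    have "fst (es ! e) = fst (es ! f)" using src_eq[OF ef(1,2)] ef(3) by simp
    then have "wd e = wd f" using a(3) by (simp add: wd_def)
    then show "e = f" by (rule wd_inj[OF ef(1,2)])
  qed
  moreover have "last (wd e) \<in> \<Sigma>" if "e < m" for e
    using wd_props[OF that] last_in_set[of "wd e"] by fastforce
  then have "(\<lambda>e. last (wd e)) ` {e. e < m \<and> src e = v} \<subseteq> \<Sigma>" by auto
  ultimately have "card {e. e < m \<and> src e = v} \<le> \<sigma>" unfolding \<sigma>_def using fin by (rule card_inj_on_le)
  moreover have "card {e. e < m \<and> src e = v} \<le> m" using card_mono[of "{..<m}" "{e. e < m \<and> src e = v}"] by auto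
  ultimately show ?thesis by simp
qed

lemma diET_iff: "diET G c \<longleftrightarrow> (\<exists>p. good m p)"
proof
  assume "diET G c"
  then obtain p u v where p: "pcas u p v" "distinct p" "set p = parcs G" "respecting c p"
    unfolding diET_def eulerian_trail_def pre_digraph.trail_def pre_digraph.awalk_def cas_with_proj_eq by blast
  have adj: "\<forall>i. Suc i < length p \<longrightarrow> snd (p ! i) = fst (p ! Suc i)" using ex_pcas_iff[of u p] p(1) by blast
  have lp: "length p = m" using p(2,3) m_eq distinct_card by force
  define q where "q = map (position es) p"
  have q: "q ! i < m \<and> es ! (q ! i) = p ! i" if "i < m" for i
  proof -
    have "p ! i \<in> set es" using that lp p(3) set_es(1) by auto
    then show ?thesis using that lp position_less[of "p ! i" es] nth_position[of "p ! i" es] by (simp add: q_def m_def)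
  qed
  have "good m q" unfolding good_def walk_def
  proof (intro conjI allI impI)
    show "length q = m" by (simp add: q_def lp)
    have "inj_on (position es) (set p)"
      by (rule inj_onI) (metis nth_position p(3) set_es(1))
    then show "distinct q" using p(2) by (simp add: q_def distinct_map)
    show "set q \<subseteq> {..<m}"
    proof
      fix x assume "x \<in> set q"
      then obtain i where i: "i < length q" "q ! i = x" by (metis in_set_conv_nth)
      then show "x \<in> {..<m}" using q[of i] lp by (simp add: q_def)
    qed
    fix i assume "i < length q"
    then have i: "i < m" by (simp add: q_def lp)
    have "Suc i \<in> {1..length p}" using i lp by simp
    then have "Suc i \<in> c (p ! (Suc i - 1))" using p(4) unfolding respecting_def by blast
    then have "Suc i \<in> c (es ! (q ! i))" using q[OF i] by simp
    then show "lo (q ! i) \<le> Suc i" "Suc i \<le> hi (q ! i)" using interval(5)[of "q ! i" "Suc i"] q[OF i] by simp_all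
  next
    fix i assume "Suc i < length q"
    then have i: "Suc i < m" by (simp add: q_def lp)
    then show "dst (q ! i) = src (q ! Suc i)" using q[of i] q[of "Suc i"] adj lp dst_src_eq[of "q ! i" "q ! Suc i"] by simp
  qed
  then show "\<exists>p. good m p" by blast
next
  assume "\<exists>p. good m p"
  then obtain q where q: "good m q" by blast
  have g: "set q \<subseteq> {..<m}" "\<And>i. i < m \<Longrightarrow> lo (q ! i) \<le> Suc i \<and> Suc i \<le> hi (q ! i)"
    "\<And>i. Suc i < m \<Longrightarrow> dst (q ! i) = src (q ! Suc i)" "distinct q" "length q = m"
    using q unfolding good_def walk_def by auto
  have qm: "q ! i < m" if "i < m" for i
  proof -
    have "q ! i \<in> set q" using that g(5) by simp
    then show ?thesis using g(1) by blast
  qed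
  define p where "p = map ((!) es) q"
  have sq: "set q = {..<m}" using set_complete[OF q] .
  have "set p = set es" unfolding p_def set_map sq m_def set_conv_nth[of es] by blast
  then have sp: "set p = parcs G" using set_es(1) by simp
  have "inj_on ((!) es) (set q)" by (rule inj_on_nth[OF set_es(2)]) (simp add: sq m_def)
  then have dp: "distinct p" unfolding p_def distinct_map using g(4) by blast
  have "\<exists>v. pcas (fst (p ! 0)) p v"
    unfolding ex_pcas_iff
  proof (intro conjI allI impI refl)
    fix i assume "Suc i < length p"
    then have i: "Suc i < m" "i < m" using g(5) by (simp_all add: p_def)
    show "snd (p ! i) = fst (p ! Suc i)" using dst_src_eq[OF qm[OF i(2)] qm[OF i(1)]] g(3)[OF i(1)] i g(5) by (simp add: p_def)
  qed
  then obtain v where v: "pcas (fst (p ! 0)) p v" by blast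
  have "p ! 0 \<in> parcs G" using sp m1 g(5) nth_mem[of 0 p] by (simp add: p_def)
  then have "fst (p ! 0) \<in> pverts G" using ends by blast
  then have "eulerian_trail G p" unfolding eulerian_trail_def pre_digraph.trail_def pre_digraph.awalk_def cas_with_proj_eq with_proj_simps using v dp sp by auto
  moreover have "respecting c p" unfolding respecting_def
  proof
    fix t assume t: "t \<in> {1..length p}"
    then have i: "t - 1 < m" "Suc (t - 1) = t" using g(5) by (auto simp: p_def)
    have "p ! (t - 1) = es ! (q ! (t - 1))" using i g(5) by (simp add: p_def)
    then show "t \<in> c (p ! (t - 1))" using interval(5)[OF qm[OF i(1)]] g(2)[OF i(1)] i(2) by simp
  qed
  ultimately show "diET G c" unfolding diET_def by blast
qed

definition arc_words :: "nat list" where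
  "arc_words = concat (map (\<lambda>(u, v). [position vs u, position vs v] @ encode_interval (c (u, v))) es)"

lemma xs_eq: "xs = [m, w, k, length ls, nV] @ arc_words @ concat (map (map (position ls)) vs)"
  by (simp add: xs_def encode_instance_def arc_words_def m_def nV_def)

lemma arc_words_length: "length arc_words = 4 * m"
  unfolding arc_words_def by (subst length_concat_const[of _ _ 4]) (auto simp: encode_interval_def m_def)

lemma arc_words_nth: "e < m \<Longrightarrow> j < 4 \<Longrightarrow> arc_words ! (4 * e + j) = [src e, dst e, lo e, hi e] ! j"
proof -
  assume a: "e < m" "j < 4"
  have "arc_words ! (4 * e + j) = (\<lambda>(u, v). [position vs u, position vs v] @ encode_interval (c (u, v))) (es ! e) ! j"
    unfolding arc_words_def by (rule nth_concat_const) (use a in \<open>auto simp: encode_interval_def m_def\<close>)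
  also have "\<dots> = [src e, dst e, lo e, hi e] ! j"
    by (auto simp: src_def dst_def lo_def hi_def encode_interval_def split: prod.splits)
  finally show ?thesis .
qed

lemma xs_length: "length xs = 5 + 4 * m + nV * K"
proof -
  have "length (concat (map (map (position ls)) vs)) = nV * K" unfolding nV_def
    by (rule length_concat_const) (use vert set_vs in auto)
  then show ?thesis by (simp add: xs_eq arc_words_length)
qed

lemma xs_nth_arc: "e < m \<Longrightarrow> j < 4 \<Longrightarrow> xs ! (5 + 4 * e + j) = [src e, dst e, lo e, hi e] ! j"
proof -
  assume a: "e < m" "j < 4"
  have "4 * e + j < 4 * m" using a by linarith
  then have "xs ! (5 + (4 * e + j)) = arc_words ! (4 * e + j)" unfolding xs_eq by (simp add: nth_append arc_words_length)
  then show ?thesis using arc_words_nth[OF a] by (simp add: add.assoc)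
qed

end

lemma power_absorb: "c \<le> 10 \<Longrightarrow> 10 \<le> Y \<Longrightarrow> c * Y ^ n \<le> Y ^ Suc n" for Y :: nat
  using mult_le_mono1[of c Y "Y ^ n"] by simp

lemma address_space:
  fixes Y m l n d v w K wn b :: nat
  assumes Y: "10 \<le> Y" and le: "m \<le> Y" "l \<le> Y" "d \<le> Y" "v \<le> Y" "w \<le> Y" "K \<le> Y" and n: "n \<le> (Y + 1)\<^sup>2"
    and b: "wn \<le> 6 * w + 9" "b \<le> wn"
  shows "(6 + m + l + (m + m * n) * (d * (l + 1)) + 2) * (v + m + 1) \<le> Y ^ 12"
    "m + m * n + 1 < Y ^ 12" "12 * wn * b + 6 * w + K + m + 20 \<le> Y ^ 12" "v + 4 * m + w + K + 4 \<le> Y ^ 12" "Y + 16 * Y ^ 12 + 16 \<le> Y ^ 16"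
proof -
  have pw: "Y ^ i \<le> Y ^ j" if "i \<le> j" for i j using Y that by (intro power_increasing) auto
  have a: "c * Y ^ i \<le> Y ^ j" if "c \<le> 10" "i < j" for c i j
    using power_absorb[OF that(1) Y, of i] pw[of "Suc i" j] that(2) by linarith
  have p: "Y ^ 2 \<le> Y ^ 6" "Y ^ 2 \<le> Y ^ 8" "Y ^ 2 \<le> Y ^ 12" "Y ^ 2 \<le> Y ^ 14" by (rule pw, simp)+
  have Y2: "10 * Y \<le> Y ^ 2" using a[of 10 1 2] by simp
  have "Y + 1 \<le> 2 * Y" using Y by simp
  then have "(Y + 1)\<^sup>2 \<le> (2 * Y)\<^sup>2" by (rule power_mono) simp
  also have "\<dots> = 4 * Y ^ 2" by (simp add: power_mult_distrib)
  also have "\<dots> \<le> Y ^ 3" by (rule a) simp_all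
  finally have n3: "n \<le> Y ^ 3" using n by simp
  have "m * n \<le> Y * Y ^ 3" using le(1) n3 by (rule mult_le_mono)
  also have "Y * Y ^ 3 = Y ^ 4" by (simp add: eval_nat_numeral)
  finally have "m * n \<le> Y ^ 4" .
  moreover have "m \<le> Y ^ 4" using le(1) pw[of 1 4] by simp
  ultimately have "m + m * n \<le> 2 * Y ^ 4" by simp
  also have "\<dots> \<le> Y ^ 5" by (rule a) simp_all
  finally have mn: "m + m * n \<le> Y ^ 5" .
  have "d * (l + 1) \<le> Y * (2 * Y)" by (rule mult_le_mono) (use le Y in simp_all)
  also have "\<dots> = 2 * Y ^ 2" by (simp add: power2_eq_square)
  also have "\<dots> \<le> Y ^ 3" by (rule a) simp_all
  finally have dl: "d * (l + 1) \<le> Y ^ 3" .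
  have "(m + m * n) * (d * (l + 1)) \<le> Y ^ 5 * Y ^ 3" by (rule mult_le_mono[OF mn dl])
  then have p8: "(m + m * n) * (d * (l + 1)) \<le> Y ^ 8" by (simp add: power_add[symmetric])
  have "6 + m + l + 2 \<le> 10 * Y" using le Y by simp
  then have "6 + m + l + 2 \<le> Y ^ 8" using Y2 p by linarith
  then have "6 + m + l + (m + m * n) * (d * (l + 1)) + 2 \<le> 2 * Y ^ 8" using p8 by linarith
  also have "\<dots> \<le> Y ^ 9" by (rule a) simp_all
  finally have f1: "6 + m + l + (m + m * n) * (d * (l + 1)) + 2 \<le> Y ^ 9" .
  have f2: "v + m + 1 \<le> Y ^ 2" using le Y Y2 by linarith
  have "(6 + m + l + (m + m * n) * (d * (l + 1)) + 2) * (v + m + 1) \<le> Y ^ 9 * Y ^ 2" by (rule mult_le_mono[OF f1 f2])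
  also have "\<dots> = Y ^ 11" by (simp add: power_add[symmetric])
  finally show "(6 + m + l + (m + m * n) * (d * (l + 1)) + 2) * (v + m + 1) \<le> Y ^ 12" using pw[of 11 12] by simp
  have "m + m * n + 1 < 10 * Y ^ 5" using mn Y one_le_power[of Y 5] by linarith
  also have "\<dots> \<le> Y ^ 12" by (rule a) simp_all
  finally show "m + m * n + 1 < Y ^ 12" .
  have "wn \<le> 10 * Y" using b le Y by linarith
  then have wb: "wn \<le> Y ^ 2" "b \<le> Y ^ 2" using Y2 b(2) by linarith+
  have "12 * wn * b \<le> Y ^ 2 * Y ^ 2 * Y ^ 2" using Y Y2 wb by (intro mult_le_mono) linarith
  then have w6: "12 * wn * b \<le> Y ^ 6" by (simp add: power_add[symmetric])
  have "6 * w + K + m + 20 \<le> 10 * Y" using le Y by linarith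
  then have "6 * w + K + m + 20 \<le> Y ^ 6" using Y2 p by linarith
  then have "12 * wn * b + 6 * w + K + m + 20 \<le> 2 * Y ^ 6" using w6 by linarith
  also have "\<dots> \<le> Y ^ 12" by (rule a) simp_all
  finally show "12 * wn * b + 6 * w + K + m + 20 \<le> Y ^ 12" .
  have "v + 4 * m + w + K + 4 \<le> 10 * Y" using le Y by linarith
  then show "v + 4 * m + w + K + 4 \<le> Y ^ 12" using Y2 p by linarith
  have "16 * Y ^ 12 \<le> 10 * (10 * Y ^ 12)" by simp
  also have "\<dots> \<le> 10 * Y ^ 13" using a[of 10 12 13] by simp
  also have "\<dots> \<le> Y ^ 14" by (rule a) simp_all
  finally have "16 * Y ^ 12 \<le> Y ^ 14" .
  moreover have "Y + 16 \<le> Y ^ 14" using p Y Y2 by linarith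
  ultimately have "Y + 16 * Y ^ 12 + 16 \<le> 2 * Y ^ 14" by linarith
  also have "\<dots> \<le> Y ^ 16" by (rule a) simp_all
  finally show "Y + 16 * Y ^ 12 + 16 \<le> Y ^ 16" .
qed

context encoded
begin

definition nmax :: nat where "nmax = Max (insert 0 ((\<lambda>t. card (St t)) ` {1..m}))"
definition lmax :: nat where "lmax = Max (insert 0 ((\<lambda>s. length (snd s)) ` (\<Union>t\<in>{..m}. St t)))"

lemma card_St_nmax: "1 \<le> t \<Longrightarrow> t \<le> m \<Longrightarrow> card (St t) \<le> nmax"
  unfolding nmax_def by (rule Max_ge) simp_all

lemma nmax_le: "(\<And>t. 1 \<le> t \<Longrightarrow> t \<le> m \<Longrightarrow> card (St t) \<le> x) \<Longrightarrow> nmax \<le> x"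
  unfolding nmax_def by (subst Max_le_iff) simp_all

lemma finite_lengths: "finite (insert 0 ((\<lambda>s. length (snd s)) ` (\<Union>t\<in>{..m}. St t)))"
  by (intro finite.insertI finite_imageI finite_UN_I finite_St) simp

lemma length_St_lmax: "(v, l) \<in> St t \<Longrightarrow> t \<le> m \<Longrightarrow> length l \<le> lmax"
proof -
  assume "(v, l) \<in> St t" "t \<le> m"
  then have "(v, l) \<in> (\<Union>t\<in>{..m}. St t)" by blast
  from imageI[OF this, of "\<lambda>s. length (snd s)"] have "length l \<in> (\<lambda>s. length (snd s)) ` (\<Union>t\<in>{..m}. St t)" by simp
  then show "length l \<le> lmax" unfolding lmax_def by (intro Max_ge[OF finite_lengths] insertI2)
qed

lemma lmax_le:
  assumes "\<And>t p. 1 \<le> t \<Longrightarrow> good t p \<Longrightarrow> length (stack p) \<le> x" shows "lmax \<le> x"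
proof -
  have "length (snd s) \<le> x" if "s \<in> St t" for s t
  proof (cases t)
    case 0 then show ?thesis using that by auto
  next
    case (Suc i)
    have "s \<in> {(dst (last p), stack p) | p. good (Suc i) p}" using that unfolding Suc St_Suc .
    then obtain p where p: "s = (dst (last p), stack p)" "good (Suc i) p" by blast
    then show ?thesis using assms[OF _ p(2)] by simp
  qed
  then show ?thesis unfolding lmax_def by (subst Max_le_iff[OF finite_lengths]) simp_all
qed

lemma \<sigma>1: "1 \<le> \<sigma>"
proof (rule ccontr)
  assume "\<not> 1 \<le> \<sigma>"
  then have "\<sigma> = 0" by simp
  then show False using m_le m1 by simp
qed

lemma counts:
  assumes rel: releases_bounded and cb: "critical_bounded critical_max"
  shows "state_counts \<sigma> K w nmax lmax critical_max (bitlen windows) windows ((w - 2 + K) div Suc K) (w div (4 * Suc K))"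
proof
  define r where "r = (w - 2 + K) div Suc K"
  have r: "w \<le> 2 + r * Suc K" by (rule blocks_bounds[OF r_def])
  have op: "opts L" if "L = 2 * w - 1 \<or> L = \<sigma> ^ Suc K" for L
    using that opts_released[OF rel] opts_total[OF m_le] by blast
  show "1 \<le> \<sigma>" "1 \<le> K" "1 \<le> w" by (rule \<sigma>1, rule K1, rule w1)
  show "w \<le> \<sigma> ^ Suc K" using wm m_le by (rule le_trans)
  show "(w - 2 + K) div Suc K = (w - 2 + K) div Suc K" "w div (4 * Suc K) = w div (4 * Suc K)" by (rule refl)+
  fix L assume L: "L = 2 * w - 1 \<or> L = \<sigma> ^ Suc K"
  show "nmax \<le> L ^ Suc ((w - 2 + K) div Suc K)"
    unfolding r_def[symmetric] by (rule nmax_le) (rule card_St_pow[OF op[OF L] _ r])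
  have L1: "1 \<le> L" using L w1 \<sigma>1 by auto
  assume w4: "4 * Suc K \<le> w"
  show "nmax \<le> max (L ^ (Suc ((w - 2 + K) div Suc K) - w div (4 * Suc K)) * (L - w div 4) ^ (w div (4 * Suc K)))
      (L ^ (3 * w div (4 * Suc K) + 2))"
    unfolding r_def[symmetric]
  proof (rule nmax_le)
    fix t assume t: "1 \<le> t" "t \<le> m"
    show "card (St t) \<le> max (L ^ (Suc r - w div (4 * Suc K)) * (L - w div 4) ^ (w div (4 * Suc K))) (L ^ (3 * w div (4 * Suc K) + 2))"
    proof (cases "3 * w \<le> 4 * (t - 1)")
      case True
      show ?thesis using card_St_late[OF op[OF L] t(1) True r w4 refl] by (rule le_trans) simp
    next
      case False
      then have "4 * (t - 1) < 3 * w" by simp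
      from card_St_early[OF op[OF L] L1 t(1) this] show ?thesis by (rule le_trans) simp
    qed
  qed
next
  show "nmax \<le> 2 * w * (critical_max + 1) ^ critical_max"
    by (rule nmax_le) (rule card_St_crit[OF rel cb _ _ wm])
  show "lmax \<le> w" by (rule lmax_le) (rule length_stack_le)
  show "lmax \<le> critical_max + 1" by (rule lmax_le) (rule length_stack_crit[OF cb])
  show "windows = (6 * w + K) div (K div 8 + 1) + 1" by (rule windows_def)
  show "2 ^ bitlen windows \<le> 2 * windows" by (rule two_power_bitlen_le) (simp add: windows_def)
  show "critical_max = 12 * windows * bitlen windows" by (rule critical_max_def)
qed

definition T :: real where "T = time_bound \<sigma> k m w"

lemma T_eq: "T = real m * real (min (\<sigma> ^ K) (2 * w - 1)) powr (real w / real K + 1)"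
proof -
  have "k - 1 = K" "real k - 1 = real K" using k2 by (simp_all add: K_def of_nat_diff)
  then show ?thesis unfolding T_def time_bound_def by simp
qed

lemma T_ge: "real m \<le> T" "real (min (\<sigma> ^ K) (2 * w - 1)) powr (real w / real K + 1) \<le> T"
proof -
  define P where "P = real (min (\<sigma> ^ K) (2 * w - 1)) powr (real w / real K + 1)"
  have "1 \<le> min (\<sigma> ^ K) (2 * w - 1)" using \<sigma>1 w1 by simp
  then have P1: "1 \<le> P" unfolding P_def by (intro ge_one_powr_ge_zero) auto
  have T: "T = real m * P" by (simp add: T_eq P_def)
  have "real m * 1 \<le> real m * P" using P1 by (rule mult_left_mono) simp
  then show "real m \<le> T" unfolding T by simp
  have "1 * P \<le> real m * P" using m1 P1 by (intro mult_right_mono) auto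
  then show "real (min (\<sigma> ^ K) (2 * w - 1)) powr (real w / real K + 1) \<le> T" unfolding T P_def by simp
qed

lemma program_decides:
  assumes ws: "adequate_word_size 16 xs T W" and C: "0 \<le> C" and \<sigma>S: "\<sigma> \<le> S"
    and est: "\<And>n l D b wn r s. state_counts \<sigma> K w n l D b wn r s \<Longrightarrow>
      real ((1 + n) * (l + 2)) \<le> C * real (min (\<sigma> ^ K) (2 * w - 1)) powr (real w / real K + 1)"
  shows "decides_within W program xs (3002 * (1 + real S) * (C + 2) * T) (diET G c)"
proof -
  define y where "y = real (length xs) + T"
  define Y where "Y = nat \<lfloor>y\<rfloor>"
  define Z where "Z = Y ^ 12"
  define dg where "dg = min \<sigma> m"
  have T1: "1 \<le> T" using T_ge(1) m1 by linarith
  have y1: "1 \<le> y" using T1 by (simp add: y_def)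
  have Yy: "real Y \<le> y" "y < real Y + 1" using y1 by (simp_all add: Y_def)
  have "0 < nV" using srcV[of 0] m1 by simp
  then have nK: "nV \<le> nV * K" "K \<le> nV * K" using K1 by simp_all
  have len: "5 + 5 * m + nV * K \<le> Y"
  proof -
    have "real (5 + 5 * m + nV * K) \<le> y" using T_ge(1) unfolding y_def xs_length by simp
    then show ?thesis unfolding Y_def by (simp add: le_nat_floor)
  qed
  have Y: "10 \<le> Y" "m \<le> Y" "nV \<le> Y" "w \<le> Y" "K \<le> Y" "dg \<le> Y" "length xs \<le> Y"
    using len nK m1 wm unfolding dg_def xs_length by linarith+
  have YW: "Y ^ 16 \<le> 2 ^ W"
  proof -
    have "16 * log 2 y \<le> real W" using ws unfolding adequate_word_size_def y_def by simp
    then have "2 powr (16 * log 2 y) \<le> 2 powr real W" by (intro powr_mono) auto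
    moreover have "2 powr (16 * log 2 y) = y ^ 16"
    proof -
      have "2 powr (16 * log 2 y) = (2 powr log 2 y) powr 16" by (simp only: powr_powr mult.commute)
      also have "2 powr log 2 y = y" using y1 by simp
      also have "y powr 16 = y ^ 16" using y1 powr_realpow[of y 16] by simp
      finally show ?thesis .
    qed
    ultimately have "y ^ 16 \<le> 2 ^ W" by (simp add: powr_realpow)
    moreover have "real Y ^ 16 \<le> y ^ 16" using Yy(1) by (rule power_mono) simp
    ultimately have "real (Y ^ 16) \<le> real (2 ^ W)" by simp
    then show ?thesis by (simp only: of_nat_le_iff)
  qed
  have wins: "windows \<le> 6 * w + 9" unfolding windows_def by (rule window_count_le)
  note space = address_space[OF Y(1,2) _ Y(6,3,4,5) _ wins bitlen_le]
  interpret P: prog W "length xs" Z m w src dst lo hi K nV dg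
  proof
    show "5 + 4 * m \<le> length xs" by (simp add: xs_length)
    show "length xs + 16 * Z + 16 \<le> 2 ^ W" using space(5)[of 0 0] YW Y(7) unfolding Z_def by simp
    show "card {e. e < m \<and> src e = v} \<le> dg" for v unfolding dg_def by (rule deg)
    show "12 * ((6 * w + K) div (K div 8 + 1) + 1) * bitlen ((6 * w + K) div (K div 8 + 1) + 1) + 6 * w + K + m + 20 \<le> Z"
      using space(3)[of 0 0] unfolding Z_def windows_def by simp
    show "nV + 4 * m + w + K + 4 \<le> Z" using space(4)[of 0 0] unfolding Z_def by simp
  qed (fact m1 w1 wm | rule interval srcV dstV, assumption)+
  define \<mu> where "\<mu> = (\<lambda>i. if i < length xs then xs ! i else 0)"
  have init: "initial xs = \<lparr>reg = (\<lambda>_. 0), mem = \<mu>\<rparr>" by (simp add: initial_def \<mu>_def)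
  have l5: "5 \<le> length xs" by (simp add: xs_length)
  have first: "\<mu> i = [m, w, k, length ls, nV] ! i" if "i < 5" for i
  proof -
    have "xs ! i = [m, w, k, length ls, nV] ! i" unfolding xs_eq by (subst nth_append) (use that in simp)
    then show ?thesis using that l5 by (simp add: \<mu>_def)
  qed
  have h: "\<mu> 0 = m" "\<mu> 1 = w" "\<mu> 2 = Suc K" "\<mu> 4 = nV" "length xs = 5 + 4 * m + nV * K"
  proof -
    show "\<mu> 0 = m" using first[of 0] by simp
    show "\<mu> 1 = w" using first[of 1] by simp
    have "\<mu> 2 = k" using first[of 2] by simp
    then show "\<mu> 2 = Suc K" using k_eq by (rule trans)
    show "\<mu> 4 = nV" using first[of 4] by simp
    show "length xs = 5 + 4 * m + nV * K" by (rule xs_length)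
  qed
  have fd: "P.fd \<mu> j e = [src e, dst e, lo e, hi e] ! j" if "e < m" "j < 4" for e j
  proof -
    have "5 + 4 * e + j < length xs" using that unfolding xs_length by linarith
    then have "\<mu> (5 + 4 * e + j) = xs ! (5 + 4 * e + j)" by (simp only: \<mu>_def if_True)
    then show ?thesis unfolding P.fd_def xs_nth_arc[OF that] .
  qed
  have inp: "P.input \<mu>" unfolding P.input_def
  proof (intro allI impI conjI)
    fix e assume e: "e < m"
    show "P.fd \<mu> 0 e = src e" "P.fd \<mu> 1 e = dst e" "P.fd \<mu> 2 e = lo e" "P.fd \<mu> 3 e = hi e"
      using fd[OF e, of 0] fd[OF e, of 1] fd[OF e, of 2] fd[OF e, of 3] by simp_all
  qed
  have zero: "\<mu> x = 0" if "length xs \<le> x" for x using that by (simp add: \<mu>_def)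
  have Dc: "P.D = critical_max" unfolding P.D_def P.wn_def critical_max_def windows_def ..
  have yes: "P.passes \<and> St m \<noteq> {} \<longleftrightarrow> diET G c"
    unfolding P.passes_def Dc diET_iff using solution_iff[OF m1] by blast
  have dgS: "1 + real dg \<le> 1 + real S" using \<sigma>S by (simp add: dg_def)
  obtain n l where R: "P.passes \<Longrightarrow> run W (length xs) Z m w src dst lo hi K nV dg n l"
    and cost: "real ((1 + n) * (l + 2)) * real m \<le> (C + 2) * T"
  proof (cases P.passes)
    case True
    then have rel: releases_bounded and cb: "critical_bounded critical_max" unfolding P.passes_def Dc by blast+
    note sc = counts[OF rel cb]
    interpret N: state_counts \<sigma> K w nmax lmax critical_max "bitlen windows" windows "(w - 2 + K) div Suc K" "w div (4 * Suc K)" by (rule sc)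
    define P' where "P' = real (min (\<sigma> ^ K) (2 * w - 1)) powr (real w / real K + 1)"
    have "real nmax \<le> P' ^ 2" unfolding P'_def by (rule N.n_square)
    also have "\<dots> \<le> y ^ 2" using T_ge(2) unfolding P'_def y_def by (intro power_mono) auto
    also have "\<dots> \<le> (real Y + 1) ^ 2" using Yy(2) y1 by (intro power_mono) auto
    finally have "real nmax \<le> real ((Y + 1) ^ 2)" by (simp add: add.commute)
    then have nY: "nmax \<le> (Y + 1)\<^sup>2" by (simp only: of_nat_le_iff)
    have lY: "lmax \<le> Y" using N.l_le(1) Y(4) by simp
    show ?thesis
    proof (rule that[of nmax lmax])
      show "run W (length xs) Z m w src dst lo hi K nV dg nmax lmax"
      proof
        show "card (St t) \<le> nmax" if "1 \<le> t" "t \<le> m" for t using that by (rule card_St_nmax)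
        show "length l \<le> lmax" if "(v, l) \<in> St t" "t \<le> m" for t v l using that by (rule length_St_lmax)
        show "P.cap (6 + m + lmax + (m + m * nmax) * (dg * (lmax + 1)))"
          unfolding P.cap_def unfolding Z_def by (rule space(1)[OF lY nY])
        show "m + m * nmax + 1 < Z" unfolding Z_def by (rule space(2)[OF lY nY])
      qed
      have "real ((1 + nmax) * (lmax + 2)) * real m \<le> C * P' * real m"
        unfolding P'_def by (rule mult_right_mono[OF est[OF sc]]) simp
      also have "\<dots> = C * T" by (simp add: T_eq P'_def)
      also have "\<dots> \<le> (C + 2) * T" using T1 by (intro mult_right_mono) auto
      finally show "real ((1 + nmax) * (lmax + 2)) * real m \<le> (C + 2) * T" .
    qed
  next
    case False
    have "2 * real m \<le> 2 * T" using T_ge(1) by simp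
    also have "\<dots> \<le> (C + 2) * T" using C T1 by (intro mult_right_mono) auto
    finally show ?thesis using False by (intro that[of 0 0]) auto
  qed
  from P.program_runs[OF h inp zero R]
  obtain t \<rho>' \<mu>' where ex: "exec W program (initial xs) t \<lparr>reg = \<rho>', mem = \<mu>'\<rparr>"
    and t: "t \<le> 3002 * (m * (1 + n) * (1 + dg) * (l + 2))" and r0: "\<rho>' 0 = (if P.passes \<and> St m \<noteq> {} then 1 else 0)"
    unfolding runs_def init by blast
  have "real t \<le> real (3002 * (m * (1 + n) * (1 + dg) * (l + 2)))" using t by (rule of_nat_mono)
  also have "\<dots> = 3002 * ((1 + real dg) * (real ((1 + n) * (l + 2)) * real m))" by (simp add: algebra_simps)
  also have "\<dots> \<le> 3002 * ((1 + real S) * ((C + 2) * T))"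
    by (intro mult_left_mono mult_mono dgS cost) simp_all
  finally have "real t \<le> 3002 * (1 + real S) * (C + 2) * T" by (simp only: mult.assoc)
  moreover have "reg \<lparr>reg = \<rho>', mem = \<mu>'\<rparr> 0 = (if diET G c then 1 else 0)" using r0 unfolding yes by simp
  ultimately show ?thesis unfolding decides_within_def using ex by blast
qed

end

theorem theorem3:
  "\<exists>(P :: com) (a :: nat). \<forall>S :: nat. \<exists>C :: real.
     \<forall>(\<Sigma> :: 'a set) (k :: nat) (G :: 'a list pair_pre_digraph) (c :: 'a list \<times> 'a list \<Rightarrow> nat set)
       (w :: nat) (ls :: 'a list) (vs :: 'a list list) (es :: ('a list \<times> 'a list) list) (W :: nat).
       finite \<Sigma> \<and> card \<Sigma> \<le> S \<and>
       2 \<le> k \<and> de_bruijn_graph k \<Sigma> G \<and>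
       interval_function G c \<and> interval_width G c = w \<and> 1 \<le> w \<and>
       enumerates ls \<Sigma> \<and> enumerates vs (pverts G) \<and> enumerates es (parcs G) \<and>
       adequate_word_size a (encode_instance ls vs es k w c)
         (time_bound (card \<Sigma>) k (card (parcs G)) w) W
       \<longrightarrow> decides_within W P (encode_instance ls vs es k w c)
             (C * time_bound (card \<Sigma>) k (card (parcs G)) w) (diET G c)"
proof (rule exI[of _ program], rule exI[of _ 16], rule allI)
  fix S :: nat
  obtain C :: real where C: "0 \<le> C" and est: "\<forall>\<sigma> K w n l D b wn r s. state_counts \<sigma> K w n l D b wn r s \<longrightarrow> \<sigma> \<le> S \<longrightarrow>
      real ((1 + n) * (l + 2)) \<le> C * real (min (\<sigma> ^ K) (2 * w - 1)) powr (real w / real K + 1)"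
    using estimate[of S] by (elim exE conjE)
  show "\<exists>C :: real. \<forall>(\<Sigma> :: 'a set) (k :: nat) (G :: 'a list pair_pre_digraph) (c :: 'a list \<times> 'a list \<Rightarrow> nat set)
       (w :: nat) (ls :: 'a list) (vs :: 'a list list) (es :: ('a list \<times> 'a list) list) (W :: nat).
       finite \<Sigma> \<and> card \<Sigma> \<le> S \<and>
       2 \<le> k \<and> de_bruijn_graph k \<Sigma> G \<and>
       interval_function G c \<and> interval_width G c = w \<and> 1 \<le> w \<and>
       enumerates ls \<Sigma> \<and> enumerates vs (pverts G) \<and> enumerates es (parcs G) \<and>
       adequate_word_size 16 (encode_instance ls vs es k w c)
         (time_bound (card \<Sigma>) k (card (parcs G)) w) W
       \<longrightarrow> decides_within W program (encode_instance ls vs es k w c)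
             (C * time_bound (card \<Sigma>) k (card (parcs G)) w) (diET G c)"
  proof (intro exI[of _ "3002 * (1 + real S) * (C + 2)"] allI impI, elim conjE)
    fix \<Sigma> :: "'a set" and k w W :: nat and G :: "'a list pair_pre_digraph" and c ls vs es
    assume a: "finite \<Sigma>" "card \<Sigma> \<le> S" "2 \<le> k" "de_bruijn_graph k \<Sigma> G" "interval_function G c" "interval_width G c = w" "1 \<le> w"
      "enumerates ls \<Sigma>" "enumerates vs (pverts G)" "enumerates es (parcs G)"
      and ws: "adequate_word_size 16 (encode_instance ls vs es k w c) (time_bound (card \<Sigma>) k (card (parcs G)) w) W"
    interpret encoded \<Sigma> k G c w ls vs es by (rule encoded.intro[OF a(1,3-10)])
    have T: "time_bound (card \<Sigma>) k (card (parcs G)) w = T" by (simp add: T_def \<sigma>_def m_eq)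
    have \<sigma>S: "\<sigma> \<le> S" using a(2) by (simp add: \<sigma>_def)
    have "real ((1 + n) * (l + 2)) \<le> C * real (min (\<sigma> ^ K) (2 * w - 1)) powr (real w / real K + 1)"
      if "state_counts \<sigma> K w n l D b wn r s" for n l D b wn r s
      using est[rule_format, OF that \<sigma>S] .
    from program_decides[OF ws[unfolded T xs_def[symmetric]] C \<sigma>S this]
    show "decides_within W program (encode_instance ls vs es k w c)
        (3002 * (1 + real S) * (C + 2) * time_bound (card \<Sigma>) k (card (parcs G)) w) (diET G c)"
      unfolding T xs_def .
  qed
qed

end
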